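(* Let $\mathbb A$ be a fixed graph of groups with finite vertex groups over a finite directed graph $A$, with base vertex $v$ and a presentation $\mathrm{Bass}(\mathbb A)=\langle X\mid R\rangle$ as described in the context. Let $H=\langle\epsilon(W_1),\ldots,\epsilon(W_s)\rangle\le\pi_1(\mathbb A,v)$, where $(W_1,\ldots,W_s)$ is a tuple of words in $(X^{\pm1})^*$ representing elements of $\pi_1(\mathbb A,v)$, and let $\mathcal A_F$ be the graph produced from this tuple by the folding algorithm described in the context. Then $H$ is a free group if and only if every $\mathrm{Verts}(A)$-component $C$ of $\mathcal A_F$ is isomorphic to a copy of the Cayley graph $\Gamma_{[w]}$, where $w$ is a vertex of $C$. Furthermore, if $H$ is given by a tuple $(W_1,\ldots,W_s)$ of words in the generating set $X$ of $\mathrm{Bass}(\mathbb A)$, then freeness of $H$ can be determined by modifying the folding algorithm in a way that only incurs an $O(N)$ overhead cost, where $N$ is the sum of the lengths of the input words.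
   Context: **Graphs of groups.** A directed graph has vertices, edges, and initial/terminal maps $i,t$; $e^{-1}$ is the reverse of $e$, $i(e^{-1})=t(e)$, $t(e^{-1})=i(e)$. A graph of groups $\mathbb A$ over $A$ assigns a group $\mathbb A_w$ to each vertex, $\mathbb A_e$ to each edge, and monomorphisms $i_e:\mathbb A_e\to\mathbb A_{i(e)}$, $t_e:\mathbb A_e\to\mathbb A_{t(e)}$. **Presentation.** For each vertex $w$ fix a finite tuple $\mathscr G_w$ of symbols generating $\mathbb A_w$ (all symbols distinct) and a finite presentation $\mathbb A_w=\langle\mathscr G_w\mid R_w\rangle$. For each edge $e$ and $h\in\mathbb A_e$ fix a word $W(t_e(h))$ in $\mathscr G_{t(e)}^{\pm1}$ representing $t_e(h)$ and a word $V(i_e(h))$ in $\mathscr G_{i(e)}^{\pm1}$ representing $i_e(h)$. Put $X=\mathrm{Edges}(A)\cup\bigcup_w\mathscr G_w$, $R=\{eW(t_e(h))e^{-1}V(i_e(h))^{-1}: e\in\mathrm{Edges}(A),h\in\mathbb A_e\}\cup\bigcup_wR_w$, $\mathrm{Bass}(\mathbb A)=\langle X\mid R\rangle$, with evaluation map $\epsilon:(X^{\pm1})^*\to\mathrm{Bass}(\mathbb A)$ sending a word to the product of its letters. A word $W$ represents an element $g$ if $\epsilon(W)=g$. **Fundamental group.** $\pi_1(\mathbb A,v)\le\mathrm{Bass}(\mathbb A)$ is the subgroup generated by the elements $a_0e_1^{\epsilon_1}a_1\cdots e_p^{\epsilon_p}a_p$ where $e_1^{\epsilon_1}\cdots e_p^{\epsilon_p}$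 ($\epsilon_j=\pm1$) is a (possibly empty) loop at $v$ in $A$, $a_0\in\mathbb A_v$, $a_j\in\mathbb A_{t(e_j^{\epsilon_j})}$. **Labelled graphs.** In a directed $X$-labelled graph every edge $f$ has a label $\mu(f)\in X$. A fold identifies two distinct edges with the same label and the same initial vertex, or with the same label and the same terminal vertex (identifying also their other endpoints). $\Gamma_w$ is the $X$-labelled Cayley graph of $\mathbb A_w$ with respect to $\mathscr G_w$. **The folding algorithm**, on input $(W_1,\dots,W_s)$: (1) For each $W_j$ make a linear labelled directed graph along which $W_j$ can be read, and identify all the endpoints of these linear graphs to obtain a bouquet $\mathcal A_0$ with basepoint $v_0$. (2) Vertex saturation: for each vertex $z$ of $\mathcal A_0$, if $z$ is adjacent to an edge with a label in $\mathscr G_w$, set $[z]=w$ and attach a copy of $\Gamma_{[z]}$ to $z$; if $z$ is adjacent to an edge $f$ with $t(f)=z$ or $i(f)=z$ and label $e\in\mathrm{Edges}(A)$, attach a copy of $\Gamma_{t(e)}$ or $\Gamma_{i(e)}$, respectively, to $z$. Result: $\mathcal A_1$. (3) Edge saturation: for each edge $f$ of $\mathcal A_1$ with label $e\in\mathrm{Edges}(A)$ and each relation $r=eW(t_e(h))e^{-1}V(i_e(h))^{-1}$ involving $e$ in $R$, attach at $i(f)$ a loop with label $r$. Result: $\mathcal A_2$. (4) Perform folds on $\mathcal A_2$ (by a fast Stallings folding algorithm) until none is possible; the result is $\mathcal A_F$. The graph $\mathcal A_F$ carries a map $z\mapsto[z]$ from its vertices to $\mathrm{Verts}(A)$ such that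 an edge labelled in $\mathscr G_w$ joins vertices $z$ with $[z]=w$, and an edge labelled $e\in\mathrm{Edges}(A)$ goes from a vertex $z$ with $[z]=i(e)$ to a vertex $z'$ with $[z']=t(e)$. **Components.** For $u\in\mathrm{Verts}(A)$, the $u$-components of $\mathcal A_F$ are the connected components of the subgraph of $\mathcal A_F$ consisting of all edges with labels in $\mathscr G_u$; each vertex of $\mathcal A_F$ is regarded as lying in some $u$-component. The $\mathrm{Verts}(A)$-components are the $u$-components for all $u\in\mathrm{Verts}(A)$. **Running time** is the count of pointer operations and operations on integers of uniformly bounded size; the constant in $O(\cdot)$ depends on the fixed $\mathbb A$ and its presentation. *)

theory Defs
  imports "HOL-Algebra.Generated_Groups" "Graph_Theory.Digraph"
begin

text \<open>The letter \<open>(x, True)\<close> stands for \<open>x\<close> and \<open>(x, False)\<close> for its formal inverse.\<close>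

type_synonym 'x word = "('x \<times> bool) list"

abbreviation words :: "'x set \<Rightarrow> 'x word set" where
  "words X \<equiv> lists (X \<times> UNIV)"

definition word_inv :: "'x word \<Rightarrow> 'x word" where
  "word_inv W = rev (map (\<lambda>(x, b). (x, \<not> b)) W)"

text \<open>The congruence on the words over \<open>X\<close> whose classes are the elements of
  \<open>\<langle>X | R\<rangle>\<close>.\<close>

inductive_set pres_rel :: "'x set \<Rightarrow> 'x word set \<Rightarrow> ('x word \<times> 'x word) set"
  for X :: "'x set" and R :: "'x word set" where
  refl: "U \<in> words X \<Longrightarrow> (U, U) \<in> pres_rel X R"
| sym: "(U, V) \<in> pres_rel X R \<Longrightarrow> (V, U) \<in> pres_rel X R"
| trans: "(U, V) \<in> pres_rel X R \<Longrightarrow> (V, W) \<in> pres_rel X R \<Longrightarrow> (U, W) \<in> pres_rel X R"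
| cancel: "U \<in> words X \<Longrightarrow> V \<in> words X \<Longrightarrow> x \<in> X \<Longrightarrow>
    (U @ [(x, b), (x, \<not> b)] @ V, U @ V) \<in> pres_rel X R"
| relator: "U \<in> words X \<Longrightarrow> V \<in> words X \<Longrightarrow> r \<in> R \<Longrightarrow> r \<in> words X \<Longrightarrow>
    (U @ r @ V, U @ V) \<in> pres_rel X R"

definition pres_class :: "'x set \<Rightarrow> 'x word set \<Rightarrow> 'x word \<Rightarrow> 'x word set" where
  "pres_class X R W = pres_rel X R `` {W}"

definition pres_group :: "'x set \<Rightarrow> 'x word set \<Rightarrow> 'x word set monoid" where
  "pres_group X R =
    \<lparr> carrier = words X // pres_rel X R,
      mult = (\<lambda>P Q. \<Union>U\<in>P. \<Union>V\<in>Q. pres_class X R (U @ V)),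
      one = pres_class X R [] \<rparr>"

text \<open>A basis embeds into the group, so it is no restriction that the alphabet \<open>S\<close>
  consists of elements of the type of the group.\<close>

definition free_group :: "('a, 'b) monoid_scheme \<Rightarrow> bool" where
  "free_group G \<longleftrightarrow> group G \<and> (\<exists>S :: 'a set. G \<cong> pres_group S {})"

fun word_val :: "('a, 'b) monoid_scheme \<Rightarrow> ('x \<Rightarrow> 'a) \<Rightarrow> 'x word \<Rightarrow> 'a" where
  "word_val G f [] = \<one>\<^bsub>G\<^esub>"
| "word_val G f ((x, b) # W) = (if b then f x else inv\<^bsub>G\<^esub> (f x)) \<otimes>\<^bsub>G\<^esub> word_val G f W"

record ('v, 'e, 'g, 'h) graph_of_groups =
  ugraph :: "('v, 'e) pre_digraph"
  vgrp :: "'v \<Rightarrow> 'g monoid"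
  egrp :: "'e \<Rightarrow> 'h monoid"
  imap :: "'e \<Rightarrow> 'h \<Rightarrow> 'g"
  tmap :: "'e \<Rightarrow> 'h \<Rightarrow> 'g"

text \<open>The data of the presentation: the tuple of generating symbols \<open>gens w\<close>, the element
  \<open>gval s\<close> of the vertex group denoted by the symbol \<open>s\<close>, the relators \<open>rels w\<close>, and
  the words \<open>tword e h\<close> and \<open>iword e h\<close> chosen for the images of \<open>h\<close> under
  \<open>tmap e\<close> and \<open>imap e\<close>.\<close>

record ('v, 'e, 'g, 'h, 's) presented_graph_of_groups = "('v, 'e, 'g, 'h) graph_of_groups" +
  gens :: "'v \<Rightarrow> 's list"
  gval :: "'s \<Rightarrow> 'g"
  rels :: "'v \<Rightarrow> 's word set"
  tword :: "'e \<Rightarrow> 'h \<Rightarrow> 's word"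
  iword :: "'e \<Rightarrow> 'h \<Rightarrow> 's word"

locale gog =
  fixes \<A> :: "('v, 'e, 'g, 'h, 'm) graph_of_groups_scheme"
  assumes finite_graph: "fin_digraph (ugraph \<A>)"
    and vertex_group: "w \<in> verts (ugraph \<A>) \<Longrightarrow> group (vgrp \<A> w)"
    and edge_group: "e \<in> arcs (ugraph \<A>) \<Longrightarrow> group (egrp \<A> e)"
    and imap_mon: "e \<in> arcs (ugraph \<A>) \<Longrightarrow>
      imap \<A> e \<in> mon (egrp \<A> e) (vgrp \<A> (tail (ugraph \<A>) e))"
    and tmap_mon: "e \<in> arcs (ugraph \<A>) \<Longrightarrow>
      tmap \<A> e \<in> mon (egrp \<A> e) (vgrp \<A> (head (ugraph \<A>) e))"

locale presented_gog = gog \<A>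
  for \<A> :: "('v, 'e, 'g, 'h, 's) presented_graph_of_groups" +
  assumes distinct_gens: "w \<in> verts (ugraph \<A>) \<Longrightarrow> distinct (gens \<A> w)"
    and disjoint_gens: "w \<in> verts (ugraph \<A>) \<Longrightarrow> w' \<in> verts (ugraph \<A>) \<Longrightarrow> w \<noteq> w' \<Longrightarrow>
      set (gens \<A> w) \<inter> set (gens \<A> w') = {}"
    and finite_rels: "w \<in> verts (ugraph \<A>) \<Longrightarrow> finite (rels \<A> w)"
    and rels_words: "w \<in> verts (ugraph \<A>) \<Longrightarrow> rels \<A> w \<subseteq> words (set (gens \<A> w))"
    and presentation: "w \<in> verts (ugraph \<A>) \<Longrightarrow>
      \<exists>\<phi> \<in> iso (pres_group (set (gens \<A> w)) (rels \<A> w)) (vgrp \<A> w). \<forall>s \<in> set (gens \<A> w).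
        \<phi> (pres_class (set (gens \<A> w)) (rels \<A> w) [(s, True)]) = gval \<A> s"
    and tword: "e \<in> arcs (ugraph \<A>) \<Longrightarrow> h \<in> carrier (egrp \<A> e) \<Longrightarrow>
      tword \<A> e h \<in> words (set (gens \<A> (head (ugraph \<A>) e))) \<and>
      word_val (vgrp \<A> (head (ugraph \<A>) e)) (gval \<A>) (tword \<A> e h) = tmap \<A> e h"
    and iword: "e \<in> arcs (ugraph \<A>) \<Longrightarrow> h \<in> carrier (egrp \<A> e) \<Longrightarrow>
      iword \<A> e h \<in> words (set (gens \<A> (tail (ugraph \<A>) e))) \<and>
      word_val (vgrp \<A> (tail (ugraph \<A>) e)) (gval \<A>) (iword \<A> e h) = imap \<A> e h"

datatype ('e, 's) letter = Edge 'e | Gen 's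

definition gen_letters ::
    "('v, 'e, 'g, 'h, 's) presented_graph_of_groups \<Rightarrow> 'v \<Rightarrow> ('e, 's) letter set" where
  "gen_letters \<A> w = Gen ` set (gens \<A> w)"

definition alphabet ::
    "('v, 'e, 'g, 'h, 's) presented_graph_of_groups \<Rightarrow> ('e, 's) letter set" where
  "alphabet \<A> = Edge ` arcs (ugraph \<A>) \<union> (\<Union>w \<in> verts (ugraph \<A>). gen_letters \<A> w)"

definition gen_word :: "'s word \<Rightarrow> ('e, 's) letter word" where
  "gen_word = map (\<lambda>(s, b). (Gen s, b))"

definition edge_relator ::
    "('v, 'e, 'g, 'h, 's) presented_graph_of_groups \<Rightarrow> 'e \<Rightarrow> 'h \<Rightarrow> ('e, 's) letter word" where
  "edge_relator \<A> e h =
    [(Edge e, True)] @ gen_word (tword \<A> e h) @ [(Edge e, False)] @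
    word_inv (gen_word (iword \<A> e h))"

definition relators ::
    "('v, 'e, 'g, 'h, 's) presented_graph_of_groups \<Rightarrow> ('e, 's) letter word set" where
  "relators \<A> =
    {edge_relator \<A> e h | e h. e \<in> arcs (ugraph \<A>) \<and> h \<in> carrier (egrp \<A> e)} \<union>
    (\<Union>w \<in> verts (ugraph \<A>). gen_word ` rels \<A> w)"

definition Bass ::
    "('v, 'e, 'g, 'h, 's) presented_graph_of_groups \<Rightarrow> ('e, 's) letter word set monoid" where
  "Bass \<A> = pres_group (alphabet \<A>) (relators \<A>)"

definition ev ::
    "('v, 'e, 'g, 'h, 's) presented_graph_of_groups \<Rightarrow>
     ('e, 's) letter word \<Rightarrow> ('e, 's) letter word set" where
  "ev \<A> = pres_class (alphabet \<A>) (relators \<A>)"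

text \<open>The image of the vertex group at \<open>w\<close> in the Bass group.\<close>

definition vertex_elements ::
    "('v, 'e, 'g, 'h, 's) presented_graph_of_groups \<Rightarrow> 'v \<Rightarrow> ('e, 's) letter word set set" where
  "vertex_elements \<A> w = ev \<A> ` words (gen_letters \<A> w)"

text \<open>\<open>path_element \<A> u w p\<close>: \<open>p\<close> is a product \<open>a\<^sub>0 e\<^sub>1 a\<^sub>1 \<dots> e\<^sub>p a\<^sub>p\<close> in which the
  \<open>e\<^sub>i\<close> are edges or reversed edges forming a path from \<open>u\<close> to \<open>w\<close>.\<close>

inductive path_element ::
    "('v, 'e, 'g, 'h, 's) presented_graph_of_groups \<Rightarrow>
     'v \<Rightarrow> 'v \<Rightarrow> ('e, 's) letter word set \<Rightarrow> bool"
  for \<A> :: "('v, 'e, 'g, 'h, 's) presented_graph_of_groups" where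
  start: "u \<in> verts (ugraph \<A>) \<Longrightarrow> a \<in> vertex_elements \<A> u \<Longrightarrow> path_element \<A> u u a"
| forward: "path_element \<A> u (tail (ugraph \<A>) e) p \<Longrightarrow> e \<in> arcs (ugraph \<A>) \<Longrightarrow>
    a \<in> vertex_elements \<A> (head (ugraph \<A>) e) \<Longrightarrow>
    path_element \<A> u (head (ugraph \<A>) e)
      (p \<otimes>\<^bsub>Bass \<A>\<^esub> ev \<A> [(Edge e, True)] \<otimes>\<^bsub>Bass \<A>\<^esub> a)"
| backward: "path_element \<A> u (head (ugraph \<A>) e) p \<Longrightarrow> e \<in> arcs (ugraph \<A>) \<Longrightarrow>
    a \<in> vertex_elements \<A> (tail (ugraph \<A>) e) \<Longrightarrow>
    path_element \<A> u (tail (ugraph \<A>) e)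
      (p \<otimes>\<^bsub>Bass \<A>\<^esub> ev \<A> [(Edge e, False)] \<otimes>\<^bsub>Bass \<A>\<^esub> a)"

definition fundamental_group ::
    "('v, 'e, 'g, 'h, 's) presented_graph_of_groups \<Rightarrow> 'v \<Rightarrow> ('e, 's) letter word set set" where
  "fundamental_group \<A> v = generate (Bass \<A>) {p. path_element \<A> v v p}"

definition input_tuples ::
    "('v, 'e, 'g, 'h, 's) presented_graph_of_groups \<Rightarrow> 'v \<Rightarrow> ('e, 's) letter word list set" where
  "input_tuples \<A> v =
    {Ws. \<forall>W \<in> set Ws. W \<in> words (alphabet \<A>) \<and> ev \<A> W \<in> fundamental_group \<A> v}"

definition generated_subgroup ::
    "('v, 'e, 'g, 'h, 's) presented_graph_of_groups \<Rightarrow> ('e, 's) letter word list \<Rightarrow>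
     ('e, 's) letter word set monoid" where
  "generated_subgroup \<A> Ws =
    (Bass \<A>)\<lparr>carrier := generate (Bass \<A>) (ev \<A> ` set Ws)\<rparr>"

record ('a, 'b, 'x) lgraph = "('a, 'b) pre_digraph" +
  lab :: "'b \<Rightarrow> 'x"
  base :: 'a

definition lgraph_iso :: "('a, 'b, 'x) lgraph \<Rightarrow> ('c, 'd, 'x) lgraph \<Rightarrow> bool" where
  "lgraph_iso \<Gamma> \<Delta> \<longleftrightarrow> (\<exists>\<phi> \<psi>.
    bij_betw \<phi> (verts \<Gamma>) (verts \<Delta>) \<and> bij_betw \<psi> (arcs \<Gamma>) (arcs \<Delta>) \<and>
    (\<forall>f \<in> arcs \<Gamma>. tail \<Delta> (\<psi> f) = \<phi> (tail \<Gamma> f) \<and> head \<Delta> (\<psi> f) = \<phi> (head \<Gamma> f) \<and>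
      lab \<Delta> (\<psi> f) = lab \<Gamma> f))"

text \<open>For every \<open>i \<in> I\<close>, a separate copy of \<open>D i\<close> is attached to \<open>\<Gamma>\<close> by
  identifying its base point with the vertex \<open>p i\<close>.\<close>

definition attach ::
    "('a, 'b, 'x) lgraph \<Rightarrow> 'i set \<Rightarrow> ('i \<Rightarrow> 'a) \<Rightarrow> ('i \<Rightarrow> ('c, 'd, 'x) lgraph) \<Rightarrow>
     ('a + 'i \<times> 'c, 'b + 'i \<times> 'd, 'x) lgraph" where
  "attach \<Gamma> I p D =
    (let emb = (\<lambda>i c. if c = base (D i) then Inl (p i) else Inr (i, c)) in
    \<lparr> verts = Inl ` verts \<Gamma> \<union> (\<Union>i \<in> I. emb i ` verts (D i)),
      arcs = Inl ` arcs \<Gamma> \<union> Inr ` (SIGMA i:I. arcs (D i)),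
      tail = case_sum (\<lambda>f. Inl (tail \<Gamma> f)) (\<lambda>(i, f). emb i (tail (D i) f)),
      head = case_sum (\<lambda>f. Inl (head \<Gamma> f)) (\<lambda>(i, f). emb i (head (D i) f)),
      lab = case_sum (lab \<Gamma>) (\<lambda>(i, f). lab (D i) f),
      base = Inl (base \<Gamma>) \<rparr>)"

text \<open>The linear graph along which \<open>W\<close> is read, with both ends identified to the vertex
  \<open>0\<close>; vertex \<open>k\<close> is the position after the first \<open>k\<close> letters. An inverse letter is
  read by traversing an edge backwards.\<close>

definition word_loop :: "'x word \<Rightarrow> (nat, nat, 'x) lgraph" where
  "word_loop W =
    (let pos = (\<lambda>k. if k = length W then 0 else k) in
    \<lparr> verts = insert 0 {..<length W},
      arcs = {..<length W},
      tail = (\<lambda>k. if snd (W ! k) then k else pos (Suc k)),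
      head = (\<lambda>k. if snd (W ! k) then pos (Suc k) else k),
      lab = (\<lambda>k. fst (W ! k)),
      base = 0 \<rparr>)"

definition cayley_graph ::
    "('v, 'e, 'g, 'h, 's) presented_graph_of_groups \<Rightarrow> 'v \<Rightarrow>
     ('g, 'g \<times> 's, ('e, 's) letter) lgraph" where
  "cayley_graph \<A> w =
    \<lparr> verts = carrier (vgrp \<A> w),
      arcs = carrier (vgrp \<A> w) \<times> set (gens \<A> w),
      tail = (\<lambda>(g, s). g),
      head = (\<lambda>(g, s). g \<otimes>\<^bsub>vgrp \<A> w\<^esub> gval \<A> s),
      lab = (\<lambda>(g, s). Gen s),
      base = \<one>\<^bsub>vgrp \<A> w\<^esub> \<rparr>"

definition bouquet ::
    "'x word list \<Rightarrow> (unit + nat \<times> nat, unit + nat \<times> nat, 'x) lgraph" where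
  "bouquet Ws =
    attach \<lparr>verts = {()}, arcs = {}, tail = (\<lambda>_. ()), head = (\<lambda>_. ()),
            lab = (\<lambda>_. undefined), base = ()\<rparr>
      {..<length Ws} (\<lambda>_. ()) (\<lambda>j. word_loop (Ws ! j))"

text \<open>\<open>u \<in> vtypes \<A> v \<Gamma> z\<close> expresses \<open>[z] = u\<close>: the type of a vertex is read off from any
  adjacent edge, and the base point has type \<open>v\<close> (this is needed for inputs consisting of
  empty words, where the base point has no adjacent edge). If the input words are read along
  loops at \<open>v\<close>, then every vertex has exactly one type. A word representing an element of the
  fundamental group need not be of this form, for instance \<open>s s\<^sup>-\<^sup>1\<close> with \<open>s\<close> in
  \<open>gens \<A> w\<close> and \<open>w \<noteq> v\<close>; therefore types are kept as sets, and a vertex is saturated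
  for each of its types.\<close>

definition vtypes ::
    "('v, 'e, 'g, 'h, 's) presented_graph_of_groups \<Rightarrow> 'v \<Rightarrow>
     ('a, 'b, ('e, 's) letter) lgraph \<Rightarrow> 'a \<Rightarrow> 'v set" where
  "vtypes \<A> v \<Gamma> z = {u \<in> verts (ugraph \<A>).
    (z = base \<Gamma> \<and> u = v) \<or>
    (\<exists>f \<in> arcs \<Gamma>. (tail \<Gamma> f = z \<or> head \<Gamma> f = z) \<and> lab \<Gamma> f \<in> gen_letters \<A> u) \<or>
    (\<exists>f \<in> arcs \<Gamma>. \<exists>e \<in> arcs (ugraph \<A>). lab \<Gamma> f = Edge e \<and>
      ((tail \<Gamma> f = z \<and> u = tail (ugraph \<A>) e) \<or>
       (head \<Gamma> f = z \<and> u = head (ugraph \<A>) e)))}"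

definition vertex_saturation ::
    "('v, 'e, 'g, 'h, 's) presented_graph_of_groups \<Rightarrow> 'v \<Rightarrow>
     ('a, 'b, ('e, 's) letter) lgraph \<Rightarrow>
     ('a + ('a \<times> 'v) \<times> 'g, 'b + ('a \<times> 'v) \<times> 'g \<times> 's, ('e, 's) letter) lgraph" where
  "vertex_saturation \<A> v \<Gamma> =
    attach \<Gamma> (SIGMA z:verts \<Gamma>. vtypes \<A> v \<Gamma> z) (\<lambda>(z, u). z) (\<lambda>(z, u). cayley_graph \<A> u)"

definition edge_saturation ::
    "('v, 'e, 'g, 'h, 's) presented_graph_of_groups \<Rightarrow>
     ('a, 'b, ('e, 's) letter) lgraph \<Rightarrow>
     ('a + ('b \<times> 'e \<times> 'h) \<times> nat, 'b + ('b \<times> 'e \<times> 'h) \<times> nat, ('e, 's) letter) lgraph" where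
  "edge_saturation \<A> \<Gamma> =
    attach \<Gamma>
      {(f, e, h). f \<in> arcs \<Gamma> \<and> e \<in> arcs (ugraph \<A>) \<and> lab \<Gamma> f = Edge e \<and> h \<in> carrier (egrp \<A> e)}
      (\<lambda>(f, e, h). tail \<Gamma> f) (\<lambda>(f, e, h). word_loop (edge_relator \<A> e h))"

text \<open>Identify the edge \<open>g\<close> with an edge that is kept, and the vertex \<open>b\<close> with \<open>a\<close>.\<close>

definition identify ::
    "'b \<Rightarrow> 'a \<Rightarrow> 'a \<Rightarrow> ('a, 'b, 'x) lgraph \<Rightarrow> ('a, 'b, 'x) lgraph" where
  "identify g a b \<Gamma> =
    (let \<sigma> = (\<lambda>z. if z = b then a else z) in
    \<lparr> verts = \<sigma> ` verts \<Gamma>, arcs = arcs \<Gamma> - {g}, tail = \<sigma> \<circ> tail \<Gamma>, head = \<sigma> \<circ> head \<Gamma>,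
      lab = lab \<Gamma>, base = \<sigma> (base \<Gamma>) \<rparr>)"

inductive fold_step :: "('a, 'b, 'x) lgraph \<Rightarrow> ('a, 'b, 'x) lgraph \<Rightarrow> bool" where
  fold_out: "f \<in> arcs \<Gamma> \<Longrightarrow> g \<in> arcs \<Gamma> \<Longrightarrow> f \<noteq> g \<Longrightarrow> lab \<Gamma> f = lab \<Gamma> g \<Longrightarrow>
    tail \<Gamma> f = tail \<Gamma> g \<Longrightarrow> fold_step \<Gamma> (identify g (head \<Gamma> f) (head \<Gamma> g) \<Gamma>)"
| fold_in: "f \<in> arcs \<Gamma> \<Longrightarrow> g \<in> arcs \<Gamma> \<Longrightarrow> f \<noteq> g \<Longrightarrow> lab \<Gamma> f = lab \<Gamma> g \<Longrightarrow>
    head \<Gamma> f = head \<Gamma> g \<Longrightarrow> fold_step \<Gamma> (identify g (tail \<Gamma> f) (tail \<Gamma> g) \<Gamma>)"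

text \<open>\<open>\<Gamma>\<close> is a possible result \<open>\<A>\<^sub>F\<close> of the folding algorithm, for some order in which
  the folds are performed.\<close>

definition folding_result ::
    "('v, 'e, 'g, 'h, 's) presented_graph_of_groups \<Rightarrow> 'v \<Rightarrow> ('e, 's) letter word list \<Rightarrow>
     (_, _, ('e, 's) letter) lgraph \<Rightarrow> bool" where
  "folding_result \<A> v Ws \<Gamma> \<longleftrightarrow>
    fold_step\<^sup>*\<^sup>* (edge_saturation \<A> (vertex_saturation \<A> v (bouquet Ws))) \<Gamma> \<and>
    (\<nexists>\<Gamma>'. fold_step \<Gamma> \<Gamma>')"

definition component :: "('a, 'b, 'x) lgraph \<Rightarrow> 'x set \<Rightarrow> 'a \<Rightarrow> ('a, 'b, 'x) lgraph" where
  "component \<Gamma> L z =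
    (let E = {f \<in> arcs \<Gamma>. lab \<Gamma> f \<in> L};
         C = (\<lambda>f. (tail \<Gamma> f, head \<Gamma> f)) ` E
     in \<Gamma>\<lparr>verts := {y. (z, y) \<in> (C \<union> C\<inverse>)\<^sup>*},
           arcs := {f \<in> E. (z, tail \<Gamma> f) \<in> (C \<union> C\<inverse>)\<^sup>*},
           base := z\<rparr>)"

definition vertex_components ::
    "('v, 'e, 'g, 'h, 's) presented_graph_of_groups \<Rightarrow> 'v \<Rightarrow>
     ('a, 'b, ('e, 's) letter) lgraph \<Rightarrow> 'v \<Rightarrow> ('a, 'b, ('e, 's) letter) lgraph set" where
  "vertex_components \<A> v \<Gamma> u =
    {component \<Gamma> (gen_letters \<A> u) z | z. z \<in> verts \<Gamma> \<and> u \<in> vtypes \<A> v \<Gamma> z}"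

text \<open>A record in memory maps field numbers to values. Programs name registers and fields by
  literals only, and \<open>exec B\<close> gets stuck if an integer exceeds \<open>B\<close> in absolute value, so a
  program run under a fixed \<open>B\<close> uses pointer operations and integers of bounded size only.\<close>

datatype val = Null | Ptr nat | Num int

record state =
  regs :: "nat \<Rightarrow> val"
  mem :: "nat \<Rightarrow> nat \<Rightarrow> val"
  fresh :: nat

datatype arith = Plus | Minus | Times

datatype test = Eq nat nat | Less nat nat

datatype com =
    Skip
  | SetNull nat
  | Const nat int
  | Copy nat nat
  | Arith arith nat nat nat
  | New nat
  | Load nat nat nat
  | Store nat nat nat
  | Seq com com
  | If test com com
  | While test com

fun apply_arith :: "arith \<Rightarrow> int \<Rightarrow> int \<Rightarrow> int" where
  "apply_arith Plus i j = i + j"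
| "apply_arith Minus i j = i - j"
| "apply_arith Times i j = i * j"

inductive tested :: "test \<Rightarrow> state \<Rightarrow> bool \<Rightarrow> bool" where
  "tested (Eq r s) \<sigma> (regs \<sigma> r = regs \<sigma> s)"
| "regs \<sigma> r = Num i \<Longrightarrow> regs \<sigma> s = Num j \<Longrightarrow> tested (Less r s) \<sigma> (i < j)"

abbreviation set_reg :: "state \<Rightarrow> nat \<Rightarrow> val \<Rightarrow> state" where
  "set_reg \<sigma> r x \<equiv> \<sigma>\<lparr>regs := (regs \<sigma>)(r := x)\<rparr>"

text \<open>\<open>exec B c \<sigma> t \<sigma>'\<close>: started in \<open>\<sigma>\<close>, the program \<open>c\<close> terminates in \<open>\<sigma>'\<close> after
  \<open>t\<close> operations.\<close>

inductive exec :: "int \<Rightarrow> com \<Rightarrow> state \<Rightarrow> nat \<Rightarrow> state \<Rightarrow> bool" for B :: int where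
  "exec B Skip \<sigma> 0 \<sigma>"
| "exec B (SetNull r) \<sigma> 1 (set_reg \<sigma> r Null)"
| "\<bar>i\<bar> \<le> B \<Longrightarrow> exec B (Const r i) \<sigma> 1 (set_reg \<sigma> r (Num i))"
| "exec B (Copy r s) \<sigma> 1 (set_reg \<sigma> r (regs \<sigma> s))"
| "regs \<sigma> s = Num i \<Longrightarrow> regs \<sigma> q = Num j \<Longrightarrow> \<bar>apply_arith f i j\<bar> \<le> B \<Longrightarrow>
    exec B (Arith f r s q) \<sigma> 1 (set_reg \<sigma> r (Num (apply_arith f i j)))"
| "exec B (New r) \<sigma> 1
    \<lparr>regs = (regs \<sigma>)(r := Ptr (fresh \<sigma>)), mem = (mem \<sigma>)(fresh \<sigma> := (\<lambda>_. Null)),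
     fresh = Suc (fresh \<sigma>)\<rparr>"
| "regs \<sigma> s = Ptr a \<Longrightarrow> exec B (Load r s k) \<sigma> 1 (set_reg \<sigma> r (mem \<sigma> a k))"
| "regs \<sigma> r = Ptr a \<Longrightarrow> exec B (Store r k s) \<sigma> 1
    (\<sigma>\<lparr>mem := (mem \<sigma>)(a := (mem \<sigma> a)(k := regs \<sigma> s))\<rparr>)"
| "exec B c \<sigma> t \<sigma>' \<Longrightarrow> exec B d \<sigma>' t' \<sigma>'' \<Longrightarrow> exec B (Seq c d) \<sigma> (t + t') \<sigma>''"
| "tested b \<sigma> True \<Longrightarrow> exec B c \<sigma> t \<sigma>' \<Longrightarrow> exec B (If b c d) \<sigma> (Suc t) \<sigma>'"
| "tested b \<sigma> False \<Longrightarrow> exec B d \<sigma> t \<sigma>' \<Longrightarrow> exec B (If b c d) \<sigma> (Suc t) \<sigma>'"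
| "tested b \<sigma> False \<Longrightarrow> exec B (While b c) \<sigma> 1 \<sigma>"
| "tested b \<sigma> True \<Longrightarrow> exec B c \<sigma> t \<sigma>' \<Longrightarrow> exec B (While b c) \<sigma>' t' \<sigma>'' \<Longrightarrow>
    exec B (While b c) \<sigma> (Suc (t + t')) \<sigma>''"

text \<open>\<open>modification c d\<close>: the program \<open>d\<close> is \<open>c\<close> with further commands inserted.\<close>

inductive modification :: "com \<Rightarrow> com \<Rightarrow> bool" where
  "modification c c"
| "modification c d \<Longrightarrow> modification c (Seq q d)"
| "modification c d \<Longrightarrow> modification c (Seq d q)"
| "modification c d \<Longrightarrow> modification c' d' \<Longrightarrow> modification (Seq c c') (Seq d d')"
| "modification c d \<Longrightarrow> modification c' d' \<Longrightarrow> modification (If b c c') (If b d d')"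
| "modification c d \<Longrightarrow> modification (While b c) (While b d)"

text \<open>Linked lists: field \<open>0\<close> of a cell holds the entry, field \<open>1\<close> the next cell. A memory
  is paired with its first unused address.\<close>

fun put_list :: "val list \<Rightarrow> (nat \<Rightarrow> nat \<Rightarrow> val) \<times> nat \<Rightarrow> val \<times> (nat \<Rightarrow> nat \<Rightarrow> val) \<times> nat" where
  "put_list [] M = (Null, M)"
| "put_list (x # xs) M =
    (let (p, m, n) = put_list xs M
     in (Ptr n, m(n := (\<lambda>_. Null)(0 := x, 1 := p)), Suc n))"

text \<open>The letters are encoded through a numbering \<open>num\<close> of the alphabet.\<close>

definition code :: "('x \<Rightarrow> nat) \<Rightarrow> 'x \<times> bool \<Rightarrow> nat" where
  "code num = (\<lambda>(x, b). 2 * num x + (if b then 0 else 1))"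

fun put_words ::
    "('x \<Rightarrow> nat) \<Rightarrow> 'x word list \<Rightarrow> (nat \<Rightarrow> nat \<Rightarrow> val) \<times> nat \<Rightarrow>
     val list \<times> (nat \<Rightarrow> nat \<Rightarrow> val) \<times> nat" where
  "put_words num [] M = ([], M)"
| "put_words num (W # Ws) M =
    (let (p, M') = put_list (map (\<lambda>l. Num (int (code num l))) W) M;
         (ps, M'') = put_words num Ws M'
     in (p # ps, M''))"

text \<open>The input is a linked list of linked lists of letters, pointed to by register \<open>0\<close>.\<close>

definition input_state :: "('x \<Rightarrow> nat) \<Rightarrow> 'x word list \<Rightarrow> state" where
  "input_state num Ws =
    (let (ps, M) = put_words num Ws (\<lambda>_ _. Null, 0);
         (p, m, n) = put_list ps M
     in \<lparr>regs = (\<lambda>_. Null)(0 := p), mem = m, fresh = n\<rparr>)"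

text \<open>A folded graph is output as a pointer in register \<open>0\<close> to the record of its base point.
  The record of a vertex has one field per letter \<open>l\<close> of \<open>X\<^sup>\<plusminus>\<close>, with number \<open>code num l\<close>,
  pointing to the vertex reached by reading \<open>l\<close>, or \<open>Null\<close> if \<open>l\<close> cannot be read.\<close>

definition outputs ::
    "('x \<Rightarrow> nat) \<Rightarrow> 'x set \<Rightarrow> state \<Rightarrow> ('a, 'b, 'x) lgraph \<Rightarrow> bool" where
  "outputs num X \<sigma> \<Gamma> \<longleftrightarrow> (\<exists>\<rho>. inj_on \<rho> (verts \<Gamma>) \<and>
    regs \<sigma> 0 = Ptr (\<rho> (base \<Gamma>)) \<and>
    (\<forall>f \<in> arcs \<Gamma>.
      mem \<sigma> (\<rho> (tail \<Gamma> f)) (code num (lab \<Gamma> f, True)) = Ptr (\<rho> (head \<Gamma> f)) \<and>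
      mem \<sigma> (\<rho> (head \<Gamma> f)) (code num (lab \<Gamma> f, False)) = Ptr (\<rho> (tail \<Gamma> f))) \<and>
    (\<forall>z \<in> verts \<Gamma>. \<forall>x \<in> X.
      ((\<nexists>f. f \<in> arcs \<Gamma> \<and> lab \<Gamma> f = x \<and> tail \<Gamma> f = z) \<longrightarrow>
        mem \<sigma> (\<rho> z) (code num (x, True)) = Null) \<and>
      ((\<nexists>f. f \<in> arcs \<Gamma> \<and> lab \<Gamma> f = x \<and> head \<Gamma> f = z) \<longrightarrow>
        mem \<sigma> (\<rho> z) (code num (x, False)) = Null)))"

definition implements_folding ::
    "('v, 'e, 'g, 'h, 's) presented_graph_of_groups \<Rightarrow> 'v \<Rightarrow> (('e, 's) letter \<Rightarrow> nat) \<Rightarrow>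
     int \<Rightarrow> com \<Rightarrow> bool" where
  "implements_folding \<A> v num B c \<longleftrightarrow>
    (\<forall>Ws \<in> input_tuples \<A> v. \<exists>t \<sigma> \<Gamma>. exec B c (input_state num Ws) t \<sigma> \<and>
      folding_result \<A> v Ws \<Gamma> \<and> outputs num (alphabet \<A>) \<sigma> \<Gamma>)"

definition total_length :: "'x word list \<Rightarrow> nat" where
  "total_length Ws = sum_list (map length Ws)"

end

theory Submission
  imports Defs "HOL-Library.Countable_Set" "HOL-Algebra.Multiplicative_Group"
begin

text \<open>The folded graph \<open>\<Gamma>\<close> accepts exactly the subgroup \<open>H\<close>, and every vertex group
  \<open>\<A>\<^sub>u\<close> acts on the vertices of type \<open>u\<close> by reading words; the component of such a vertex is
  a copy of the Cayley graph iff its stabiliser is trivial. A nontrivial stabiliser is conjugate in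
  \<open>Bass(\<A>)\<close> to a finite subgroup of \<open>H\<close>, so it is an obstruction to freeness. Conversely, if all
  the actions are free, they extend to a representation of \<open>Bass(\<A>)\<close> by permutations of a set
  containing the vertices of \<open>\<Gamma>\<close>, twisted by a cocycle with values in an arbitrary group; these
  cocycles retract \<open>H\<close> onto the free group on the edges outside a spanning tree of the graph of
  orbits. Since \<open>\<Gamma>\<close> has \<open>O(N)\<close> vertices, a graph search that tests at each vertex whether some
  word for a nontrivial element of a vertex group is read along a loop decides freeness in linear
  time.\<close>

subsection \<open>Presented groups\<close>

text \<open>Neither a normal form theorem nor the Bass-Serre tree is used; permutations of
  \<open>nat\<close> take their place. They are available because a free action of a finite group on
  an infinite set of numbers is unique up to isomorphism. Hence a free action on a finite set of
  numbers, and an equivariant injection between finite invariant sets, extend to all of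
  \<open>nat\<close>, and the partial data seen in the folded graph become a representation of the
  whole Bass group. The same device, started from empty data, embeds the vertex groups in the Bass
  group.

  The cocycles must respect the relators. They are coboundaries on the vertex groups, and on an edge
  letter the only condition left is invariance under the edge group. This leaves just enough freedom
  to prescribe the value on one edge per orbit and on one connection of each vertex to its orbit
  representative.

  The folds may happen in any order; determinism of the result alone shows that each of its edges
  comes from the bouquet, from an attached Cayley graph, or by edge group translation from a bouquet
  edge.

  The search marks vertices in a record field that the given program never writes.\<close>

declare in_lists_conv_set [simp del] in_listsD [rule del] in_listsI [rule del]
  lists.intros [rule del] lists.Nil [simp]

lemma word_inv_Nil [simp]: "word_inv [] = []"
  and word_inv_Cons [simp]: "word_inv (l # W) = word_inv W @ [(fst l, \<not> snd l)]"
  and word_inv_append [simp]: "word_inv (U @ V) = word_inv V @ word_inv U"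
  by (auto simp: word_inv_def split: prod.splits)

lemma word_inv_word_inv [simp]: "word_inv (word_inv W) = W"
  by (induction W) auto

lemma word_inv_in_words [simp]: "word_inv W \<in> words X \<longleftrightarrow> W \<in> words X"
  by (induction W) (auto simp: mem_Times_iff)

lemma pres_rel_words: "(U, V) \<in> pres_rel X R \<Longrightarrow> U \<in> words X \<and> V \<in> words X"
  by (induction rule: pres_rel.induct) auto

lemma equiv_pres_rel: "equiv (words X) (pres_rel X R)"
proof (rule equivI)
  show "pres_rel X R \<subseteq> words X \<times> words X"
    using pres_rel_words by fastforce
  show "refl_on (words X) (pres_rel X R)"
    by (auto simp: refl_on_def intro: pres_rel.refl)
  show "Relation.sym (pres_rel X R)"
    by (auto simp: Relation.sym_def intro: pres_rel.sym)
  show "Relation.trans (pres_rel X R)"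
    by (auto simp: Relation.trans_def intro: pres_rel.trans)
qed

lemma pres_rel_context:
  assumes "(U, V) \<in> pres_rel X R" "P \<in> words X" "Q \<in> words X"
  shows "(P @ U @ Q, P @ V @ Q) \<in> pres_rel X R"
  using assms
proof (induction rule: pres_rel.induct)
  case (refl U)
  then show ?case by (auto intro!: pres_rel.refl)
next
  case (sym U V)
  then show ?case by (simp add: pres_rel.sym)
next
  case (trans U V W)
  then show ?case by (meson pres_rel.trans)
next
  case (cancel U V x b)
  then show ?case using pres_rel.cancel[of "P @ U" X "V @ Q" x b R] by auto
next
  case (relator U V r)
  then show ?case using pres_rel.relator[of "P @ U" X "V @ Q" r R] by auto
qed

lemma pres_rel_append:
  assumes "(U, U') \<in> pres_rel X R" "(V, V') \<in> pres_rel X R"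
  shows "(U @ V, U' @ V') \<in> pres_rel X R"
proof -
  have "(U @ V, U' @ V) \<in> pres_rel X R"
    using pres_rel_context[OF assms(1), of "[]" V] assms(2) pres_rel_words by fastforce
  moreover have "(U' @ V, U' @ V') \<in> pres_rel X R"
    using pres_rel_context[OF assms(2), of U' "[]"] assms(1) pres_rel_words by fastforce
  ultimately show ?thesis by (rule pres_rel.trans)
qed

text \<open>The letters cancel from the innermost pair outwards.\<close>

lemma pres_rel_inv_right: "W \<in> words X \<Longrightarrow> (W @ word_inv W, []) \<in> pres_rel X R"
proof (induction W)
  case Nil
  then show ?case by (auto intro: pres_rel.refl)
next
  case (Cons l W)
  obtain x b where l: "l = (x, b)" by fastforce
  have "([l] @ (W @ word_inv W) @ [(x, \<not> b)], [l] @ [] @ [(x, \<not> b)]) \<in> pres_rel X R"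
    using Cons l by (intro pres_rel_context) auto
  moreover have "([] @ [(x, b), (x, \<not> b)] @ [], [] @ []) \<in> pres_rel X R"
    using Cons l by (intro pres_rel.cancel) auto
  ultimately show ?case using l by (auto intro: pres_rel.trans)
qed

lemma pres_rel_inv_left: "W \<in> words X \<Longrightarrow> (word_inv W @ W, []) \<in> pres_rel X R"
  using pres_rel_inv_right[of "word_inv W" X R] by simp

lemma pres_class_eq_iff:
  "U \<in> words X \<Longrightarrow> V \<in> words X \<Longrightarrow>
    pres_class X R U = pres_class X R V \<longleftrightarrow> (U, V) \<in> pres_rel X R"
  unfolding pres_class_def by (rule eq_equiv_class_iff[OF equiv_pres_rel])

lemma in_pres_class: "W \<in> pres_class X R U \<longleftrightarrow> (U, W) \<in> pres_rel X R"
  by (auto simp: pres_class_def)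

lemma carrier_pres_group: "carrier (pres_group X R) = pres_class X R ` words X"
  by (auto simp: pres_group_def quotient_def pres_class_def)

lemma pres_class_closed [simp]: "W \<in> words X \<Longrightarrow> pres_class X R W \<in> carrier (pres_group X R)"
  by (auto simp: carrier_pres_group)

lemma one_pres_group: "\<one>\<^bsub>pres_group X R\<^esub> = pres_class X R []"
  by (simp add: pres_group_def)

text \<open>The product is a union of classes over all pairs of representatives; since
  \<open>pres_rel\<close> is a congruence, these classes all coincide and the union is one of
  them.\<close>

lemma mult_pres_group:
  assumes "U \<in> words X" "V \<in> words X"
  shows "pres_class X R U \<otimes>\<^bsub>pres_group X R\<^esub> pres_class X R V = pres_class X R (U @ V)"
proof -
  have "pres_class X R (U' @ V') = pres_class X R (U @ V)"
    if "U' \<in> pres_class X R U" "V' \<in> pres_class X R V" for U' V'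
  proof -
    have rel: "(U @ V, U' @ V') \<in> pres_rel X R"
      using that unfolding in_pres_class by (rule pres_rel_append)
    then show ?thesis
      using pres_rel_words[OF rel] by (simp add: pres_class_eq_iff pres_rel.sym)
  qed
  then have "(\<Union>U' \<in> pres_class X R U. \<Union>V' \<in> pres_class X R V. pres_class X R (U' @ V')) =
      (\<Union>U' \<in> pres_class X R U. \<Union>V' \<in> pres_class X R V. pres_class X R (U @ V))"
    by (simp cong: SUP_cong)
  also have "U \<in> pres_class X R U" "V \<in> pres_class X R V"
    using assms by (simp_all add: in_pres_class pres_rel.refl)
  then have "(\<Union>U' \<in> pres_class X R U. \<Union>V' \<in> pres_class X R V. pres_class X R (U @ V)) =
      pres_class X R (U @ V)"
    by blast
  finally show ?thesis
    by (simp add: pres_group_def)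
qed

lemma group_pres_group: "group (pres_group X R)"
proof (rule groupI)
  fix P assume "P \<in> carrier (pres_group X R)"
  then obtain W where W: "W \<in> words X" "P = pres_class X R W"
    by (auto simp: carrier_pres_group)
  have "pres_class X R (word_inv W) \<otimes>\<^bsub>pres_group X R\<^esub> P = \<one>\<^bsub>pres_group X R\<^esub>"
    using W pres_rel_inv_left[OF W(1)]
    by (simp add: one_pres_group mult_pres_group pres_class_eq_iff)
  moreover have "pres_class X R (word_inv W) \<in> carrier (pres_group X R)"
    using W(1) by simp
  ultimately show "\<exists>Q \<in> carrier (pres_group X R). Q \<otimes>\<^bsub>pres_group X R\<^esub> P = \<one>\<^bsub>pres_group X R\<^esub>"
    by (rule bexI)
  show "\<one>\<^bsub>pres_group X R\<^esub> \<otimes>\<^bsub>pres_group X R\<^esub> P = P"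
    using W by (simp add: one_pres_group mult_pres_group)
  fix Q assume "Q \<in> carrier (pres_group X R)"
  then obtain U where U: "U \<in> words X" "Q = pres_class X R U"
    by (auto simp: carrier_pres_group)
  show "P \<otimes>\<^bsub>pres_group X R\<^esub> Q \<in> carrier (pres_group X R)"
    using W U by (simp add: mult_pres_group)
  fix S assume "S \<in> carrier (pres_group X R)"
  then obtain V where V: "V \<in> words X" "S = pres_class X R V"
    by (auto simp: carrier_pres_group)
  show "P \<otimes>\<^bsub>pres_group X R\<^esub> Q \<otimes>\<^bsub>pres_group X R\<^esub> S =
      P \<otimes>\<^bsub>pres_group X R\<^esub> (Q \<otimes>\<^bsub>pres_group X R\<^esub> S)"
    using W U V by (simp add: mult_pres_group)
qed (simp add: one_pres_group)

lemma inv_pres_group: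
  assumes "W \<in> words X"
  shows "inv\<^bsub>pres_group X R\<^esub> (pres_class X R W) = pres_class X R (word_inv W)"
  using assms pres_rel_inv_left[OF assms, of R]
  by (intro group.inv_equality group_pres_group)
    (simp_all add: one_pres_group mult_pres_group pres_class_eq_iff)

section \<open>Values of words in a group and the universal property of presentations\<close>

lemma (in group) word_val_closed:
  assumes "\<And>x. x \<in> X \<Longrightarrow> f x \<in> carrier G" "W \<in> words X"
  shows "word_val G f W \<in> carrier G"
  using assms(2) by (induction W) (auto simp: assms(1))

lemma (in group) word_val_append:
  assumes "\<And>x. x \<in> X \<Longrightarrow> f x \<in> carrier G" "U \<in> words X" "V \<in> words X"
  shows "word_val G f (U @ V) = word_val G f U \<otimes> word_val G f V"
  using assms(2)
proof (induction U)
  case Nil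
  then show ?case using word_val_closed[of X f V, OF assms(1,3)] by simp
next
  case (Cons l U)
  obtain x b where l: "l = (x, b)" by fastforce
  have "word_val G f U \<in> carrier G" "word_val G f V \<in> carrier G" "f x \<in> carrier G"
    using Cons assms l word_val_closed[of X f, OF assms(1)] by auto
  then show ?case using Cons l by (auto simp: m_assoc)
qed

lemma (in group) word_val_inv:
  assumes "\<And>x. x \<in> X \<Longrightarrow> f x \<in> carrier G" "W \<in> words X"
  shows "word_val G f (word_inv W) = inv (word_val G f W)"
  using assms(2)
proof (induction W)
  case (Cons l U)
  obtain x b where l: "l = (x, b)" by fastforce
  have "word_val G f U \<in> carrier G" "f x \<in> carrier G"
    using Cons assms l word_val_closed[of X f, OF assms(1)] by auto
  then show ?case using Cons l
    by (auto simp: inv_mult_group word_val_append[of X f, OF assms(1)])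
qed auto

lemma (in group) word_val_pres_rel:
  assumes f: "\<And>x. x \<in> X \<Longrightarrow> f x \<in> carrier G"
    and rel: "\<And>r. r \<in> R \<Longrightarrow> r \<in> words X \<Longrightarrow> word_val G f r = \<one>"
    and "(U, V) \<in> pres_rel X R"
  shows "word_val G f U = word_val G f V"
  using assms(3)
proof (induction rule: pres_rel.induct)
  case (cancel U V x b)
  let ?W = "[(x, b), (x, \<not> b)]"
  have W: "?W \<in> words X" "word_val G f ?W = \<one>"
    using f[OF cancel(3)] cancel(3) by auto
  have "word_val G f (U @ ?W @ V) = word_val G f U \<otimes> (word_val G f ?W \<otimes> word_val G f V)"
    using cancel W(1) word_val_append[of X f U "?W @ V", OF f] word_val_append[of X f ?W V, OF f]
    by (metis append_in_lists_conv)
  then show ?case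
    using cancel word_val_closed[of X f V, OF f] word_val_append[of X f U V, OF f] W(2)
    by (metis l_one)
next
  case (relator U V r)
  have "word_val G f (U @ r @ V) = word_val G f U \<otimes> (word_val G f r \<otimes> word_val G f V)"
    using relator word_val_append[of X f U "r @ V", OF f] word_val_append[of X f r V, OF f]
    by (metis append_in_lists_conv)
  then show ?case
    using relator word_val_closed[of X f V, OF f] word_val_append[of X f U V, OF f]
      rel[OF relator(3,4)]
    by (metis l_one)
qed simp_all

text \<open>Von Dyck's universal property. The value at a class is computed from an arbitrary
  representative, and \<open>word_val_pres_rel\<close> makes it independent of the choice.\<close>

lemma (in group) pres_group_lift:
  assumes f: "\<And>x. x \<in> X \<Longrightarrow> f x \<in> carrier G"
    and rel: "\<And>r. r \<in> R \<Longrightarrow> r \<in> words X \<Longrightarrow> word_val G f r = \<one>"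
  obtains \<Phi> where "\<Phi> \<in> hom (pres_group X R) G"
    and "\<And>W. W \<in> words X \<Longrightarrow> \<Phi> (pres_class X R W) = word_val G f W"
proof -
  define \<Phi> where "\<Phi> P = word_val G f (SOME W. W \<in> P)" for P
  have val: "\<Phi> (pres_class X R W) = word_val G f W" if "W \<in> words X" for W
  proof -
    have "W \<in> pres_class X R W" using that by (simp add: in_pres_class pres_rel.refl)
    then have "(SOME W'. W' \<in> pres_class X R W) \<in> pres_class X R W" by (rule someI)
    then have "(W, SOME W'. W' \<in> pres_class X R W) \<in> pres_rel X R" by (simp add: in_pres_class)
    from word_val_pres_rel[OF f rel this] show ?thesis by (simp add: \<Phi>_def)
  qed
  show ?thesis
  proof
    show "\<Phi> \<in> hom (pres_group X R) G"
      by (auto simp: hom_def carrier_pres_group mult_pres_group val word_val_closed[of X f, OF f]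
        word_val_append[of X f, OF f])
  qed (fact val)
qed

text \<open>Evaluating a word at classes of words amounts to substitution; the substitution that
  fixes every letter yields \<open>word_val_pres_group\<close>.\<close>

lemma pres_class_word_val:
  assumes "\<And>x. x \<in> Y \<Longrightarrow> f x \<in> words X" "W \<in> words Y"
  shows "word_val (pres_group X R) (\<lambda>x. pres_class X R (f x)) W =
    pres_class X R (concat (map (\<lambda>(x, b). if b then f x else word_inv (f x)) W))"
    "concat (map (\<lambda>(x, b). if b then f x else word_inv (f x)) W) \<in> words X"
proof -
  have "word_val (pres_group X R) (\<lambda>x. pres_class X R (f x)) W =
      pres_class X R (concat (map (\<lambda>(x, b). if b then f x else word_inv (f x)) W)) \<and>
    concat (map (\<lambda>(x, b). if b then f x else word_inv (f x)) W) \<in> words X"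
    using assms(2)
  proof (induction W)
    case (Cons l W)
    obtain x b where l: "l = (x, b)" by fastforce
    have "f x \<in> words X" using Cons l assms by auto
    then show ?case using Cons l
      by (auto simp: mult_pres_group inv_pres_group word_inv_in_words simp del: in_lists_conv_set)
  qed (auto simp: one_pres_group)
  then show "word_val (pres_group X R) (\<lambda>x. pres_class X R (f x)) W =
      pres_class X R (concat (map (\<lambda>(x, b). if b then f x else word_inv (f x)) W))"
    "concat (map (\<lambda>(x, b). if b then f x else word_inv (f x)) W) \<in> words X" by blast+
qed

lemma word_val_pres_group:
  assumes "W \<in> words X"
  shows "word_val (pres_group X R) (\<lambda>x. pres_class X R [(x, True)]) W = pres_class X R W"
proof -
  have "concat (map (\<lambda>(x, b). if b then [(x, True)] else word_inv [(x, True)]) W) = W"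
    by (induction W) auto
  then show ?thesis
    using pres_class_word_val(1)[of X "\<lambda>x. [(x, True)]" X W R] assms by auto
qed

lemma hom_word_val:
  assumes "group G" "group H" "\<phi> \<in> hom G H" "\<And>x. x \<in> X \<Longrightarrow> f x \<in> carrier G" "W \<in> words X"
  shows "\<phi> (word_val G f W) = word_val H (\<lambda>x. \<phi> (f x)) W"
proof -
  interpret group_hom G H \<phi> using assms by (simp add: group_hom_def group_hom_axioms_def)
  show ?thesis using assms(5)
  proof (induction W)
    case (Cons l W)
    then show ?case using assms(4) G.word_val_closed[of X f, OF assms(4)] by (cases l) auto
  qed auto
qed

lemma word_val_cong:
  "W \<in> words X \<Longrightarrow> (\<And>x. x \<in> X \<Longrightarrow> f x = g x) \<Longrightarrow> word_val G f W = word_val G g W"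
  by (induction W) auto

subsection \<open>Free groups\<close>

definition reduced :: "'x word \<Rightarrow> bool" where
  "reduced W \<longleftrightarrow> successively (\<lambda>k l. l \<noteq> (fst k, \<not> snd k)) W"

text \<open>Left multiplication by a letter in the free group, expressed on reduced words.\<close>

definition red_cons :: "'x \<times> bool \<Rightarrow> 'x word \<Rightarrow> 'x word" where
  "red_cons l W = (if W \<noteq> [] \<and> hd W = (fst l, \<not> snd l) then tl W else l # W)"

definition reduce :: "'x word \<Rightarrow> 'x word" where
  "reduce W = foldr red_cons W []"

lemma reduced_red_cons: "reduced W \<Longrightarrow> reduced (red_cons l W)"
  by (cases W) (auto simp: reduced_def red_cons_def successively_Cons)

lemma reduced_foldr_red_cons: "reduced V \<Longrightarrow> reduced (foldr red_cons U V)"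
  by (induction U) (auto intro: reduced_red_cons)

lemma red_cons_inverse: "reduced W \<Longrightarrow> red_cons (x, b) (red_cons (x, \<not> b) W) = W"
  by (cases W; cases "tl W") (auto simp: reduced_def red_cons_def)

lemma reduce_append: "reduce (U @ V) = foldr red_cons U (reduce V)"
  by (simp add: reduce_def)

lemma reduced_reduce: "reduced (reduce W)"
  unfolding reduce_def by (rule reduced_foldr_red_cons) (simp add: reduced_def)

text \<open>Van der Waerden's argument: the letters act on reduced words through
  \<open>red_cons\<close>, and a letter and its formal inverse act inversely, so cancelling a pair
  does not change the result. This makes the reduced form an invariant of the class.\<close>

lemma reduce_pres_rel: "(U, V) \<in> pres_rel X {} \<Longrightarrow> reduce U = reduce V"
proof (induction rule: pres_rel.induct)
  case (cancel U V x b)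
  then show ?case
    using red_cons_inverse[OF reduced_reduce[of V], of x b] reduce_append[of "[(x, b), (x, \<not> b)]" V]
    by (auto simp: reduce_append)
qed auto

lemma reduce_reduced: "reduced W \<Longrightarrow> reduce W = W"
proof (induction W)
  case (Cons l W)
  then show ?case
    by (cases W) (auto simp: reduce_def reduced_def red_cons_def)
qed (simp add: reduce_def)

lemma pres_rel_reduce: "W \<in> words X \<Longrightarrow> (W, reduce W) \<in> pres_rel X R"
proof (induction W)
  case Nil
  show ?case by (simp add: reduce_def pres_rel.refl)
next
  case (Cons l W)
  obtain x b where l: "l = (x, b)" by fastforce
  have "([l], [l]) \<in> pres_rel X R" using Cons by (intro pres_rel.refl) simp
  then have IH: "([l] @ W, [l] @ reduce W) \<in> pres_rel X R"
    using Cons by (intro pres_rel_append) simp_all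
  then have words: "[l] @ reduce W \<in> words X" using pres_rel_words by blast
  have "([l] @ reduce W, red_cons l (reduce W)) \<in> pres_rel X R"
  proof (cases "reduce W \<noteq> [] \<and> hd (reduce W) = (x, \<not> b)")
    case True
    then obtain W' where W': "reduce W = (x, \<not> b) # W'" by (cases "reduce W") auto
    then show ?thesis
      using pres_rel.cancel[of "[]" X W' x b R] words l by (simp add: red_cons_def)
  next
    case False
    then have "red_cons l (reduce W) = [l] @ reduce W" using l by (auto simp: red_cons_def)
    then show ?thesis using pres_rel.refl[OF words] by simp
  qed
  from pres_rel.trans[OF IH this] show ?case by (simp add: reduce_def)
qed

section \<open>Powers of reduced words and torsion\<close>

lemma reduced_power:
  assumes "reduced W" "W \<noteq> []" "hd W \<noteq> (fst (last W), \<not> snd (last W))"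
  shows "reduced (concat (replicate n W))"
proof (induction n)
  case (Suc n)
  then show ?case using assms
    by (cases n) (auto simp: reduced_def successively_append_iff)
qed (simp add: reduced_def)

lemma pres_class_power:
  "W \<in> words X \<Longrightarrow>
    pres_class X R W [^]\<^bsub>pres_group X R\<^esub> (n::nat) = pres_class X R (concat (replicate n W))"
proof (induction n)
  case 0
  then show ?case by (simp add: one_pres_group)
next
  case (Suc n)
  interpret group "pres_group X R" by (rule group_pres_group)
  have "concat (replicate n W) \<in> words X" using Suc by (auto simp: in_lists_conv_set)
  moreover have "concat (replicate n W) @ W = W @ concat (replicate n W)"
    by (induction n) auto
  ultimately show ?case using Suc by (simp add: mult_pres_group)
qed

lemma (in group) conj_pow:
  assumes "x \<in> carrier G" "y \<in> carrier G"
  shows "(x \<otimes> y \<otimes> inv x) [^] (n::nat) = x \<otimes> y [^] n \<otimes> inv x"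
proof (induction n)
  case (Suc n)
  have "inv x \<otimes> (x \<otimes> y \<otimes> inv x) = y \<otimes> inv x"
    using assms by (simp add: m_assoc[symmetric])
  then show ?case using Suc assms by (simp add: m_assoc)
qed (use assms in auto)

lemma (in group) conj_eq_one:
  assumes "x \<in> carrier G" "y \<in> carrier G" "x \<otimes> y \<otimes> inv x = \<one>"
  shows "y = \<one>"
proof -
  have "x \<otimes> y = x"
    using assms by (metis inv_closed inv_comm inv_equality m_closed inv_inv)
  then show ?thesis using assms(1,2) by simp
qed

text \<open>If \<open>W\<close> is cyclically reduced, its powers are reduced and nonempty, hence
  nontrivial. Otherwise \<open>W\<close> is a shorter reduced word conjugated by its first letter,
  and a conjugate has the same order; so the induction is on the length.\<close>

lemma reduced_word_torsion_free:
  assumes "reduced W" "W \<in> words X" "n > 0"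
    "pres_class X {} W [^]\<^bsub>pres_group X {}\<^esub> (n::nat) = \<one>\<^bsub>pres_group X {}\<^esub>"
  shows "W = []"
  using assms(1,2,4)
proof (induction "length W" arbitrary: W rule: less_induct)
  case less
  interpret group "pres_group X {}" by (rule group_pres_group)
  show ?case
  proof (rule ccontr)
    assume "W \<noteq> []"
    show False
    proof (cases "hd W = (fst (last W), \<not> snd (last W))")
      case True
      obtain l V' where W: "W = l # V'" using \<open>W \<noteq> []\<close> by (cases W) auto
      have "V' \<noteq> []" using True W by (cases l) auto
      then obtain V m where V': "V' = V @ [m]" by (cases V' rule: rev_cases) auto
      have m: "m = (fst l, \<not> snd l)" using True W V' by (cases l; cases m) auto
      have "V \<noteq> []" using less(2) W V' m by (auto simp: reduced_def)
      have "reduced V"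
        using less(2) W V' by (auto simp: reduced_def successively_append_iff successively_Cons)
      have l: "[l] \<in> words X" and V: "V \<in> words X" using less(3) W V' by auto
      let ?c = "pres_class X {}"
      have "?c W = ?c [l] \<otimes>\<^bsub>pres_group X {}\<^esub> ?c V \<otimes>\<^bsub>pres_group X {}\<^esub>
          inv\<^bsub>pres_group X {}\<^esub> (?c [l])"
        using less(3) l V by (simp add: inv_pres_group mult_pres_group W V' m)
      then have "?c [l] \<otimes>\<^bsub>pres_group X {}\<^esub> (?c V [^]\<^bsub>pres_group X {}\<^esub> n) \<otimes>\<^bsub>pres_group X {}\<^esub>
          inv\<^bsub>pres_group X {}\<^esub> (?c [l]) = \<one>\<^bsub>pres_group X {}\<^esub>"
        using less(4) conj_pow l V by simp
      then have "?c V [^]\<^bsub>pres_group X {}\<^esub> n = \<one>\<^bsub>pres_group X {}\<^esub>"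
        using conj_eq_one[of "?c [l]" "?c V [^]\<^bsub>pres_group X {}\<^esub> n"] l V by simp
      then show False using less(1)[of V] \<open>reduced V\<close> V \<open>V \<noteq> []\<close> W V' by auto
    next
      case False
      have W': "concat (replicate n W) \<in> words X"
        using less(3) by (auto simp: in_lists_conv_set)
      have "pres_class X {} (concat (replicate n W)) = pres_class X {} []"
        using less(4) pres_class_power[OF less(3)] by (simp add: one_pres_group)
      then have "(concat (replicate n W), []) \<in> pres_rel X {}"
        using W' by (simp add: pres_class_eq_iff)
      then have "reduce (concat (replicate n W)) = reduce []" by (rule reduce_pres_rel)
      then have "concat (replicate n W) = []"
        using reduce_reduced[OF reduced_power[OF less(2) \<open>W \<noteq> []\<close> False]] by (simp add: reduce_def)
      then show False using \<open>n > 0\<close> \<open>W \<noteq> []\<close> by auto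
    qed
  qed
qed

lemma free_group_torsion_free:
  assumes "free_group G" "x \<in> carrier G" "x [^]\<^bsub>G\<^esub> (n::nat) = \<one>\<^bsub>G\<^esub>" "n > 0"
  shows "x = \<one>\<^bsub>G\<^esub>"
proof -
  from assms(1) obtain S :: "'a set" and \<phi>
    where G: "group G" and \<phi>: "\<phi> \<in> iso G (pres_group S {})"
    unfolding free_group_def is_iso_def by blast
  interpret G: group G by (fact G)
  interpret group_hom G "pres_group S {}" \<phi>
    using G \<phi> group_pres_group by (auto simp: group_hom_def group_hom_axioms_def iso_def)
  obtain W where W: "W \<in> words S" "\<phi> x = pres_class S {} W"
    using hom_closed[OF assms(2)] by (auto simp: carrier_pres_group)
  have W': "(W, reduce W) \<in> pres_rel S {}" by (rule pres_rel_reduce[OF W(1)])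
  then have rW: "reduce W \<in> words S" "\<phi> x = pres_class S {} (reduce W)"
    using pres_rel_words[OF W'] W by (auto simp: pres_class_eq_iff)
  have "pres_class S {} (reduce W) [^]\<^bsub>pres_group S {}\<^esub> n = \<one>\<^bsub>pres_group S {}\<^esub>"
    using assms(2,3) rW(2) by (metis hom_nat_pow hom_one)
  then have "reduce W = []"
    using reduced_word_torsion_free[OF reduced_reduce rW(1) assms(4)] by blast
  then have "\<phi> x = \<phi> \<one>\<^bsub>G\<^esub>" using rW by (simp add: one_pres_group)
  then show ?thesis using \<phi> assms(2) by (auto simp: iso_def bij_betw_def inj_on_def)
qed

text \<open>The retraction of \<open>H\<close> onto the free group shows that the \<open>g i\<close> satisfy no relation.\<close>

lemma free_group_criterion:
  assumes H: "group H" and g: "\<And>i. i \<in> I \<Longrightarrow> g i \<in> carrier H"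
    and gen: "\<And>x. x \<in> carrier H \<Longrightarrow> \<exists>W \<in> words I. x = word_val H g W"
    and \<Phi>: "\<Phi> \<in> hom H (pres_group I {})"
    and \<Phi>g: "\<And>i. i \<in> I \<Longrightarrow> \<Phi> (g i) = pres_class I {} [(i, True)]"
  shows "free_group H"
proof -
  interpret H: group H by (fact H)
  \<comment> \<open>\<open>free_group\<close> expects an alphabet of group elements, so the index
    set is replaced by its image under \<open>g\<close>; words over the image are pulled back by
    choosing a preimage of each letter.\<close>
  let ?S = "g ` I"
  obtain \<Psi> where \<Psi>: "\<Psi> \<in> hom (pres_group ?S {}) H"
    "\<And>W. W \<in> words ?S \<Longrightarrow> \<Psi> (pres_class ?S {} W) = word_val H (\<lambda>x. x) W"
    by (rule H.pres_group_lift[of ?S "\<lambda>x. x" "{}"]) (use g in auto)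
  let ?m = "map (\<lambda>(i, b). (g i, b))"
  have m_words: "?m W \<in> words ?S" if "W \<in> words I" for W
    using that by (induction W) auto
  have m_val: "word_val H (\<lambda>x. x) (?m W) = word_val H g W" for W
    by (induction W) auto
  have m_surj: "\<exists>W \<in> words I. U = ?m W" if "U \<in> words ?S" for U
    using that
  proof (induction U)
    case (Cons l U)
    from Cons(1) obtain i b where l: "l = (g i, b)" "i \<in> I" by auto
    from Cons(3) obtain W where W: "W \<in> words I" "U = ?m W" by (rule bexE)
    show ?case by (rule bexI[of _ "(i, b) # W"]) (simp_all add: l W)
  next
    case Nil
    show ?case by (rule bexI[of _ "[]"]) simp_all
  qed
  have m_rel: "(?m U, ?m V) \<in> pres_rel ?S {}" if "(U, V) \<in> pres_rel I {}" for U V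
    using that
  proof (induction rule: pres_rel.induct)
    case (refl U)
    then show ?case by (intro pres_rel.refl m_words)
  next
    case (cancel U V i b)
    then show ?case using pres_rel.cancel[of "?m U" ?S "?m V" "g i" b "{}"] m_words by simp
  next
    case (sym U V)
    then show ?case by (simp add: pres_rel.sym)
  next
    case (trans U V W)
    then show ?case by (meson pres_rel.trans)
  qed simp
  interpret \<Psi>: group_hom "pres_group ?S {}" H \<Psi>
    using H \<Psi>(1) group_pres_group by (auto simp: group_hom_def group_hom_axioms_def)
  have "\<Psi> \<in> iso (pres_group ?S {}) H"
  proof (rule \<Psi>.iso_iff[THEN iffD2], intro conjI ballI impI)
    show "carrier H \<subseteq> \<Psi> ` carrier (pres_group ?S {})"
    proof
      fix x assume "x \<in> carrier H"
      then obtain W where W: "W \<in> words I" "x = word_val H g W" using gen by blast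
      then have "x = \<Psi> (pres_class ?S {} (?m W))"
        by (simp add: \<Psi>(2)[OF m_words[OF W(1)]] m_val)
      then show "x \<in> \<Psi> ` carrier (pres_group ?S {})"
        by (rule image_eqI) (intro pres_class_closed m_words W(1))
    qed
  next
    fix P assume P: "P \<in> carrier (pres_group ?S {})" "\<Psi> P = \<one>\<^bsub>H\<^esub>"
    then obtain U where "U \<in> words ?S" "P = pres_class ?S {} U"
      by (auto simp: carrier_pres_group)
    then obtain W where W: "W \<in> words I" "P = pres_class ?S {} (?m W)"
      using m_surj[of U] by blast
    then have "word_val H g W = \<one>\<^bsub>H\<^esub>"
      using P(2) by (simp add: \<Psi>(2)[OF m_words[OF W(1)]] m_val)
    then have "\<one>\<^bsub>pres_group I {}\<^esub> = word_val (pres_group I {}) (\<lambda>i. \<Phi> (g i)) W"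
      using hom_word_val[of H _ \<Phi> I g, OF H group_pres_group \<Phi> g W(1)] hom_one[OF \<Phi> H group_pres_group] by simp
    also have "\<dots> = word_val (pres_group I {}) (\<lambda>i. pres_class I {} [(i, True)]) W"
      by (rule word_val_cong[OF W(1)]) (rule \<Phi>g)
    also have "\<dots> = pres_class I {} W"
      by (rule word_val_pres_group[OF W(1)])
    finally have "(W, []) \<in> pres_rel I {}"
      using W(1) by (simp add: one_pres_group pres_class_eq_iff pres_rel.sym)
    then have "(?m W, []) \<in> pres_rel ?S {}" using m_rel[of W "[]"] by simp
    then show "P = \<one>\<^bsub>pres_group ?S {}\<^esub>"
      using W m_words by (simp add: one_pres_group pres_class_eq_iff)
  qed
  then have "H \<cong> pres_group ?S {}"
    using group.iso_sym[OF group_pres_group] by (auto simp: is_iso_def)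
  then show ?thesis using H unfolding free_group_def by (intro conjI exI[of _ ?S])
qed

subsection \<open>Reading words in labelled graphs\<close>

text \<open>Only the labelled edges, as triples, are kept, so that walks can be transported between
  graphs of different types. A letter with \<open>False\<close> is read against the direction of its
  edge.\<close>

fun reads :: "('a \<times> 'x \<times> 'a) set \<Rightarrow> 'a \<Rightarrow> 'x word \<Rightarrow> 'a \<Rightarrow> bool" where
  "reads T z [] z' \<longleftrightarrow> z = z'"
| "reads T z (l # W) z' \<longleftrightarrow>
    (\<exists>y. (if snd l then (z, fst l, y) else (y, fst l, z)) \<in> T \<and> reads T y W z')"

lemma reads_append: "reads T z (U @ V) z' \<longleftrightarrow> (\<exists>y. reads T z U y \<and> reads T y V z')"
  by (induction U arbitrary: z) auto

lemma reads_word_inv: "reads T z (word_inv W) z' \<longleftrightarrow> reads T z' W z"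
  by (induction W arbitrary: z z') (auto simp: reads_append)

lemma reads_words: "reads T z W z' \<Longrightarrow> fst ` snd ` T \<subseteq> X \<Longrightarrow> W \<in> words X"
proof (induction W arbitrary: z)
  case (Cons l W)
  then obtain y where y: "(if snd l then (z, fst l, y) else (y, fst l, z)) \<in> T" "reads T y W z'"
    by auto
  then have "fst l \<in> X" using Cons(3) by (force split: if_splits)
  then show ?case using Cons(1)[OF y(2) Cons(3)] by (simp add: mem_Times_iff)
qed simp

lemma reads_map:
  "reads T z W z' \<Longrightarrow> (\<And>x l y. (x, l, y) \<in> T \<Longrightarrow> (\<pi> x, l, \<pi> y) \<in> T') \<Longrightarrow> reads T' (\<pi> z) W (\<pi> z')"
proof (induction W arbitrary: z)
  case (Cons l W)
  from Cons(2) obtain y where "(if snd l then (z, fst l, y) else (y, fst l, z)) \<in> T" "reads T y W z'"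
    by auto
  then show ?case using Cons(1)[OF _ Cons(3)] Cons(3) by (auto split: if_splits intro!: exI[of _ "\<pi> y"])
qed simp

subsection \<open>A freeness criterion for loops in graphs\<close>

text \<open>The unrestricted wreath product of \<open>K\<close> with the permutations of
  \<open>'y\<close>, written for right actions. A homomorphism into it is a permutation
  representation together with a cocycle with values in \<open>K\<close>.\<close>

definition wreath :: "('k, 'm) monoid_scheme \<Rightarrow> (('y \<Rightarrow> 'y) \<times> ('y \<Rightarrow> 'k)) monoid" where
  "wreath K =
    \<lparr> carrier = {(p, c). bij p \<and> range c \<subseteq> carrier K},
      mult = (\<lambda>(p, c) (q, d). (q \<circ> p, \<lambda>y. c y \<otimes>\<^bsub>K\<^esub> d (p y))),
      one = (id, \<lambda>_. \<one>\<^bsub>K\<^esub>) \<rparr>"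

lemma carrier_wreath: "(p, c) \<in> carrier (wreath K) \<longleftrightarrow> bij p \<and> (\<forall>y. c y \<in> carrier K)"
  by (auto simp: wreath_def)

lemma mult_wreath: "(p, c) \<otimes>\<^bsub>wreath K\<^esub> (q, d) = (q \<circ> p, \<lambda>y. c y \<otimes>\<^bsub>K\<^esub> d (p y))"
  by (simp add: wreath_def)

lemma one_wreath: "\<one>\<^bsub>wreath K\<^esub> = (id, \<lambda>_. \<one>\<^bsub>K\<^esub>)"
  by (simp add: wreath_def)

lemma group_wreath:
  assumes "group K"
  shows "group (wreath K :: (('y \<Rightarrow> 'y) \<times> ('y \<Rightarrow> _)) monoid)"
proof -
  interpret K: group K by fact
  show ?thesis
  proof (rule groupI)
    fix x :: "('y \<Rightarrow> 'y) \<times> ('y \<Rightarrow> _)" assume x: "x \<in> carrier (wreath K)"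
    obtain p c where pc: "x = (p, c)" by (cases x)
    have p: "bij p" "\<And>y. c y \<in> carrier K" using x by (auto simp: pc carrier_wreath)
    let ?x' = "(inv_into UNIV p, \<lambda>y. inv\<^bsub>K\<^esub> (c (inv_into UNIV p y)))"
    have "?x' \<in> carrier (wreath K)"
      using p by (auto simp: carrier_wreath bij_imp_bij_inv)
    moreover have "?x' \<otimes>\<^bsub>wreath K\<^esub> x = \<one>\<^bsub>wreath K\<^esub>"
      using p by (auto simp: pc mult_wreath one_wreath bij_is_surj surj_f_inv_f fun_eq_iff)
    ultimately show "\<exists>y \<in> carrier (wreath K). y \<otimes>\<^bsub>wreath K\<^esub> x = \<one>\<^bsub>wreath K\<^esub>" by blast
  qed (auto simp: carrier_wreath mult_wreath one_wreath bij_comp K.m_assoc fun_eq_iff)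
qed

text \<open>Traversing an edge backwards inverts its permutation and its cocycle value; this is what
  the letters with \<open>False\<close> require.\<close>

lemma fst_inv_wreath:
  assumes "group K" "x \<in> carrier (wreath K)" "fst x y = z"
  shows "fst (inv\<^bsub>wreath K\<^esub> x) z = y" "snd (inv\<^bsub>wreath K\<^esub> x) z = inv\<^bsub>K\<^esub> (snd x y)"
proof -
  interpret W: group "wreath K" by (rule group_wreath) fact
  interpret K: group K by fact
  obtain p c where x: "x = (p, c)" by (cases x)
  obtain q d where i: "inv\<^bsub>wreath K\<^esub> x = (q, d)" by (cases "inv\<^bsub>wreath K\<^esub> x")
  have "(q, d) \<in> carrier (wreath K)" using W.inv_closed[OF assms(2)] i by simp
  then have d: "\<And>y. d y \<in> carrier K" and c: "\<And>y. c y \<in> carrier K"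
    using assms(2) by (auto simp: carrier_wreath x)
  have "(p, c) \<otimes>\<^bsub>wreath K\<^esub> (q, d) = \<one>\<^bsub>wreath K\<^esub>"
    using W.r_inv[OF assms(2)] x i by simp
  then have "q (p y) = y" "c y \<otimes>\<^bsub>K\<^esub> d (p y) = \<one>\<^bsub>K\<^esub>"
    by (simp_all add: mult_wreath one_wreath fun_eq_iff)
  moreover from this have "d (p y) = inv\<^bsub>K\<^esub> (c y)"
    using c d K.inv_equality K.inv_comm by metis
  ultimately show "fst (inv\<^bsub>wreath K\<^esub> x) z = y" "snd (inv\<^bsub>wreath K\<^esub> x) z = inv\<^bsub>K\<^esub> (snd x y)"
    unfolding i using assms(3) by (simp_all add: x)
qed

text \<open>Breadth-first search from \<open>n\<close>: each reachable vertex other than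
  \<open>n\<close> has a predecessor one step closer, and the edges to the predecessors form the
  tree \<open>M\<^sub>0\<close>. The last conclusion says that a tree edge is the final letter of
  the chosen path to one of its ends, so its fundamental loop is trivial.\<close>

lemma spanning_tree:
  fixes src tgt :: "'m \<Rightarrow> 'y" and M :: "'m set"
  defines "T \<equiv> (\<lambda>m. (src m, m, tgt m)) ` M"
  obtains P :: "'y \<Rightarrow> 'm word" and M\<^sub>0 where "M\<^sub>0 \<subseteq> M" "P n = []"
    "\<And>z W. reads T n W z \<Longrightarrow> reads T n (P z) z \<and> P z \<in> words M\<^sub>0"
    "\<And>m. m \<in> M\<^sub>0 \<Longrightarrow> P (tgt m) = P (src m) @ [(m, True)] \<or> P (src m) = P (tgt m) @ [(m, False)]"
proof -
  define V where "V = {z. \<exists>W. reads T n W z}"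
  define d where "d z = (LEAST k. \<exists>W. reads T n W z \<and> length W = k)" for z
  have d_le: "d z \<le> length W" if "reads T n W z" for W z
    unfolding d_def using that by (intro Least_le) blast
  have "\<exists>y l. y \<in> V \<and> d z = Suc (d y) \<and> reads T y [l] z" if "z \<in> V" "z \<noteq> n" for z
  proof -
    from that(1) have "\<exists>k W. reads T n W z \<and> length W = k" by (auto simp: V_def)
    then have "\<exists>W. reads T n W z \<and> length W = d z"
      unfolding d_def by (rule LeastI_ex)
    then obtain W where W: "reads T n W z" "length W = d z" by blast
    then have "W \<noteq> []" using that(2) by auto
    then obtain W' l where W': "W = W' @ [l]" by (cases W rule: rev_cases) auto
    then obtain y where y: "reads T n W' y" "reads T y [l] z" using W(1) by (auto simp: reads_append)
    then have "y \<in> V" by (auto simp: V_def)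
    from y(1) have "\<exists>k W. reads T n W y \<and> length W = k" by blast
    then have "\<exists>W. reads T n W y \<and> length W = d y"
      unfolding d_def by (rule LeastI_ex)
    then obtain U where U: "reads T n U y" "length U = d y" by blast
    then have "reads T n (U @ [l]) z" using y(2) by (simp only: reads_append) blast
    then have "d z \<le> Suc (d y)" using d_le U by fastforce
    moreover have "d y \<le> length W'" by (rule d_le) fact
    ultimately show ?thesis using \<open>y \<in> V\<close> y(2) W W' by (intro exI[of _ y] exI[of _ l]) auto
  qed
  then obtain pre l where pre: "\<And>z. z \<in> V \<Longrightarrow> z \<noteq> n \<Longrightarrow>
      pre z \<in> V \<and> d z = Suc (d (pre z)) \<and> reads T (pre z) [l z] z"
    by metis
  \<comment> \<open>\<open>Q j z\<close> follows predecessors for at most \<open>j\<close> steps. It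
    is used with \<open>j\<close> the distance of \<open>z\<close>, and the test for
    \<open>n\<close> gives the empty path there for every \<open>j\<close>.\<close>
  define Q where "Q = rec_nat (\<lambda>_. []) (\<lambda>_ q z. if z = n then [] else q (pre z) @ [l z])"
  define P where "P z = Q (d z) z" for z
  define M\<^sub>0 where "M\<^sub>0 = (\<lambda>z. fst (l z)) ` (V - {n})"
  have "reads T n [] n" by simp
  then have "n \<in> V" unfolding V_def by blast
  have Pn: "P n = []" by (cases "d n") (auto simp: P_def Q_def)
  have Pz: "P z = P (pre z) @ [l z]" if "z \<in> V" "z \<noteq> n" for z
    using pre[OF that] that by (simp add: P_def Q_def)
  have PV: "reads T n (P z) z \<and> P z \<in> words M\<^sub>0" if "z \<in> V" for z
    using that
  proof (induction "d z" arbitrary: z rule: less_induct)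
    case less
    show ?case
    proof (cases "z = n")
      case False
      note p = pre[OF less(2) False]
      then have "reads T n (P (pre z)) (pre z) \<and> P (pre z) \<in> words M\<^sub>0" using less by auto
      moreover have "fst (l z) \<in> M\<^sub>0" using less(2) False by (auto simp: M\<^sub>0_def)
      ultimately show ?thesis using p
        by (simp add: Pz[OF less(2) False] mem_Times_iff reads_append del: reads.simps) blast
    qed (simp add: Pn)
  qed
  show ?thesis
  proof (rule that[of M\<^sub>0 P])
    show "M\<^sub>0 \<subseteq> M"
    proof
      fix m assume "m \<in> M\<^sub>0"
      then obtain z where z: "z \<in> V" "z \<noteq> n" "m = fst (l z)" by (auto simp: M\<^sub>0_def)
      show "m \<in> M" using pre[OF z(1,2)] z(3) by (auto simp: T_def split: if_splits)
    qed
    fix m assume "m \<in> M\<^sub>0"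
    then obtain z where z: "z \<in> V" "z \<noteq> n" "m = fst (l z)" by (auto simp: M\<^sub>0_def)
    obtain b where b: "l z = (m, b)" using z(3) by (cases "l z") auto
    then show "P (tgt m) = P (src m) @ [(m, True)] \<or> P (src m) = P (tgt m) @ [(m, False)]"
      using pre[OF z(1,2)] Pz[OF z(1,2)] by (cases b) (auto simp: T_def)
  qed (use Pn PV in \<open>auto simp: V_def\<close>)
qed

lemma (in group) word_val_subgroup:
  assumes "subgroup H G" "\<And>x. x \<in> X \<Longrightarrow> f x \<in> H" "W \<in> words X"
  shows "word_val (G\<lparr>carrier := H\<rparr>) f W = word_val G f W"
  using assms(3)
proof (induction W)
  case (Cons l W)
  then show ?case using assms(1,2) by (cases l) (auto simp: m_inv_consistent)
qed auto

text \<open>The cocycles provide homomorphisms from the loops at \<open>n\<close> onto the free group on the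
  edges outside a spanning tree.\<close>

lemma free_group_loops:
  fixes G (structure) and src tgt :: "'m \<Rightarrow> 'y" and lam :: "'m \<Rightarrow> 'g" and M :: "'m set"
  defines "T \<equiv> (\<lambda>m. (src m, m, tgt m)) ` M"
  assumes G: "group G" and lam: "\<And>m. m \<in> M \<Longrightarrow> lam m \<in> carrier G"
    and conn: "\<And>m. m \<in> M \<Longrightarrow> \<exists>W. reads T n W (src m)"
    and cocycle: "\<And>(I :: 'm set) c. (\<And>m. m \<in> M \<Longrightarrow> c m \<in> carrier (pres_group I {})) \<Longrightarrow>
      \<exists>\<Psi> \<in> hom G (wreath (pres_group I {})). \<forall>m \<in> M.
        fst (\<Psi> (lam m)) (src m) = tgt m \<and> snd (\<Psi> (lam m)) (src m) = c m"
  shows "free_group (G\<lparr>carrier := {word_val G lam W | W. reads T n W n}\<rparr>)"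
proof -
  interpret group G by fact
  let ?v = "word_val G lam"
  let ?H = "{?v W | W. reads T n W n}"
  obtain P M\<^sub>0 where M\<^sub>0: "M\<^sub>0 \<subseteq> M" and Pn: "P n = []"
    and P: "\<And>z W. reads T n W z \<Longrightarrow> reads T n (P z) z \<and> P z \<in> words M\<^sub>0"
    and PM: "\<And>m. m \<in> M\<^sub>0 \<Longrightarrow>
      P (tgt m) = P (src m) @ [(m, True)] \<or> P (src m) = P (tgt m) @ [(m, False)]"
    by (rule spanning_tree[where src = src and tgt = tgt and M = M and n = n, folded T_def]) (rule that)
  have T_words: "W \<in> words M" if "reads T z W z'" for z W z'
    by (rule reads_words[OF that]) (auto simp: T_def)
  have v_closed: "?v W \<in> carrier G" if "W \<in> words M" for W
    by (rule word_val_closed[OF lam that])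
  have v_append: "?v (U @ V) = ?v U \<otimes> ?v V" if "U \<in> words M" "V \<in> words M" for U V
    by (rule word_val_append[OF lam that])
  have v_inv: "?v (word_inv W) = inv (?v W)" if "W \<in> words M" for W
    by (rule word_val_inv[OF lam that])
  have H: "subgroup ?H G"
  proof
    show "?H \<subseteq> carrier G" using v_closed T_words by blast
    have "reads T n [] n" by simp
    then show "\<one> \<in> ?H" by (metis (mono_tags, lifting) mem_Collect_eq word_val.simps(1))
    fix x assume "x \<in> ?H"
    then obtain U where U: "x = ?v U" "reads T n U n" by blast
    then have "inv x = ?v (word_inv U)" "reads T n (word_inv U) n"
      using v_inv T_words by (auto simp: reads_word_inv)
    then show "inv x \<in> ?H" by blast
    fix y assume "y \<in> ?H"
    then obtain V where V: "y = ?v V" "reads T n V n" by blast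
    then have "x \<otimes> y = ?v (U @ V)" "reads T n (U @ V) n"
      using U v_append T_words by (auto simp: reads_append)
    then show "x \<otimes> y \<in> ?H" by blast
  qed
  interpret H: group "G\<lparr>carrier := ?H\<rparr>" by (rule subgroup.subgroup_is_group[OF H G])
  define I where "I = M - M\<^sub>0"
  let ?K = "pres_group I {}"
  interpret K: group ?K by (rule group_pres_group)
  \<comment> \<open>Edges outside the tree receive free generators and tree edges the neutral
    element, so that tree paths have value one.\<close>
  define c where "c m = (if m \<in> I then pres_class I {} [(m, True)] else \<one>\<^bsub>?K\<^esub>)" for m
  have c: "c m \<in> carrier ?K" for m by (simp add: c_def)
  obtain \<Psi> where \<Psi>: "\<Psi> \<in> hom G (wreath ?K)"
    and \<Psi>m: "\<And>m. m \<in> M \<Longrightarrow> fst (\<Psi> (lam m)) (src m) = tgt m \<and> snd (\<Psi> (lam m)) (src m) = c m"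
    using cocycle[of c I] c by blast
  interpret \<Psi>: group_hom G "wreath ?K" \<Psi>
    using \<Psi> G group_wreath[OF group_pres_group]
    by (auto simp: group_hom_def group_hom_axioms_def)
  have \<Psi>_mult: "fst (\<Psi> (g \<otimes> h)) y = fst (\<Psi> h) (fst (\<Psi> g) y)"
    "snd (\<Psi> (g \<otimes> h)) y = snd (\<Psi> g) y \<otimes>\<^bsub>?K\<^esub> snd (\<Psi> h) (fst (\<Psi> g) y)"
    if "g \<in> carrier G" "h \<in> carrier G" for g h y
    using that by (cases "\<Psi> g"; cases "\<Psi> h"; simp add: mult_wreath)+
  \<comment> \<open>Along a path the permutations track the vertices while the cocycle multiplies
    the values \<open>c\<close> of the edges.\<close>
  have walk: "fst (\<Psi> (?v W)) y = z \<and> snd (\<Psi> (?v W)) y = word_val ?K c W"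
    if "reads T y W z" for W y z
    using that
  proof (induction W arbitrary: y)
    case Nil
    then show ?case using \<Psi>.hom_one by (simp add: one_wreath)
  next
    case (Cons l W)
    obtain m b where l: "l = (m, b)" by (cases l)
    from Cons(2) have "\<exists>x. (if b then (y, m, x) else (x, m, y)) \<in> T \<and> reads T x W z"
      by (cases b) (simp_all add: l)
    then obtain x where x: "(if b then (y, m, x) else (x, m, y)) \<in> T" "reads T x W z" by blast
    have "m \<in> M" using x(1) by (auto simp: T_def split: if_splits)
    let ?a = "if b then lam m else inv (lam m)"
    have a: "?a \<in> carrier G" using lam[OF \<open>m \<in> M\<close>] by simp
    have "fst (\<Psi> ?a) y = x \<and> snd (\<Psi> ?a) y = (if b then c m else inv\<^bsub>?K\<^esub> (c m))"
    proof (cases b)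
      case True
      then show ?thesis using x(1) \<Psi>m[OF \<open>m \<in> M\<close>] by (auto simp: T_def)
    next
      case False
      then have "x = src m" "y = tgt m" using x(1) by (auto simp: T_def)
      then show ?thesis
        using False \<Psi>m[OF \<open>m \<in> M\<close>] lam[OF \<open>m \<in> M\<close>] fst_inv_wreath[OF group_pres_group, of "\<Psi> (lam m)" I "{}" x y]
        by simp
    qed
    moreover have "?v W \<in> carrier G" using v_closed T_words[OF x(2)] by blast
    ultimately show ?case
      using Cons(1)[OF x(2)] a l by (simp add: \<Psi>_mult del: \<Psi>.hom_mult)
  qed
  have cP: "word_val ?K c U = \<one>\<^bsub>?K\<^esub>" if "U \<in> words M\<^sub>0" for U
    using that
  proof (induction U)
    case (Cons l U)
    have "c (fst l) = \<one>\<^bsub>?K\<^esub>" using Cons(1) by (auto simp: c_def I_def)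
    then show ?case using Cons by (cases l) simp
  qed simp
  \<comment> \<open>The fundamental loop of \<open>m\<close>: out along the tree, across
    \<open>m\<close>, and back along the tree.\<close>
  define g where "g m = ?v (P (src m) @ [(m, True)] @ word_inv (P (tgt m)))" for m
  have Pr: "reads T n (P (src m)) (src m)" "reads T n (P (tgt m)) (tgt m)"
    "P (src m) \<in> words M" "P (tgt m) \<in> words M" "P (src m) \<in> words M\<^sub>0" "P (tgt m) \<in> words M\<^sub>0"
    if "m \<in> M" for m
  proof -
    obtain W where W: "reads T n W (src m)" using conn \<open>m \<in> M\<close> by blast
    have "reads T (src m) [(m, True)] (tgt m)" using \<open>m \<in> M\<close> by (auto simp: T_def)
    then have "reads T n (W @ [(m, True)]) (tgt m)" using W by (simp only: reads_append) blast
    note p = P[OF W] P[OF this]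
    then show "reads T n (P (src m)) (src m)" "reads T n (P (tgt m)) (tgt m)"
      "P (src m) \<in> words M\<^sub>0" "P (tgt m) \<in> words M\<^sub>0" by blast+
    then show "P (src m) \<in> words M" "P (tgt m) \<in> words M" using T_words by blast+
  qed
  have g_loop: "reads T n (P (src m) @ [(m, True)] @ word_inv (P (tgt m))) n" if "m \<in> M" for m
    using Pr[OF that] that unfolding reads_append reads_word_inv by (force simp: T_def)
  have gH: "g m \<in> ?H" if "m \<in> M" for m
    using g_loop[OF that] unfolding g_def by blast
  have g_val: "g m = ?v (P (src m)) \<otimes> lam m \<otimes> inv (?v (P (tgt m)))" if "m \<in> M" for m
    using Pr[OF that] that lam[OF that] v_closed unfolding g_def
    by (simp add: v_append v_inv m_assoc)
  have g_tree: "g m = \<one>" if "m \<in> M\<^sub>0" for m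
  proof -
    have "m \<in> M" using that M\<^sub>0 by blast
    note Pr = Pr(3,4)[OF \<open>m \<in> M\<close>] and lam = lam[OF \<open>m \<in> M\<close>]
    note closed = v_closed[OF Pr(1)] v_closed[OF Pr(2)]
    from PM[OF that] show ?thesis
    proof
      assume "P (tgt m) = P (src m) @ [(m, True)]"
      then show ?thesis using g_val[OF \<open>m \<in> M\<close>] lam Pr closed \<open>m \<in> M\<close> by (simp add: v_append)
    next
      assume "P (src m) = P (tgt m) @ [(m, False)]"
      then show ?thesis using g_val[OF \<open>m \<in> M\<close>] lam Pr closed \<open>m \<in> M\<close>
        by (simp add: v_append m_assoc)
    qed
  qed
  show ?thesis
  \<comment> \<open>The retraction is the cocycle at \<open>n\<close>; it is multiplicative on loops
    because these fix \<open>n\<close>.\<close>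
  proof (rule free_group_criterion[of _ I g "\<lambda>h. snd (\<Psi> h) n"])
    show "group (G\<lparr>carrier := ?H\<rparr>)" by (rule H.is_group)
    show "g m \<in> carrier (G\<lparr>carrier := ?H\<rparr>)" if "m \<in> I" for m
      using gH that by (simp add: I_def)
    show "(\<lambda>h. snd (\<Psi> h) n) \<in> hom (G\<lparr>carrier := ?H\<rparr>) ?K"
    proof (rule homI)
      fix x assume "x \<in> carrier (G\<lparr>carrier := ?H\<rparr>)"
      then obtain U where U: "x = ?v U" "reads T n U n" by auto
      then show "snd (\<Psi> x) n \<in> carrier ?K"
        using walk[OF U(2)] K.word_val_closed[of UNIV c U] c by (simp add: lists_UNIV)
      fix y assume "y \<in> carrier (G\<lparr>carrier := ?H\<rparr>)"
      then obtain V where V: "y = ?v V" "reads T n V n" by auto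
      show "snd (\<Psi> (x \<otimes>\<^bsub>G\<lparr>carrier := ?H\<rparr>\<^esub> y)) n = snd (\<Psi> x) n \<otimes>\<^bsub>?K\<^esub> snd (\<Psi> y) n"
        using walk[OF U(2)] U V v_closed T_words by (simp add: \<Psi>_mult del: \<Psi>.hom_mult)
    qed
    show "snd (\<Psi> (g m)) n = pres_class I {} [(m, True)]" if "m \<in> I" for m
    proof -
      have m: "m \<in> M" using that by (simp add: I_def)
      have "word_val ?K c (P (src m) @ [(m, True)] @ word_inv (P (tgt m))) = c m"
        using Pr[OF m] c cP by (simp add: K.word_val_append[of UNIV c] lists_UNIV)
      then show ?thesis using walk[OF g_loop[OF m]] that by (simp add: g_def c_def)
    qed
    fix x assume "x \<in> carrier (G\<lparr>carrier := ?H\<rparr>)"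
    then obtain U where U: "x = ?v U" "reads T n U n" by auto
    let ?f = "filter (\<lambda>(m, b). m \<in> I)"
    \<comment> \<open>Telescoping: inserting the tree paths between consecutive letters turns the
      value of a path into a product of fundamental loops. Those of tree edges are trivial, so only
      the letters in \<open>I\<close> remain.\<close>
    have "?v (P y) \<otimes> ?v W \<otimes> inv (?v (P z)) = word_val G g (?f W)"
      if "reads T y W z" "reads T n (P y) y" for y W z
      using that
    proof (induction W arbitrary: y)
      case Nil
      then show ?case using v_closed T_words by simp
    next
      case (Cons l W)
      obtain m b where l: "l = (m, b)" by (cases l)
      from Cons(2) have "\<exists>x. (if b then (y, m, x) else (x, m, y)) \<in> T \<and> reads T x W z"
        by (cases b) (simp_all add: l)
      then obtain x where x: "(if b then (y, m, x) else (x, m, y)) \<in> T" "reads T x W z" by blast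
      have m: "m \<in> M" using x(1) by (auto simp: T_def split: if_splits)
      have yx: "(y = src m \<and> x = tgt m \<and> b) \<or> (y = tgt m \<and> x = src m \<and> \<not> b)"
        using x(1) by (auto simp: T_def split: if_splits)
      then have "reads T n (P x) x" using Pr[OF m] by auto
      have Pz: "?v (P z) \<in> carrier G"
        using P[of "P x @ W" z] \<open>reads T n (P x) x\<close> x(2) v_closed T_words
        by (auto simp: reads_append)
      have Px: "?v (P x) \<in> carrier G" "?v (P y) \<in> carrier G" "?v W \<in> carrier G"
        using \<open>reads T n (P x) x\<close> Cons(3) x(2) v_closed T_words by blast+
      let ?a = "if b then lam m else inv (lam m)" and ?g = "if b then g m else inv (g m)"
      have a: "?a \<in> carrier G" using lam[OF m] by simp
      have "?g = ?v (P y) \<otimes> ?a \<otimes> inv (?v (P x))"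
        using yx g_val[OF m] Px lam[OF m] by (auto simp: inv_mult_group m_assoc)
      then have "?v (P y) \<otimes> (?a \<otimes> ?v W) \<otimes> inv (?v (P z)) =
          ?g \<otimes> (?v (P x) \<otimes> ?v W \<otimes> inv (?v (P z)))"
        using Px a Pz by (simp add: m_assoc) (simp flip: m_assoc)
      also have "\<dots> = ?g \<otimes> word_val G g (?f W)"
        using Cons(1)[OF x(2) \<open>reads T n (P x) x\<close>] by simp
      also have "\<dots> = word_val G g (?f (l # W))"
      proof (cases "m \<in> I")
        case False
        then have "g m = \<one>" using g_tree m by (simp add: I_def)
        moreover have "word_val G g (?f W) \<in> carrier G"
          using Cons(1)[OF x(2) \<open>reads T n (P x) x\<close>] Px Pz by (metis inv_closed m_closed)
        ultimately show ?thesis using False l by simp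
      qed (simp add: l)
      finally show ?case by (simp add: l)
    qed
    from this[OF U(2)] have "?v U = word_val G g (?f U)"
      using Pn v_closed[OF T_words[OF U(2)]] by simp
    moreover have f: "?f U \<in> words I" by (auto simp: in_lists_conv_set)
    ultimately have "x = word_val (G\<lparr>carrier := ?H\<rparr>) g (?f U)"
      using word_val_subgroup[OF H, of I g "?f U"] gH U(1) by (simp add: I_def)
    then show "\<exists>W \<in> words I. x = word_val (G\<lparr>carrier := ?H\<rparr>) g W"
      using f by (rule bexI)
  qed
qed

subsection \<open>Free actions of finite groups\<close>

definition free_action :: "('g, 'm) monoid_scheme \<Rightarrow> 'y set \<Rightarrow> ('y \<Rightarrow> 'g \<Rightarrow> 'y) \<Rightarrow> bool" where
  "free_action G S \<alpha> \<longleftrightarrow> (\<forall>y \<in> S. \<alpha> y \<one>\<^bsub>G\<^esub> = y \<and> (\<forall>g \<in> carrier G. \<alpha> y g \<in> S \<and>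
    (\<alpha> y g = y \<longrightarrow> g = \<one>\<^bsub>G\<^esub>) \<and> (\<forall>h \<in> carrier G. \<alpha> (\<alpha> y g) h = \<alpha> y (g \<otimes>\<^bsub>G\<^esub> h))))"

lemma free_actionD:
  assumes "free_action G S \<alpha>" "y \<in> S"
  shows "\<alpha> y \<one>\<^bsub>G\<^esub> = y" "\<And>g. g \<in> carrier G \<Longrightarrow> \<alpha> y g \<in> S"
    "\<And>g. g \<in> carrier G \<Longrightarrow> \<alpha> y g = y \<Longrightarrow> g = \<one>\<^bsub>G\<^esub>"
    "\<And>g h. g \<in> carrier G \<Longrightarrow> h \<in> carrier G \<Longrightarrow> \<alpha> (\<alpha> y g) h = \<alpha> y (g \<otimes>\<^bsub>G\<^esub> h)"
  using assms by (simp_all add: free_action_def)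

lemma free_action_inj:
  fixes G (structure)
  assumes "group G" "free_action G S \<alpha>" "y \<in> S" "g \<in> carrier G" "h \<in> carrier G" "\<alpha> y g = \<alpha> y h"
  shows "g = h"
proof -
  interpret group G by fact
  note D = free_actionD[OF assms(2,3)]
  have "\<alpha> y (g \<otimes> inv h) = \<alpha> y (h \<otimes> inv h)"
    using D(4)[of g "inv h"] D(4)[of h "inv h"] assms by simp
  then have "g \<otimes> inv h = \<one>" using D assms by simp
  then show ?thesis using assms by (metis inv_inv inv_equality inv_closed)
qed

text \<open>Injectivity of \<open>\<phi>\<close> is what preserves freeness; this serves for the two
  inclusions of an edge group into vertex groups.\<close>

lemma free_action_hom:
  assumes "group G" "group H" "\<phi> \<in> mon G H" "free_action H S \<alpha>"
  shows "free_action G S (\<lambda>y g. \<alpha> y (\<phi> g))"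
proof -
  interpret group_hom G H \<phi>
    using assms by (simp add: group_hom_def group_hom_axioms_def mon_def)
  have "g = \<one>\<^bsub>G\<^esub>" if "g \<in> carrier G" "\<phi> g = \<one>\<^bsub>H\<^esub>" for g
    using that assms(3) by (auto simp: mon_def inj_on_def)
  then show ?thesis
    using free_actionD[OF assms(4)] by (simp add: free_action_def)
qed

text \<open>Free actions are classified by their numbers of orbits. Orbits of a finite group are
  finite, so an infinite set of numbers has countably infinitely many of them, and a choice of one
  representative per orbit identifies the action with right multiplication on
  \<open>carrier G \<times> UNIV\<close>.\<close>

lemma free_action_trivial:
  fixes G :: "('g, 'm) monoid_scheme" (structure) and S :: "nat set"
  assumes G: "group G" "finite (carrier G)" and S: "infinite S" and \<alpha>: "free_action G S \<alpha>"
  obtains b :: "nat \<Rightarrow> 'g \<times> nat" where "bij_betw b S (carrier G \<times> UNIV)"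
    "\<And>y g. y \<in> S \<Longrightarrow> g \<in> carrier G \<Longrightarrow> b (\<alpha> y g) = (fst (b y) \<otimes>\<^bsub>G\<^esub> g, snd (b y))"
proof -
  interpret group G by fact
  note D = free_actionD[OF \<alpha>]
  define r where "r y = (LEAST z. z \<in> \<alpha> y ` carrier G)" for y
  have r_in: "r y \<in> \<alpha> y ` carrier G" if "y \<in> S" for y
    unfolding r_def by (rule LeastI[of _ "\<alpha> y \<one>"]) simp
  have r_S: "r y \<in> S" if "y \<in> S" for y using r_in[OF that] D(2)[OF that] by auto
  have r_act: "r (\<alpha> y g) = r y" if "y \<in> S" "g \<in> carrier G" for y g
  proof -
    have "\<alpha> (\<alpha> y g) ` carrier G = \<alpha> y ` carrier G"
    proof -
      have "\<alpha> y h \<in> \<alpha> (\<alpha> y g) ` carrier G" if "h \<in> carrier G" for h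
      proof (rule image_eqI)
        show "\<alpha> y h = \<alpha> (\<alpha> y g) (inv g \<otimes> h)"
          using D(4)[OF \<open>y \<in> S\<close> \<open>g \<in> carrier G\<close>, of "inv g \<otimes> h"] \<open>g \<in> carrier G\<close> that
          by (simp flip: m_assoc)
      qed (use \<open>g \<in> carrier G\<close> that in simp)
      moreover have "\<alpha> (\<alpha> y g) h \<in> \<alpha> y ` carrier G" if "h \<in> carrier G" for h
        using D(4)[OF \<open>y \<in> S\<close> \<open>g \<in> carrier G\<close> that] \<open>g \<in> carrier G\<close> that by simp
      ultimately show ?thesis by blast
    qed
    then show ?thesis by (simp add: r_def)
  qed
  have "\<exists>g \<in> carrier G. y = \<alpha> (r y) g" if "y \<in> S" for y
  proof -
    obtain h where h: "h \<in> carrier G" "r y = \<alpha> y h" using r_in[OF \<open>y \<in> S\<close>] by blast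
    then have "y = \<alpha> (r y) (inv h)" using D(1,4)[OF \<open>y \<in> S\<close>] by simp
    then show ?thesis using h by blast
  qed
  then obtain k where k: "\<And>y. y \<in> S \<Longrightarrow> k y \<in> carrier G \<and> y = \<alpha> (r y) (k y)" by metis
  have "S \<subseteq> (\<Union>z \<in> r ` S. \<alpha> z ` carrier G)" using k by blast
  then have "infinite (r ` S)" using S G(2) by (meson finite_UN finite_imageI finite_subset)
  then have e: "bij_betw (to_nat_on (r ` S)) (r ` S) UNIV"
    by (intro to_nat_on_infinite countable_image) auto
  \<comment> \<open>Coordinates of \<open>y\<close>: the group element that carries the
    representative of its orbit to \<open>y\<close>, and the number of that orbit.\<close>
  let ?b = "\<lambda>y. (k y, to_nat_on (r ` S) (r y))"
  have k_act: "k (\<alpha> y g) = k y \<otimes> g" if "y \<in> S" "g \<in> carrier G" for y g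
  proof (rule free_action_inj[OF G(1) \<alpha> r_S[OF that(1)]])
    have "\<alpha> (r y) (k (\<alpha> y g)) = \<alpha> y g" using k[of "\<alpha> y g"] r_act[OF that] D(2)[OF that] by simp
    also have "\<dots> = \<alpha> (\<alpha> (r y) (k y)) g" using k[OF that(1)] by simp
    also have "\<dots> = \<alpha> (r y) (k y \<otimes> g)" using D(4)[OF r_S[OF that(1)]] k[OF that(1)] that(2) by metis
    finally show "\<alpha> (r y) (k (\<alpha> y g)) = \<alpha> (r y) (k y \<otimes> g)" .
  qed (use that k D(2)[OF that] in auto)
  show ?thesis
  proof (rule that[of ?b])
    have "inj_on ?b S"
    proof (rule inj_onI)
      fix y z assume "y \<in> S" "z \<in> S" "?b y = ?b z"
      then have "k y = k z" "r y = r z" using e by (auto simp: bij_betw_def inj_on_def)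
      then show "y = z" using k \<open>y \<in> S\<close> \<open>z \<in> S\<close> by metis
    qed
    moreover have "?b ` S = carrier G \<times> UNIV"
    proof (intro equalityI subsetI)
      fix x :: "'g \<times> nat" assume "x \<in> carrier G \<times> UNIV"
      then obtain g n where x: "x = (g, n)" "g \<in> carrier G" by auto
      have "n \<in> to_nat_on (r ` S) ` r ` S" using e by (simp add: bij_betw_def)
      then obtain z where z: "z \<in> S" "n = to_nat_on (r ` S) (r z)" by blast
      let ?h = "inv (k z) \<otimes> g"
      have h: "?h \<in> carrier G" using k[OF z(1)] x by simp
      have "k (\<alpha> z ?h) = g" using k_act[OF z(1) h] k[OF z(1)] x by (simp flip: m_assoc)
      then have "?b (\<alpha> z ?h) = x" using r_act[OF z(1) h] x z by simp
      then show "x \<in> ?b ` S" using D(2)[OF z(1) h] by blast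
    qed (use k in auto)
    ultimately show "bij_betw ?b S (carrier G \<times> UNIV)" by (simp add: bij_betw_def)
  qed (use k_act r_act in simp)
qed

lemma infinite_Compl_nat: "finite (D :: nat set) \<Longrightarrow> infinite (- D)"
  using Diff_infinite_finite[of D "UNIV :: nat set"] by (simp add: Compl_eq_Diff_UNIV)

text \<open>The complement of a finite set of numbers is countably infinite, hence in bijection with
  \<open>carrier G \<times> UNIV\<close>, from which it receives the free action by right
  multiplication.\<close>

lemma extend_free_action:
  fixes G (structure) and D :: "nat set"
  assumes G: "group G" "finite (carrier G)" and D: "finite D" "free_action G D a"
  obtains \<alpha> where "free_action G UNIV \<alpha>" "\<And>y g. y \<in> D \<Longrightarrow> \<alpha> y g = a y g"
proof -
  interpret group G by fact
  have "infinite (- D)" by (rule infinite_Compl_nat[OF D(1)])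
  then have 1: "bij_betw (to_nat_on (- D)) (- D) UNIV" by (intro to_nat_on_infinite) auto
  have "infinite (carrier G \<times> (UNIV :: nat set))"
    using one_closed by (auto simp: finite_cartesian_product_iff)
  then have "bij_betw (from_nat_into (carrier G \<times> UNIV)) UNIV (carrier G \<times> (UNIV :: nat set))"
    using G(2) by (intro bij_betw_from_nat_into countable_SIGMA) (auto intro: countable_finite)
  from bij_betw_trans[OF 1 this]
  have "\<exists>c. bij_betw c (- D) (carrier G \<times> (UNIV :: nat set))" by blast
  then obtain c where c: "bij_betw c (- D) (carrier G \<times> (UNIV :: nat set))" by blast
  let ?i = "inv_into (- D) c"
  define \<alpha> where "\<alpha> y g = (if y \<in> D then a y g else ?i (fst (c y) \<otimes> g, snd (c y)))" for y g
  have i: "c (?i x) = x" "?i x \<notin> D" if "fst x \<in> carrier G" for x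
    using c that bij_betw_inv_into_right[OF c, of x] bij_betw_apply[OF bij_betw_inv_into[OF c], of x]
    by (auto simp: mem_Times_iff)
  have c1: "fst (c y) \<in> carrier G" "?i (c y) = y" if "y \<notin> D" for y
    using c that bij_betw_apply[OF c] bij_betw_inv_into_left[OF c, of y] by (auto simp: mem_Times_iff)
  note Da = free_actionD[OF D(2)]
  have "free_action G UNIV \<alpha>"
    unfolding free_action_def
  proof (intro ballI conjI impI)
    fix y g h assume g: "g \<in> carrier G"
    show "\<alpha> y g = y \<Longrightarrow> g = \<one>"
    proof (cases "y \<in> D")
      case False
      assume "\<alpha> y g = y"
      then have "c y = (fst (c y) \<otimes> g, snd (c y))"
        using False i[of "(fst (c y) \<otimes> g, snd (c y))"] c1[OF False] g by (simp add: \<alpha>_def)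
      then have "fst (c y) \<otimes> g = fst (c y)" by (metis fst_conv)
      then show ?thesis using c1[OF False] g by simp
    qed (use Da g in \<open>auto simp: \<alpha>_def\<close>)
    assume h: "h \<in> carrier G"
    show "\<alpha> (\<alpha> y g) h = \<alpha> y (g \<otimes> h)"
      using g h Da c1 i by (simp add: \<alpha>_def m_assoc)
  qed (use Da c1 in \<open>simp_all add: \<alpha>_def\<close>)
  then show ?thesis by (rule that) (simp add: \<alpha>_def)
qed

text \<open>The complements of \<open>D\<close> and of its image are infinite and invariant, so by
  \<open>free_action_trivial\<close> both carry the standard free action, and an isomorphism between
  them completes \<open>f\<close>. The infinite supply of spare points is what prevents a mismatch
  of orbit numbers.\<close>

lemma extend_equivariant_bij:
  fixes G :: "('g, 'm) monoid_scheme" (structure) and D :: "nat set"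
  assumes G: "group G" "finite (carrier G)"
    and \<alpha>: "free_action G UNIV \<alpha>" and \<beta>: "free_action G UNIV \<beta>"
    and D: "finite D" "\<And>y g. y \<in> D \<Longrightarrow> g \<in> carrier G \<Longrightarrow> \<alpha> y g \<in> D"
    and f: "inj_on (f :: nat \<Rightarrow> nat) D" "\<And>y g. y \<in> D \<Longrightarrow> g \<in> carrier G \<Longrightarrow> f (\<alpha> y g) = \<beta> (f y) g"
  obtains E where "bij E" "\<And>y g. g \<in> carrier G \<Longrightarrow> E (\<alpha> y g) = \<beta> (E y) g"
    "\<And>y. y \<in> D \<Longrightarrow> E y = f y"
proof -
  interpret group G by fact
  have inv_closed_compl: "free_action G (- A) \<gamma>"
    if "free_action G UNIV \<gamma>" and A: "\<And>y g. y \<in> A \<Longrightarrow> g \<in> carrier G \<Longrightarrow> \<gamma> y g \<in> A" for A \<gamma>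
  proof -
    have "\<gamma> y g \<notin> A" if "y \<notin> A" "g \<in> carrier G" for y g
    proof
      assume "\<gamma> y g \<in> A"
      then have "\<gamma> (\<gamma> y g) (inv g) \<in> A" using that A by simp
      then show False using free_actionD[OF \<open>free_action G UNIV \<gamma>\<close>, of y] that by simp
    qed
    then show ?thesis using that(1) by (simp add: free_action_def)
  qed
  have inf: "infinite (- D)" "infinite (- (f ` D))"
    using D(1) by (auto intro!: infinite_Compl_nat)
  have \<alpha>': "free_action G (- D) \<alpha>" by (rule inv_closed_compl[OF \<alpha> D(2)])
  have \<beta>': "free_action G (- (f ` D)) \<beta>"
  proof (rule inv_closed_compl[OF \<beta>])
    show "\<beta> y g \<in> f ` D" if y: "y \<in> f ` D" and "g \<in> carrier G" for y g
    proof -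
      obtain z where "z \<in> D" "y = f z" using y by blast
      then have "\<beta> y g = f (\<alpha> z g)" "\<alpha> z g \<in> D" using f(2) D(2) \<open>g \<in> carrier G\<close> by simp_all
      then show ?thesis by simp
    qed
  qed
  obtain b :: "nat \<Rightarrow> 'g \<times> nat" where
    b: "bij_betw b (- D) (carrier G \<times> UNIV)"
      "\<And>y g. y \<in> - D \<Longrightarrow> g \<in> carrier G \<Longrightarrow> b (\<alpha> y g) = (fst (b y) \<otimes> g, snd (b y))"
    by (rule free_action_trivial[OF G inf(1) \<alpha>']) (rule that)
  obtain c :: "nat \<Rightarrow> 'g \<times> nat" where
    c: "bij_betw c (- (f ` D)) (carrier G \<times> UNIV)"
      "\<And>y g. y \<in> - (f ` D) \<Longrightarrow> g \<in> carrier G \<Longrightarrow> c (\<beta> y g) = (fst (c y) \<otimes> g, snd (c y))"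
    by (rule free_action_trivial[OF G inf(2) \<beta>']) (rule that)
  let ?i = "inv_into (- (f ` D)) c"
  define E where "E y = (if y \<in> D then f y else ?i (b y))" for y
  have i: "bij_betw (?i \<circ> b) (- D) (- (f ` D))"
    by (rule bij_betw_trans[OF b(1) bij_betw_inv_into[OF c(1)]])
  have E1: "bij_betw E D (f ` D)"
    using f(1) by (simp add: bij_betw_def inj_on_def E_def)
  have E2: "bij_betw E (- D) (- (f ` D))"
    using bij_betw_cong[of "- D" E "?i \<circ> b"] i by (simp add: E_def)
  have "bij E"
    using bij_betw_combine[OF E1 E2] by simp
  moreover have "E (\<alpha> y g) = \<beta> (E y) g" if g: "g \<in> carrier G" for y g
  proof (cases "y \<in> D")
    case True
    then show ?thesis using D(2) f(2) g by (simp add: E_def)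
  next
    case False
    then have ng: "\<alpha> y g \<in> - D" using free_actionD(2)[OF \<alpha>'] g by simp
    have Ey: "E y \<in> - (f ` D)" "E (\<alpha> y g) \<in> - (f ` D)"
      using bij_betw_apply[OF E2] False ng by auto
    have cE: "c (E z) = b z" if "z \<in> - D" for z
      using that bij_betw_inv_into_right[OF c(1)] bij_betw_apply[OF b(1) that] by (simp add: E_def)
    have "\<beta> (E y) g \<in> - (f ` D)" using free_actionD(2)[OF \<beta>' Ey(1) g] .
    moreover have "c (E (\<alpha> y g)) = c (\<beta> (E y) g)"
      using cE False ng b(2) c(2)[OF Ey(1) g] g by simp
    ultimately show ?thesis using c(1) Ey(2) by (auto simp: bij_betw_def inj_on_def)
  qed
  moreover have "E y = f y" if "y \<in> D" for y
    using that by (simp add: E_def)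
  ultimately show ?thesis by (rule that)
qed

subsection \<open>Permutation representations of the Bass group\<close>

locale finite_gog = presented_gog \<A>
  for \<A> :: "('v, 'e, 'g, 'h, 's) presented_graph_of_groups" +
  assumes finite_vgrp: "w \<in> verts (ugraph \<A>) \<Longrightarrow> finite (carrier (vgrp \<A> w))"
begin

abbreviation "\<V> \<equiv> verts (ugraph \<A>)"
abbreviation "\<E> \<equiv> arcs (ugraph \<A>)"
abbreviation "src \<equiv> tail (ugraph \<A>)"
abbreviation "tgt \<equiv> head (ugraph \<A>)"
abbreviation "gset u \<equiv> set (gens \<A> u)"
abbreviation "val u \<equiv> word_val (vgrp \<A> u) (gval \<A>)"
abbreviation "\<X> \<equiv> alphabet \<A>"
abbreviation "\<R> \<equiv> relators \<A>"

lemma finite_\<V>: "finite \<V>" and finite_\<E>: "finite \<E>"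
  and src_in [simp]: "e \<in> \<E> \<Longrightarrow> src e \<in> \<V>" and tgt_in [simp]: "e \<in> \<E> \<Longrightarrow> tgt e \<in> \<V>"
proof -
  interpret fin_digraph "ugraph \<A>" by (rule finite_graph)
  show "finite \<V>" "finite \<E>" "e \<in> \<E> \<Longrightarrow> src e \<in> \<V>" "e \<in> \<E> \<Longrightarrow> tgt e \<in> \<V>" by auto
qed

lemma finite_\<X>: "finite \<X>"
  using finite_\<V> finite_\<E> by (auto simp: alphabet_def gen_letters_def)

lemma imap_in [simp]: "e \<in> \<E> \<Longrightarrow> h \<in> carrier (egrp \<A> e) \<Longrightarrow> imap \<A> e h \<in> carrier (vgrp \<A> (src e))"
  using imap_mon by (auto simp: mon_def hom_def)

lemma tmap_in [simp]: "e \<in> \<E> \<Longrightarrow> h \<in> carrier (egrp \<A> e) \<Longrightarrow> tmap \<A> e h \<in> carrier (vgrp \<A> (tgt e))"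
  using tmap_mon by (auto simp: mon_def hom_def)

lemma finite_egrp: "e \<in> \<E> \<Longrightarrow> finite (carrier (egrp \<A> e))"
proof -
  assume e: "e \<in> \<E>"
  have "inj_on (imap \<A> e) (carrier (egrp \<A> e))" using imap_mon[OF e] by (simp add: mon_def)
  moreover have "imap \<A> e ` carrier (egrp \<A> e) \<subseteq> carrier (vgrp \<A> (src e))" using e by auto
  ultimately show ?thesis using finite_vgrp[of "src e"] e by (meson finite_imageD finite_subset src_in)
qed

lemma group_Bass: "group (Bass \<A>)"
  by (simp add: Bass_def group_pres_group)

lemma ev_in [simp]: "W \<in> words \<X> \<Longrightarrow> ev \<A> W \<in> carrier (Bass \<A>)"
  by (simp add: Bass_def ev_def)

lemma ev_append: "U \<in> words \<X> \<Longrightarrow> V \<in> words \<X> \<Longrightarrow> ev \<A> (U @ V) = ev \<A> U \<otimes>\<^bsub>Bass \<A>\<^esub> ev \<A> V"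
  by (simp add: Bass_def ev_def mult_pres_group)

lemma ev_Nil: "ev \<A> [] = \<one>\<^bsub>Bass \<A>\<^esub>"
  by (simp add: Bass_def ev_def one_pres_group)

lemma ev_inv: "W \<in> words \<X> \<Longrightarrow> ev \<A> (word_inv W) = inv\<^bsub>Bass \<A>\<^esub> (ev \<A> W)"
  by (simp add: Bass_def ev_def inv_pres_group)

lemma gen_in [simp]: "u \<in> \<V> \<Longrightarrow> s \<in> gset u \<Longrightarrow> Gen s \<in> \<X>"
  by (auto simp: alphabet_def gen_letters_def)

lemma edge_in [simp]: "e \<in> \<E> \<Longrightarrow> Edge e \<in> \<X>"
  by (auto simp: alphabet_def)

lemma gen_word_in [simp]: "u \<in> \<V> \<Longrightarrow> W \<in> words (gset u) \<Longrightarrow> gen_word W \<in> words \<X>"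
  by (induction W) (auto simp: gen_word_def)

lemma gen_word_simps [simp]:
  "gen_word [] = []" "gen_word (l # W) = (Gen (fst l), snd l) # gen_word W"
  "gen_word (U @ V) = gen_word U @ gen_word V" "word_inv (gen_word W) = gen_word (word_inv W)"
  by (auto simp: gen_word_def word_inv_def rev_map split: prod.splits)

section \<open>The vertex groups, their words, and their images in the Bass group\<close>

lemma gval_in [simp]:
  assumes "u \<in> \<V>" "s \<in> gset u"
  shows "gval \<A> s \<in> carrier (vgrp \<A> u)"
proof -
  from presentation[OF assms(1)] obtain \<phi> where
    \<phi>: "\<phi> \<in> iso (pres_group (gset u) (rels \<A> u)) (vgrp \<A> u)"
    and "\<phi> (pres_class (gset u) (rels \<A> u) [(s, True)]) = gval \<A> s" using assms(2) by blast
  moreover have "pres_class (gset u) (rels \<A> u) [(s, True)] \<in> carrier (pres_group (gset u) (rels \<A> u))"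
    using assms(2) by simp
  ultimately show ?thesis using hom_in_carrier[of \<phi>] by (metis Group.iso_iff)
qed

lemma val_pres:
  assumes "u \<in> \<V>"
  obtains \<phi> where "\<phi> \<in> iso (pres_group (gset u) (rels \<A> u)) (vgrp \<A> u)"
    "\<And>W. W \<in> words (gset u) \<Longrightarrow> \<phi> (pres_class (gset u) (rels \<A> u) W) = val u W"
proof -
  from presentation[OF assms(1)] obtain \<phi> where
    \<phi>: "\<phi> \<in> iso (pres_group (gset u) (rels \<A> u)) (vgrp \<A> u)"
    and gen: "\<And>s. s \<in> gset u \<Longrightarrow> \<phi> (pres_class (gset u) (rels \<A> u) [(s, True)]) = gval \<A> s"
    by blast
  have "\<phi> (pres_class (gset u) (rels \<A> u) W) = val u W" if W: "W \<in> words (gset u)" for W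
  proof -
    have "\<phi> (pres_class (gset u) (rels \<A> u) W) =
        word_val (vgrp \<A> u) (\<lambda>s. \<phi> (pres_class (gset u) (rels \<A> u) [(s, True)])) W"
      unfolding word_val_pres_group[OF W, symmetric]
      using \<phi> by (intro hom_word_val[OF group_pres_group vertex_group[OF assms] _ _ W]) (auto simp: iso_def)
    also have "\<dots> = val u W" by (rule word_val_cong[OF W gen])
    finally show ?thesis .
  qed
  with \<phi> show ?thesis by (rule that)
qed

lemma val_in [simp]: "u \<in> \<V> \<Longrightarrow> W \<in> words (gset u) \<Longrightarrow> val u W \<in> carrier (vgrp \<A> u)"
  by (rule group.word_val_closed[OF vertex_group]) simp_all

lemma val_append:
  "u \<in> \<V> \<Longrightarrow> U \<in> words (gset u) \<Longrightarrow> V \<in> words (gset u) \<Longrightarrow>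
    val u (U @ V) = val u U \<otimes>\<^bsub>vgrp \<A> u\<^esub> val u V"
  by (rule group.word_val_append[OF vertex_group]) simp_all

lemma val_eq_iff:
  assumes "u \<in> \<V>" "U \<in> words (gset u)" "V \<in> words (gset u)"
  shows "val u U = val u V \<longleftrightarrow> (U, V) \<in> pres_rel (gset u) (rels \<A> u)"
proof -
  obtain \<phi> where \<phi>: "\<phi> \<in> iso (pres_group (gset u) (rels \<A> u)) (vgrp \<A> u)"
    "\<And>W. W \<in> words (gset u) \<Longrightarrow> \<phi> (pres_class (gset u) (rels \<A> u) W) = val u W"
    by (rule val_pres[OF assms(1)]) blast
  have "inj_on \<phi> (carrier (pres_group (gset u) (rels \<A> u)))"
    using \<phi>(1) by (simp add: iso_def bij_betw_def)
  then have "val u U = val u V \<longleftrightarrow>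
      pres_class (gset u) (rels \<A> u) U = pres_class (gset u) (rels \<A> u) V"
    using \<phi>(2)[OF assms(2)] \<phi>(2)[OF assms(3)] assms(2,3)
    by (metis inj_onD pres_class_closed)
  then show ?thesis using assms by (simp add: pres_class_eq_iff)
qed

lemma val_surj:
  assumes "u \<in> \<V>" "a \<in> carrier (vgrp \<A> u)"
  shows "\<exists>W. W \<in> words (gset u) \<and> val u W = a"
proof -
  obtain \<phi> where \<phi>: "\<phi> \<in> iso (pres_group (gset u) (rels \<A> u)) (vgrp \<A> u)"
    "\<And>W. W \<in> words (gset u) \<Longrightarrow> \<phi> (pres_class (gset u) (rels \<A> u) W) = val u W"
    by (rule val_pres[OF assms(1)]) blast
  have "a \<in> \<phi> ` carrier (pres_group (gset u) (rels \<A> u))"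
    using \<phi>(1) assms(2) by (simp add: iso_def bij_betw_def)
  then show ?thesis using \<phi>(2) by (auto simp: carrier_pres_group)
qed

lemma val_rel:
  assumes "u \<in> \<V>" "r \<in> rels \<A> u"
  shows "r \<in> words (gset u)" "val u r = \<one>\<^bsub>vgrp \<A> u\<^esub>"
proof -
  show r: "r \<in> words (gset u)" using rels_words assms by blast
  have "([] @ r @ [], [] @ []) \<in> pres_rel (gset u) (rels \<A> u)"
    using r assms(2) by (intro pres_rel.relator) simp_all
  then show "val u r = \<one>\<^bsub>vgrp \<A> u\<^esub>" using val_eq_iff[OF assms(1) r, of "[]"] by simp
qed

text \<open>The relators of a vertex group are among those of the Bass group, so every derivation
  over the generators of \<open>u\<close> remains one over the whole alphabet.\<close>

lemma ev_gen_word_eq: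
  assumes u: "u \<in> \<V>" and "U \<in> words (gset u)" "V \<in> words (gset u)" "val u U = val u V"
  shows "ev \<A> (gen_word U) = ev \<A> (gen_word V)"
proof -
  have "(U, V) \<in> pres_rel (gset u) (rels \<A> u)" using val_eq_iff assms by blast
  then have "(gen_word U :: ('e, 's) letter word, gen_word V) \<in> pres_rel \<X> \<R>"
  proof (induction rule: pres_rel.induct)
    case (refl U)
    then show ?case using u by (simp add: pres_rel.refl)
  next
    case (sym U V)
    then show ?case by (simp add: pres_rel.sym)
  next
    case (trans U V W)
    then show ?case by (meson pres_rel.trans)
  next
    case (cancel U V x b)
    then show ?case
      using pres_rel.cancel[of "gen_word U" \<X> "gen_word V" "Gen x" b \<R>] u by simp
  next
    case (relator U V r)
    have "gen_word r \<in> \<R>" using relator(3) u by (auto simp: relators_def)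
    then show ?case
      using pres_rel.relator[of "gen_word U" \<X> "gen_word V" "gen_word r" \<R>] u relator by simp
  qed
  then show ?thesis using assms by (simp add: ev_def pres_class_eq_iff)
qed

text \<open>The canonical map from the vertex group at \<open>u\<close> to the Bass group. A
  representing word is chosen, and \<open>ev_gen_word_eq\<close> makes the value independent of the
  choice.\<close>

definition vel :: "'v \<Rightarrow> 'g \<Rightarrow> ('e, 's) letter word set" where
  "vel u a = ev \<A> (gen_word (SOME W. W \<in> words (gset u) \<and> val u W = a))"

lemma ev_gen_word: "u \<in> \<V> \<Longrightarrow> W \<in> words (gset u) \<Longrightarrow> ev \<A> (gen_word W) = vel u (val u W)"
  unfolding vel_def using someI_ex[OF val_surj, of u "val u W"] by (intro ev_gen_word_eq) auto

lemma vel_hom: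
  assumes u: "u \<in> \<V>"
  shows "vel u \<in> hom (vgrp \<A> u) (Bass \<A>)"
proof (rule homI)
  fix a assume "a \<in> carrier (vgrp \<A> u)"
  then obtain U where U: "U \<in> words (gset u)" "val u U = a" using val_surj[OF u] by blast
  then show "vel u a \<in> carrier (Bass \<A>)" using ev_gen_word[OF u U(1)] ev_in[of "gen_word U"] u by simp
  fix b assume "b \<in> carrier (vgrp \<A> u)"
  then obtain V where V: "V \<in> words (gset u)" "val u V = b" using val_surj[OF u] by blast
  then show "vel u (a \<otimes>\<^bsub>vgrp \<A> u\<^esub> b) = vel u a \<otimes>\<^bsub>Bass \<A>\<^esub> vel u b"
    using ev_gen_word[OF u, of "U @ V"] ev_gen_word[OF u, of U] ev_gen_word[OF u, of V] U u
    by (simp add: val_append ev_append)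
qed

lemma group_hom_vel: "u \<in> \<V> \<Longrightarrow> group_hom (vgrp \<A> u) (Bass \<A>) (vel u)"
  using vel_hom vertex_group group_Bass by (simp add: group_hom_def group_hom_axioms_def)

lemma vel_in [simp]: "u \<in> \<V> \<Longrightarrow> a \<in> carrier (vgrp \<A> u) \<Longrightarrow> vel u a \<in> carrier (Bass \<A>)"
  using vel_hom by (auto simp: hom_def)

lemma tword_in [simp]: "e \<in> \<E> \<Longrightarrow> h \<in> carrier (egrp \<A> e) \<Longrightarrow> tword \<A> e h \<in> words (gset (tgt e))"
  and val_tword [simp]: "e \<in> \<E> \<Longrightarrow> h \<in> carrier (egrp \<A> e) \<Longrightarrow> val (tgt e) (tword \<A> e h) = tmap \<A> e h"
  and iword_in [simp]: "e \<in> \<E> \<Longrightarrow> h \<in> carrier (egrp \<A> e) \<Longrightarrow> iword \<A> e h \<in> words (gset (src e))"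
  and val_iword [simp]: "e \<in> \<E> \<Longrightarrow> h \<in> carrier (egrp \<A> e) \<Longrightarrow> val (src e) (iword \<A> e h) = imap \<A> e h"
  using tword iword by auto

lemma gen_tword_in [simp]:
  "e \<in> \<E> \<Longrightarrow> h \<in> carrier (egrp \<A> e) \<Longrightarrow> gen_word (tword \<A> e h) \<in> words \<X>"
  and gen_iword_in [simp]:
  "e \<in> \<E> \<Longrightarrow> h \<in> carrier (egrp \<A> e) \<Longrightarrow> gen_word (iword \<A> e h) \<in> words \<X>"
  using gen_word_in[of "tgt e"] gen_word_in[of "src e"] by simp_all

lemma edge_relator_words:
  "e \<in> \<E> \<Longrightarrow> h \<in> carrier (egrp \<A> e) \<Longrightarrow> edge_relator \<A> e h \<in> words \<X>"
  by (simp add: edge_relator_def del: gen_word_simps(4))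

lemma ev_edge_relator:
  assumes "e \<in> \<E>" "h \<in> carrier (egrp \<A> e)"
  shows "ev \<A> (edge_relator \<A> e h) = \<one>\<^bsub>Bass \<A>\<^esub>"
proof -
  have "edge_relator \<A> e h \<in> \<R>" using assms by (auto simp: relators_def)
  then have "([] @ edge_relator \<A> e h @ [], [] @ []) \<in> pres_rel \<X> \<R>"
    using edge_relator_words[OF assms] by (intro pres_rel.relator) simp_all
  then have "ev \<A> (edge_relator \<A> e h) = ev \<A> []"
    unfolding ev_def using edge_relator_words[OF assms] by (subst pres_class_eq_iff) simp_all
  then show ?thesis by (simp add: ev_Nil)
qed

lemma edge_relation:
  assumes e: "e \<in> \<E>" and h: "h \<in> carrier (egrp \<A> e)"
  shows "vel (src e) (imap \<A> e h) \<otimes>\<^bsub>Bass \<A>\<^esub> ev \<A> [(Edge e, True)] =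
    ev \<A> [(Edge e, True)] \<otimes>\<^bsub>Bass \<A>\<^esub> vel (tgt e) (tmap \<A> e h)"
proof -
  interpret group "Bass \<A>" by (rule group_Bass)
  let ?e = "ev \<A> [(Edge e, True)]" and ?t = "vel (tgt e) (tmap \<A> e h)" and ?i = "vel (src e) (imap \<A> e h)"
  have in_carrier: "?e \<in> carrier (Bass \<A>)" "?t \<in> carrier (Bass \<A>)" "?i \<in> carrier (Bass \<A>)"
    using e h by simp_all
  \<comment> \<open>The relator is bracketed as a product \<open>e t\<close> times the inverse of a
    product \<open>i e\<close>, so that its triviality becomes an equality of two products.\<close>
  have split: "edge_relator \<A> e h = ([(Edge e, True)] @ gen_word (tword \<A> e h)) @
      word_inv (gen_word (iword \<A> e h) @ [(Edge e, True)])"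
    by (simp add: edge_relator_def)
  have "ev \<A> (edge_relator \<A> e h) = (?e \<otimes>\<^bsub>Bass \<A>\<^esub> ?t) \<otimes>\<^bsub>Bass \<A>\<^esub>
      inv\<^bsub>Bass \<A>\<^esub> (?i \<otimes>\<^bsub>Bass \<A>\<^esub> ?e)"
    unfolding split using e h
    by (subst ev_append; (subst ev_inv)?)
      (simp_all add: ev_append ev_gen_word[of "tgt e"] ev_gen_word[of "src e"]
        del: append.simps word_inv_append gen_word_simps(4))
  then have "(?e \<otimes>\<^bsub>Bass \<A>\<^esub> ?t) \<otimes>\<^bsub>Bass \<A>\<^esub> inv\<^bsub>Bass \<A>\<^esub> (?i \<otimes>\<^bsub>Bass \<A>\<^esub> ?e) = \<one>\<^bsub>Bass \<A>\<^esub>"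
    using ev_edge_relator[OF e h] by simp
  then show ?thesis using in_carrier by (metis inv_closed inv_equality inv_inv m_closed)
qed

text \<open>Permutations \<open>E e\<close> that intertwine the two actions of each edge group
  respect the edge relators. The cocycle is \<open>\<delta>\<close> on the edges, twisted by the
  change of coordinates \<open>\<kappa>\<close>. On vertex groups it is therefore the coboundary of
  \<open>\<kappa>\<close>, and in an edge relator the inner values of \<open>\<kappa>\<close>
  cancel, which leaves the invariance of \<open>\<delta>\<close> under the edge group.\<close>

lemma bass_representation:
  fixes \<alpha> :: "'v \<Rightarrow> nat \<Rightarrow> 'g \<Rightarrow> nat" and K :: "('k, 'm) monoid_scheme"
  assumes K: "group K"
    and \<alpha>: "\<And>u. u \<in> \<V> \<Longrightarrow> free_action (vgrp \<A> u) UNIV (\<alpha> u)"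
    and E: "\<And>e. e \<in> \<E> \<Longrightarrow> bij (E e)"
    and E_\<alpha>: "\<And>e y h. e \<in> \<E> \<Longrightarrow> h \<in> carrier (egrp \<A> e) \<Longrightarrow>
      E e (\<alpha> (src e) y (imap \<A> e h)) = \<alpha> (tgt e) (E e y) (tmap \<A> e h)"
    and \<kappa>: "\<And>u y. u \<in> \<V> \<Longrightarrow> \<kappa> u y \<in> carrier K"
    and \<delta>: "\<And>e y. e \<in> \<E> \<Longrightarrow> \<delta> e y \<in> carrier K"
    and \<delta>_\<alpha>: "\<And>e y h. e \<in> \<E> \<Longrightarrow> h \<in> carrier (egrp \<A> e) \<Longrightarrow> \<delta> e (\<alpha> (src e) y (imap \<A> e h)) = \<delta> e y"
  obtains \<Psi> where "\<Psi> \<in> hom (Bass \<A>) (wreath K)"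
    "\<And>u a. u \<in> \<V> \<Longrightarrow> a \<in> carrier (vgrp \<A> u) \<Longrightarrow>
      \<Psi> (vel u a) = (\<lambda>y. \<alpha> u y a, \<lambda>y. \<kappa> u y \<otimes>\<^bsub>K\<^esub> inv\<^bsub>K\<^esub> (\<kappa> u (\<alpha> u y a)))"
    "\<And>e. e \<in> \<E> \<Longrightarrow> \<Psi> (ev \<A> [(Edge e, True)]) =
      (E e, \<lambda>y. \<kappa> (src e) y \<otimes>\<^bsub>K\<^esub> \<delta> e y \<otimes>\<^bsub>K\<^esub> inv\<^bsub>K\<^esub> (\<kappa> (tgt e) (E e y)))"
proof -
  interpret K: group K by fact
  interpret W: group "wreath K :: ((nat \<Rightarrow> nat) \<times> (nat \<Rightarrow> 'k)) monoid" by (rule group_wreath[OF K])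
  define \<rho> where "\<rho> u a = (\<lambda>y. \<alpha> u y a, \<lambda>y. \<kappa> u y \<otimes>\<^bsub>K\<^esub> inv\<^bsub>K\<^esub> (\<kappa> u (\<alpha> u y a)))" for u a
  define \<eta> where "\<eta> e = (E e, \<lambda>y. \<kappa> (src e) y \<otimes>\<^bsub>K\<^esub> \<delta> e y \<otimes>\<^bsub>K\<^esub> inv\<^bsub>K\<^esub> (\<kappa> (tgt e) (E e y)))" for e
  \<comment> \<open>A symbol lies in the tuple of only one vertex, which is recovered by
    choice.\<close>
  define f where "f x = (case x of Edge e \<Rightarrow> \<eta> e | Gen s \<Rightarrow> \<rho> (SOME u. u \<in> \<V> \<and> s \<in> gset u) (gval \<A> s))" for x
  have f_gen: "f (Gen s) = \<rho> u (gval \<A> s)" if "u \<in> \<V>" "s \<in> gset u" for u s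
  proof -
    have "(SOME u. u \<in> \<V> \<and> s \<in> gset u) = u"
      using disjoint_gens that by (intro some_equality) auto
    then show ?thesis by (simp add: f_def)
  qed
  have f_edge: "f (Edge e) = \<eta> e" for e by (simp add: f_def)
  have \<rho>: "\<rho> u \<in> hom (vgrp \<A> u) (wreath K)" if u: "u \<in> \<V>" for u
  proof (rule homI)
    interpret vgrp: group "vgrp \<A> u" by (rule vertex_group[OF u])
    note a = free_actionD[OF \<alpha>[OF u], simplified]
    fix g assume g: "g \<in> carrier (vgrp \<A> u)"
    have "bij (\<lambda>y. \<alpha> u y g)"
      using g by (intro bij_betw_byWitness[where f' = "\<lambda>y. \<alpha> u y (inv\<^bsub>vgrp \<A> u\<^esub> g)"]) (auto simp: a)
    then show "\<rho> u g \<in> carrier (wreath K)" using \<kappa>[OF u] by (simp add: \<rho>_def carrier_wreath)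
    fix h assume h: "h \<in> carrier (vgrp \<A> u)"
    show "\<rho> u (g \<otimes>\<^bsub>vgrp \<A> u\<^esub> h) = \<rho> u g \<otimes>\<^bsub>wreath K\<^esub> \<rho> u h"
      using g h \<kappa>[OF u] by (simp add: \<rho>_def mult_wreath a fun_eq_iff K.m_assoc) (simp flip: K.m_assoc)
  qed
  have \<eta>: "\<eta> e \<in> carrier (wreath K)" if "e \<in> \<E>" for e
    using that E \<kappa> \<delta> by (simp add: \<eta>_def carrier_wreath)
  have f_in: "f x \<in> carrier (wreath K)" if "x \<in> \<X>" for x
  proof (cases x)
    case (Edge e)
    then show ?thesis using that \<eta>[of e] by (auto simp: f_edge alphabet_def gen_letters_def)
  next
    case (Gen s)
    then obtain u where u: "u \<in> \<V>" "s \<in> gset u" using \<open>x \<in> \<X>\<close> by (auto simp: alphabet_def gen_letters_def)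
    then show ?thesis using Gen \<rho>[OF u(1)] gval_in[OF u] by (auto simp: f_gen[OF u] hom_def)
  qed
  have f_gen_word: "word_val (wreath K) f (gen_word U) = \<rho> u (val u U)"
    if u: "u \<in> \<V>" and U: "U \<in> words (gset u)" for u U
  proof -
    have "\<rho> u (val u U) = word_val (wreath K) (\<lambda>s. \<rho> u (gval \<A> s)) U"
      by (rule hom_word_val[OF vertex_group[OF u] group_wreath[OF K] \<rho>[OF u] _ U]) (simp add: u)
    also have "\<dots> = word_val (wreath K) (\<lambda>s. f (Gen s)) U"
      by (rule word_val_cong[OF U]) (simp add: f_gen[OF u])
    also have "\<dots> = word_val (wreath K) f (gen_word U)"
      by (induction U) auto
    finally show ?thesis ..
  qed
  have rel: "word_val (wreath K) f r = \<one>\<^bsub>wreath K\<^esub>" if r: "r \<in> \<R>" for r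
  proof -
    from r consider e h where "e \<in> \<E>" "h \<in> carrier (egrp \<A> e)" "r = edge_relator \<A> e h"
      | u q where "u \<in> \<V>" "q \<in> rels \<A> u" "r = gen_word q"
      by (auto simp: relators_def)
    then show ?thesis
    proof cases
      case 1
      note e = 1(1) and h = 1(2)
      let ?t = "\<rho> (tgt e) (tmap \<A> e h)" and ?i = "\<rho> (src e) (imap \<A> e h)"
      have in_carrier: "?t \<in> carrier (wreath K)" "?i \<in> carrier (wreath K)"
        using \<rho>[of "tgt e"] \<rho>[of "src e"] e h by (auto simp: hom_def)
      have "\<eta> e \<otimes>\<^bsub>wreath K\<^esub> ?t = ?i \<otimes>\<^bsub>wreath K\<^esub> \<eta> e"
        using e h \<kappa>[of "src e"] \<kappa>[of "tgt e"] \<delta>[OF e]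
        by (simp add: \<eta>_def \<rho>_def mult_wreath fun_eq_iff E_\<alpha> \<delta>_\<alpha> K.m_assoc) (simp flip: K.m_assoc)
      moreover have split: "r = ([(Edge e, True)] @ gen_word (tword \<A> e h)) @
          word_inv (gen_word (iword \<A> e h) @ [(Edge e, True)])"
        by (simp add: 1(3) edge_relator_def)
      have "word_val (wreath K) f r = word_val (wreath K) f ([(Edge e, True)] @ gen_word (tword \<A> e h))
          \<otimes>\<^bsub>wreath K\<^esub> inv\<^bsub>wreath K\<^esub> (word_val (wreath K) f (gen_word (iword \<A> e h) @ [(Edge e, True)]))"
        unfolding split
        by (subst W.word_val_append[of \<X> f, OF f_in]) 
          (use e h in \<open>simp_all add: W.word_val_inv[of \<X> f, OF f_in] del: word_inv_append gen_word_simps(4)\<close>)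
      moreover have "word_val (wreath K) f ([(Edge e, True)] @ gen_word (tword \<A> e h)) = \<eta> e \<otimes>\<^bsub>wreath K\<^esub> ?t"
        by (subst W.word_val_append[of \<X> f, OF f_in])
          (use e h \<eta> in \<open>simp_all add: f_edge f_gen_word[of "tgt e"]\<close>)
      moreover have "word_val (wreath K) f (gen_word (iword \<A> e h) @ [(Edge e, True)]) = ?i \<otimes>\<^bsub>wreath K\<^esub> \<eta> e"
        by (subst W.word_val_append[of \<X> f, OF f_in])
          (use e h \<eta> in \<open>simp_all add: f_edge f_gen_word[of "src e"]\<close>)
      ultimately show ?thesis using in_carrier \<eta>[OF e] by simp
    next
      case 2
      then show ?thesis
        using val_rel[OF 2(1,2)] f_gen_word hom_one[OF \<rho>[OF 2(1)] vertex_group[OF 2(1)] group_wreath[OF K]]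
        by simp
    qed
  qed
  obtain \<Psi> where \<Psi>: "\<Psi> \<in> hom (pres_group \<X> \<R>) (wreath K)"
    "\<And>W. W \<in> words \<X> \<Longrightarrow> \<Psi> (pres_class \<X> \<R> W) = word_val (wreath K) f W"
    by (rule W.pres_group_lift[of \<X> f \<R>]) (use f_in rel in auto)
  show ?thesis
  proof (rule that[of \<Psi>])
    show "\<Psi> \<in> hom (Bass \<A>) (wreath K)" using \<Psi>(1) by (simp add: Bass_def)
    fix u a assume u: "u \<in> \<V>" and "a \<in> carrier (vgrp \<A> u)"
    then obtain U where U: "U \<in> words (gset u)" "val u U = a" using val_surj by blast
    then have "\<Psi> (vel u a) = \<rho> u a"
      using \<Psi>(2)[of "gen_word U"] f_gen_word[OF u U(1)] ev_gen_word[OF u U(1)] u by (simp add: ev_def)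
    then show "\<Psi> (vel u a) = (\<lambda>y. \<alpha> u y a, \<lambda>y. \<kappa> u y \<otimes>\<^bsub>K\<^esub> inv\<^bsub>K\<^esub> (\<kappa> u (\<alpha> u y a)))"
      by (simp add: \<rho>_def)
  next
    fix e assume "e \<in> \<E>"
    then show "\<Psi> (ev \<A> [(Edge e, True)]) =
        (E e, \<lambda>y. \<kappa> (src e) y \<otimes>\<^bsub>K\<^esub> \<delta> e y \<otimes>\<^bsub>K\<^esub> inv\<^bsub>K\<^esub> (\<kappa> (tgt e) (E e y)))"
      using \<Psi>(2)[of "[(Edge e, True)]"] \<eta> by (simp add: ev_def f_edge) (simp add: \<eta>_def)
  qed
qed

text \<open>The vertex groups embed: let every vertex group act freely on \<open>nat\<close>.\<close>

lemma vel_eq_one: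
  assumes u: "u \<in> \<V>" and a: "a \<in> carrier (vgrp \<A> u)" and "vel u a = \<one>\<^bsub>Bass \<A>\<^esub>"
  shows "a = \<one>\<^bsub>vgrp \<A> u\<^esub>"
proof -
  \<comment> \<open>Only the permutations are wanted here, so the cocycle takes values in the
    trivial group, presented without generators.\<close>
  let ?K = "pres_group ({} :: nat set) {}"
  interpret K: group ?K by (rule group_pres_group)
  \<comment> \<open>Starting from the empty set, the extension lemmas produce free actions on
    \<open>nat\<close> and, below, intertwining bijections for the edges.\<close>
  have "\<exists>\<alpha>. free_action (vgrp \<A> u) (UNIV :: nat set) \<alpha>" if "u \<in> \<V>" for u
    by (rule extend_free_action[OF vertex_group[OF that] finite_vgrp[OF that], of "{}" "\<lambda>y _. y"])
      (auto simp: free_action_def)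
  then obtain \<alpha> where \<alpha>: "\<And>u. u \<in> \<V> \<Longrightarrow> free_action (vgrp \<A> u) (UNIV :: nat set) (\<alpha> u)" by metis
  have "\<exists>E. bij E \<and> (\<forall>y. \<forall>h \<in> carrier (egrp \<A> e).
      E (\<alpha> (src e) y (imap \<A> e h)) = \<alpha> (tgt e) (E y) (tmap \<A> e h))" if e: "e \<in> \<E>" for e
    by (rule extend_equivariant_bij[OF edge_group[OF e] finite_egrp[OF e]
        free_action_hom[OF edge_group[OF e] vertex_group imap_mon[OF e] \<alpha>]
        free_action_hom[OF edge_group[OF e] vertex_group tmap_mon[OF e] \<alpha>], of "{}" "\<lambda>y. y"])
      (use e in auto)
  then obtain E where E: "\<And>e. e \<in> \<E> \<Longrightarrow> bij (E e) \<and> (\<forall>y. \<forall>h \<in> carrier (egrp \<A> e).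
      E e (\<alpha> (src e) y (imap \<A> e h)) = \<alpha> (tgt e) (E e y) (tmap \<A> e h))" by metis
  obtain \<Psi> where \<Psi>: "\<Psi> \<in> hom (Bass \<A>) (wreath ?K)"
    "\<And>u a. u \<in> \<V> \<Longrightarrow> a \<in> carrier (vgrp \<A> u) \<Longrightarrow>
      \<Psi> (vel u a) = (\<lambda>y. \<alpha> u y a, \<lambda>y. \<one>\<^bsub>?K\<^esub> \<otimes>\<^bsub>?K\<^esub> inv\<^bsub>?K\<^esub> \<one>\<^bsub>?K\<^esub>)"
    by (rule bass_representation[where K = ?K and \<alpha> = \<alpha> and E = E and \<kappa> = "\<lambda>_ _. \<one>\<^bsub>?K\<^esub>"
        and \<delta> = "\<lambda>_ _. \<one>\<^bsub>?K\<^esub>"]) (use \<alpha> E in \<open>auto simp: group_pres_group\<close>)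
  have "\<Psi> (vel u a) = \<one>\<^bsub>wreath ?K\<^esub>"
    using hom_one[OF \<Psi>(1) group_Bass group_wreath[OF group_pres_group]] assms(3) by simp
  then have "\<alpha> u 0 a = 0"
    using \<Psi>(2)[OF u a] by (simp add: one_wreath fun_eq_iff)
  then show ?thesis using free_actionD(3)[OF \<alpha>[OF u] _ a, of 0] by simp
qed

end

subsection \<open>Labelled graphs as sets of triples\<close>

definition triples :: "('a, 'b, 'x) lgraph \<Rightarrow> ('a \<times> 'x \<times> 'a) set" where
  "triples \<Gamma> = (\<lambda>f. (tail \<Gamma> f, lab \<Gamma> f, head \<Gamma> f)) ` arcs \<Gamma>"

abbreviation map_triple :: "('a \<Rightarrow> 'b) \<Rightarrow> 'a \<times> 'x \<times> 'a \<Rightarrow> 'b \<times> 'x \<times> 'b" where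
  "map_triple \<pi> \<equiv> (\<lambda>(x, l, y). (\<pi> x, l, \<pi> y))"

definition wf_graph :: "('a, 'b, 'x) lgraph \<Rightarrow> bool" where
  "wf_graph \<Gamma> \<longleftrightarrow> base \<Gamma> \<in> verts \<Gamma> \<and>
    (\<forall>(x, l, y) \<in> triples \<Gamma>. x \<in> verts \<Gamma> \<and> y \<in> verts \<Gamma>)"

definition connected_graph :: "('a, 'b, 'x) lgraph \<Rightarrow> bool" where
  "connected_graph \<Gamma> \<longleftrightarrow> (\<forall>z \<in> verts \<Gamma>. \<exists>W. reads (triples \<Gamma>) (base \<Gamma>) W z)"

text \<open>Only triples are compared, so a fold, which deletes one of two edges that become
  parallel with equal labels, counts as a quotient map.\<close>

definition quotient_map ::
    "('a \<Rightarrow> 'c) \<Rightarrow> ('a, 'b, 'x) lgraph \<Rightarrow> ('c, 'd, 'x) lgraph \<Rightarrow> bool" where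
  "quotient_map \<pi> \<Gamma> \<Delta> \<longleftrightarrow> verts \<Delta> = \<pi> ` verts \<Gamma> \<and> base \<Delta> = \<pi> (base \<Gamma>) \<and>
    triples \<Delta> = map_triple \<pi> ` triples \<Gamma>"

definition deterministic :: "('a \<times> 'x \<times> 'a) set \<Rightarrow> bool" where
  "deterministic T \<longleftrightarrow> (\<forall>x l y z. (x, l, y) \<in> T \<longrightarrow> (x, l, z) \<in> T \<longrightarrow> y = z) \<and>
    (\<forall>x l y z. (y, l, x) \<in> T \<longrightarrow> (z, l, x) \<in> T \<longrightarrow> y = z)"

lemma reads_ConsI:
  "(if snd l then (z, fst l, y) else (y, fst l, z)) \<in> T \<Longrightarrow> reads T y W z' \<Longrightarrow> reads T z (l # W) z'"
  by auto

lemma deterministic_reads: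
  "deterministic T \<Longrightarrow> reads T z W x \<Longrightarrow> reads T z W y \<Longrightarrow> x = y"
proof (induction W arbitrary: z)
  case (Cons l W)
  from Cons(3) obtain x' where x': "(if snd l then (z, fst l, x') else (x', fst l, z)) \<in> T" "reads T x' W x"
    by auto
  from Cons(4) obtain y' where y': "(if snd l then (z, fst l, y') else (y', fst l, z)) \<in> T" "reads T y' W y"
    by auto
  have "x' = y'" using x'(1) y'(1) Cons(2) unfolding deterministic_def by (cases "snd l") simp_all
  then show ?case using Cons(1,2) x'(2) y'(2) by blast
qed simp

lemma reads_verts:
  assumes "wf_graph \<Gamma>" "reads (triples \<Gamma>) z W z'" "z \<in> verts \<Gamma>"
  shows "z' \<in> verts \<Gamma>"
  using assms(2,3)
proof (induction W arbitrary: z)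
  case (Cons l W)
  then obtain y where "(if snd l then (z, fst l, y) else (y, fst l, z)) \<in> triples \<Gamma>" "reads (triples \<Gamma>) y W z'"
    by auto
  moreover from this(1) have "y \<in> verts \<Gamma>"
    using assms(1) unfolding wf_graph_def by (cases "snd l") auto
  ultimately show ?case using Cons(1) by blast
qed simp

section \<open>Quotients of labelled graphs and folds\<close>

lemma quotient_map_reads:
  "quotient_map \<pi> \<Gamma> \<Delta> \<Longrightarrow> reads (triples \<Gamma>) x W y \<Longrightarrow> reads (triples \<Delta>) (\<pi> x) W (\<pi> y)"
  by (erule reads_map) (force simp: quotient_map_def)

lemma quotient_map_wf: "quotient_map \<pi> \<Gamma> \<Delta> \<Longrightarrow> wf_graph \<Gamma> \<Longrightarrow> wf_graph \<Delta>"
  unfolding quotient_map_def wf_graph_def by fastforce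

lemma quotient_map_connected:
  assumes "quotient_map \<pi> \<Gamma> \<Delta>" "connected_graph \<Gamma>"
  shows "connected_graph \<Delta>"
  unfolding connected_graph_def
proof
  fix z assume "z \<in> verts \<Delta>"
  then obtain y where y: "y \<in> verts \<Gamma>" "z = \<pi> y" using assms(1) by (auto simp: quotient_map_def)
  then obtain W where "reads (triples \<Gamma>) (base \<Gamma>) W y" using assms(2) by (auto simp: connected_graph_def)
  from quotient_map_reads[OF assms(1) this]
  have "reads (triples \<Delta>) (base \<Delta>) W z" using assms(1) y(2) by (simp add: quotient_map_def)
  then show "\<exists>W. reads (triples \<Delta>) (base \<Delta>) W z" by blast
qed

text \<open>The images of \<open>f\<close> and \<open>g\<close> coincide after the identification,
  so deleting \<open>g\<close> removes no triple.\<close>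

lemma identify_quotient:
  assumes "wf_graph \<Gamma>" "f \<in> arcs \<Gamma>" "g \<in> arcs \<Gamma>" "f \<noteq> g" "lab \<Gamma> f = lab \<Gamma> g"
    "(tail \<Gamma> f = tail \<Gamma> g \<and> a = head \<Gamma> f \<and> b = head \<Gamma> g) \<or>
     (head \<Gamma> f = head \<Gamma> g \<and> a = tail \<Gamma> f \<and> b = tail \<Gamma> g)"
  shows "quotient_map (\<lambda>z. if z = b then a else z) \<Gamma> (identify g a b \<Gamma>)"
proof -
  let ?\<sigma> = "\<lambda>z. if z = b then a else z"
  let ?t = "\<lambda>k. (tail \<Gamma> k, lab \<Gamma> k, head \<Gamma> k)"
  have "map_triple ?\<sigma> (?t f) = map_triple ?\<sigma> (?t g)" using assms by auto
  then have "(\<lambda>k. map_triple ?\<sigma> (?t k)) ` arcs \<Gamma> = (\<lambda>k. map_triple ?\<sigma> (?t k)) ` (arcs \<Gamma> - {g})"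
    using assms(2-4) by (smt (verit) Diff_iff image_cong image_iff insert_Diff insert_iff singletonD image_insert insert_absorb)
  moreover have "triples (identify g a b \<Gamma>) = (\<lambda>k. map_triple ?\<sigma> (?t k)) ` (arcs \<Gamma> - {g})"
    by (simp add: identify_def triples_def Let_def)
  moreover have "map_triple ?\<sigma> ` triples \<Gamma> = (\<lambda>k. map_triple ?\<sigma> (?t k)) ` arcs \<Gamma>"
    by (simp add: triples_def image_image)
  ultimately show ?thesis
    by (simp add: quotient_map_def identify_def Let_def)
qed

lemma fold_step_quotient:
  assumes "fold_step \<Gamma> \<Delta>" "wf_graph \<Gamma>"
  obtains \<pi> where "quotient_map \<pi> \<Gamma> \<Delta>"
  using assms(1)
proof cases
  case (fold_out f g)
  then show ?thesis using identify_quotient[OF assms(2), of f g "head \<Gamma> f" "head \<Gamma> g"] that by blast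
next
  case (fold_in f g)
  then show ?thesis using identify_quotient[OF assms(2), of f g "tail \<Gamma> f" "tail \<Gamma> g"] that by blast
qed

lemma folds_quotient:
  assumes "fold_step\<^sup>*\<^sup>* \<Gamma> \<Delta>" "wf_graph \<Gamma>"
  shows "\<exists>\<pi>. quotient_map \<pi> \<Gamma> \<Delta>"
  using assms(1)
proof induction
  case base
  have "quotient_map id \<Gamma> \<Gamma>" by (auto simp: quotient_map_def image_def)
  then show ?case by blast
next
  case (step \<Delta> \<Delta>')
  then obtain \<pi> where \<pi>: "quotient_map \<pi> \<Gamma> \<Delta>" by blast
  obtain \<rho> where \<rho>: "quotient_map \<rho> \<Delta> \<Delta>'"
    using fold_step_quotient[OF step(2) quotient_map_wf[OF \<pi> assms(2)]] by blast
  have "map_triple (\<rho> \<circ> \<pi>) ` triples \<Gamma> = map_triple \<rho> ` map_triple \<pi> ` triples \<Gamma>"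
    by (auto simp: image_image split_beta)
  then have "quotient_map (\<rho> \<circ> \<pi>) \<Gamma> \<Delta>'"
    using \<pi> \<rho> by (simp add: quotient_map_def image_comp)
  then show ?case by blast
qed

text \<open>Two distinct edges violating either conclusion would admit a fold. The injectivity shows
  that passing to triples loses nothing for a completely folded graph.\<close>

lemma no_fold_deterministic:
  assumes "\<nexists>\<Delta>. fold_step \<Gamma> \<Delta>"
  shows "deterministic (triples \<Gamma>)"
    "inj_on (\<lambda>f. (tail \<Gamma> f, lab \<Gamma> f, head \<Gamma> f)) (arcs \<Gamma>)"
proof -
  have eq: "f = g" if "f \<in> arcs \<Gamma>" "g \<in> arcs \<Gamma>" "lab \<Gamma> f = lab \<Gamma> g"
    "tail \<Gamma> f = tail \<Gamma> g \<or> head \<Gamma> f = head \<Gamma> g" for f g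
    using that fold_step.intros[of f \<Gamma> g] assms by metis
  then show "inj_on (\<lambda>f. (tail \<Gamma> f, lab \<Gamma> f, head \<Gamma> f)) (arcs \<Gamma>)"
    by (auto simp: inj_on_def)
  show "deterministic (triples \<Gamma>)"
    unfolding deterministic_def triples_def using eq by (auto simp: image_iff)
qed

subsection \<open>Attached graphs and word loops\<close>

definition attach_emb ::
    "('i \<Rightarrow> 'a) \<Rightarrow> ('i \<Rightarrow> ('c, 'd, 'x) lgraph) \<Rightarrow> 'i \<Rightarrow> 'c \<Rightarrow> 'a + 'i \<times> 'c" where
  "attach_emb p D i c = (if c = base (D i) then Inl (p i) else Inr (i, c))"

lemma triples_attach:
  fixes D :: "'i \<Rightarrow> ('c, 'd, 'x) lgraph"
  shows "triples (attach (\<Gamma> :: ('a, 'b, 'x) lgraph) I p D) =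
    map_triple Inl ` triples \<Gamma> \<union> (\<Union>i \<in> I. map_triple (attach_emb p D i) ` triples (D i))"
proof -
  have "f ` (SIGMA i:I. B i) = (\<Union>i \<in> I. (\<lambda>x. f (i, x)) ` B i)"
    for f :: "'i \<times> 'd \<Rightarrow> ('a + 'i \<times> 'c) \<times> 'x \<times> ('a + 'i \<times> 'c)" and B by auto
  then show ?thesis
    by (simp add: triples_def attach_def Let_def image_Un image_UN image_image
        attach_emb_def[of p D, abs_def])
qed

lemma verts_attach:
  "verts (attach \<Gamma> I p D) = Inl ` verts \<Gamma> \<union> (\<Union>i \<in> I. attach_emb p D i ` verts (D i))"
  by (simp add: attach_def Let_def attach_emb_def)

lemma base_attach [simp]: "base (attach \<Gamma> I p D) = Inl (base \<Gamma>)"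
  by (simp add: attach_def Let_def)

lemma attach_emb_base [simp]: "attach_emb p D i (base (D i)) = Inl (p i)"
  by (simp add: attach_emb_def)

lemma reads_attach_Inl:
  "reads (triples \<Gamma>) x W y \<Longrightarrow> reads (triples (attach \<Gamma> I p D)) (Inl x) W (Inl y)"
  by (erule reads_map) (force simp: triples_attach)

lemma reads_attach_emb:
  "i \<in> I \<Longrightarrow> reads (triples (D i)) x W y \<Longrightarrow>
    reads (triples (attach \<Gamma> I p D)) (attach_emb p D i x) W (attach_emb p D i y)"
  by (erule reads_map) (force simp: triples_attach)

lemma wf_attach:
  assumes "wf_graph \<Gamma>" "\<And>i. i \<in> I \<Longrightarrow> wf_graph (D i)"
  shows "wf_graph (attach \<Gamma> I p D)"
  using assms unfolding wf_graph_def triples_attach verts_attach by fastforce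

lemma connected_attach:
  assumes "connected_graph \<Gamma>" "\<And>i. i \<in> I \<Longrightarrow> connected_graph (D i)" "\<And>i. i \<in> I \<Longrightarrow> p i \<in> verts \<Gamma>"
  shows "connected_graph (attach \<Gamma> I p D)"
  unfolding connected_graph_def
proof
  let ?A = "attach \<Gamma> I p D"
  fix z assume "z \<in> verts ?A"
  then consider x where "x \<in> verts \<Gamma>" "z = Inl x"
    | i c where "i \<in> I" "c \<in> verts (D i)" "z = attach_emb p D i c"
    by (auto simp: verts_attach)
  then show "\<exists>W. reads (triples ?A) (base ?A) W z"
  proof cases
    case 1
    then show ?thesis using assms(1) reads_attach_Inl unfolding connected_graph_def by fastforce
  next
    case 2
    obtain U where "reads (triples \<Gamma>) (base \<Gamma>) U (p i)"
      using assms(1,3) 2 by (auto simp: connected_graph_def)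
    from reads_attach_Inl[OF this]
    have U: "reads (triples ?A) (base ?A) U (Inl (p i))" by simp
    obtain W where "reads (triples (D i)) (base (D i)) W c"
      using assms(2) 2 by (auto simp: connected_graph_def)
    from reads_attach_emb[OF 2(1), of D, OF this]
    have "reads (triples ?A) (Inl (p i)) W z" using 2 by simp
    then have "reads (triples ?A) (base ?A) (U @ W) z" using U unfolding reads_append by blast
    then show ?thesis by blast
  qed
qed

lemma finite_attach:
  "finite (verts \<Gamma>) \<Longrightarrow> finite I \<Longrightarrow> (\<And>i. i \<in> I \<Longrightarrow> finite (verts (D i))) \<Longrightarrow>
    finite (verts (attach \<Gamma> I p D))"
  by (simp add: verts_attach)

lemma card_attach:
  assumes "finite (verts \<Gamma>)" "finite I" "\<And>i. i \<in> I \<Longrightarrow> finite (verts (D i))"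
    "\<And>i. i \<in> I \<Longrightarrow> p i \<in> verts \<Gamma>"
  shows "card (verts (attach \<Gamma> I p D)) \<le>
    card (verts \<Gamma>) + (\<Sum>i \<in> I. card (verts (D i) - {base (D i)}))"
proof -
  let ?S = "SIGMA i:I. verts (D i) - {base (D i)}"
  have fin: "finite ?S" using assms by blast
  have "verts (attach \<Gamma> I p D) \<subseteq> verts \<Gamma> <+> ?S"
    using assms(4) by (auto simp: verts_attach attach_emb_def Plus_def)
  then have "card (verts (attach \<Gamma> I p D)) \<le> card (verts \<Gamma> <+> ?S)"
    using assms(1) fin by (intro card_mono finite_Plus)
  also have "card (verts \<Gamma> <+> ?S) = card (verts \<Gamma>) + card ?S"
    using assms(1) fin by (rule card_Plus)
  also have "card ?S = (\<Sum>i \<in> I. card (verts (D i) - {base (D i)}))"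
    using assms by (intro card_SigmaI) auto
  finally show ?thesis .
qed

section \<open>Loops labelled by words\<close>

abbreviation loop_pos :: "'x word \<Rightarrow> nat \<Rightarrow> nat" where
  "loop_pos W k \<equiv> if k = length W then 0 else k"

lemma word_loop_sel [simp]:
  "verts (word_loop W) = insert 0 {..<length W}" "arcs (word_loop W) = {..<length W}"
  "base (word_loop W) = 0" "lab (word_loop W) k = fst (W ! k)"
  by (simp_all add: word_loop_def Let_def)

lemma triples_word_loop:
  "triples (word_loop W) = {if snd (W ! k) then (k, fst (W ! k), loop_pos W (Suc k))
    else (loop_pos W (Suc k), fst (W ! k), k) | k. k < length W}"
  by (auto simp: triples_def word_loop_def Let_def)

lemma reads_word_loop:
  "j \<le> k \<Longrightarrow> k \<le> length W \<Longrightarrow>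
    reads (triples (word_loop W)) (loop_pos W j) (take (k - j) (drop j W)) (loop_pos W k)"
proof (induction "k - j" arbitrary: j)
  case (Suc d)
  then have j: "j < length W" "j < k" by auto
  have "take (k - j) (drop j W) = W ! j # take (k - Suc j) (drop (Suc j) W)"
    using j by (metis Cons_nth_drop_Suc Suc_diff_Suc take_Suc_Cons)
  moreover have "(if snd (W ! j) then (loop_pos W j, fst (W ! j), loop_pos W (Suc j))
      else (loop_pos W (Suc j), fst (W ! j), loop_pos W j)) \<in> triples (word_loop W)"
    using j unfolding triples_word_loop by auto
  moreover have "reads (triples (word_loop W)) (loop_pos W (Suc j))
      (take (k - Suc j) (drop (Suc j) W)) (loop_pos W k)"
    using Suc j by (intro Suc(1)) auto
  ultimately show ?case by (simp only:) (rule reads_ConsI)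
qed auto

lemma wf_word_loop: "wf_graph (word_loop W)"
  by (auto simp: wf_graph_def triples_word_loop)

lemma connected_word_loop: "connected_graph (word_loop W)"
  unfolding connected_graph_def
proof
  fix z assume "z \<in> verts (word_loop W)"
  then have "z \<le> length W" "loop_pos W z = z" by auto
  then have "reads (triples (word_loop W)) 0 (take z W) z"
    using reads_word_loop[of 0 z W] by (auto split: if_splits)
  then show "\<exists>U. reads (triples (word_loop W)) (base (word_loop W)) U z" by auto
qed

text \<open>Places an edge of the loop between a prefix and a suffix of the word. In a folded image,
  determinism then computes the ends of the edge from what these two words read.\<close>

lemma word_loop_triple:
  assumes "t \<in> triples (word_loop W)"
  obtains U l V x y where "W = U @ l # V" "reads (triples (word_loop W)) 0 U x"
    "t = (if snd l then (x, fst l, y) else (y, fst l, x))" "reads (triples (word_loop W)) y V 0"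
proof -
  from assms obtain k where k: "k < length W" "t = (if snd (W ! k) then (k, fst (W ! k), loop_pos W (Suc k))
    else (loop_pos W (Suc k), fst (W ! k), k))" by (auto simp: triples_word_loop)
  show ?thesis
  proof (rule that[of "take k W" "W ! k" "drop (Suc k) W" k "loop_pos W (Suc k)"])
    show "W = take k W @ W ! k # drop (Suc k) W" using k(1) by (rule id_take_nth_drop)
    show "reads (triples (word_loop W)) 0 (take k W) k"
      using reads_word_loop[of 0 k W] k(1) by (auto split: if_splits)
    show "reads (triples (word_loop W)) (loop_pos W (Suc k)) (drop (Suc k) W) 0"
      using reads_word_loop[of "Suc k" "length W" W] k(1) by simp
  qed (fact k(2))
qed

subsection \<open>Potentials\<close>

text \<open>A potential assigns to each vertex a representative of the coset of \<open>H\<close> that is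
  reached by the paths from the base point to this vertex.\<close>

definition potential :: "('k, 'm) monoid_scheme \<Rightarrow> ('x \<Rightarrow> 'k) \<Rightarrow> 'k set \<Rightarrow> ('a, 'b, 'x) lgraph \<Rightarrow>
    ('a \<Rightarrow> 'k) \<Rightarrow> bool" where
  "potential G f H \<Gamma> p \<longleftrightarrow> (\<forall>z \<in> verts \<Gamma>. p z \<in> carrier G) \<and> p (base \<Gamma>) \<in> H \<and>
    (\<forall>(x, l, y) \<in> triples \<Gamma>. f l \<in> carrier G \<and> p x \<otimes>\<^bsub>G\<^esub> f l \<otimes>\<^bsub>G\<^esub> inv\<^bsub>G\<^esub> (p y) \<in> H)"

lemma potentialD:
  assumes "potential G f H \<Gamma> p"
  shows "\<And>z. z \<in> verts \<Gamma> \<Longrightarrow> p z \<in> carrier G" "p (base \<Gamma>) \<in> H"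
    "\<And>x l y. (x, l, y) \<in> triples \<Gamma> \<Longrightarrow> f l \<in> carrier G"
    "\<And>x l y. (x, l, y) \<in> triples \<Gamma> \<Longrightarrow> p x \<otimes>\<^bsub>G\<^esub> f l \<otimes>\<^bsub>G\<^esub> inv\<^bsub>G\<^esub> (p y) \<in> H"
  using assms unfolding potential_def by blast+

text \<open>Two edges that may be folded share the label and one end, so the values of
  \<open>p\<close> at their other ends lie in the same right coset of \<open>H\<close>. Replacing
  one of these values by the other keeps all the edge conditions, and the same \<open>p\<close>
  serves for the folded graph.\<close>

lemma potential_identify:
  fixes G (structure)
  assumes G: "group G" and H: "subgroup H G" and wf: "wf_graph \<Gamma>" and p: "potential G f H \<Gamma> p"
    and fg: "f' \<in> arcs \<Gamma>" "g \<in> arcs \<Gamma>" "f' \<noteq> g" "lab \<Gamma> f' = lab \<Gamma> g"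
    "(tail \<Gamma> f' = tail \<Gamma> g \<and> a = head \<Gamma> f' \<and> b = head \<Gamma> g) \<or>
     (head \<Gamma> f' = head \<Gamma> g \<and> a = tail \<Gamma> f' \<and> b = tail \<Gamma> g)"
  shows "potential G f H (identify g a b \<Gamma>) p"
proof -
  interpret group G by fact
  interpret H: subgroup H G by fact
  let ?\<sigma> = "\<lambda>z. if z = b then a else z"
  have q: "quotient_map ?\<sigma> \<Gamma> (identify g a b \<Gamma>)"
    by (rule identify_quotient[OF wf fg])
  note P = potentialD[OF p]
  have t: "(tail \<Gamma> k, lab \<Gamma> k, head \<Gamma> k) \<in> triples \<Gamma>" if "k \<in> arcs \<Gamma>" for k
    using that by (auto simp: triples_def)
  have ends: "tail \<Gamma> k \<in> verts \<Gamma>" "head \<Gamma> k \<in> verts \<Gamma>" if "k \<in> arcs \<Gamma>" for k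
    using wf t[OF that] by (auto simp: wf_graph_def)
  have ab: "a \<in> verts \<Gamma>" "b \<in> verts \<Gamma>" using fg ends by auto
  have c: "p (tail \<Gamma> k) \<in> carrier G" "p (head \<Gamma> k) \<in> carrier G" "f (lab \<Gamma> k) \<in> carrier G" if "k \<in> arcs \<Gamma>" for k
    using P ends[OF that] t[OF that] by blast+
  have ab_H: "p a \<otimes> inv (p b) \<in> H"
    using fg(5)
  proof
    assume e: "tail \<Gamma> f' = tail \<Gamma> g \<and> a = head \<Gamma> f' \<and> b = head \<Gamma> g"
    let ?q = "p (tail \<Gamma> g)" and ?l = "f (lab \<Gamma> g)"
    have "?q \<otimes> ?l \<otimes> inv (p a) \<in> H" "?q \<otimes> ?l \<otimes> inv (p b) \<in> H"
      using P(4)[OF t[OF fg(1)]] P(4)[OF t[OF fg(2)]] e fg(4) by simp_all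
    then have "inv (?q \<otimes> ?l \<otimes> inv (p a)) \<otimes> (?q \<otimes> ?l \<otimes> inv (p b)) \<in> H"
      by (rule H.m_closed[OF H.m_inv_closed])
    moreover have "inv (?q \<otimes> ?l \<otimes> inv (p a)) \<otimes> (?q \<otimes> ?l \<otimes> inv (p b)) = p a \<otimes> inv (p b)"
      using c[OF fg(1)] c[OF fg(2)] e by (simp add: inv_mult_group m_assoc) (simp flip: m_assoc)
    ultimately show ?thesis by simp
  next
    assume e: "head \<Gamma> f' = head \<Gamma> g \<and> a = tail \<Gamma> f' \<and> b = tail \<Gamma> g"
    let ?q = "p (head \<Gamma> g)" and ?l = "f (lab \<Gamma> g)"
    have "p a \<otimes> ?l \<otimes> inv ?q \<in> H" "p b \<otimes> ?l \<otimes> inv ?q \<in> H"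
      using P(4)[OF t[OF fg(1)]] P(4)[OF t[OF fg(2)]] e fg(4) by simp_all
    then have "(p a \<otimes> ?l \<otimes> inv ?q) \<otimes> inv (p b \<otimes> ?l \<otimes> inv ?q) \<in> H"
      using H.m_closed H.m_inv_closed by blast
    moreover have "(p a \<otimes> ?l \<otimes> inv ?q) \<otimes> inv (p b \<otimes> ?l \<otimes> inv ?q) = p a \<otimes> inv (p b)"
      using c[OF fg(1)] c[OF fg(2)] e by (simp add: inv_mult_group m_assoc) (simp flip: m_assoc)
    ultimately show ?thesis by simp
  qed
  have \<sigma>_H: "p (?\<sigma> z) \<otimes> inv (p z) \<in> H" if "z \<in> verts \<Gamma>" for z
    using ab_H P(1)[OF that] H.one_closed by simp
  have \<sigma>_c: "p (?\<sigma> z) \<in> carrier G" if "z \<in> verts \<Gamma>" for z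
    using that ab P(1) by simp
  have base: "base \<Gamma> \<in> verts \<Gamma>" using wf by (simp add: wf_graph_def)
  have "p (?\<sigma> (base \<Gamma>)) = p (?\<sigma> (base \<Gamma>)) \<otimes> inv (p (base \<Gamma>)) \<otimes> p (base \<Gamma>)"
    using \<sigma>_c[OF base] P(1)[OF base] by (simp add: m_assoc)
  then have 1: "p (?\<sigma> (base \<Gamma>)) \<in> H"
    using \<sigma>_H[OF base] P(2) by (metis H.m_closed)
  have 2: "p (?\<sigma> x) \<otimes> f l \<otimes> inv (p (?\<sigma> y)) \<in> H" if xly: "(x, l, y) \<in> triples \<Gamma>" for x l y
  proof -
    have xy: "x \<in> verts \<Gamma>" "y \<in> verts \<Gamma>" using wf xly by (auto simp: wf_graph_def)
    note c = P(1)[OF xy(1)] P(1)[OF xy(2)] \<sigma>_c[OF xy(1)] \<sigma>_c[OF xy(2)] P(3)[OF xly]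
    let ?A = "p (?\<sigma> x)" and ?B = "p (?\<sigma> y)"
    have "(?A \<otimes> inv (p x)) \<otimes> ((p x \<otimes> f l \<otimes> inv (p y)) \<otimes> inv (?B \<otimes> inv (p y))) \<in> H"
      by (rule H.m_closed[OF \<sigma>_H[OF xy(1)] H.m_closed[OF P(4)[OF xly] H.m_inv_closed[OF \<sigma>_H[OF xy(2)]]]])
    moreover have "(a' \<otimes> inv x') \<otimes> ((x' \<otimes> l' \<otimes> inv y') \<otimes> inv (b' \<otimes> inv y')) = a' \<otimes> l' \<otimes> inv b'"
      if "a' \<in> carrier G" "b' \<in> carrier G" "x' \<in> carrier G" "y' \<in> carrier G" "l' \<in> carrier G" for a' b' x' y' l'
    proof -
      have "inv y' \<otimes> (y' \<otimes> inv b') = inv b'"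
        "inv x' \<otimes> (x' \<otimes> (l' \<otimes> inv b')) = l' \<otimes> inv b'"
        using that by (simp_all flip: m_assoc)
      then show ?thesis using that by (simp add: inv_mult_group m_assoc)
    qed
    from this[OF c(3,4,1,2,5)]
    have "(?A \<otimes> inv (p x)) \<otimes> ((p x \<otimes> f l \<otimes> inv (p y)) \<otimes> inv (?B \<otimes> inv (p y))) =
        ?A \<otimes> f l \<otimes> inv ?B" .
    ultimately show ?thesis by simp
  qed
  show ?thesis
    unfolding potential_def
  proof (intro conjI ballI)
    show "p (base (identify g a b \<Gamma>)) \<in> H" using 1 q by (simp add: quotient_map_def)
    show "p z \<in> carrier G" if "z \<in> verts (identify g a b \<Gamma>)" for z
    proof -
      from that q have "z \<in> ?\<sigma> ` verts \<Gamma>" by (simp add: quotient_map_def)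
      then show ?thesis using \<sigma>_c by (elim imageE) (simp only:)
    qed
    fix t assume "t \<in> triples (identify g a b \<Gamma>)"
    then obtain x l y where "(x, l, y) \<in> triples \<Gamma>" "t = (?\<sigma> x, l, ?\<sigma> y)"
      using q by (auto simp: quotient_map_def)
    then show "case t of (x, l, y) \<Rightarrow> f l \<in> carrier G \<and> p x \<otimes> f l \<otimes> inv (p y) \<in> H"
      using 2 P(3) by (simp del: if_split)
  qed
qed

lemma potential_folds:
  assumes "group G" "subgroup H G" "wf_graph \<Gamma>" "potential G f H \<Gamma> p" "fold_step\<^sup>*\<^sup>* \<Gamma> \<Delta>"
  shows "potential G f H \<Delta> p"
  using assms(5)
proof induction
  case (step \<Delta> \<Delta>')
  have wf: "wf_graph \<Delta>" using folds_quotient[OF step(1) assms(3)] quotient_map_wf assms(3) by blast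
  from step(2) show ?case
  proof cases
    case (fold_out f' g)
    then show ?thesis
      using potential_identify[OF assms(1,2) wf step(3), of f' g "head \<Delta> f'" "head \<Delta> g"] by blast
  next
    case (fold_in f' g)
    then show ?thesis
      using potential_identify[OF assms(1,2) wf step(3), of f' g "tail \<Delta> f'" "tail \<Delta> g"] by blast
  qed
qed (fact assms(4))

text \<open>A vertex of the copy \<open>D i\<close> gets the value at the attaching point times a
  value relative to the base of the copy; the normalisation \<open>q_base\<close> makes both
  prescriptions agree where the graphs meet.\<close>

lemma potential_attach:
  fixes G (structure)
  assumes G: "group G" and H: "subgroup H G" and p: "potential G f H \<Gamma> p"
    and P: "\<And>i. i \<in> I \<Longrightarrow> P i \<in> verts \<Gamma>"
    and q: "\<And>i z. i \<in> I \<Longrightarrow> z \<in> verts (D i) \<Longrightarrow> q i z \<in> carrier G"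
    and q_base: "\<And>i. i \<in> I \<Longrightarrow> q i (base (D i)) = \<one>"
    and wf: "\<And>i. i \<in> I \<Longrightarrow> wf_graph (D i)"
    and t: "\<And>i x l y. i \<in> I \<Longrightarrow> (x, l, y) \<in> triples (D i) \<Longrightarrow>
      f l \<in> carrier G \<and> p (P i) \<otimes> (q i x \<otimes> f l \<otimes> inv (q i y)) \<otimes> inv (p (P i)) \<in> H"
  shows "potential G f H (attach \<Gamma> I P D) (case_sum p (\<lambda>(i, c). p (P i) \<otimes> q i c))"
proof -
  interpret group G by fact
  let ?p = "case_sum p (\<lambda>(i, c). p (P i) \<otimes> q i c)"
  note Pp = potentialD[OF p]
  have emb: "?p (attach_emb P D i c) = p (P i) \<otimes> q i c" if "i \<in> I" for i c
    using q_base[OF that] Pp(1)[OF P[OF that]] by (simp add: attach_emb_def)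
  show ?thesis
    unfolding potential_def
  proof (intro conjI ballI)
    show "?p z \<in> carrier G" if "z \<in> verts (attach \<Gamma> I P D)" for z
      using that Pp(1) P q by (auto simp: verts_attach emb)
    show "?p (base (attach \<Gamma> I P D)) \<in> H" using Pp(2) by simp
    fix w assume "w \<in> triples (attach \<Gamma> I P D)"
    then consider x l y where "(x, l, y) \<in> triples \<Gamma>" "w = (Inl x, l, Inl y)"
      | i x l y where "i \<in> I" "(x, l, y) \<in> triples (D i)"
        "w = (attach_emb P D i x, l, attach_emb P D i y)"
      by (auto simp: triples_attach)
    then show "case w of (x, l, y) \<Rightarrow> f l \<in> carrier G \<and> ?p x \<otimes> f l \<otimes> inv (?p y) \<in> H"
    proof cases
      case 1
      then show ?thesis using Pp(3,4) by simp
    next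
      case 2
      have "x \<in> verts (D i)" "y \<in> verts (D i)" using wf[OF 2(1)] 2(2) by (auto simp: wf_graph_def)
      then have c: "q i x \<in> carrier G" "q i y \<in> carrier G" "p (P i) \<in> carrier G" "f l \<in> carrier G"
        using q[OF 2(1)] Pp(1)[OF P[OF 2(1)]] t[OF 2(1,2)] by blast+
      then have "p (P i) \<otimes> (q i x \<otimes> f l \<otimes> inv (q i y)) \<otimes> inv (p (P i)) =
          (p (P i) \<otimes> q i x) \<otimes> f l \<otimes> inv (p (P i) \<otimes> q i y)"
        by (simp add: inv_mult_group m_assoc)
      then show ?thesis using t[OF 2(1,2)] 2(3) by (simp add: emb[OF 2(1)])
    qed
  qed
qed

text \<open>The edge conditions telescope along a path.\<close>

lemma potential_reads:
  fixes G (structure)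
  assumes G: "group G" and H: "subgroup H G" and wf: "wf_graph \<Gamma>" and p: "potential G f H \<Gamma> p"
    and "reads (triples \<Gamma>) x W y" "x \<in> verts \<Gamma>"
  shows "word_val G f W \<in> carrier G \<and> p x \<otimes> word_val G f W \<otimes> inv (p y) \<in> H"
  using assms(5,6)
proof (induction W arbitrary: x)
  interpret group G by fact
  interpret H: subgroup H G by fact
  note P = potentialD[OF p]
  case Nil
  then show ?case using P(1) H.one_closed by simp
next
  interpret group G by fact
  interpret H: subgroup H G by fact
  note P = potentialD[OF p]
  case (Cons l W)
  then obtain z where z: "(if snd l then (x, fst l, z) else (z, fst l, x)) \<in> triples \<Gamma>"
    "reads (triples \<Gamma>) z W y" by auto
  have zv: "z \<in> verts \<Gamma>" using z(1) wf by (cases "snd l") (auto simp: wf_graph_def)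
  have yv: "y \<in> verts \<Gamma>" by (rule reads_verts[OF wf z(2) zv])
  let ?a = "if snd l then f (fst l) else inv (f (fst l))"
  have f: "f (fst l) \<in> carrier G" using z(1) P(3) by (cases "snd l") auto
  note c = P(1)[OF zv] P(1)[OF yv] P(1)[OF Cons(3)]
  have IH: "word_val G f W \<in> carrier G" "p z \<otimes> word_val G f W \<otimes> inv (p y) \<in> H"
    using Cons(1)[OF z(2) zv] by blast+
  have "p x \<otimes> ?a \<otimes> inv (p z) \<in> H"
  proof (cases "snd l")
    case True
    then show ?thesis using P(4) z(1) by simp
  next
    case False
    then have "inv (p z \<otimes> f (fst l) \<otimes> inv (p x)) \<in> H" using P(4) z(1) by (intro H.m_inv_closed) simp
    moreover have "inv (p z \<otimes> f (fst l) \<otimes> inv (p x)) = p x \<otimes> inv (f (fst l)) \<otimes> inv (p z)"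
      using c f by (simp add: inv_mult_group m_assoc)
    ultimately show ?thesis using False by simp
  qed
  from H.m_closed[OF this IH(2)]
  have "(p x \<otimes> ?a \<otimes> inv (p z)) \<otimes> (p z \<otimes> word_val G f W \<otimes> inv (p y)) \<in> H" .
  moreover have "(p x \<otimes> ?a \<otimes> inv (p z)) \<otimes> (p z \<otimes> word_val G f W \<otimes> inv (p y)) =
      p x \<otimes> (?a \<otimes> word_val G f W) \<otimes> inv (p y)"
  proof -
    have "inv (p z) \<otimes> (p z \<otimes> (word_val G f W \<otimes> inv (p y))) = word_val G f W \<otimes> inv (p y)"
      using c IH(1) by (simp flip: m_assoc)
    then show ?thesis using c f IH(1) by (simp add: m_assoc)
  qed
  moreover have "word_val G f (l # W) = ?a \<otimes> word_val G f W" by (cases l) simp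
  ultimately show ?case using f IH(1) by simp
qed

lemma take_words: "W \<in> words X \<Longrightarrow> take k W \<in> words X"
  by (metis append_in_lists_conv append_take_drop_id)

text \<open>Evaluating prefixes gives a potential along the word: every edge contributes the neutral
  element except the one that closes the loop, which contributes the value of \<open>W\<close> or
  its inverse.\<close>

lemma potential_word_loop:
  fixes G (structure)
  assumes G: "group G" and f: "\<And>x. x \<in> X \<Longrightarrow> f x \<in> carrier G" and W: "W \<in> words X"
    and xly: "(x, l, y) \<in> triples (word_loop W)"
  defines "q \<equiv> \<lambda>k. word_val G f (take k W)"
  shows "f l \<in> carrier G" "q x \<otimes> f l \<otimes> inv (q y) \<in> {\<one>, word_val G f W, inv (word_val G f W)}"
proof -
  interpret group G by fact
  from xly obtain k where "k < length W" "(x, l, y) = (if snd (W ! k)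
      then (k, fst (W ! k), loop_pos W (Suc k)) else (loop_pos W (Suc k), fst (W ! k), k))"
    unfolding triples_word_loop by blast
  then have k: "k < length W" "l = fst (W ! k)"
    "(x, y) = (if snd (W ! k) then (k, loop_pos W (Suc k)) else (loop_pos W (Suc k), k))"
    by (simp_all split: if_splits)
  have Wk: "W ! k \<in> X \<times> UNIV" using W k(1) by (auto simp: in_lists_conv_set)
  then show fl: "f l \<in> carrier G" using f k(2) by (auto simp: mem_Times_iff)
  note take_W = take_words[OF W]
  have c: "q j \<in> carrier G" for j unfolding q_def by (rule word_val_closed[OF f take_W])
  let ?a = "if snd (W ! k) then f l else inv (f l)"
  have qS: "q (Suc k) = q k \<otimes> ?a"
    unfolding q_def take_Suc_conv_app_nth[OF k(1)]
    using word_val_append[of X f "take k W" "[W ! k]", OF f take_W] Wk k(2) fl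
    by (cases "W ! k") simp
  have q0: "q 0 = \<one>" and qn: "q (length W) = word_val G f W" by (simp_all add: q_def)
  show "q x \<otimes> f l \<otimes> inv (q y) \<in> {\<one>, word_val G f W, inv (word_val G f W)}"
  proof (cases "snd (W ! k)")
    case True
    then have "q x \<otimes> f l = q (Suc k)" using k(3) qS by simp
    then show ?thesis using k(3) True c[of "Suc k"] q0 qn by auto
  next
    case False
    then have "f l \<otimes> inv (q k) = inv (q (Suc k))"
      using qS c[of k] fl by (simp add: inv_mult_group)
    then have "q x \<otimes> f l \<otimes> inv (q y) = q x \<otimes> inv (q (Suc k))"
      using k(3) False c fl by (simp add: m_assoc)
    then show ?thesis using k(3) False c[of "Suc k"] q0 qn by auto
  qed
qed

subsection \<open>The structure of the folded graph\<close>

context finite_gog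
begin

lemma triples_cayley:
  "triples (cayley_graph \<A> u) =
    {(g, Gen s, g \<otimes>\<^bsub>vgrp \<A> u\<^esub> gval \<A> s) | g s. g \<in> carrier (vgrp \<A> u) \<and> s \<in> gset u}"
  by (auto simp: triples_def cayley_graph_def image_iff)

lemma verts_cayley [simp]: "verts (cayley_graph \<A> u) = carrier (vgrp \<A> u)"
  and base_cayley [simp]: "base (cayley_graph \<A> u) = \<one>\<^bsub>vgrp \<A> u\<^esub>"
  by (simp_all add: cayley_graph_def)

lemma wf_cayley: "u \<in> \<V> \<Longrightarrow> wf_graph (cayley_graph \<A> u)"
  using vertex_group by (auto simp: wf_graph_def triples_cayley group.is_monoid monoid.m_closed)

lemma reads_cayley:
  assumes u: "u \<in> \<V>" and "g \<in> carrier (vgrp \<A> u)" "W \<in> words (gset u)"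
  shows "reads (triples (cayley_graph \<A> u)) g (gen_word W) (g \<otimes>\<^bsub>vgrp \<A> u\<^esub> val u W)"
  using assms(2,3)
proof (induction W arbitrary: g)
  interpret group "vgrp \<A> u" by (rule vertex_group[OF u])
  case Nil
  then show ?case by simp
next
  interpret group "vgrp \<A> u" by (rule vertex_group[OF u])
  case (Cons l W)
  obtain s b where l: "l = (s, b)" by (cases l)
  have s: "s \<in> gset u" and W: "W \<in> words (gset u)" using Cons l by auto
  note c = gval_in[OF u s] val_in[OF u W] Cons(2)
  let ?g = "g \<otimes>\<^bsub>vgrp \<A> u\<^esub> (if b then gval \<A> s else inv\<^bsub>vgrp \<A> u\<^esub> (gval \<A> s))"
  have step: "(if snd (Gen s, b) then (g, fst (Gen s, b), ?g) else (?g, fst (Gen s, b), g))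
      \<in> triples (cayley_graph \<A> u)"
    using c s by (cases b) (force simp: triples_cayley m_assoc)+
  have IH: "reads (triples (cayley_graph \<A> u)) ?g (gen_word W) (?g \<otimes>\<^bsub>vgrp \<A> u\<^esub> val u W)"
    using Cons(1)[of ?g] c W by simp
  have g: "?g \<otimes>\<^bsub>vgrp \<A> u\<^esub> val u W = g \<otimes>\<^bsub>vgrp \<A> u\<^esub> val u (l # W)" using c l by (simp add: m_assoc)
  have "reads (triples (cayley_graph \<A> u)) g ((Gen s, b) # gen_word W) (?g \<otimes>\<^bsub>vgrp \<A> u\<^esub> val u W)"
    by (rule reads_ConsI[OF step IH])
  then show ?case unfolding g using l by simp
qed

lemma connected_cayley: "u \<in> \<V> \<Longrightarrow> connected_graph (cayley_graph \<A> u)"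
  unfolding connected_graph_def
proof
  fix g assume u: "u \<in> \<V>" and "g \<in> verts (cayley_graph \<A> u)"
  interpret group "vgrp \<A> u" by (rule vertex_group[OF u])
  obtain W where W: "W \<in> words (gset u)" "val u W = g"
    using val_surj[OF u] \<open>g \<in> verts (cayley_graph \<A> u)\<close> by auto
  have "reads (triples (cayley_graph \<A> u)) (base (cayley_graph \<A> u)) (gen_word W) g"
    using reads_cayley[OF u one_closed W(1)] val_in[OF u W(1)] W(2) by simp
  then show "\<exists>W. reads (triples (cayley_graph \<A> u)) (base (cayley_graph \<A> u)) W g" by blast
qed

lemma gen_word_split:
  assumes "gen_word P = U @ l # V"
  shows "\<exists>P1 m P2. P = P1 @ m # P2 \<and> U = gen_word P1 \<and> V = gen_word P2 \<and> l = (Gen (fst m), snd m)"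
proof -
  from assms obtain P1 P' where P: "P = P1 @ P'" "U = gen_word P1" "l # V = gen_word P'"
    unfolding gen_word_def map_eq_append_conv by metis
  then obtain m P2 where "P' = m # P2" by (cases P') auto
  then show ?thesis using P by auto
qed

lemma vtypes_iff:
  "u \<in> vtypes \<A> v \<Gamma> z \<longleftrightarrow> u \<in> \<V> \<and> ((z = base \<Gamma> \<and> u = v) \<or>
    (\<exists>x s y. (x, Gen s, y) \<in> triples \<Gamma> \<and> (x = z \<or> y = z) \<and> s \<in> gset u) \<or>
    (\<exists>x e y. (x, Edge e, y) \<in> triples \<Gamma> \<and> e \<in> \<E> \<and> ((x = z \<and> u = src e) \<or> (y = z \<and> u = tgt e))))"
  unfolding vtypes_def triples_def gen_letters_def
  by (auto simp: image_iff) (metis, metis, (metis)+)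

lemma vtypes_map:
  assumes "u \<in> vtypes \<A> v \<Gamma> z" "base \<Delta> = \<pi> (base \<Gamma>)"
    "\<And>x l y. (x, l, y) \<in> triples \<Gamma> \<Longrightarrow> (\<pi> x, l, \<pi> y) \<in> triples \<Delta>"
  shows "u \<in> vtypes \<A> v \<Delta> (\<pi> z)"
  using assms(1) unfolding vtypes_iff
proof (elim conjE disjE exE, goal_cases)
  case 1
  then show ?case using assms(2) by simp
next
  case (2 x s y)
  then show ?case using assms(3)[OF 2(2)] by blast
next
  case (3 x s y)
  then show ?case using assms(3)[OF 3(2)] by blast
next
  case (4 x e y)
  then show ?case using assms(3)[OF 4(2)] by blast
next
  case (5 x e y)
  then show ?case using assms(3)[OF 5(2)] by blast
qed

end

section \<open>The graphs produced by the folding algorithm\<close>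

locale folded_gog = finite_gog \<A>
  for \<A> :: "('v, 'e, 'g, 'h, 's) presented_graph_of_groups" +
  fixes v :: 'v and Ws :: "('e, 's) letter word list" and \<Gamma>
  assumes v_in: "v \<in> \<V>" and input: "Ws \<in> input_tuples \<A> v"
    and folding: "folding_result \<A> v Ws \<Gamma>"
begin

abbreviation "A0 \<equiv> bouquet Ws"
abbreviation "A1 \<equiv> vertex_saturation \<A> v A0"
abbreviation "A2 \<equiv> edge_saturation \<A> A1"
abbreviation "T \<equiv> triples \<Gamma>"
abbreviation "H \<equiv> generate (Bass \<A>) (ev \<A> ` set Ws)"
abbreviation "point \<equiv> \<lparr>verts = {()}, arcs = {}, tail = (\<lambda>_. ()), head = (\<lambda>_. ()),
  lab = (\<lambda>_. undefined), base = ()\<rparr>"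
abbreviation "I1 \<equiv> SIGMA z:verts A0. vtypes \<A> v A0 z"
abbreviation "emb1 \<equiv> attach_emb (\<lambda>(z, u). z) (\<lambda>(z, u). cayley_graph \<A> u)"
abbreviation "emb2 \<equiv> attach_emb (\<lambda>(f, e, h). tail A1 f) (\<lambda>(f, e, h). word_loop (edge_relator \<A> e h))"
abbreviation "I2 \<equiv> {(f, e, h). f \<in> arcs A1 \<and> e \<in> \<E> \<and> lab A1 f = Edge e \<and> h \<in> carrier (egrp \<A> e)}"

lemma input_words: "W \<in> set Ws \<Longrightarrow> W \<in> words \<X>"
  using input by (auto simp: input_tuples_def)

lemma wf_point: "wf_graph point" and connected_point: "connected_graph point"
proof -
  show "wf_graph point" by (simp add: wf_graph_def triples_def)
  have "reads (triples point) () [] ()" by simp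
  then show "connected_graph point" unfolding connected_graph_def by (metis (full_types) old.unit.exhaust)
qed

lemma wf_A0: "wf_graph A0" and connected_A0: "connected_graph A0"
  unfolding bouquet_def
  by (intro wf_attach wf_point wf_word_loop)
    (intro connected_attach connected_point connected_word_loop, simp)

lemma vtypes_\<V>: "u \<in> vtypes \<A> v \<Delta> z \<Longrightarrow> u \<in> \<V>"
  by (simp add: vtypes_def)

lemma wf_A1: "wf_graph A1" and connected_A1: "connected_graph A1"
  unfolding vertex_saturation_def
  by (auto intro!: wf_attach wf_A0 wf_cayley connected_attach connected_A0 connected_cayley dest: vtypes_\<V>)

lemma wf_A2: "wf_graph A2" and connected_A2: "connected_graph A2"
proof -
  have "tail A1 f \<in> verts A1" if "f \<in> arcs A1" for f
    using wf_A1 that by (force simp: wf_graph_def triples_def)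
  then show "wf_graph A2" "connected_graph A2"
    unfolding edge_saturation_def
    by (auto intro!: wf_attach wf_A1 wf_word_loop connected_attach connected_A1 connected_word_loop)
qed

definition \<pi> where "\<pi> = (SOME \<pi>. quotient_map \<pi> A2 \<Gamma>)"

lemma quotient_\<pi>: "quotient_map \<pi> A2 \<Gamma>"
  unfolding \<pi>_def using folds_quotient[of A2 \<Gamma>] folding wf_A2
  by (intro someI_ex[of "\<lambda>\<pi>. quotient_map \<pi> A2 \<Gamma>"]) (simp add: folding_result_def)

lemma deterministic_T: "deterministic T"
  and arcs_inj: "inj_on (\<lambda>f. (tail \<Gamma> f, lab \<Gamma> f, head \<Gamma> f)) (arcs \<Gamma>)"
  using folding by (auto simp: folding_result_def intro!: no_fold_deterministic)

lemmas T_det = deterministic_reads[OF deterministic_T]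

lemma wf_\<Gamma>: "wf_graph \<Gamma>" and connected_\<Gamma>: "connected_graph \<Gamma>"
  using quotient_map_wf[OF quotient_\<pi> wf_A2] quotient_map_connected[OF quotient_\<pi> connected_A2] .

lemma base_in [simp]: "base \<Gamma> \<in> verts \<Gamma>"
  using wf_\<Gamma> by (simp add: wf_graph_def)

text \<open>Coordinates on the folded graph: \<open>\<pi>0 x\<close> is the image of a vertex of the
  bouquet, and \<open>\<gamma> (x, u) g\<close> that of the element \<open>g\<close> in the Cayley
  graph attached at \<open>x\<close> for the type \<open>u\<close>.\<close>

definition \<pi>0 where "\<pi>0 x = \<pi> (Inl (Inl x))"
definition \<gamma> where "\<gamma> i g = \<pi> (Inl (emb1 i g))"

lemma base_A0 [simp]: "base \<Gamma> = \<pi>0 (base A0)"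
  using quotient_\<pi> by (simp add: quotient_map_def \<pi>0_def edge_saturation_def vertex_saturation_def)

lemma triples_A1:
  "triples A1 = map_triple Inl ` triples A0 \<union>
    (\<Union>i \<in> I1. map_triple (emb1 i) ` triples (cayley_graph \<A> (snd i)))"
  unfolding vertex_saturation_def triples_attach by (simp add: split_beta)

lemma A2_T: "(x, l, y) \<in> triples A2 \<Longrightarrow> (\<pi> x, l, \<pi> y) \<in> T"
  using quotient_\<pi> by (force simp: quotient_map_def)

lemma A1_T: "(x, l, y) \<in> triples A1 \<Longrightarrow> (\<pi> (Inl x), l, \<pi> (Inl y)) \<in> T"
  by (rule A2_T) (force simp: edge_saturation_def triples_attach)

lemma A0_T: "(x, l, y) \<in> triples A0 \<Longrightarrow> (\<pi>0 x, l, \<pi>0 y) \<in> T"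
  unfolding \<pi>0_def by (rule A1_T) (force simp: triples_A1)

lemma reads_A0: "reads (triples A0) x W y \<Longrightarrow> reads T (\<pi>0 x) W (\<pi>0 y)"
  by (erule reads_map) (rule A0_T)

lemma cayley_T:
  "i \<in> I1 \<Longrightarrow> (x, l, y) \<in> triples (cayley_graph \<A> (snd i)) \<Longrightarrow> (\<gamma> i x, l, \<gamma> i y) \<in> T"
  unfolding \<gamma>_def by (rule A1_T) (force simp: triples_A1)

lemma reads_\<gamma>:
  assumes "(x, u) \<in> I1" "g \<in> carrier (vgrp \<A> u)" "W \<in> words (gset u)"
  shows "reads T (\<gamma> (x, u) g) (gen_word W) (\<gamma> (x, u) (g \<otimes>\<^bsub>vgrp \<A> u\<^esub> val u W))"
proof -
  have "u \<in> \<V>" using assms(1) vtypes_\<V> by auto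
  from reads_map[where \<pi> = "\<gamma> (x, u)" and T' = T, OF reads_cayley[OF this assms(2,3)]] show ?thesis
    using cayley_T[OF assms(1)] by simp
qed

lemma \<gamma>_one: "\<gamma> (x, u) \<one>\<^bsub>vgrp \<A> u\<^esub> = \<pi>0 x"
  by (simp add: \<gamma>_def \<pi>0_def attach_emb_def)

lemma reads_\<gamma>_one:
  assumes "(x, u) \<in> I1" "W \<in> words (gset u)"
  shows "reads T (\<pi>0 x) (gen_word W) (\<gamma> (x, u) (val u W))"
proof -
  have u: "u \<in> \<V>" using assms(1) vtypes_\<V> by auto
  interpret group "vgrp \<A> u" by (rule vertex_group[OF u])
  show ?thesis using reads_\<gamma>[OF assms(1) one_closed assms(2)] val_in[OF u assms(2)] by (simp add: \<gamma>_one)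
qed

lemma I1_edge:
  assumes "(x, Edge e, y) \<in> triples A0" "e \<in> \<E>"
  shows "(x, src e) \<in> I1" "(y, tgt e) \<in> I1"
proof -
  have "src e \<in> vtypes \<A> v A0 x" "tgt e \<in> vtypes \<A> v A0 y"
    using assms unfolding vtypes_iff by (metis src_in, metis tgt_in)
  then show "(x, src e) \<in> I1" "(y, tgt e) \<in> I1"
    using wf_A0 assms(1) by (auto simp: wf_graph_def)
qed

lemma A1_edge:
  assumes "f \<in> arcs A1" "lab A1 f = Edge e"
  obtains x y where "tail A1 f = Inl x" "head A1 f = Inl y" "(x, Edge e, y) \<in> triples A0"
proof -
  have "(tail A1 f, Edge e, head A1 f) \<in> triples A1"
    using assms by (force simp: triples_def)
  then show ?thesis using that by (auto simp: triples_A1 triples_cayley)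
qed

lemma loop_T:
  assumes "(f, e, h) \<in> I2" "(a, l, b) \<in> triples (word_loop (edge_relator \<A> e h))"
  shows "(\<pi> (emb2 (f, e, h) a), l, \<pi> (emb2 (f, e, h) b)) \<in> T"
proof (rule A2_T)
  have "(emb2 (f, e, h) a, l, emb2 (f, e, h) b) \<in>
      map_triple (emb2 (f, e, h)) ` triples (word_loop (edge_relator \<A> e h))"
    using assms(2) by force
  then show "(emb2 (f, e, h) a, l, emb2 (f, e, h) b) \<in> triples A2"
    unfolding edge_saturation_def triples_attach by (intro UnI2 UN_I[OF assms(1)]) simp
qed

lemma edge_loop_T:
  assumes e: "(x, Edge e, y) \<in> triples A0" "e \<in> \<E>" and h: "h \<in> carrier (egrp \<A> e)"
  obtains q where "q 0 = \<pi>0 x"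
    "map_triple q ` triples (word_loop (edge_relator \<A> e h)) \<subseteq> T"
proof -
  from e(1) have "(Inl x, Edge e, Inl y) \<in> triples A1" by (force simp: triples_A1)
  then obtain f where f: "f \<in> arcs A1" "lab A1 f = Edge e" "tail A1 f = Inl x"
    by (auto simp: triples_def)
  show ?thesis
  proof (rule that[of "\<lambda>k. \<pi> (emb2 (f, e, h) k)"])
    show "\<pi> (emb2 (f, e, h) 0) = \<pi>0 x" using f(3) by (simp add: attach_emb_def \<pi>0_def)
    show "map_triple (\<lambda>k. \<pi> (emb2 (f, e, h) k)) ` triples (word_loop (edge_relator \<A> e h)) \<subseteq> T"
      using loop_T[of f e h] f(1,2) e(2) h by auto
  qed
qed

text \<open>This is what edge saturation achieves. When the relator loop for \<open>h\<close> is
  read in the folded graph, determinism fixes the vertices before and after its second edge letter: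
  they are the translates, by the two images of \<open>h\<close>, of the ends of the given
  edge.\<close>

lemma edge_\<gamma>_T:
  assumes e: "(x, Edge e, y) \<in> triples A0" "e \<in> \<E>" and h: "h \<in> carrier (egrp \<A> e)"
  shows "(\<gamma> (x, src e) (imap \<A> e h), Edge e, \<gamma> (y, tgt e) (tmap \<A> e h)) \<in> T"
proof -
  let ?r = "edge_relator \<A> e h"
  obtain q where q: "q 0 = \<pi>0 x" "map_triple q ` triples (word_loop ?r) \<subseteq> T"
    by (rule edge_loop_T[OF e h])
  have "reads (triples (word_loop ?r)) 0 ?r 0"
    using reads_word_loop[of 0 "length ?r" ?r] by (simp split: if_splits)
  then have "reads T (\<pi>0 x) ?r (\<pi>0 x)"
    using q(2) unfolding q(1)[symmetric] by (elim reads_map) auto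
  then obtain a b c where a: "reads T (\<pi>0 x) [(Edge e, True)] a"
    and b: "reads T a (gen_word (tword \<A> e h)) b" and c: "reads T b [(Edge e, False)] c"
    and d: "reads T c (word_inv (gen_word (iword \<A> e h))) (\<pi>0 x)"
    unfolding edge_relator_def reads_append by blast
  have "reads T (\<pi>0 x) [(Edge e, True)] (\<pi>0 y)" using A0_T[OF e(1)] by simp
  then have "a = \<pi>0 y" using a T_det by blast
  then have "b = \<gamma> (y, tgt e) (tmap \<A> e h)"
    using T_det[OF b] reads_\<gamma>_one[OF I1_edge(2)[OF e] tword_in[OF e(2) h]] e(2) h by simp
  moreover have "c = \<gamma> (x, src e) (imap \<A> e h)"
    using d T_det[of "\<pi>0 x" _ c] reads_\<gamma>_one[OF I1_edge(1)[OF e] iword_in[OF e(2) h]] e(2) h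
    unfolding reads_word_inv by simp
  ultimately show ?thesis using c by simp
qed

text \<open>Used to sort the edges of an attached relator loop; each alternative retains the prefix
  or the suffix from which the ends of the edge are computed.\<close>

lemma relator_split:
  assumes "e # gen_word P @ e' # gen_word Q = U @ l # V"
  shows "(U = [] \<and> l = e) \<or>
    (\<exists>P1 m P2. P = P1 @ m # P2 \<and> U = e # gen_word P1 \<and> l = (Gen (fst m), snd m)) \<or>
    (U = e # gen_word P \<and> l = e' \<and> V = gen_word Q) \<or>
    (\<exists>Q1 m Q2. Q = Q1 @ m # Q2 \<and> V = gen_word Q2 \<and> l = (Gen (fst m), snd m))"
proof (cases U)
  case Nil
  then show ?thesis using assms by simp
next
  case (Cons k U')
  have U: "U = e # U'" and eq: "gen_word P @ e' # gen_word Q = U' @ l # V" using assms Cons by auto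
  from eq consider us where "gen_word P = U' @ us" "us @ e' # gen_word Q = l # V"
    | us where "gen_word P @ us = U'" "e' # gen_word Q = us @ l # V"
    unfolding append_eq_append_conv2 by blast
  then show ?thesis
  proof cases
    case 1
    show ?thesis
    proof (cases us)
      case Nil
      then show ?thesis using 1 U by auto
    next
      case (Cons m us')
      then have "gen_word P = U' @ l # us'" using 1 by auto
      from gen_word_split[OF this] show ?thesis using U by blast
    qed
  next
    case 2
    show ?thesis
    proof (cases us)
      case Nil
      then show ?thesis using 2 U by auto
    next
      case (Cons m us')
      then have "gen_word Q = us' @ l # V" using 2 by auto
      from gen_word_split[OF this] show ?thesis by blast
    qed
  qed
qed

text \<open>By determinism, an edge labelled \<open>Gen s\<close> at a vertex of a Cayley copy is
  the edge that the copy already has there.\<close>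

lemma gen_step:
  assumes "(x, u) \<in> I1" "g \<in> carrier (vgrp \<A> u)" "s \<in> gset u" "reads T (\<gamma> (x, u) g) [(Gen s, b)] z"
  shows "\<exists>k \<in> carrier (vgrp \<A> u). (if b then (\<gamma> (x, u) g, Gen s, z) else (z, Gen s, \<gamma> (x, u) g)) =
      (\<gamma> (x, u) k, Gen s, \<gamma> (x, u) (k \<otimes>\<^bsub>vgrp \<A> u\<^esub> gval \<A> s))"
proof -
  have u: "u \<in> \<V>" using assms(1) vtypes_\<V> by auto
  interpret group "vgrp \<A> u" by (rule vertex_group[OF u])
  have gv: "gval \<A> s \<in> carrier (vgrp \<A> u)" by (rule gval_in[OF u assms(3)])
  have "reads T (\<gamma> (x, u) g) (gen_word [(s, b)]) (\<gamma> (x, u) (g \<otimes>\<^bsub>vgrp \<A> u\<^esub> val u [(s, b)]))"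
    using assms by (intro reads_\<gamma>) auto
  then have z: "z = \<gamma> (x, u) (g \<otimes>\<^bsub>vgrp \<A> u\<^esub> val u [(s, b)])"
    using assms(4) T_det by (simp del: reads.simps word_val.simps)
  show ?thesis
  proof (cases b)
    case True
    then show ?thesis using z assms(2) gv by (intro bexI[of _ g]) auto
  next
    case False
    then show ?thesis using z assms(2) gv
      by (intro bexI[of _ "g \<otimes>\<^bsub>vgrp \<A> u\<^esub> inv\<^bsub>vgrp \<A> u\<^esub> gval \<A> s"]) (auto simp: m_assoc)
  qed
qed

text \<open>The relator loops of the edge saturation create no further kinds of edges. Their
  generator edges fold into the Cayley copies at the two ends of the saturated edge, the leading
  edge letter folds onto that edge, and the other edge letter becomes its translate by the edge
  group element.\<close>

lemma T_cases:
  assumes "t \<in> T"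
  obtains (A0) x l y where "(x, l, y) \<in> triples A0" "t = (\<pi>0 x, l, \<pi>0 y)"
  | (gen) x u g s where "(x, u) \<in> I1" "g \<in> carrier (vgrp \<A> u)" "s \<in> gset u"
      "t = (\<gamma> (x, u) g, Gen s, \<gamma> (x, u) (g \<otimes>\<^bsub>vgrp \<A> u\<^esub> gval \<A> s))"
  | (edge) x e y h where "(x, Edge e, y) \<in> triples A0" "e \<in> \<E>" "h \<in> carrier (egrp \<A> e)"
      "t = (\<gamma> (x, src e) (imap \<A> e h), Edge e, \<gamma> (y, tgt e) (tmap \<A> e h))"
proof -
  from assms have "t \<in> map_triple \<pi> ` triples A2" using quotient_\<pi> by (simp add: quotient_map_def)
  then consider t' where "t' \<in> triples A1" "t = map_triple (\<lambda>x. \<pi> (Inl x)) t'"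
    | i t' where "i \<in> I2" "t' \<in> triples (word_loop (edge_relator \<A> (fst (snd i)) (snd (snd i))))"
      "t = map_triple (\<lambda>k. \<pi> (emb2 i k)) t'"
    unfolding edge_saturation_def triples_attach by fastforce
  then show ?thesis
  proof cases
    case 1
    then consider x l y where "(x, l, y) \<in> triples A0" "t' = (Inl x, l, Inl y)"
      | i x l y where "i \<in> I1" "(x, l, y) \<in> triples (cayley_graph \<A> (snd i))" "t' = (emb1 i x, l, emb1 i y)"
      unfolding triples_A1 by auto
    then show ?thesis
    proof cases
      case 1
      then show ?thesis using \<open>t = _\<close> by (intro A0) (auto simp: \<pi>0_def)
    next
      case (2 i x l y)
      then show ?thesis using \<open>t = _\<close>
        by (cases i) (auto simp: \<gamma>_def triples_cayley intro!: gen)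
    qed
  next
    case (2 i t')
    obtain f e h where i: "i = (f, e, h)" by (cases i)
    have e: "e \<in> \<E>" and h: "h \<in> carrier (egrp \<A> e)" and f: "f \<in> arcs A1" "lab A1 f = Edge e"
      using 2(1) i by auto
    obtain x y where xy: "tail A1 f = Inl x" "(x, Edge e, y) \<in> triples A0"
      by (rule A1_edge[OF f])
    define q where "q k = \<pi> (emb2 i k)" for k
    let ?r = "edge_relator \<A> e h"
    have q0: "q 0 = \<pi>0 x" using xy(1) by (simp add: q_def i attach_emb_def \<pi>0_def)
    have qT: "(q a, l, q b) \<in> T" if "(a, l, b) \<in> triples (word_loop ?r)" for a l b
      using loop_T[of f e h] that 2(1) by (simp add: q_def i)
    have t': "t' \<in> triples (word_loop ?r)" using 2(2) i by simp
    obtain U l V a b where r: "?r = U @ l # V" and U: "reads (triples (word_loop ?r)) 0 U a"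
      and ab: "t' = (if snd l then (a, fst l, b) else (b, fst l, a))"
      and V: "reads (triples (word_loop ?r)) b V 0"
      by (rule word_loop_triple[OF t'])
    have RU: "reads T (\<pi>0 x) U (q a)" using reads_map[where \<pi> = q and T' = T, OF U qT] q0 by simp
    have RV: "reads T (q b) V (\<pi>0 x)" using reads_map[where \<pi> = q and T' = T, OF V qT] q0 by simp
    have t: "t = (if snd l then (q a, fst l, q b) else (q b, fst l, q a))"
      using 2(3) ab by (auto simp: q_def)
    then have Rl: "reads T (q a) [l] (q b)" using assms by (auto split: if_splits)
    note Ix = I1_edge(1)[OF xy(2) e] and Iy = I1_edge(2)[OF xy(2) e]
    have Re: "reads T (\<pi>0 x) [(Edge e, True)] (\<pi>0 y)" using A0_T[OF xy(2)] by simp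
    have r': "(Edge e, True) # gen_word (tword \<A> e h) @ (Edge e, False) # gen_word (word_inv (iword \<A> e h)) = U @ l # V"
      using r by (simp add: edge_relator_def)
    from relator_split[OF r'] consider "U = []" "l = (Edge e, True)"
      | P m Q where "tword \<A> e h = P @ m # Q" "U = (Edge e, True) # gen_word P" "l = (Gen (fst m), snd m)"
      | "U = (Edge e, True) # gen_word (tword \<A> e h)" "l = (Edge e, False)"
          "V = gen_word (word_inv (iword \<A> e h))"
      | P m Q where "word_inv (iword \<A> e h) = P @ m # Q" "V = gen_word Q" "l = (Gen (fst m), snd m)"
      by blast
    then show ?thesis
    proof cases
      case 1
      then have "q a = \<pi>0 x" using RU by simp
      moreover have "q b = \<pi>0 y"
        using T_det[of "q a" "[l]" "q b" "\<pi>0 y"] Rl Re 1(2) calculation by simp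
      ultimately show ?thesis using t 1 xy(2) by (intro A0) auto
    next
      case (2 P m Q)
      have "P @ m # Q \<in> words (gset (tgt e))" using tword_in[OF e h] 2 by simp
      then have P: "P \<in> words (gset (tgt e))" "fst m \<in> gset (tgt e)" by (auto simp: mem_Times_iff)
      have "reads T (\<pi>0 x) ([(Edge e, True)] @ gen_word P) (\<gamma> (y, tgt e) (val (tgt e) P))"
        using Re reads_\<gamma>_one[OF Iy P(1)] unfolding reads_append by blast
      then have "reads T (\<pi>0 x) U (\<gamma> (y, tgt e) (val (tgt e) P))" by (simp only: 2(2) append.simps)
      then have qa: "q a = \<gamma> (y, tgt e) (val (tgt e) P)" by (rule T_det[OF RU])
      have valP: "val (tgt e) P \<in> carrier (vgrp \<A> (tgt e))" using P e by simp
      have "reads T (\<gamma> (y, tgt e) (val (tgt e) P)) [(Gen (fst m), snd m)] (q b)"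
        using Rl by (simp only: qa 2(3))
      from gen_step[OF Iy valP P(2) this] obtain g where g: "g \<in> carrier (vgrp \<A> (tgt e))"
        "(if snd m then (q a, Gen (fst m), q b) else (q b, Gen (fst m), q a)) =
          (\<gamma> (y, tgt e) g, Gen (fst m), \<gamma> (y, tgt e) (g \<otimes>\<^bsub>vgrp \<A> (tgt e)\<^esub> gval \<A> (fst m)))"
        unfolding qa[symmetric] by blast
      have "t = (\<gamma> (y, tgt e) g, Gen (fst m), \<gamma> (y, tgt e) (g \<otimes>\<^bsub>vgrp \<A> (tgt e)\<^esub> gval \<A> (fst m)))"
        using t 2(3) g(2) by (cases "snd m") simp_all
      then show ?thesis by (rule gen[OF Iy g(1) P(2)])
    next
      case 3
      have "reads T (\<pi>0 x) ([(Edge e, True)] @ gen_word (tword \<A> e h)) (\<gamma> (y, tgt e) (val (tgt e) (tword \<A> e h)))"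
        using Re reads_\<gamma>_one[OF Iy tword_in[OF e h]] unfolding reads_append by blast
      then have "reads T (\<pi>0 x) U (\<gamma> (y, tgt e) (tmap \<A> e h))"
        by (simp only: 3(1) append.simps val_tword[OF e h])
      then have qa: "q a = \<gamma> (y, tgt e) (tmap \<A> e h)" by (rule T_det[OF RU])
      have "reads T (\<pi>0 x) (gen_word (iword \<A> e h)) (q b)"
        using RV 3(3) reads_word_inv[of T "q b" "gen_word (iword \<A> e h)"] by simp
      then have "q b = \<gamma> (x, src e) (imap \<A> e h)"
        using T_det reads_\<gamma>_one[OF Ix iword_in[OF e h]] e h by simp
      then show ?thesis using t 3(2) qa by (intro edge[OF xy(2) e h]) auto
    next
      case (4 P m Q)
      have "P @ m # Q \<in> words (gset (src e))" using iword_in[OF e h] by (metis 4(1) word_inv_in_words)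
      then have Q: "word_inv Q \<in> words (gset (src e))" "fst m \<in> gset (src e)" by (auto simp: mem_Times_iff)
      \<comment> \<open>An edge in the last segment is located from the end of the loop, by reading
        the remaining suffix backwards.\<close>
      have "reads T (\<pi>0 x) (gen_word (word_inv Q)) (q b)"
        using RV 4(2) reads_word_inv[of T "\<pi>0 x" "gen_word Q" "q b"] by simp
      then have qb: "q b = \<gamma> (x, src e) (val (src e) (word_inv Q))"
        using T_det reads_\<gamma>_one[OF Ix Q(1)] by blast
      have valQ: "val (src e) (word_inv Q) \<in> carrier (vgrp \<A> (src e))" using Q e by simp
      have "reads T (q b) [(Gen (fst m), \<not> snd m)] (q a)"
        using Rl 4(3) reads_word_inv[of T "q b" "[l]" "q a"] by simp
      then have "reads T (\<gamma> (x, src e) (val (src e) (word_inv Q))) [(Gen (fst m), \<not> snd m)] (q a)"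
        by (simp only: qb)
      from gen_step[OF Ix valQ Q(2) this] obtain g where g: "g \<in> carrier (vgrp \<A> (src e))"
        "(if \<not> snd m then (q b, Gen (fst m), q a) else (q a, Gen (fst m), q b)) =
          (\<gamma> (x, src e) g, Gen (fst m), \<gamma> (x, src e) (g \<otimes>\<^bsub>vgrp \<A> (src e)\<^esub> gval \<A> (fst m)))"
        unfolding qb[symmetric] by blast
      have "t = (\<gamma> (x, src e) g, Gen (fst m), \<gamma> (x, src e) (g \<otimes>\<^bsub>vgrp \<A> (src e)\<^esub> gval \<A> (fst m)))"
        using t 4(3) g(2) by (cases "snd m") simp_all
      then show ?thesis by (rule gen[OF Ix g(1) Q(2)])
    qed
  qed
qed

end

context folded_gog
begin

section \<open>Types of vertices and the action of the vertex groups\<close>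

lemma T_wf: "(x, l, y) \<in> T \<Longrightarrow> x \<in> verts \<Gamma> \<and> y \<in> verts \<Gamma>"
  using wf_\<Gamma> by (auto simp: wf_graph_def)

lemma A0_labels: "(x, l, y) \<in> triples A0 \<Longrightarrow> l \<in> \<X>"
proof -
  assume "(x, l, y) \<in> triples A0"
  moreover have "triples point = {}" by (simp add: triples_def)
  ultimately obtain j a b where j: "j < length Ws" and t: "(a, l, b) \<in> triples (word_loop (Ws ! j))"
    unfolding bouquet_def triples_attach by auto
  obtain U k V c d where W: "Ws ! j = U @ k # V" "(a, l, b) = (if snd k then (c, fst k, d) else (d, fst k, c))"
    by (rule word_loop_triple[OF t])
  have "l = fst k" using W(2) by (simp split: if_splits)
  moreover have "Ws ! j \<in> words \<X>" by (rule input_words) (use j in simp)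
  then have "U @ k # V \<in> words \<X>" by (simp only: W(1))
  ultimately show "l \<in> \<X>" by (auto simp: mem_Times_iff)
qed

lemma I1_\<V>: "(x, u) \<in> I1 \<Longrightarrow> u \<in> \<V>"
  using vtypes_\<V> by auto

lemma T_labels:
  assumes "(x, l, y) \<in> T"
  shows "l \<in> \<X>"
  using assms
proof (cases rule: T_cases)
  case (A0 x' l' y')
  then show ?thesis using A0_labels[of x' l' y'] by simp
next
  case (gen x' u g s)
  then show ?thesis using gen_in[OF I1_\<V>[OF gen(1)]] by simp
qed simp

text \<open>At the attaching vertex the type is inherited from the bouquet. Any other vertex of the
  copy meets an edge with a label from \<open>gset u\<close>, because a nontrivial group has a
  generator.\<close>

lemma type_\<gamma>:
  assumes "(x, u) \<in> I1" "g \<in> carrier (vgrp \<A> u)"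
  shows "u \<in> vtypes \<A> v \<Gamma> (\<gamma> (x, u) g)"
proof (cases "g = \<one>\<^bsub>vgrp \<A> u\<^esub>")
  case True
  have "u \<in> vtypes \<A> v \<Gamma> (\<pi>0 x)"
    by (rule vtypes_map[of _ _ A0]) (use assms(1) A0_T in auto)
  then show ?thesis using True by (simp add: \<gamma>_one)
next
  case False
  have u: "u \<in> \<V>" using assms(1) vtypes_\<V> by auto
  obtain W where W: "W \<in> words (gset u)" "val u W = g" using val_surj[OF u assms(2)] by blast
  then have "W \<noteq> []" using False by auto
  then obtain s where s: "s \<in> gset u" using W(1) by (cases W) auto
  have "(\<gamma> (x, u) g, Gen s, \<gamma> (x, u) (g \<otimes>\<^bsub>vgrp \<A> u\<^esub> gval \<A> s)) \<in> T"
    by (rule cayley_T[OF assms(1)]) (use assms(2) s in \<open>auto simp: triples_cayley\<close>)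
  then show ?thesis unfolding vtypes_iff using u s by blast
qed

lemma gen_unique: "u \<in> \<V> \<Longrightarrow> w \<in> \<V> \<Longrightarrow> s \<in> gset u \<Longrightarrow> s \<in> gset w \<Longrightarrow> u = w"
  using disjoint_gens by blast

text \<open>Folding creates no type that was not saturated, so every vertex of type \<open>u\<close>
  lies in the image of a Cayley copy, where \<open>act_\<gamma>\<close> computes the action.\<close>

lemma type_cases:
  assumes "u \<in> vtypes \<A> v \<Gamma> z"
  obtains x g where "(x, u) \<in> I1" "g \<in> carrier (vgrp \<A> u)" "z = \<gamma> (x, u) g"
proof -
  note result = that
  have u: "u \<in> \<V>" by (rule vtypes_\<V>[OF assms])
  interpret group "vgrp \<A> u" by (rule vertex_group[OF u])
  have A0_type: thesis if "x \<in> verts A0" "u \<in> vtypes \<A> v A0 x" "z = \<pi>0 x" for x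
    using that by (intro result[of x "\<one>\<^bsub>vgrp \<A> u\<^esub>"]) (auto simp: \<gamma>_one)
  from assms consider "z = base \<Gamma>" "u = v"
    | x s y where "(x, Gen s, y) \<in> T" "x = z \<or> y = z" "s \<in> gset u"
    | x e y where "(x, Edge e, y) \<in> T" "e \<in> \<E>" "(x = z \<and> u = src e) \<or> (y = z \<and> u = tgt e)"
    unfolding vtypes_iff by blast
  then show ?thesis
  proof cases
    case 1
    then show ?thesis using wf_A0 v_in by (intro A0_type[of "base A0"]) (auto simp: vtypes_iff wf_graph_def)
  next
    case (2 x s y)
    from 2(1) show ?thesis
    proof (cases rule: T_cases)
      case (A0 x' l y')
      then have "(x', Gen s, y') \<in> triples A0" by simp
      then have "u \<in> vtypes \<A> v A0 x'" "u \<in> vtypes \<A> v A0 y'" "x' \<in> verts A0" "y' \<in> verts A0"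
        using u 2(3) wf_A0 unfolding vtypes_iff wf_graph_def by blast+
      then show ?thesis using A0 2(2) A0_type by auto
    next
      case (gen x' w g s')
      have s: "s \<in> gset w" using gen(3,4) by simp
      have w: "w = u" by (rule gen_unique[OF I1_\<V>[OF gen(1)] u s 2(3)])
      have "g \<otimes>\<^bsub>vgrp \<A> u\<^esub> gval \<A> s' \<in> carrier (vgrp \<A> u)" "g \<in> carrier (vgrp \<A> u)"
        using gen(2,3) gval_in[OF u] w by simp_all
      moreover have "z = \<gamma> (x', u) g \<or> z = \<gamma> (x', u) (g \<otimes>\<^bsub>vgrp \<A> u\<^esub> gval \<A> s')"
        using gen(4) 2(2) w by auto
      ultimately show ?thesis using result gen(1) w by blast
    qed simp
  next
    case (3 x e y)
    from 3(1) show ?thesis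
    proof (cases rule: T_cases)
      case (A0 x' l y')
      then have "(x', Edge e, y') \<in> triples A0" by simp
      from I1_edge[OF this 3(2)] show ?thesis using A0 3(3) A0_type by auto
    next
      case (edge x' e' y' h)
      then have "e' = e" by simp
      moreover have "imap \<A> e h \<in> carrier (vgrp \<A> (src e))" "tmap \<A> e h \<in> carrier (vgrp \<A> (tgt e))"
        using edge(2,3) \<open>e' = e\<close> by simp_all
      moreover have "(x', src e) \<in> I1" "(y', tgt e) \<in> I1"
        using I1_edge[OF edge(1,2)] \<open>e' = e\<close> by simp_all
      moreover have "x = \<gamma> (x', src e) (imap \<A> e h)" "y = \<gamma> (y', tgt e) (tmap \<A> e h)"
        using edge(4) \<open>e' = e\<close> by simp_all
      ultimately show ?thesis using 3(3) result by blast
    qed simp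
  qed
qed

text \<open>The vertex reached from \<open>z\<close> by reading a word for \<open>a\<close>. On a
  Cayley copy this is right multiplication, which is why all words for \<open>a\<close> lead to the
  same vertex.\<close>

definition act :: "'v \<Rightarrow> _ \<Rightarrow> 'g \<Rightarrow> _" where
  "act u z a = (SOME z'. \<exists>W. W \<in> words (gset u) \<and> val u W = a \<and> reads T z (gen_word W) z')"

lemma act_\<gamma>:
  assumes i: "(x, u) \<in> I1" and "g \<in> carrier (vgrp \<A> u)" "a \<in> carrier (vgrp \<A> u)"
  shows "act u (\<gamma> (x, u) g) a = \<gamma> (x, u) (g \<otimes>\<^bsub>vgrp \<A> u\<^esub> a)"
  unfolding act_def
proof (rule some_equality)
  have u: "u \<in> \<V>" using i vtypes_\<V> by auto
  obtain W where "W \<in> words (gset u)" "val u W = a" using val_surj[OF u assms(3)] by blast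
  then show "\<exists>W. W \<in> words (gset u) \<and> val u W = a \<and>
      reads T (\<gamma> (x, u) g) (gen_word W) (\<gamma> (x, u) (g \<otimes>\<^bsub>vgrp \<A> u\<^esub> a))"
    using reads_\<gamma>[OF i assms(2)] by blast
  fix z' assume "\<exists>W. W \<in> words (gset u) \<and> val u W = a \<and> reads T (\<gamma> (x, u) g) (gen_word W) z'"
  then show "z' = \<gamma> (x, u) (g \<otimes>\<^bsub>vgrp \<A> u\<^esub> a)" using reads_\<gamma>[OF i assms(2)] T_det by blast
qed

lemma act_reads:
  assumes "u \<in> vtypes \<A> v \<Gamma> z" "W \<in> words (gset u)"
  shows "reads T z (gen_word W) (act u z (val u W))"
proof -
  obtain x g where xg: "(x, u) \<in> I1" "g \<in> carrier (vgrp \<A> u)" "z = \<gamma> (x, u) g"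
    by (rule type_cases[OF assms(1)])
  show ?thesis
    unfolding xg(3) act_\<gamma>[OF xg(1,2) val_in[OF I1_\<V>[OF xg(1)] assms(2)]]
    by (rule reads_\<gamma>[OF xg(1,2) assms(2)])
qed

lemma act_type:
  assumes "u \<in> vtypes \<A> v \<Gamma> z" "a \<in> carrier (vgrp \<A> u)"
  shows "u \<in> vtypes \<A> v \<Gamma> (act u z a)"
proof -
  obtain x g where xg: "(x, u) \<in> I1" "g \<in> carrier (vgrp \<A> u)" "z = \<gamma> (x, u) g"
    by (rule type_cases[OF assms(1)])
  interpret group "vgrp \<A> u" by (rule vertex_group[OF I1_\<V>[OF xg(1)]])
  show ?thesis
    unfolding xg(3) act_\<gamma>[OF xg(1,2) assms(2)]
    by (rule type_\<gamma>[OF xg(1) m_closed[OF xg(2) assms(2)]])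
qed

lemma type_verts: "u \<in> vtypes \<A> v \<Gamma> z \<Longrightarrow> z \<in> verts \<Gamma>"
  unfolding vtypes_iff using T_wf base_in by blast

lemma act_one: "u \<in> vtypes \<A> v \<Gamma> z \<Longrightarrow> act u z \<one>\<^bsub>vgrp \<A> u\<^esub> = z"
  using act_reads[of u z "[]"] by simp

lemma act_mult:
  assumes "u \<in> vtypes \<A> v \<Gamma> z" "a \<in> carrier (vgrp \<A> u)" "b \<in> carrier (vgrp \<A> u)"
  shows "act u (act u z a) b = act u z (a \<otimes>\<^bsub>vgrp \<A> u\<^esub> b)"
proof -
  interpret group "vgrp \<A> u" by (rule vertex_group[OF vtypes_\<V>[OF assms(1)]])
  show ?thesis by (rule type_cases[OF assms(1)]) (use assms(2,3) in \<open>simp add: act_\<gamma> m_assoc\<close>)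
qed

lemma gen_types:
  assumes "(z, Gen s, z') \<in> T"
  obtains u where "u \<in> \<V>" "s \<in> gset u" "u \<in> vtypes \<A> v \<Gamma> z" "u \<in> vtypes \<A> v \<Gamma> z'" "z' = act u z (gval \<A> s)"
proof -
  obtain u where u: "u \<in> \<V>" "s \<in> gset u"
    using T_labels[OF assms] by (auto simp: alphabet_def gen_letters_def)
  have t: "u \<in> vtypes \<A> v \<Gamma> z" "u \<in> vtypes \<A> v \<Gamma> z'" using assms u unfolding vtypes_iff by blast+
  have "reads T z (gen_word [(s, True)]) (act u z (val u [(s, True)]))"
    using u by (intro act_reads t) simp
  moreover have "val u [(s, True)] = gval \<A> s"
    using gval_in[OF u] vertex_group[OF u(1)] by (simp add: group.is_monoid monoid.r_one)
  ultimately have "z' = act u z (gval \<A> s)"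
    using assms deterministic_T unfolding deterministic_def by simp
  then show ?thesis using u t by (intro that)
qed

lemma edge_types:
  assumes "(z, Edge e, z') \<in> T"
  shows "e \<in> \<E>" "src e \<in> vtypes \<A> v \<Gamma> z" "tgt e \<in> vtypes \<A> v \<Gamma> z'"
proof -
  show e: "e \<in> \<E>" using T_labels[OF assms] by (auto simp: alphabet_def gen_letters_def)
  show "src e \<in> vtypes \<A> v \<Gamma> z" "tgt e \<in> vtypes \<A> v \<Gamma> z'"
    using assms e src_in[OF e] tgt_in[OF e] unfolding vtypes_iff by blast+
qed

text \<open>An edge group acts on the edges with its label: by \<open>T_cases\<close> such an edge
  is the translate of a bouquet edge by some \<open>k\<close>, and its translate by \<open>h\<close>
  is the translate of that bouquet edge by the product, present by
  \<open>edge_\<gamma>_T\<close>.\<close>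

lemma edge_act:
  assumes "(z, Edge e, z') \<in> T" and h: "h \<in> carrier (egrp \<A> e)"
  shows "(act (src e) z (imap \<A> e h), Edge e, act (tgt e) z' (tmap \<A> e h)) \<in> T"
proof -
  have e: "e \<in> \<E>" by (rule edge_types(1)[OF assms(1)])
  interpret egrp: group "egrp \<A> e" by (rule edge_group[OF e])
  interpret i: group_hom "egrp \<A> e" "vgrp \<A> (src e)" "imap \<A> e"
    using imap_mon[OF e] edge_group[OF e] vertex_group[of "src e"] e
    by (simp add: group_hom_def group_hom_axioms_def mon_def)
  interpret t: group_hom "egrp \<A> e" "vgrp \<A> (tgt e)" "tmap \<A> e"
    using tmap_mon[OF e] edge_group[OF e] vertex_group[of "tgt e"] e
    by (simp add: group_hom_def group_hom_axioms_def mon_def)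
  have *: "\<exists>x y k. (x, Edge e, y) \<in> triples A0 \<and> k \<in> carrier (egrp \<A> e) \<and>
      z = \<gamma> (x, src e) (imap \<A> e k) \<and> z' = \<gamma> (y, tgt e) (tmap \<A> e k)"
    using assms(1)
  proof (cases rule: T_cases)
    case (A0 x l y)
    \<comment> \<open>A bouquet edge is its own translate by the neutral element.\<close>
    then show ?thesis by (intro exI[of _ x] exI[of _ y] exI[of _ "\<one>\<^bsub>egrp \<A> e\<^esub>"]) (simp add: \<gamma>_one)
  qed auto
  then obtain x y k where xy: "(x, Edge e, y) \<in> triples A0" and k: "k \<in> carrier (egrp \<A> e)"
    and z: "z = \<gamma> (x, src e) (imap \<A> e k)" "z' = \<gamma> (y, tgt e) (tmap \<A> e k)" by blast
  have "act (src e) z (imap \<A> e h) = \<gamma> (x, src e) (imap \<A> e (k \<otimes>\<^bsub>egrp \<A> e\<^esub> h))"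
    "act (tgt e) z' (tmap \<A> e h) = \<gamma> (y, tgt e) (tmap \<A> e (k \<otimes>\<^bsub>egrp \<A> e\<^esub> h))"
    using act_\<gamma>[OF I1_edge(1)[OF xy e]] act_\<gamma>[OF I1_edge(2)[OF xy e]] k h e z by simp_all
  then show ?thesis using edge_\<gamma>_T[OF xy e, of "k \<otimes>\<^bsub>egrp \<A> e\<^esub> h"] k h by simp
qed

subsection \<open>Loops in the folded graph\<close>

abbreviation "\<phi> \<equiv> \<lambda>l. ev \<A> [(l, True)]"

lemma word_val_\<phi>: "W \<in> words \<X> \<Longrightarrow> word_val (Bass \<A>) \<phi> W = ev \<A> W"
  using word_val_pres_group by (simp add: Bass_def ev_def)

lemma H_subgroup: "subgroup H (Bass \<A>)"
  using group_Bass input_words by (intro group.generate_is_subgroup) auto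

text \<open>The prefix values of the input words form the potential; the closing edges contribute
  generators of \<open>H\<close> or their inverses. The leading factor one is the value at the base
  point.\<close>

lemma potential_A0: "potential (Bass \<A>) \<phi> H A0
    (case_sum (\<lambda>_. \<one>\<^bsub>Bass \<A>\<^esub>) (\<lambda>(j, k). \<one>\<^bsub>Bass \<A>\<^esub> \<otimes>\<^bsub>Bass \<A>\<^esub> word_val (Bass \<A>) \<phi> (take k (Ws ! j))))"
  unfolding bouquet_def
proof (rule potential_attach[OF group_Bass H_subgroup])
  interpret group "Bass \<A>" by (rule group_Bass)
  interpret H: subgroup H "Bass \<A>" by (rule H_subgroup)
  show "potential (Bass \<A>) \<phi> H point (\<lambda>_. \<one>\<^bsub>Bass \<A>\<^esub>)"
    using H.one_closed by (simp add: potential_def triples_def)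
  fix j assume "j \<in> {..<length Ws}"
  then have j: "Ws ! j \<in> set Ws" by simp
  have W: "Ws ! j \<in> words \<X>" by (rule input_words[OF j])
  show "word_val (Bass \<A>) \<phi> (take k (Ws ! j)) \<in> carrier (Bass \<A>)" for k
    using W by (intro word_val_closed[of \<X>] take_words) simp_all
  show "wf_graph (word_loop (Ws ! j))" by (rule wf_word_loop)
  fix x l y assume "(x, l, y) \<in> triples (word_loop (Ws ! j))"
  note t = potential_word_loop[of "Bass \<A>" \<X> \<phi>, OF group_Bass _ W this]
  have "ev \<A> (Ws ! j) \<in> H" using j by (simp add: generate.incl)
  then have "word_val (Bass \<A>) \<phi> (take x (Ws ! j)) \<otimes>\<^bsub>Bass \<A>\<^esub> \<phi> l \<otimes>\<^bsub>Bass \<A>\<^esub>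
      inv\<^bsub>Bass \<A>\<^esub> word_val (Bass \<A>) \<phi> (take y (Ws ! j)) \<in> H"
    using t(2) H.one_closed H.m_inv_closed word_val_\<phi>[OF W] by auto
  then show "\<phi> l \<in> carrier (Bass \<A>) \<and> \<one>\<^bsub>Bass \<A>\<^esub> \<otimes>\<^bsub>Bass \<A>\<^esub>
      (word_val (Bass \<A>) \<phi> (take x (Ws ! j)) \<otimes>\<^bsub>Bass \<A>\<^esub> \<phi> l \<otimes>\<^bsub>Bass \<A>\<^esub>
      inv\<^bsub>Bass \<A>\<^esub> word_val (Bass \<A>) \<phi> (take y (Ws ! j))) \<otimes>\<^bsub>Bass \<A>\<^esub> inv\<^bsub>Bass \<A>\<^esub> \<one>\<^bsub>Bass \<A>\<^esub> \<in> H"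
    using t(1) H.mem_carrier by simp
qed simp_all

lemma A1_tail: "f \<in> arcs A1 \<Longrightarrow> tail A1 f \<in> verts A1"
  using wf_A1 by (force simp: wf_graph_def triples_def)

text \<open>Cayley graphs and relator loops contain only loops of trivial value in the Bass group,
  so the potential of the bouquet extends over both saturations, by \<open>vel\<close> and by the
  prefix values of the relators, and it survives every fold.\<close>

lemma ex_potential: "\<exists>p. potential (Bass \<A>) \<phi> H \<Gamma> p"
proof -
  interpret group "Bass \<A>" by (rule group_Bass)
  interpret H: subgroup H "Bass \<A>" by (rule H_subgroup)
  obtain p0 where p0: "potential (Bass \<A>) \<phi> H A0 p0" using potential_A0 by blast
  have "potential (Bass \<A>) \<phi> H A1
      (case_sum p0 (\<lambda>(i, c). p0 (case i of (z, u) \<Rightarrow> z) \<otimes>\<^bsub>Bass \<A>\<^esub> vel (snd i) c))"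
    unfolding vertex_saturation_def
  proof (rule potential_attach[OF group_Bass H_subgroup p0], goal_cases)
    case (1 i)
    then show ?case by auto
  next
    case (2 i z)
    obtain x u where i: "i = (x, u)" by (cases i)
    then show ?case using 2 I1_\<V>[of x u] by simp
  next
    case (3 i)
    obtain x u where i: "i = (x, u)" by (cases i)
    then show ?case using 3 I1_\<V>[of x u] group_hom.hom_one[OF group_hom_vel] by simp
  next
    case (4 i)
    obtain x u where i: "i = (x, u)" by (cases i)
    then show ?case using 4 I1_\<V>[of x u] wf_cayley by simp
  next
    case (5 i x l y)
    then obtain z u where i: "i = (z, u)" "z \<in> verts A0" "u \<in> vtypes \<A> v A0 z" by auto
    have u: "u \<in> \<V>" using 5(1) i(1) I1_\<V> by blast
    interpret vel: group_hom "vgrp \<A> u" "Bass \<A>" "vel u" by (rule group_hom_vel[OF u])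
    from 5(2) i obtain s where s: "l = Gen s" "s \<in> gset u" "x \<in> carrier (vgrp \<A> u)"
      "y = x \<otimes>\<^bsub>vgrp \<A> u\<^esub> gval \<A> s" by (auto simp: triples_cayley)
    have \<phi>s: "\<phi> l = vel u (gval \<A> s)" using ev_gen_word[OF u, of "[(s, True)]"] s u by simp
    have "p0 z \<in> carrier (Bass \<A>)" using potentialD(1)[OF p0] i by blast
    moreover have "gval \<A> s \<in> carrier (vgrp \<A> u)" using s(2) u by simp
    moreover from this have "vel u x \<otimes>\<^bsub>Bass \<A>\<^esub> \<phi> l \<otimes>\<^bsub>Bass \<A>\<^esub> inv\<^bsub>Bass \<A>\<^esub> (vel u y) = \<one>\<^bsub>Bass \<A>\<^esub>"
      using s u \<phi>s by simp
    ultimately show ?case using i(1) \<phi>s H.one_closed u by simp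
  qed
  then obtain p1 where p1: "potential (Bass \<A>) \<phi> H A1 p1" by blast
  have "potential (Bass \<A>) \<phi> H A2 (case_sum p1 (\<lambda>(i, c). p1 (case i of (f, e, h) \<Rightarrow> tail A1 f) \<otimes>\<^bsub>Bass \<A>\<^esub>
      word_val (Bass \<A>) \<phi> (take c (edge_relator \<A> (fst (snd i)) (snd (snd i))))))"
    unfolding edge_saturation_def
  proof (rule potential_attach[OF group_Bass H_subgroup p1], goal_cases)
    case (1 i)
    then show ?case using A1_tail by auto
  next
    case (2 i k)
    then have "edge_relator \<A> (fst (snd i)) (snd (snd i)) \<in> words \<X>" using edge_relator_words by auto
    then show ?case by (intro word_val_closed[of \<X>] take_words) simp_all
  next
    case (5 i x l y)
    obtain f e h where i: "i = (f, e, h)" by (cases i)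
    have eh: "e \<in> \<E>" "h \<in> carrier (egrp \<A> e)" "tail A1 f \<in> verts A1"
      using 5(1) i A1_tail by auto
    have p1f: "p1 (tail A1 f) \<in> carrier (Bass \<A>)" using potentialD(1)[OF p1 eh(3)] .
    have W: "edge_relator \<A> e h \<in> words \<X>" using eh by (intro edge_relator_words)
    have "(x, l, y) \<in> triples (word_loop (edge_relator \<A> e h))" using 5(2) i by simp
    note t = potential_word_loop[of "Bass \<A>" \<X> \<phi>, OF group_Bass _ W this]
    have "word_val (Bass \<A>) \<phi> (take x (edge_relator \<A> e h)) \<otimes>\<^bsub>Bass \<A>\<^esub> \<phi> l \<otimes>\<^bsub>Bass \<A>\<^esub>
        inv\<^bsub>Bass \<A>\<^esub> word_val (Bass \<A>) \<phi> (take y (edge_relator \<A> e h)) = \<one>\<^bsub>Bass \<A>\<^esub>"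
      using t(2) word_val_\<phi>[OF W] ev_edge_relator[OF eh(1,2)] by simp
    then show ?case using t(1) i p1f H.one_closed by simp
  qed (auto simp: wf_word_loop)
  then have "potential (Bass \<A>) \<phi> H \<Gamma> (case_sum p1 (\<lambda>(i, c). p1 (case i of (f, e, h) \<Rightarrow> tail A1 f) \<otimes>\<^bsub>Bass \<A>\<^esub>
      word_val (Bass \<A>) \<phi> (take c (edge_relator \<A> (fst (snd i)) (snd (snd i))))))"
    by (rule potential_folds[OF group_Bass H_subgroup wf_A2]) (use folding in \<open>simp add: folding_result_def\<close>)
  then show ?thesis by blast
qed

lemma reads_\<X>: "reads T x W y \<Longrightarrow> W \<in> words \<X>"
  using reads_words[of T x W y \<X>] T_labels by fastforce

lemma loop_in_H: "reads T (base \<Gamma>) W (base \<Gamma>) \<Longrightarrow> ev \<A> W \<in> H"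
proof -
  assume W: "reads T (base \<Gamma>) W (base \<Gamma>)"
  interpret group "Bass \<A>" by (rule group_Bass)
  interpret H: subgroup H "Bass \<A>" by (rule H_subgroup)
  obtain p where p: "potential (Bass \<A>) \<phi> H \<Gamma> p" using ex_potential by blast
  have b: "p (base \<Gamma>) \<in> H" by (rule potentialD(2)[OF p])
  have e: "ev \<A> W \<in> carrier (Bass \<A>)" using reads_\<X>[OF W] by simp
  have "p (base \<Gamma>) \<otimes>\<^bsub>Bass \<A>\<^esub> ev \<A> W \<otimes>\<^bsub>Bass \<A>\<^esub> inv\<^bsub>Bass \<A>\<^esub> p (base \<Gamma>) \<in> H"
    using potential_reads[OF group_Bass H_subgroup wf_\<Gamma> p W base_in] word_val_\<phi>[OF reads_\<X>[OF W]] by simp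
  from H.m_closed[OF H.m_inv_closed[OF b] H.m_closed[OF this b]]
  show "ev \<A> W \<in> H" using H.mem_carrier[OF b] e by (simp add: m_assoc) (simp flip: m_assoc)
qed

lemma input_loop:
  assumes "W \<in> set Ws"
  shows "reads T (base \<Gamma>) W (base \<Gamma>)"
proof -
  obtain j where j: "j < length Ws" "W = Ws ! j" using assms by (metis in_set_conv_nth)
  have "reads (triples (word_loop W)) 0 W 0"
    using reads_word_loop[of 0 "length W" W] by (simp split: if_splits)
  then have "reads (triples A0) (base A0) W (base A0)"
    using reads_attach_emb[of j "{..<length Ws}" "\<lambda>j. word_loop (Ws ! j)" 0 W 0 point "\<lambda>_. ()"] j
    by (simp add: bouquet_def attach_emb_def)
  from reads_A0[OF this] show ?thesis by simp
qed

lemma H_loop: "x \<in> H \<Longrightarrow> \<exists>W. reads T (base \<Gamma>) W (base \<Gamma>) \<and> x = ev \<A> W"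
proof (induction rule: generate.induct)
  case one
  show ?case by (rule exI[of _ "[]"]) (simp add: ev_Nil)
next
  case (incl x)
  then show ?case using input_loop by blast
next
  case (inv x)
  then obtain W where W: "W \<in> set Ws" "x = ev \<A> W" by blast
  have "reads T (base \<Gamma>) (word_inv W) (base \<Gamma>)"
    using input_loop[OF W(1)] by (simp only: reads_word_inv)
  then show ?case using ev_inv[OF input_words[OF W(1)]] W(2) by (intro exI[of _ "word_inv W"]) simp
next
  case (eng x y)
  then obtain U V where "reads T (base \<Gamma>) U (base \<Gamma>)" "x = ev \<A> U"
    "reads T (base \<Gamma>) V (base \<Gamma>)" "y = ev \<A> V" by blast
  then show ?case using ev_append[of U V] reads_\<X>
    by (intro exI[of _ "U @ V"]) (auto simp: reads_append)
qed

text \<open>A nontrivial stabiliser in a vertex group is conjugate to a torsion subgroup of \<open>H\<close>.\<close>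

lemma free_group_stabiliser:
  assumes free: "free_group (generated_subgroup \<A> Ws)"
    and z: "u \<in> vtypes \<A> v \<Gamma> z" and a: "a \<in> carrier (vgrp \<A> u)" "act u z a = z"
  shows "a = \<one>\<^bsub>vgrp \<A> u\<^esub>"
proof -
  interpret group "Bass \<A>" by (rule group_Bass)
  interpret H: subgroup H "Bass \<A>" by (rule H_subgroup)
  have u: "u \<in> \<V>" by (rule vtypes_\<V>[OF z])
  interpret vel: group_hom "vgrp \<A> u" "Bass \<A>" "vel u" by (rule group_hom_vel[OF u])
  obtain p where p: "potential (Bass \<A>) \<phi> H \<Gamma> p" using ex_potential by blast
  obtain W where W: "W \<in> words (gset u)" "val u W = a" using val_surj[OF u a(1)] by blast
  have "reads T z (gen_word W) z" using act_reads[OF z W(1)] W(2) a(2) by simp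
  then have "p z \<otimes>\<^bsub>Bass \<A>\<^esub> ev \<A> (gen_word W) \<otimes>\<^bsub>Bass \<A>\<^esub> inv\<^bsub>Bass \<A>\<^esub> p z \<in> H"
    using potential_reads[OF group_Bass H_subgroup wf_\<Gamma> p _ type_verts[OF z]]
      word_val_\<phi>[OF gen_word_in[OF u W(1)]] by metis
  then have x: "p z \<otimes>\<^bsub>Bass \<A>\<^esub> vel u a \<otimes>\<^bsub>Bass \<A>\<^esub> inv\<^bsub>Bass \<A>\<^esub> p z \<in> H" (is "?x \<in> H")
    using ev_gen_word[OF u W(1)] W(2) by simp
  have pz: "p z \<in> carrier (Bass \<A>)" by (rule potentialD(1)[OF p type_verts[OF z]])
  have va: "vel u a \<in> carrier (Bass \<A>)" using u a(1) by simp
  \<comment> \<open>By Lagrange the order of the finite vertex group is an exponent for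
    \<open>a\<close>, hence for its conjugate in \<open>H\<close>.\<close>
  let ?n = "order (vgrp \<A> u)"
  have n: "?n > 0" using finite_vgrp[OF u] a(1) by (auto simp: order_def card_gt_0_iff)
  have "vel u a [^]\<^bsub>Bass \<A>\<^esub> ?n = vel u (a [^]\<^bsub>vgrp \<A> u\<^esub> ?n)"
    using vel.hom_nat_pow[OF a(1)] by simp
  also have "a [^]\<^bsub>vgrp \<A> u\<^esub> ?n = \<one>\<^bsub>vgrp \<A> u\<^esub>" by (rule group.pow_order_eq_1[OF vertex_group[OF u] a(1)])
  finally have "?x [^]\<^bsub>Bass \<A>\<^esub> ?n = \<one>\<^bsub>Bass \<A>\<^esub>" using conj_pow[OF pz va] pz by simp
  then have "?x [^]\<^bsub>generated_subgroup \<A> Ws\<^esub> ?n = \<one>\<^bsub>generated_subgroup \<A> Ws\<^esub>"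
    by (simp add: generated_subgroup_def nat_pow_consistent[symmetric])
  then have "?x = \<one>\<^bsub>generated_subgroup \<A> Ws\<^esub>"
    using free_group_torsion_free[OF free _ _ n] x by (simp add: generated_subgroup_def)
  then have "?x = \<one>\<^bsub>Bass \<A>\<^esub>" by (simp add: generated_subgroup_def)
  then have "vel u a = \<one>\<^bsub>Bass \<A>\<^esub>" by (rule conj_eq_one[OF pz va])
  then show ?thesis by (rule vel_eq_one[OF u a(1)])
qed

end

text \<open>The vertex type that results from the bouquet and the two saturations, spelled out so
  that the edge type of the auxiliary graph below can be named.\<close>

type_synonym ('v, 'e, 'g, 'h, 's) folded_vertex =
  "((unit + nat \<times> nat) + ((unit + nat \<times> nat) \<times> 'v) \<times> 'g) +
    (((unit + nat \<times> nat) + ((unit + nat \<times> nat) \<times> 'v) \<times> 'g \<times> 's) \<times> 'e \<times> 'h) \<times> nat"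

subsection \<open>Free actions imply freeness\<close>

context folded_gog
begin

section \<open>The size of the folded graph\<close>

lemma finite_A0: "finite (verts A0)" "finite (arcs A0)" "card (verts A0) \<le> 1 + total_length Ws"
  "card (arcs A0) = total_length Ws"
proof -
  have N: "total_length Ws = (\<Sum>j<length Ws. length (Ws ! j))"
    by (simp add: total_length_def sum_list_sum_nth atLeast0LessThan)
  show "finite (verts A0)" unfolding bouquet_def by (rule finite_attach) simp_all
  have A: "arcs A0 = Inr ` (SIGMA j:{..<length Ws}. {..<length (Ws ! j)})"
    by (simp add: bouquet_def attach_def Let_def)
  show "finite (arcs A0)" "card (arcs A0) = total_length Ws"
    unfolding A by (simp_all add: card_image N)
  have "card (verts A0) \<le> 1 +
      (\<Sum>j<length Ws. card (verts (word_loop (Ws ! j)) - {base (word_loop (Ws ! j))}))"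
    unfolding bouquet_def by (rule order_trans[OF card_attach]) simp_all
  also have "\<dots> \<le> 1 + (\<Sum>j<length Ws. length (Ws ! j))"
  proof -
    have "card (verts (word_loop W) - {base (word_loop W)}) \<le> length W" for W :: "('e, 's) letter word"
      using card_mono[of "{..<length W}" "verts (word_loop W) - {base (word_loop W)}"] by auto
    then show ?thesis by (simp add: sum_mono)
  qed
  finally show "card (verts A0) \<le> 1 + total_length Ws" using N by simp
qed

text \<open>Each bouquet vertex receives at most one Cayley graph for each vertex of the underlying
  graph, which is the origin of the second factor. In the first factor the summand one counts the
  base point.\<close>

lemma finite_card_A1:
  "finite (verts A1)"
  "card (verts A1) \<le> (1 + total_length Ws) * (1 + (\<Sum>u \<in> \<V>. card (carrier (vgrp \<A> u))))"
proof -
  have sub: "I1 \<subseteq> verts A0 \<times> \<V>" using I1_\<V> by blast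
  have fin: "finite (verts A0 \<times> \<V>)" using finite_A0(1) finite_\<V> by simp
  have D: "finite (verts (case i of (z, u) \<Rightarrow> cayley_graph \<A> u))" if "i \<in> I1" for i
    using that finite_vgrp I1_\<V> by (cases i) simp
  show "finite (verts A1)"
    unfolding vertex_saturation_def using finite_attach finite_A0(1) finite_subset[OF sub fin] D by blast
  let ?k = "\<Sum>u \<in> \<V>. card (carrier (vgrp \<A> u))"
  have "card (verts A1) \<le> card (verts A0) + (\<Sum>i \<in> I1. card (verts (case i of (z, u) \<Rightarrow> cayley_graph \<A> u)
      - {base (case i of (z, u) \<Rightarrow> cayley_graph \<A> u)}))"
    unfolding vertex_saturation_def
    by (rule card_attach) (use finite_A0(1) finite_subset[OF sub fin] D in auto)
  also have "(\<Sum>i \<in> I1. card (verts (case i of (z, u) \<Rightarrow> cayley_graph \<A> u)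
      - {base (case i of (z, u) \<Rightarrow> cayley_graph \<A> u)})) \<le> (\<Sum>i \<in> I1. card (carrier (vgrp \<A> (snd i))))"
  proof (rule sum_mono)
    fix i assume "i \<in> I1"
    then show "card (verts (case i of (z, u) \<Rightarrow> cayley_graph \<A> u)
      - {base (case i of (z, u) \<Rightarrow> cayley_graph \<A> u)}) \<le> card (carrier (vgrp \<A> (snd i)))"
      using finite_vgrp I1_\<V> by (cases i) (auto intro!: card_mono)
  qed
  also have "\<dots> \<le> (\<Sum>i \<in> verts A0 \<times> \<V>. card (carrier (vgrp \<A> (snd i))))"
    by (rule sum_mono2[OF fin sub]) simp
  also have "\<dots> = (\<Sum>z \<in> verts A0. ?k)"
    unfolding sum.cartesian_product by (simp add: split_beta)
  also have "\<dots> = card (verts A0) * ?k" by simp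
  finally have "card (verts A1) \<le> card (verts A0) * (1 + ?k)" by simp
  also have "\<dots> \<le> (1 + total_length Ws) * (1 + ?k)" using finite_A0(3) by (rule mult_right_mono) simp
  finally show "card (verts A1) \<le> (1 + total_length Ws) * (1 + ?k)" .
qed

text \<open>Only bouquet edges are labelled by edges of the underlying graph, so no more edges are
  saturated than the input has letters, each with the same finite supply of relators. Folds do not
  increase the number of vertices.\<close>

lemma finite_card_verts:
  "finite (verts \<Gamma>)"
  "card (verts \<Gamma>) \<le> (1 + (\<Sum>u \<in> \<V>. card (carrier (vgrp \<A> u))) +
    (\<Sum>(e, h) \<in> (SIGMA e:\<E>. carrier (egrp \<A> e)). length (edge_relator \<A> e h))) * (total_length Ws + 1)"
proof -
  let ?S = "SIGMA e:\<E>. carrier (egrp \<A> e)"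
  let ?k = "\<Sum>u \<in> \<V>. card (carrier (vgrp \<A> u))"
  let ?m = "\<Sum>(e, h) \<in> ?S. length (edge_relator \<A> e h)"
  let ?D = "\<lambda>i. case i of (f, e, h) \<Rightarrow> word_loop (edge_relator \<A> e h)"
  let ?I = "{f \<in> arcs A1. \<exists>e. lab A1 f = Edge e}"
  have I: "?I \<subseteq> Inl ` arcs A0"
    by (auto simp: vertex_saturation_def attach_def Let_def cayley_graph_def)
  have fI: "finite ?I" and cI: "card ?I \<le> total_length Ws"
    using finite_subset[OF I] surj_card_le[OF _ I] finite_A0(2,4) by auto
  have sub: "I2 \<subseteq> ?I \<times> ?S" by auto
  have fin: "finite (?I \<times> ?S)" using fI finite_\<E> finite_egrp by auto
  have fI2: "finite I2" by (rule finite_subset[OF sub fin])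
  have D: "finite (verts (?D i))" for i by (cases i) simp
  have f2: "finite (verts A2)"
    unfolding edge_saturation_def by (rule finite_attach[OF finite_card_A1(1) fI2 D])
  have V: "verts \<Gamma> = \<pi> ` verts A2" using quotient_\<pi> by (simp add: quotient_map_def)
  show "finite (verts \<Gamma>)" unfolding V using f2 by simp
  have "card (verts A2) \<le> card (verts A1) + (\<Sum>i \<in> I2. card (verts (?D i) - {base (?D i)}))"
    unfolding edge_saturation_def
    by (rule card_attach[OF finite_card_A1(1) fI2 D]) (use A1_tail in auto)
  also have "(\<Sum>i \<in> I2. card (verts (?D i) - {base (?D i)})) \<le>
      (\<Sum>i \<in> I2. case snd i of (e, h) \<Rightarrow> length (edge_relator \<A> e h))"
  proof (rule sum_mono)
    fix i
    have "card (verts (word_loop W) - {base (word_loop W)}) \<le> length W" for W :: "('e, 's) letter word"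
      using card_mono[of "{..<length W}" "verts (word_loop W) - {base (word_loop W)}"] by auto
    then show "card (verts (?D i) - {base (?D i)}) \<le> (case snd i of (e, h) \<Rightarrow> length (edge_relator \<A> e h))"
      by (cases i) simp
  qed
  also have "\<dots> \<le> (\<Sum>i \<in> ?I \<times> ?S. case snd i of (e, h) \<Rightarrow> length (edge_relator \<A> e h))"
    by (rule sum_mono2[OF fin sub]) (simp add: split_beta)
  also have "\<dots> = (\<Sum>f \<in> ?I. ?m)"
    unfolding sum.cartesian_product by (simp add: split_beta)
  also have "\<dots> = card ?I * ?m" by simp
  also have "\<dots> \<le> total_length Ws * ?m" using cI by (rule mult_right_mono) simp
  finally have "card (verts A2) \<le> (1 + total_length Ws) * (1 + ?k) + total_length Ws * ?m"
    using finite_card_A1(2) by simp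
  also have "\<dots> \<le> (1 + ?k + ?m) * (total_length Ws + 1)" by (simp add: algebra_simps)
  finally have "card (verts A2) \<le> (1 + ?k + ?m) * (total_length Ws + 1)" .
  then show "card (verts \<Gamma>) \<le> (1 + ?k + ?m) * (total_length Ws + 1)"
    unfolding V using card_image_le[OF f2, of \<pi>] by simp
qed

text \<open>The actions on the vertices of each type are carried to numbers along
  \<open>\<iota>\<close> and extended to all of \<open>nat\<close>. The edges labelled
  \<open>e\<close> form a partial injection, by determinism, which respects the edge group, by
  \<open>edge_act\<close>, and so extends to an intertwining bijection.\<close>

lemma representation:
  assumes free: "\<And>u z a. u \<in> vtypes \<A> v \<Gamma> z \<Longrightarrow> a \<in> carrier (vgrp \<A> u) \<Longrightarrow> act u z a = z \<Longrightarrow> a = \<one>\<^bsub>vgrp \<A> u\<^esub>"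
  obtains \<iota> \<alpha> E where "inj_on \<iota> (verts \<Gamma>)"
    "\<And>u. u \<in> \<V> \<Longrightarrow> free_action (vgrp \<A> u) (UNIV :: nat set) (\<alpha> u)"
    "\<And>u z a. u \<in> vtypes \<A> v \<Gamma> z \<Longrightarrow> a \<in> carrier (vgrp \<A> u) \<Longrightarrow> \<alpha> u (\<iota> z) a = \<iota> (act u z a)"
    "\<And>e. e \<in> \<E> \<Longrightarrow> bij (E e)"
    "\<And>e y h. e \<in> \<E> \<Longrightarrow> h \<in> carrier (egrp \<A> e) \<Longrightarrow>
      E e (\<alpha> (src e) y (imap \<A> e h)) = \<alpha> (tgt e) (E e y) (tmap \<A> e h)"
    "\<And>z e z'. (z, Edge e, z') \<in> T \<Longrightarrow> E e (\<iota> z) = \<iota> z'"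
proof -
  obtain \<iota> :: "_ \<Rightarrow> nat" where \<iota>: "inj_on \<iota> (verts \<Gamma>)"
    using finite_imp_inj_to_nat_seg[OF finite_card_verts(1)] by blast
  define \<iota>' where "\<iota>' = inv_into (verts \<Gamma>) \<iota>"
  have \<iota>'\<iota>: "\<iota>' (\<iota> z) = z" if "z \<in> verts \<Gamma>" for z unfolding \<iota>'_def by (rule inv_into_f_f[OF \<iota> that])
  define D where "D u = {z. u \<in> vtypes \<A> v \<Gamma> z}" for u
  have D_verts: "D u \<subseteq> verts \<Gamma>" for u using type_verts by (auto simp: D_def)
  have ex: "\<exists>\<alpha>. free_action (vgrp \<A> u) (UNIV :: nat set) \<alpha> \<and> (\<forall>z \<in> D u. \<forall>a \<in> carrier (vgrp \<A> u). \<alpha> (\<iota> z) a = \<iota> (act u z a))"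
    if u: "u \<in> \<V>" for u
  proof -
    have "free_action (vgrp \<A> u) (\<iota> ` D u) (\<lambda>y a. \<iota> (act u (\<iota>' y) a))"
      unfolding free_action_def
    proof (intro ballI conjI impI)
      fix y assume "y \<in> \<iota> ` D u"
      then obtain z where z: "y = \<iota> z" "u \<in> vtypes \<A> v \<Gamma> z" by (auto simp: D_def)
      note zv = type_verts[OF z(2)]
      show "\<iota> (act u (\<iota>' y) \<one>\<^bsub>vgrp \<A> u\<^esub>) = y" using z \<iota>'\<iota>[OF zv] act_one by simp
      fix a assume a: "a \<in> carrier (vgrp \<A> u)"
      note za = act_type[OF z(2) a]
      show "\<iota> (act u (\<iota>' y) a) \<in> \<iota> ` D u" using z \<iota>'\<iota>[OF zv] za by (simp add: D_def)
      show "a = \<one>\<^bsub>vgrp \<A> u\<^esub>" if "\<iota> (act u (\<iota>' y) a) = y"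
      proof (rule free[OF z(2) a])
        show "act u z a = z"
          using that z \<iota>'\<iota>[OF zv] inj_onD[OF \<iota> _ type_verts[OF za] zv] by simp
      qed
      fix b assume b: "b \<in> carrier (vgrp \<A> u)"
      show "\<iota> (act u (\<iota>' (\<iota> (act u (\<iota>' y) a))) b) = \<iota> (act u (\<iota>' y) (a \<otimes>\<^bsub>vgrp \<A> u\<^esub> b))"
        using z \<iota>'\<iota>[OF zv] \<iota>'\<iota>[OF type_verts[OF za]] act_mult[OF z(2) a b] by simp
    qed
    note fa = this
    have fin: "finite (\<iota> ` D u)" using finite_subset[OF D_verts finite_card_verts(1)] by simp
    obtain \<alpha> where \<alpha>: "free_action (vgrp \<A> u) UNIV \<alpha>"
      "\<And>y a. y \<in> \<iota> ` D u \<Longrightarrow> \<alpha> y a = \<iota> (act u (\<iota>' y) a)"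
      using extend_free_action[OF vertex_group[OF u] finite_vgrp[OF u] fin fa] by blast
    have "\<alpha> (\<iota> z) a = \<iota> (act u z a)" if z: "z \<in> D u" for z a
    proof -
      have "z \<in> verts \<Gamma>" using z D_verts by blast
      then show ?thesis using \<alpha>(2)[of "\<iota> z" a] z \<iota>'\<iota>[of z] by simp
    qed
    then show ?thesis using \<alpha>(1) by blast
  qed
  define \<alpha> where "\<alpha> u = (SOME \<alpha>. free_action (vgrp \<A> u) (UNIV :: nat set) \<alpha> \<and>
    (\<forall>z \<in> D u. \<forall>a \<in> carrier (vgrp \<A> u). \<alpha> (\<iota> z) a = \<iota> (act u z a)))" for u
  have \<alpha>: "free_action (vgrp \<A> u) (UNIV :: nat set) (\<alpha> u)" if "u \<in> \<V>" for u
    unfolding \<alpha>_def using someI_ex[OF ex[OF that]] by blast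
  have \<alpha>_act: "\<alpha> u (\<iota> z) a = \<iota> (act u z a)" if "u \<in> vtypes \<A> v \<Gamma> z" "a \<in> carrier (vgrp \<A> u)" for u z a
    unfolding \<alpha>_def using someI_ex[OF ex[OF vtypes_\<V>[OF that(1)]]] that by (simp add: D_def)
  have E_ex: "\<exists>E. bij E \<and> (\<forall>y. \<forall>h \<in> carrier (egrp \<A> e). E (\<alpha> (src e) y (imap \<A> e h)) = \<alpha> (tgt e) (E y) (tmap \<A> e h))
      \<and> (\<forall>z z'. (z, Edge e, z') \<in> T \<longrightarrow> E (\<iota> z) = \<iota> z')" if e: "e \<in> \<E>" for e
  proof -
    define S where "S = {z. \<exists>z'. (z, Edge e, z') \<in> T}"
    define t where "t z = (THE z'. (z, Edge e, z') \<in> T)" for z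
    have det: "z' = z''" if "(z, Edge e, z') \<in> T" "(z, Edge e, z'') \<in> T" for z z' z''
      using deterministic_T that unfolding deterministic_def by blast
    have t: "t z = z'" if "(z, Edge e, z') \<in> T" for z z'
      unfolding t_def using that det by blast
    have S_verts: "S \<subseteq> verts \<Gamma>" using T_wf by (auto simp: S_def)
    let ?f = "\<lambda>y. \<iota> (t (\<iota>' y))"
    have f: "?f (\<iota> z) = \<iota> z'" if "(z, Edge e, z') \<in> T" for z z'
      using t[OF that] \<iota>'\<iota>[of z] T_wf[OF that] by simp
    have step: "\<alpha> (src e) (\<iota> z) (imap \<A> e h) = \<iota> (act (src e) z (imap \<A> e h))"
      "\<alpha> (tgt e) (\<iota> z') (tmap \<A> e h) = \<iota> (act (tgt e) z' (tmap \<A> e h))"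
      if "(z, Edge e, z') \<in> T" "h \<in> carrier (egrp \<A> e)" for z z' h
      using \<alpha>_act edge_types[OF that(1)] that(2) by simp_all
    obtain E where E: "bij E" "\<And>y h. h \<in> carrier (egrp \<A> e) \<Longrightarrow> E (\<alpha> (src e) y (imap \<A> e h)) = \<alpha> (tgt e) (E y) (tmap \<A> e h)"
      "\<And>y. y \<in> \<iota> ` S \<Longrightarrow> E y = ?f y"
    proof (rule extend_equivariant_bij[OF edge_group[OF e] finite_egrp[OF e]
        free_action_hom[OF edge_group[OF e] vertex_group[of "src e"] imap_mon[OF e] \<alpha>[of "src e"]]
        free_action_hom[OF edge_group[OF e] vertex_group[of "tgt e"] tmap_mon[OF e] \<alpha>[of "tgt e"]], of "\<iota> ` S" ?f])
      show "finite (\<iota> ` S)" using finite_subset[OF S_verts finite_card_verts(1)] by simp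
      show "inj_on ?f (\<iota> ` S)"
      proof (rule inj_onI)
        fix y1 y2 assume "y1 \<in> \<iota> ` S" "y2 \<in> \<iota> ` S" and eq: "?f y1 = ?f y2"
        then obtain z1 z1' z2 z2' where z: "y1 = \<iota> z1" "(z1, Edge e, z1') \<in> T" "y2 = \<iota> z2" "(z2, Edge e, z2') \<in> T"
          by (auto simp: S_def)
        have "\<iota> z1' = \<iota> z2'" using eq z f by metis
        then have "z1' = z2'" using inj_onD[OF \<iota>] T_wf z by blast
        then have "z1 = z2" using z(2,4) deterministic_T unfolding deterministic_def by blast
        then show "y1 = y2" using z by simp
      qed
      fix y h assume "y \<in> \<iota> ` S" and h: "h \<in> carrier (egrp \<A> e)"
      then obtain z z' where z: "y = \<iota> z" "(z, Edge e, z') \<in> T" by (auto simp: S_def)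
      have ha: "(act (src e) z (imap \<A> e h), Edge e, act (tgt e) z' (tmap \<A> e h)) \<in> T"
        by (rule edge_act[OF z(2) h])
      show "\<alpha> (src e) y (imap \<A> e h) \<in> \<iota> ` S"
        unfolding z(1) step(1)[OF z(2) h] S_def using ha by blast
      show "?f (\<alpha> (src e) y (imap \<A> e h)) = \<alpha> (tgt e) (?f y) (tmap \<A> e h)"
        unfolding z(1) step(1)[OF z(2) h] f[OF z(2)] step(2)[OF z(2) h] by (rule f[OF ha])
    qed (use e in auto)
    have "E (\<iota> z) = \<iota> z'" if "(z, Edge e, z') \<in> T" for z z'
      using E(3)[of "\<iota> z"] f[OF that] that by (auto simp: S_def)
    then show ?thesis using E(1,2) by blast
  qed
  define E where "E e = (SOME E. bij E \<and> (\<forall>y. \<forall>h \<in> carrier (egrp \<A> e). E (\<alpha> (src e) y (imap \<A> e h)) = \<alpha> (tgt e) (E y) (tmap \<A> e h))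
      \<and> (\<forall>z z'. (z, Edge e, z') \<in> T \<longrightarrow> E (\<iota> z) = \<iota> z'))" for e
  have E: "bij (E e) \<and> (\<forall>y. \<forall>h \<in> carrier (egrp \<A> e). E e (\<alpha> (src e) y (imap \<A> e h)) = \<alpha> (tgt e) (E e y) (tmap \<A> e h))
      \<and> (\<forall>z z'. (z, Edge e, z') \<in> T \<longrightarrow> E e (\<iota> z) = \<iota> z')" if "e \<in> \<E>" for e
    unfolding E_def by (rule someI_ex[OF E_ex[OF that]])
  show ?thesis
    by (rule that[OF \<iota> \<alpha> \<alpha>_act, of E]) (use E edge_types(1) in blast)+
qed

text \<open>The free basis comes from a graph on the vertices of \<open>\<Gamma>\<close>: every vertex is joined to a
  representative of each of its orbits under the vertex groups, and there is one edge for each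
  orbit of edges under the edge groups.\<close>

lemma free_group_if_free_actions:
  assumes free: "\<And>u z a. u \<in> vtypes \<A> v \<Gamma> z \<Longrightarrow> a \<in> carrier (vgrp \<A> u) \<Longrightarrow> act u z a = z \<Longrightarrow> a = \<one>\<^bsub>vgrp \<A> u\<^esub>"
  shows "free_group (generated_subgroup \<A> Ws)"
proof -
  interpret group "Bass \<A>" by (rule group_Bass)
  obtain \<iota> \<alpha> E where \<iota>: "inj_on \<iota> (verts \<Gamma>)"
    and \<alpha>: "\<And>u. u \<in> \<V> \<Longrightarrow> free_action (vgrp \<A> u) (UNIV :: nat set) (\<alpha> u)"
    and \<alpha>_act: "\<And>u z a. u \<in> vtypes \<A> v \<Gamma> z \<Longrightarrow> a \<in> carrier (vgrp \<A> u) \<Longrightarrow> \<alpha> u (\<iota> z) a = \<iota> (act u z a)"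
    and E: "\<And>e. e \<in> \<E> \<Longrightarrow> bij (E e)"
    and E_\<alpha>: "\<And>e y h. e \<in> \<E> \<Longrightarrow> h \<in> carrier (egrp \<A> e) \<Longrightarrow>
      E e (\<alpha> (src e) y (imap \<A> e h)) = \<alpha> (tgt e) (E e y) (tmap \<A> e h)"
    and E_T: "\<And>z e z'. (z, Edge e, z') \<in> T \<Longrightarrow> E e (\<iota> z) = \<iota> z'"
    by (rule representation[OF free]) blast+
  define \<iota>' where "\<iota>' = inv_into (verts \<Gamma>) \<iota>"
  have \<iota>'\<iota>: "\<iota>' (\<iota> z) = z" if "z \<in> verts \<Gamma>" for z unfolding \<iota>'_def by (rule inv_into_f_f[OF \<iota> that])

  \<comment> \<open>The representative is chosen from the orbit as a set, so it depends on the orbit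
    only.\<close>
  define r where "r u z = (SOME x. x \<in> act u z ` carrier (vgrp \<A> u))" for u z
  have r_ex: "\<exists>a \<in> carrier (vgrp \<A> u). r u z = act u z a" if "u \<in> vtypes \<A> v \<Gamma> z" for u z
  proof -
    interpret vgrp: group "vgrp \<A> u" by (rule vertex_group[OF vtypes_\<V>[OF that]])
    have "act u z \<one>\<^bsub>vgrp \<A> u\<^esub> \<in> act u z ` carrier (vgrp \<A> u)" by simp
    then have "r u z \<in> act u z ` carrier (vgrp \<A> u)" unfolding r_def by (rule someI)
    then show ?thesis by blast
  qed
  \<comment> \<open>An element that carries \<open>z\<close> to its representative; since the action
    is free, it is unique.\<close>
  define k where "k u z = (SOME a. a \<in> carrier (vgrp \<A> u) \<and> r u z = act u z a)" for u z
  have k: "k u z \<in> carrier (vgrp \<A> u)" "act u z (k u z) = r u z" if "u \<in> vtypes \<A> v \<Gamma> z" for u z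
  proof -
    have "k u z \<in> carrier (vgrp \<A> u) \<and> r u z = act u z (k u z)"
      unfolding k_def by (rule someI_ex) (use r_ex[OF that] in blast)
    then show "k u z \<in> carrier (vgrp \<A> u)" "act u z (k u z) = r u z" by simp_all
  qed
  have r_act: "r u (act u z a) = r u z" if z: "u \<in> vtypes \<A> v \<Gamma> z" and a: "a \<in> carrier (vgrp \<A> u)" for u z a
  proof -
    interpret vgrp: group "vgrp \<A> u" by (rule vertex_group[OF vtypes_\<V>[OF z]])
    have "act u (act u z a) ` carrier (vgrp \<A> u) = act u z ` carrier (vgrp \<A> u)"
    proof (intro equalityI subsetI)
      fix x assume "x \<in> act u (act u z a) ` carrier (vgrp \<A> u)"
      then obtain b where "b \<in> carrier (vgrp \<A> u)" "x = act u (act u z a) b" by blast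
      then show "x \<in> act u z ` carrier (vgrp \<A> u)" using act_mult[OF z a] a by auto
    next
      fix x assume "x \<in> act u z ` carrier (vgrp \<A> u)"
      then obtain b where b: "b \<in> carrier (vgrp \<A> u)" "x = act u z b" by blast
      then have "x = act u (act u z a) (inv\<^bsub>vgrp \<A> u\<^esub> a \<otimes>\<^bsub>vgrp \<A> u\<^esub> b)"
        using act_mult[OF z a, of "inv\<^bsub>vgrp \<A> u\<^esub> a \<otimes>\<^bsub>vgrp \<A> u\<^esub> b"] a by (simp flip: vgrp.m_assoc)
      then show "x \<in> act u (act u z a) ` carrier (vgrp \<A> u)" using a b by blast
    qed
    then show ?thesis by (simp add: r_def)
  qed
  have r_type: "u \<in> vtypes \<A> v \<Gamma> (r u z)" if "u \<in> vtypes \<A> v \<Gamma> z" for u z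
    using act_type[OF that k(1)[OF that]] k(2)[OF that] by simp
  have rr: "r u (r u z) = r u z" if "u \<in> vtypes \<A> v \<Gamma> z" for u z
    using r_act[OF that k(1)[OF that]] k(2)[OF that] by simp

  \<comment> \<open>An edge with label \<open>e\<close> is identified with its tail;
    \<open>q e z\<close> is the tail of the representative in the orbit under the edge
    group.\<close>
  define q where "q e z = (SOME x. x \<in> (\<lambda>h. act (src e) z (imap \<A> e h)) ` carrier (egrp \<A> e))" for e z
  have q_ex: "\<exists>h \<in> carrier (egrp \<A> e). q e z = act (src e) z (imap \<A> e h)" if "e \<in> \<E>" for e z
  proof -
    interpret egrp: group "egrp \<A> e" by (rule edge_group[OF that])
    have "act (src e) z (imap \<A> e \<one>\<^bsub>egrp \<A> e\<^esub>) \<in> (\<lambda>h. act (src e) z (imap \<A> e h)) ` carrier (egrp \<A> e)" by simp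
    then have "q e z \<in> (\<lambda>h. act (src e) z (imap \<A> e h)) ` carrier (egrp \<A> e)" unfolding q_def by (rule someI)
    then show ?thesis by blast
  qed
  have q_act: "q e (act (src e) z (imap \<A> e h)) = q e z"
    if z: "src e \<in> vtypes \<A> v \<Gamma> z" and e: "e \<in> \<E>" and h: "h \<in> carrier (egrp \<A> e)" for e z h
  proof -
    interpret egrp: group "egrp \<A> e" by (rule edge_group[OF e])
    interpret i: group_hom "egrp \<A> e" "vgrp \<A> (src e)" "imap \<A> e"
      using imap_mon[OF e] edge_group[OF e] vertex_group[of "src e"] e
      by (simp add: group_hom_def group_hom_axioms_def mon_def)
    have m: "act (src e) (act (src e) z (imap \<A> e h)) (imap \<A> e j) = act (src e) z (imap \<A> e (h \<otimes>\<^bsub>egrp \<A> e\<^esub> j))"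
      if "j \<in> carrier (egrp \<A> e)" for j
      using act_mult[OF z, of "imap \<A> e h" "imap \<A> e j"] e h that by simp
    have "(\<lambda>j. act (src e) (act (src e) z (imap \<A> e h)) (imap \<A> e j)) ` carrier (egrp \<A> e) =
        (\<lambda>j. act (src e) z (imap \<A> e j)) ` carrier (egrp \<A> e)"
    proof (intro equalityI subsetI)
      fix x assume "x \<in> (\<lambda>j. act (src e) (act (src e) z (imap \<A> e h)) (imap \<A> e j)) ` carrier (egrp \<A> e)"
      then obtain j where "j \<in> carrier (egrp \<A> e)" "x = act (src e) (act (src e) z (imap \<A> e h)) (imap \<A> e j)" by blast
      then show "x \<in> (\<lambda>j. act (src e) z (imap \<A> e j)) ` carrier (egrp \<A> e)"
        using m h by (intro image_eqI[of _ _ "h \<otimes>\<^bsub>egrp \<A> e\<^esub> j"]) (simp_all del: i.hom_mult)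
    next
      fix x assume "x \<in> (\<lambda>j. act (src e) z (imap \<A> e j)) ` carrier (egrp \<A> e)"
      then obtain j where j: "j \<in> carrier (egrp \<A> e)" "x = act (src e) z (imap \<A> e j)" by blast
      have "h \<otimes>\<^bsub>egrp \<A> e\<^esub> (inv\<^bsub>egrp \<A> e\<^esub> h \<otimes>\<^bsub>egrp \<A> e\<^esub> j) = j" using h j by (simp flip: egrp.m_assoc)
      then have "x = act (src e) (act (src e) z (imap \<A> e h)) (imap \<A> e (inv\<^bsub>egrp \<A> e\<^esub> h \<otimes>\<^bsub>egrp \<A> e\<^esub> j))"
        using m[of "inv\<^bsub>egrp \<A> e\<^esub> h \<otimes>\<^bsub>egrp \<A> e\<^esub> j"] h j by (simp del: i.hom_mult)
      then show "x \<in> (\<lambda>j. act (src e) (act (src e) z (imap \<A> e h)) (imap \<A> e j)) ` carrier (egrp \<A> e)"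
        using h j(1) by blast
    qed
    then show ?thesis by (simp add: q_def)
  qed
  define t where "t e z = (THE z'. (z, Edge e, z') \<in> T)" for e z
  have t: "t e z = z'" if "(z, Edge e, z') \<in> T" for e z z'
    unfolding t_def using that deterministic_T unfolding deterministic_def by blast
  have q_T: "(q e z, Edge e, t e (q e z)) \<in> T" if z: "(z, Edge e, z') \<in> T" for e z z'
  proof -
    obtain h where h: "h \<in> carrier (egrp \<A> e)" "q e z = act (src e) z (imap \<A> e h)"
      using q_ex[OF edge_types(1)[OF z]] by blast
    then show ?thesis using edge_act[OF z h(1)] t by simp
  qed
  have qq: "q e (q e z) = q e z" if z: "(z, Edge e, z') \<in> T" for e z z'
    using q_ex[OF edge_types(1)[OF z], of z] q_act[OF edge_types(2)[OF z] edge_types(1)[OF z]] by metis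

  \<comment> \<open>A vertex that is its own representative gets no connecting edge; by freeness its
    \<open>k u z\<close> is trivial, so the empty path has the right value.\<close>
  define M where "M = Inl ` {(u, z). u \<in> vtypes \<A> v \<Gamma> z \<and> z \<noteq> r u z} \<union>
    Inr ` {(e, z). (\<exists>z'. (z, Edge e, z') \<in> T) \<and> q e z = z}"
  define s :: "('v \<times> ('v, 'e, 'g, 'h, 's) folded_vertex) + ('e \<times> ('v, 'e, 'g, 'h, 's) folded_vertex) \<Rightarrow> nat" where "s = case_sum (\<lambda>(u, z). \<iota> z) (\<lambda>(e, z). \<iota> z)"
  define s' :: "('v \<times> ('v, 'e, 'g, 'h, 's) folded_vertex) + ('e \<times> ('v, 'e, 'g, 'h, 's) folded_vertex) \<Rightarrow> nat" where "s' = case_sum (\<lambda>(u, z). \<iota> (r u z)) (\<lambda>(e, z). \<iota> (t e z))"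
  define lam :: "('v \<times> ('v, 'e, 'g, 'h, 's) folded_vertex) + ('e \<times> ('v, 'e, 'g, 'h, 's) folded_vertex) \<Rightarrow> _"
    where "lam = case_sum (\<lambda>(u, z). vel u (k u z)) (\<lambda>(e, z). ev \<A> [(Edge e, True)])"
  define S where "S = (\<lambda>m. (s m, m, s' m)) ` M"
  let ?n = "\<iota> (base \<Gamma>)"
  let ?v = "word_val (Bass \<A>) lam"
  have M_cases: thesis if "m \<in> M"
    "\<And>u z. m = Inl (u, z) \<Longrightarrow> u \<in> vtypes \<A> v \<Gamma> z \<Longrightarrow> z \<noteq> r u z \<Longrightarrow> thesis"
    "\<And>e z. m = Inr (e, z) \<Longrightarrow> (z, Edge e, t e z) \<in> T \<Longrightarrow> q e z = z \<Longrightarrow> thesis" for m thesis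
    using that t unfolding M_def by force
  have lam: "lam m \<in> carrier (Bass \<A>)" if "m \<in> M" for m
    using that by (rule M_cases) (auto simp: lam_def intro!: vel_in k(1) dest: vtypes_\<V> edge_types(1))
  have S_words: "W \<in> words M" if "reads S x W y" for x W y
    by (rule reads_words[OF that]) (auto simp: S_def)
  have v_append: "?v (U @ W) = ?v U \<otimes>\<^bsub>Bass \<A>\<^esub> ?v W" if "U \<in> words M" "W \<in> words M" for U W
    by (rule word_val_append[OF lam that])
  have v_inv: "?v (word_inv W) = inv\<^bsub>Bass \<A>\<^esub> (?v W)" if "W \<in> words M" for W
    by (rule word_val_inv[OF lam that])

  have to_rep: "\<exists>W. reads S (\<iota> z) W (\<iota> (r u z)) \<and> ?v W = vel u (k u z)" if z: "u \<in> vtypes \<A> v \<Gamma> z" for u z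
  proof (cases "z = r u z")
    case True
    then have "k u z = \<one>\<^bsub>vgrp \<A> u\<^esub>" using free[OF z k(1)[OF z]] k(2)[OF z] by simp
    then have "vel u (k u z) = \<one>\<^bsub>Bass \<A>\<^esub>" using group_hom.hom_one[OF group_hom_vel[OF vtypes_\<V>[OF z]]] by simp
    then show ?thesis using True by (intro exI[of _ "[]"]) simp
  next
    case False
    then have m: "Inl (u, z) \<in> M" using z by (auto simp: M_def)
    then have "(\<iota> z, Inl (u, z), \<iota> (r u z)) \<in> S" by (force simp: S_def s_def s'_def)
    moreover have "?v [(Inl (u, z), True)] = vel u (k u z)" using lam[OF m] by (simp add: lam_def)
    ultimately show ?thesis by (intro exI[of _ "[(Inl (u, z), True)]"]) simp
  qed
  \<comment> \<open>The path goes to the common representative and returns. Freeness gives it the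
    value \<open>vel u a\<close>: it forces \<open>k u z\<close> to be the product of
    \<open>a\<close> and the corresponding element for the translate.\<close>
  have in_orbit: "\<exists>W. reads S (\<iota> z) W (\<iota> (act u z a)) \<and> ?v W = vel u a"
    if z: "u \<in> vtypes \<A> v \<Gamma> z" and a: "a \<in> carrier (vgrp \<A> u)" for u z a
  proof -
    have u: "u \<in> \<V>" by (rule vtypes_\<V>[OF z])
    interpret vel: group_hom "vgrp \<A> u" "Bass \<A>" "vel u" by (rule group_hom_vel[OF u])
    note za = act_type[OF z a]
    note k1 = k(1)[OF z] and k2 = k(1)[OF za]
    have "act u z (k u z) = act u z (a \<otimes>\<^bsub>vgrp \<A> u\<^esub> k u (act u z a))"
      using k(2)[OF z] k(2)[OF za] r_act[OF z a] act_mult[OF z a k2] by simp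
    then have "act u z (k u z \<otimes>\<^bsub>vgrp \<A> u\<^esub> inv\<^bsub>vgrp \<A> u\<^esub> (a \<otimes>\<^bsub>vgrp \<A> u\<^esub> k u (act u z a))) = z"
      using act_mult[OF z k1, of "inv\<^bsub>vgrp \<A> u\<^esub> (a \<otimes>\<^bsub>vgrp \<A> u\<^esub> k u (act u z a))"]
        act_mult[OF z, of "a \<otimes>\<^bsub>vgrp \<A> u\<^esub> k u (act u z a)" "inv\<^bsub>vgrp \<A> u\<^esub> (a \<otimes>\<^bsub>vgrp \<A> u\<^esub> k u (act u z a))"]
        a k2 act_one[OF z] by simp
    then have "k u z \<otimes>\<^bsub>vgrp \<A> u\<^esub> inv\<^bsub>vgrp \<A> u\<^esub> (a \<otimes>\<^bsub>vgrp \<A> u\<^esub> k u (act u z a)) = \<one>\<^bsub>vgrp \<A> u\<^esub>"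
      using k1 k2 a by (intro free[OF z]) simp_all
    then have "k u z = a \<otimes>\<^bsub>vgrp \<A> u\<^esub> k u (act u z a)"
      using k1 k2 a by (metis vel.G.inv_equality vel.G.inv_inv vel.G.inv_closed vel.G.m_closed)
    then have eq: "vel u (k u z) \<otimes>\<^bsub>Bass \<A>\<^esub> inv\<^bsub>Bass \<A>\<^esub> vel u (k u (act u z a)) = vel u a"
      using k1 k2 a u by (simp add: m_assoc)
    obtain U V where U: "reads S (\<iota> z) U (\<iota> (r u z))" "?v U = vel u (k u z)"
      and V: "reads S (\<iota> (act u z a)) V (\<iota> (r u z))" "?v V = vel u (k u (act u z a))"
      using to_rep[OF z] to_rep[OF za] r_act[OF z a] by auto
    have "reads S (\<iota> z) (U @ word_inv V) (\<iota> (act u z a))"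
      using U(1) V(1) unfolding reads_append reads_word_inv by blast
    moreover have "?v (U @ word_inv V) = vel u a"
      using S_words[OF U(1)] S_words[OF V(1)] U(2) V(2) eq by (simp add: v_append v_inv)
    ultimately show ?thesis by blast
  qed
  have T_step: "\<exists>W. reads S (\<iota> z) W (\<iota> z') \<and> ?v W = ev \<A> [(l, True)]" if T: "(z, l, z') \<in> T" for z l z'
  proof (cases l)
    case (Gen g)
    then obtain u where u: "u \<in> \<V>" "g \<in> gset u" "u \<in> vtypes \<A> v \<Gamma> z" "z' = act u z (gval \<A> g)"
      using gen_types[of z g z'] T by metis
    have "ev \<A> [(l, True)] = vel u (gval \<A> g)"
      using ev_gen_word[OF u(1), of "[(g, True)]"] u(1,2) gval_in[OF u(1,2)] vertex_group[OF u(1)] Gen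
      by (simp add: group.is_monoid monoid.r_one)
    then show ?thesis using in_orbit[OF u(3) gval_in[OF u(1,2)]] u(4) by simp
  next
    case (Edge e)
    have T: "(z, Edge e, z') \<in> T" using T Edge by simp
    note et = edge_types[OF T]
    \<comment> \<open>The edge is replaced by the representative of its orbit, reached by moving
      both ends by the images of \<open>h\<close>; the edge relation shows that the value is
      unchanged.\<close>
    obtain h where h: "h \<in> carrier (egrp \<A> e)" "q e z = act (src e) z (imap \<A> e h)"
      using q_ex[OF et(1)] by blast
    have qz: "(q e z, Edge e, act (tgt e) z' (tmap \<A> e h)) \<in> T" using edge_act[OF T h(1)] h(2) by simp
    then have tq: "t e (q e z) = act (tgt e) z' (tmap \<A> e h)" by (rule t)
    have i: "imap \<A> e h \<in> carrier (vgrp \<A> (src e))" and tm: "tmap \<A> e h \<in> carrier (vgrp \<A> (tgt e))"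
      using et(1) h(1) by simp_all
    have m: "Inr (e, q e z) \<in> M" using qz qq[OF T] by (auto simp: M_def)
    then have "(\<iota> (q e z), Inr (e, q e z), \<iota> (t e (q e z))) \<in> S" by (force simp: S_def s_def s'_def)
    then have B: "reads S (\<iota> (q e z)) [(Inr (e, q e z), True)] (\<iota> (t e (q e z)))" by simp
    have vB: "?v [(Inr (e, q e z), True)] = ev \<A> [(Edge e, True)]" using lam[OF m] by (simp add: lam_def)
    obtain A where A: "reads S (\<iota> z) A (\<iota> (q e z))" "?v A = vel (src e) (imap \<A> e h)"
      using in_orbit[OF et(2) i] h(2) by auto
    obtain C where C: "reads S (\<iota> z') C (\<iota> (t e (q e z)))" "?v C = vel (tgt e) (tmap \<A> e h)"
      using in_orbit[OF et(3) tm] tq by auto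
    have "reads S (\<iota> z) (A @ [(Inr (e, q e z), True)] @ word_inv C) (\<iota> z')"
      using A(1) B C(1) unfolding reads_append reads_word_inv by blast
    moreover have "?v (A @ [(Inr (e, q e z), True)] @ word_inv C) = ev \<A> [(Edge e, True)]"
    proof -
      have c: "vel (tgt e) (tmap \<A> e h) \<in> carrier (Bass \<A>)" "vel (src e) (imap \<A> e h) \<in> carrier (Bass \<A>)"
        "ev \<A> [(Edge e, True)] \<in> carrier (Bass \<A>)" using i tm et(1) by simp_all
      have "?v (A @ [(Inr (e, q e z), True)] @ word_inv C) =
          vel (src e) (imap \<A> e h) \<otimes>\<^bsub>Bass \<A>\<^esub> ev \<A> [(Edge e, True)] \<otimes>\<^bsub>Bass \<A>\<^esub> inv\<^bsub>Bass \<A>\<^esub> vel (tgt e) (tmap \<A> e h)"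
        using S_words[OF A(1)] S_words[OF B] S_words[OF C(1)] A(2) vB C(2) c
        by (simp add: v_append v_inv m_assoc del: append_Cons append_Nil word_val.simps)
      then show ?thesis using edge_relation[OF et(1) h(1)] c by (simp add: m_assoc)
    qed
    ultimately show ?thesis using Edge by blast
  qed
  have T_walk: "\<exists>W. reads S (\<iota> z) W (\<iota> z') \<and> ?v W = ev \<A> U" if "reads T z U z'" for z U z'
    using that
  proof (induction U arbitrary: z)
    case Nil
    then show ?case by (intro exI[of _ "[]"]) (simp add: ev_Nil)
  next
    case (Cons l U)
    obtain x b where l: "l = (x, b)" by (cases l)
    from Cons(2) obtain y where y: "(if b then (z, x, y) else (y, x, z)) \<in> T" "reads T y U z'"
      using l by (cases b) auto
    have x: "x \<in> \<X>" using y(1) T_labels by (cases b) auto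
    have "\<exists>W. reads S (\<iota> z) W (\<iota> y) \<and> ?v W = ev \<A> [l]"
    proof (cases b)
      case True
      then show ?thesis using T_step[of z x y] y(1) l by simp
    next
      case False
      then obtain W where W: "reads S (\<iota> y) W (\<iota> z)" "?v W = ev \<A> [(x, True)]"
        using T_step[of y x z] y(1) by auto
      then have "reads S (\<iota> z) (word_inv W) (\<iota> y)" by (simp add: reads_word_inv)
      moreover have "?v (word_inv W) = ev \<A> [l]"
        using v_inv[OF S_words[OF W(1)]] W(2) ev_inv[of "[(x, True)]"] x False l by simp
      ultimately show ?thesis by blast
    qed
    then obtain W where W: "reads S (\<iota> z) W (\<iota> y)" "?v W = ev \<A> [l]" by blast
    obtain W' where W': "reads S (\<iota> y) W' (\<iota> z')" "?v W' = ev \<A> U" using Cons(1)[OF y(2)] by blast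
    have "reads S (\<iota> z) (W @ W') (\<iota> z')" using W(1) W'(1) unfolding reads_append by blast
    moreover have "?v (W @ W') = ev \<A> (l # U)"
      using v_append[OF S_words[OF W(1)] S_words[OF W'(1)]] W(2) W'(2) ev_append[of "[l]" U] x l reads_\<X>[OF y(2)]
      by simp
    ultimately show ?case by blast
  qed
  \<comment> \<open>Conversely, each edge of the auxiliary graph is matched by a path of the folded
    graph with the same value, so both graphs have the same values of loops at the base
    point.\<close>
  have S_step: "\<exists>z' U. s' m = \<iota> z' \<and> reads T z U z' \<and> z' \<in> verts \<Gamma> \<and> lam m = ev \<A> U"
    if "m \<in> M" "s m = \<iota> z" "z \<in> verts \<Gamma>" for m z
    using that(1)
  proof (rule M_cases)
    fix u z0 assume m: "m = Inl (u, z0)" and z0: "u \<in> vtypes \<A> v \<Gamma> z0"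
    then have "z0 = z" using inj_onD[OF \<iota> _ type_verts[OF z0] that(3)] that(2) by (simp add: s_def)
    obtain W where W: "W \<in> words (gset u)" "val u W = k u z0" using val_surj[OF vtypes_\<V>[OF z0] k(1)[OF z0]] by blast
    have "reads T z0 (gen_word W) (r u z0)" using act_reads[OF z0 W(1)] W(2) k(2)[OF z0] by simp
    then show ?thesis using m \<open>z0 = z\<close> W ev_gen_word[OF vtypes_\<V>[OF z0] W(1)] type_verts[OF r_type[OF z0]]
      by (auto simp: s'_def lam_def)
  next
    fix e z0 assume m: "m = Inr (e, z0)" and z0: "(z0, Edge e, t e z0) \<in> T"
    then have "z0 = z" using inj_onD[OF \<iota> _ _ that(3), of z0] that(2) T_wf[OF z0] by (simp add: s_def)
    then show ?thesis using m z0 T_wf[OF z0]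
      by (intro exI[of _ "t e z0"] exI[of _ "[(Edge e, True)]"]) (simp add: s'_def lam_def)
  qed
  have S_step': "\<exists>z' U. s m = \<iota> z' \<and> reads T z U z' \<and> z' \<in> verts \<Gamma> \<and> inv\<^bsub>Bass \<A>\<^esub> lam m = ev \<A> U"
    if m: "m \<in> M" "s' m = \<iota> z" "z \<in> verts \<Gamma>" for m z
  proof -
    have "\<exists>z0 \<in> verts \<Gamma>. s m = \<iota> z0"
      using m(1) type_verts T_wf by (elim M_cases) (auto simp: s_def)
    then obtain z0 where z0: "z0 \<in> verts \<Gamma>" "s m = \<iota> z0" by blast
    obtain z' U where U: "s' m = \<iota> z'" "reads T z0 U z'" "z' \<in> verts \<Gamma>" "lam m = ev \<A> U"
      using S_step[OF m(1) z0(2,1)] by blast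
    have "z' = z" using inj_onD[OF \<iota> _ U(3) m(3)] U(1) m(2) by simp
    then have "reads T z (word_inv U) z0" using U(2) by (simp add: reads_word_inv)
    then show ?thesis using z0 U(4) ev_inv[OF reads_\<X>[OF U(2)]] by (intro exI[of _ z0] exI[of _ "word_inv U"]) simp
  qed
  have S_walk: "\<exists>z' U. y = \<iota> z' \<and> z' \<in> verts \<Gamma> \<and> reads T z U z' \<and> ?v W = ev \<A> U"
    if "reads S (\<iota> z) W y" "z \<in> verts \<Gamma>" for z W y
    using that
  proof (induction W arbitrary: z)
    case Nil
    then show ?case by (intro exI[of _ z] exI[of _ "[]"]) (simp add: ev_Nil)
  next
    case (Cons l W)
    obtain m b where l: "l = (m, b)" by (cases l)
    from Cons(2) obtain x where x: "(if b then (\<iota> z, m, x) else (x, m, \<iota> z)) \<in> S" "reads S x W y"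
      using l by (cases b) auto
    have "\<exists>z' U. x = \<iota> z' \<and> reads T z U z' \<and> z' \<in> verts \<Gamma> \<and> (if b then lam m else inv\<^bsub>Bass \<A>\<^esub> lam m) = ev \<A> U"
    proof (cases b)
      case True
      then have "m \<in> M" "s m = \<iota> z" "x = s' m" using x(1) by (auto simp: S_def)
      then show ?thesis using S_step[of m z] Cons(3) True by simp
    next
      case False
      then have "m \<in> M" "s' m = \<iota> z" "x = s m" using x(1) by (auto simp: S_def)
      then show ?thesis using S_step'[of m z] Cons(3) False by simp
    qed
    then obtain z1 U where U: "x = \<iota> z1" "reads T z U z1" "z1 \<in> verts \<Gamma>"
      "(if b then lam m else inv\<^bsub>Bass \<A>\<^esub> lam m) = ev \<A> U" by blast
    obtain z' V where V: "y = \<iota> z'" "z' \<in> verts \<Gamma>" "reads T z1 V z'" "?v W = ev \<A> V"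
      using Cons(1)[of z1] x(2) U(1,3) by blast
    have "reads T z (U @ V) z'" using U(2) V(3) unfolding reads_append by blast
    moreover have "?v (l # W) = ev \<A> (U @ V)"
      using U(4) V(4) l ev_append[OF reads_\<X>[OF U(2)] reads_\<X>[OF V(3)]] by simp
    ultimately show ?case using V(1,2) by blast
  qed
  have loops: "{?v W | W. reads S ?n W ?n} = H"
  proof (intro equalityI subsetI)
    fix x assume "x \<in> {?v W | W. reads S ?n W ?n}"
    then obtain W where W: "x = ?v W" "reads S ?n W ?n" by blast
    obtain z' U where U: "?n = \<iota> z'" "z' \<in> verts \<Gamma>" "reads T (base \<Gamma>) U z'" "?v W = ev \<A> U"
      using S_walk[OF W(2) base_in] by blast
    have "base \<Gamma> = z'" using inj_onD[OF \<iota> U(1) base_in U(2)] .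
    then show "x \<in> H" using loop_in_H U(3,4) W(1) by simp
  next
    fix x assume "x \<in> H"
    then obtain U where "reads T (base \<Gamma>) U (base \<Gamma>)" "x = ev \<A> U" using H_loop by blast
    then show "x \<in> {?v W | W. reads S ?n W ?n}" using T_walk by blast
  qed
  have "free_group ((Bass \<A>)\<lparr>carrier := {?v W | W. reads S ?n W ?n}\<rparr>)"
    unfolding S_def
  proof (rule free_group_loops[OF group_Bass lam])
    fix m assume "m \<in> M"
    then have "\<exists>z \<in> verts \<Gamma>. s m = \<iota> z"
      using type_verts T_wf by (elim M_cases) (auto simp: s_def)
    then obtain z where z: "z \<in> verts \<Gamma>" "s m = \<iota> z" by blast
    then obtain U where "reads T (base \<Gamma>) U z" using connected_\<Gamma> unfolding connected_graph_def by blast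
    from T_walk[OF this] show "\<exists>W. reads ((\<lambda>m. (s m, m, s' m)) ` M) ?n W (s m)"
      unfolding S_def z(2) by blast
  next
    fix I :: "(('v \<times> ('v, 'e, 'g, 'h, 's) folded_vertex) + ('e \<times> ('v, 'e, 'g, 'h, 's) folded_vertex)) set" and c
    assume c: "\<And>m. m \<in> M \<Longrightarrow> c m \<in> carrier (pres_group I {})"
    let ?K = "pres_group I {}"
    interpret K: group ?K by (rule group_pres_group)
    \<comment> \<open>Since \<open>\<kappa>\<close> is one at representatives, its coboundary on the
      connection from \<open>z\<close> to its representative is the prescribed value. The equation
      for a representative edge is then solved for \<open>\<delta>\<close>, which is constant on
      edge group orbits because it is defined through \<open>q\<close>.\<close>
    define \<kappa> where "\<kappa> u y = (if y \<in> \<iota> ` {z. u \<in> vtypes \<A> v \<Gamma> z \<and> z \<noteq> r u z} then c (Inl (u, \<iota>' y)) else \<one>\<^bsub>?K\<^esub>)" for u y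
    define \<delta> where "\<delta> e y = (if y \<in> \<iota> ` {z. \<exists>z'. (z, Edge e, z') \<in> T}
      then let z = q e (\<iota>' y) in inv\<^bsub>?K\<^esub> (\<kappa> (src e) (\<iota> z)) \<otimes>\<^bsub>?K\<^esub> c (Inr (e, z)) \<otimes>\<^bsub>?K\<^esub> \<kappa> (tgt e) (\<iota> (t e z))
      else \<one>\<^bsub>?K\<^esub>)" for e y
    have \<kappa>: "\<kappa> u y \<in> carrier ?K" for u y
    proof -
      have "c (Inl (u, \<iota>' y)) \<in> carrier ?K" if y: "y \<in> \<iota> ` {z. u \<in> vtypes \<A> v \<Gamma> z \<and> z \<noteq> r u z}"
      proof -
        obtain z where z: "y = \<iota> z" "u \<in> vtypes \<A> v \<Gamma> z" "z \<noteq> r u z" using y by blast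
        then have "\<iota>' y = z" using \<iota>'\<iota> type_verts by simp
        then show ?thesis using z by (intro c) (auto simp: M_def)
      qed
      then show ?thesis by (simp add: \<kappa>_def)
    qed
    have \<delta>: "\<delta> e y \<in> carrier ?K" for e y
    proof -
      have "c (Inr (e, q e (\<iota>' y))) \<in> carrier ?K" if y: "y \<in> \<iota> ` {z. \<exists>z'. (z, Edge e, z') \<in> T}"
      proof -
        obtain z z' where z: "y = \<iota> z" "(z, Edge e, z') \<in> T" using y by blast
        then have "\<iota>' y = z" using \<iota>'\<iota> T_wf by simp
        then show ?thesis using q_T[OF z(2)] qq[OF z(2)] by (intro c) (auto simp: M_def)
      qed
      then show ?thesis using \<kappa> by (simp add: \<delta>_def Let_def)
    qed
    have \<delta>_\<alpha>: "\<delta> e (\<alpha> (src e) y (imap \<A> e h)) = \<delta> e y" if e: "e \<in> \<E>" and h: "h \<in> carrier (egrp \<A> e)" for e y h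
    proof -
      have im: "\<alpha> (src e) (\<iota> z) (imap \<A> e h) = \<iota> (act (src e) z (imap \<A> e h))"
        if "(z, Edge e, z') \<in> T" "h \<in> carrier (egrp \<A> e)" for z z' h
        using \<alpha>_act[OF edge_types(2)[OF that(1)]] e that(2) by simp
      have inv: "\<alpha> (src e) y (imap \<A> e h) \<in> \<iota> ` {z. \<exists>z'. (z, Edge e, z') \<in> T}"
        if y: "y \<in> \<iota> ` {z. \<exists>z'. (z, Edge e, z') \<in> T}" and h: "h \<in> carrier (egrp \<A> e)" for y h
      proof -
        obtain z z' where z: "y = \<iota> z" "(z, Edge e, z') \<in> T" using y by blast
        show ?thesis unfolding z(1) im[OF z(2) h] using edge_act[OF z(2) h] by blast
      qed
      show ?thesis
      proof (cases "y \<in> \<iota> ` {z. \<exists>z'. (z, Edge e, z') \<in> T}")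
        case True
        then obtain z z' where z: "y = \<iota> z" "(z, Edge e, z') \<in> T" by blast
        have e1: "\<iota>' y = z" using z \<iota>'\<iota> T_wf by simp
        have e2: "\<iota>' (\<alpha> (src e) y (imap \<A> e h)) = act (src e) z (imap \<A> e h)"
          unfolding z(1) im[OF z(2) h] using T_wf[OF edge_act[OF z(2) h]] by (intro \<iota>'\<iota>) simp
        have "q e (\<iota>' (\<alpha> (src e) y (imap \<A> e h))) = q e (\<iota>' y)"
          unfolding e1 e2 by (rule q_act[OF edge_types(2)[OF z(2)] e h])
        then show ?thesis using True inv[OF True h] by (simp add: \<delta>_def)
      next
        \<comment> \<open>Acting by the inverse element shows that the complement is invariant as
          well.\<close>
        case False
        interpret egrp: group "egrp \<A> e" by (rule edge_group[OF e])
        interpret i: group_hom "egrp \<A> e" "vgrp \<A> (src e)" "imap \<A> e"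
          using imap_mon[OF e] edge_group[OF e] vertex_group[of "src e"] e
          by (simp add: group_hom_def group_hom_axioms_def mon_def)
        have "\<alpha> (src e) (\<alpha> (src e) y (imap \<A> e h)) (imap \<A> e (inv\<^bsub>egrp \<A> e\<^esub> h)) = y"
          using free_actionD[OF \<alpha>[OF src_in[OF e]], of y] h e by simp
        then have "\<alpha> (src e) y (imap \<A> e h) \<notin> \<iota> ` {z. \<exists>z'. (z, Edge e, z') \<in> T}"
          using inv[of "\<alpha> (src e) y (imap \<A> e h)" "inv\<^bsub>egrp \<A> e\<^esub> h"] False h by auto
        then show ?thesis using False by (simp add: \<delta>_def)
      qed
    qed
    obtain \<Psi> where \<Psi>: "\<Psi> \<in> hom (Bass \<A>) (wreath ?K)"
      and \<Psi>_vel: "\<And>u a. u \<in> \<V> \<Longrightarrow> a \<in> carrier (vgrp \<A> u) \<Longrightarrow>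
        \<Psi> (vel u a) = (\<lambda>y. \<alpha> u y a, \<lambda>y. \<kappa> u y \<otimes>\<^bsub>?K\<^esub> inv\<^bsub>?K\<^esub> (\<kappa> u (\<alpha> u y a)))"
      and \<Psi>_edge: "\<And>e. e \<in> \<E> \<Longrightarrow> \<Psi> (ev \<A> [(Edge e, True)]) =
        (E e, \<lambda>y. \<kappa> (src e) y \<otimes>\<^bsub>?K\<^esub> \<delta> e y \<otimes>\<^bsub>?K\<^esub> inv\<^bsub>?K\<^esub> (\<kappa> (tgt e) (E e y)))"
      by (rule bass_representation[where K = ?K and \<alpha> = \<alpha> and E = E and \<kappa> = \<kappa> and \<delta> = \<delta>])
        (rule group_pres_group \<alpha> E E_\<alpha> \<kappa> \<delta> \<delta>_\<alpha> that | assumption)+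
    have "fst (\<Psi> (lam m)) (s m) = s' m \<and> snd (\<Psi> (lam m)) (s m) = c m" if "m \<in> M" for m
      using that
    proof (rule M_cases)
      fix u z assume m: "m = Inl (u, z)" and z: "u \<in> vtypes \<A> v \<Gamma> z" "z \<noteq> r u z"
      have u: "u \<in> \<V>" by (rule vtypes_\<V>[OF z(1)])
      have "\<kappa> u (\<iota> z) = c m" using m z \<iota>'\<iota>[OF type_verts[OF z(1)]] by (auto simp: \<kappa>_def)
      moreover have "\<iota> (r u z) \<notin> \<iota> ` {x. u \<in> vtypes \<A> v \<Gamma> x \<and> x \<noteq> r u x}"
      proof
        assume "\<iota> (r u z) \<in> \<iota> ` {x. u \<in> vtypes \<A> v \<Gamma> x \<and> x \<noteq> r u x}"
        then obtain x where x: "\<iota> (r u z) = \<iota> x" "u \<in> vtypes \<A> v \<Gamma> x" "x \<noteq> r u x" by blast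
        have "r u z = x" by (rule inj_onD[OF \<iota> x(1) type_verts[OF r_type[OF z(1)]] type_verts[OF x(2)]])
        then show False using x(3) rr[OF z(1)] by simp
      qed
      then have "\<kappa> u (\<iota> (r u z)) = \<one>\<^bsub>?K\<^esub>" by (simp add: \<kappa>_def)
      ultimately show ?thesis
        using m \<Psi>_vel[OF u k(1)[OF z(1)]] \<alpha>_act[OF z(1) k(1)[OF z(1)]] k(2)[OF z(1)] c[OF that]
        by (simp add: lam_def s_def s'_def)
    next
      fix e z assume m: "m = Inr (e, z)" and z: "(z, Edge e, t e z) \<in> T" "q e z = z"
      have e: "e \<in> \<E>" by (rule edge_types(1)[OF z(1)])
      have "\<delta> e (\<iota> z) = inv\<^bsub>?K\<^esub> (\<kappa> (src e) (\<iota> z)) \<otimes>\<^bsub>?K\<^esub> c m \<otimes>\<^bsub>?K\<^esub> \<kappa> (tgt e) (\<iota> (t e z))"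
        using z \<iota>'\<iota>[of z] T_wf[OF z(1)] m by (auto simp: \<delta>_def Let_def)
      then have "\<kappa> (src e) (\<iota> z) \<otimes>\<^bsub>?K\<^esub> \<delta> e (\<iota> z) \<otimes>\<^bsub>?K\<^esub> inv\<^bsub>?K\<^esub> (\<kappa> (tgt e) (\<iota> (t e z))) = c m"
        using c[OF that] \<kappa>[of "src e" "\<iota> z"] \<kappa>[of "tgt e" "\<iota> (t e z)"] by (simp add: K.m_assoc) (simp flip: K.m_assoc)
      then show ?thesis using m \<Psi>_edge[OF e] E_T[OF z(1)] by (simp add: lam_def s_def s'_def)
    qed
    then show "\<exists>\<Psi> \<in> hom (Bass \<A>) (wreath ?K). \<forall>m \<in> M. fst (\<Psi> (lam m)) (s m) = s' m \<and> snd (\<Psi> (lam m)) (s m) = c m"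
      using \<Psi> by blast
  qed
  then show ?thesis unfolding loops by (simp add: generated_subgroup_def)
qed

end

subsection \<open>Components\<close>

context folded_gog
begin

definition comp_rel where
  "comp_rel u = {(x, y). \<exists>s \<in> gset u. (x, Gen s, y) \<in> T \<or> (y, Gen s, x) \<in> T}"

lemma component_sel:
  "verts (component \<Gamma> (gen_letters \<A> u) z) = {y. (z, y) \<in> (comp_rel u)\<^sup>*}"
  "arcs (component \<Gamma> (gen_letters \<A> u) z) =
    {f \<in> arcs \<Gamma>. lab \<Gamma> f \<in> gen_letters \<A> u \<and> (z, tail \<Gamma> f) \<in> (comp_rel u)\<^sup>*}"
  "tail (component \<Gamma> (gen_letters \<A> u) z) = tail \<Gamma>"
  "head (component \<Gamma> (gen_letters \<A> u) z) = head \<Gamma>"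
  "lab (component \<Gamma> (gen_letters \<A> u) z) = lab \<Gamma>"
proof -
  let ?C = "(\<lambda>f. (tail \<Gamma> f, head \<Gamma> f)) ` {f \<in> arcs \<Gamma>. lab \<Gamma> f \<in> gen_letters \<A> u}"
  have "?C \<union> ?C\<inverse> = comp_rel u"
    unfolding comp_rel_def triples_def gen_letters_def by (force simp: image_iff)
  then show "verts (component \<Gamma> (gen_letters \<A> u) z) = {y. (z, y) \<in> (comp_rel u)\<^sup>*}"
    "arcs (component \<Gamma> (gen_letters \<A> u) z) =
      {f \<in> arcs \<Gamma>. lab \<Gamma> f \<in> gen_letters \<A> u \<and> (z, tail \<Gamma> f) \<in> (comp_rel u)\<^sup>*}"
    by (auto simp: component_def Let_def)
qed (simp_all add: component_def Let_def)

text \<open>Edges with labels from \<open>gset u\<close> are the steps of the action by generators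
  and their inverses, so a component is an orbit.\<close>

lemma comp_rel_act:
  assumes z: "u \<in> vtypes \<A> v \<Gamma> z"
  shows "{y. (z, y) \<in> (comp_rel u)\<^sup>*} = act u z ` carrier (vgrp \<A> u)"
proof (intro equalityI subsetI)
  have u: "u \<in> \<V>" by (rule vtypes_\<V>[OF z])
  interpret group "vgrp \<A> u" by (rule vertex_group[OF u])
  have step: "y \<in> act u x ` carrier (vgrp \<A> u)" if xy: "(x, y) \<in> comp_rel u" for x y
  proof -
    obtain s where s: "s \<in> gset u" "(x, Gen s, y) \<in> T \<or> (y, Gen s, x) \<in> T"
      using xy by (auto simp: comp_rel_def)
    note gv = gval_in[OF u s(1)]
    have val: "val u [(s, b)] = (if b then gval \<A> s else inv\<^bsub>vgrp \<A> u\<^esub> gval \<A> s)" for b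
      using gv by simp
    have "u \<in> vtypes \<A> v \<Gamma> x" using s u unfolding vtypes_iff by blast
    then have R: "reads T x (gen_word [(s, b)]) (act u x (val u [(s, b)]))" for b
      using s(1) by (intro act_reads) simp_all
    from s(2) show ?thesis
    proof
      assume "(x, Gen s, y) \<in> T"
      then have "reads T x (gen_word [(s, True)]) y" by simp
      then have "y = act u x (val u [(s, True)])" using R T_det by blast
      then show ?thesis using gv val by simp
    next
      assume "(y, Gen s, x) \<in> T"
      then have "reads T x (gen_word [(s, False)]) y" by simp
      then have "y = act u x (val u [(s, False)])" using R T_det by blast
      then show ?thesis using gv val by simp
    qed
  qed
  fix y assume "y \<in> {y. (z, y) \<in> (comp_rel u)\<^sup>*}"
  then have "(z, y) \<in> (comp_rel u)\<^sup>*" by simp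
  then show "y \<in> act u z ` carrier (vgrp \<A> u)"
  proof induction
    case base
    have "z = act u z \<one>\<^bsub>vgrp \<A> u\<^esub>" using act_one[OF z] by simp
    then show ?case by blast
  next
    case (step y y')
    then obtain a where a: "a \<in> carrier (vgrp \<A> u)" "y = act u z a" by blast
    obtain b where "b \<in> carrier (vgrp \<A> u)" "y' = act u y b" using \<open>\<And>x y. (x, y) \<in> comp_rel u \<Longrightarrow> _\<close> step(2) by blast
    then show ?case using act_mult[OF z a(1)] a by auto
  qed
next
  fix y assume "y \<in> act u z ` carrier (vgrp \<A> u)"
  then obtain W where W: "W \<in> words (gset u)" "y = act u z (val u W)"
    using val_surj[OF vtypes_\<V>[OF z]] by blast
  have "reads T z (gen_word W) y" using act_reads[OF z W(1)] W(2) by simp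
  from this W(1) have "(z, y) \<in> (comp_rel u)\<^sup>*"
  proof (induction W arbitrary: z)
    case (Cons l W)
    obtain s b where l: "l = (s, b)" by (cases l)
    from Cons(2) obtain x where x: "(if b then (z, Gen s, x) else (x, Gen s, z)) \<in> T"
      "reads T x (gen_word W) y" using l by (cases b) auto
    have "s \<in> gset u" using Cons(3) l by simp
    then have "(z, x) \<in> comp_rel u" using x(1) by (cases b) (auto simp: comp_rel_def)
    moreover have "(x, y) \<in> (comp_rel u)\<^sup>*" using Cons(1)[OF x(2)] Cons(3) by simp
    ultimately show ?case by (rule converse_rtrancl_into_rtrancl)
  qed simp
  then show "y \<in> {y. (z, y) \<in> (comp_rel u)\<^sup>*}" by simp
qed

text \<open>With trivial stabiliser the orbit map at \<open>z\<close> is injective, and its inverse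
  is the isomorphism on vertices. Edges correspond because a tail and a label determine an edge of
  the folded graph.\<close>

lemma component_iso:
  assumes z: "u \<in> vtypes \<A> v \<Gamma> z"
    and free: "\<And>a. a \<in> carrier (vgrp \<A> u) \<Longrightarrow> act u z a = z \<Longrightarrow> a = \<one>\<^bsub>vgrp \<A> u\<^esub>"
  shows "lgraph_iso (component \<Gamma> (gen_letters \<A> u) z) (cayley_graph \<A> u)"
proof -
  have u: "u \<in> \<V>" by (rule vtypes_\<V>[OF z])
  interpret group "vgrp \<A> u" by (rule vertex_group[OF u])
  let ?C = "component \<Gamma> (gen_letters \<A> u) z"
  have V: "verts ?C = act u z ` carrier (vgrp \<A> u)" unfolding component_sel comp_rel_act[OF z] ..
  have A: "arcs ?C = {f \<in> arcs \<Gamma>. lab \<Gamma> f \<in> gen_letters \<A> u \<and> tail \<Gamma> f \<in> act u z ` carrier (vgrp \<A> u)}"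
    unfolding component_sel comp_rel_act[OF z, symmetric] by blast
  have inj: "inj_on (act u z) (carrier (vgrp \<A> u))"
  proof (rule inj_onI)
    fix a b assume a: "a \<in> carrier (vgrp \<A> u)" and b: "b \<in> carrier (vgrp \<A> u)" and "act u z a = act u z b"
    then have "act u z (a \<otimes>\<^bsub>vgrp \<A> u\<^esub> inv\<^bsub>vgrp \<A> u\<^esub> b) = z"
      using act_mult[OF z a, of "inv\<^bsub>vgrp \<A> u\<^esub> b"] act_mult[OF z b, of "inv\<^bsub>vgrp \<A> u\<^esub> b"] act_one[OF z] by simp
    then have "a \<otimes>\<^bsub>vgrp \<A> u\<^esub> inv\<^bsub>vgrp \<A> u\<^esub> b = \<one>\<^bsub>vgrp \<A> u\<^esub>" using a b by (intro free) simp_all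
    then show "a = b" using a b by (metis inv_equality inv_inv inv_closed)
  qed
  define \<phi>' where "\<phi>' = inv_into (carrier (vgrp \<A> u)) (act u z)"
  have \<phi>'_act: "\<phi>' (act u z a) = a" if "a \<in> carrier (vgrp \<A> u)" for a
    unfolding \<phi>'_def by (rule inv_into_f_f[OF inj that])
  \<comment> \<open>Only labels of the form \<open>Gen s\<close> occur in the component; the value
    at an edge letter is unspecified.\<close>
  define g where "g l = (case l of Gen s \<Rightarrow> s)" for l :: "('e, 's) letter"
  let ?\<psi> = "\<lambda>f. (\<phi>' (tail \<Gamma> f), g (lab \<Gamma> f))"
  have arc: "\<exists>a s. a \<in> carrier (vgrp \<A> u) \<and> s \<in> gset u \<and> tail \<Gamma> f = act u z a \<and> lab \<Gamma> f = Gen s \<and>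
      head \<Gamma> f = act u z (a \<otimes>\<^bsub>vgrp \<A> u\<^esub> gval \<A> s)" if f: "f \<in> arcs ?C" for f
  proof -
    obtain a s where as: "a \<in> carrier (vgrp \<A> u)" "s \<in> gset u" "tail \<Gamma> f = act u z a" "lab \<Gamma> f = Gen s"
      using f unfolding A by (auto simp: gen_letters_def)
    have "f \<in> arcs \<Gamma>" using f unfolding A by blast
    then have t: "(act u z a, Gen s, head \<Gamma> f) \<in> T"
      unfolding triples_def by (intro image_eqI[of _ _ f]) (simp_all add: as)
    obtain w where w: "w \<in> \<V>" "s \<in> gset w" "head \<Gamma> f = act w (act u z a) (gval \<A> s)"
      by (rule gen_types[OF t])
    have "w = u" by (rule gen_unique[OF w(1) u w(2) as(2)])
    then show ?thesis using as w(3) act_mult[OF z as(1) gval_in[OF u as(2)]] by auto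
  qed
  have bij1: "bij_betw \<phi>' (verts ?C) (verts (cayley_graph \<A> u))"
    unfolding V \<phi>'_def verts_cayley by (rule bij_betw_inv_into) (rule inj_on_imp_bij_betw[OF inj])
  have bij2: "bij_betw ?\<psi> (arcs ?C) (arcs (cayley_graph \<A> u))"
    unfolding bij_betw_def
  proof
    show "inj_on ?\<psi> (arcs ?C)"
    proof (rule inj_onI)
      fix f f' assume f: "f \<in> arcs ?C" and f': "f' \<in> arcs ?C" and eq: "?\<psi> f = ?\<psi> f'"
      obtain a s where as: "a \<in> carrier (vgrp \<A> u)" "tail \<Gamma> f = act u z a" "lab \<Gamma> f = Gen s"
        "head \<Gamma> f = act u z (a \<otimes>\<^bsub>vgrp \<A> u\<^esub> gval \<A> s)" using arc[OF f] by blast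
      obtain a' s' where as': "a' \<in> carrier (vgrp \<A> u)" "tail \<Gamma> f' = act u z a'" "lab \<Gamma> f' = Gen s'"
        "head \<Gamma> f' = act u z (a' \<otimes>\<^bsub>vgrp \<A> u\<^esub> gval \<A> s')" using arc[OF f'] by blast
      have "a = a'" "s = s'" using eq as as' \<phi>'_act by (simp_all add: g_def)
      then show "f = f'" using inj_onD[OF arcs_inj, of f f'] f f' as as' by (simp add: A)
    qed
    show "?\<psi> ` arcs ?C = arcs (cayley_graph \<A> u)"
    proof (intro equalityI subsetI)
      fix x assume "x \<in> ?\<psi> ` arcs ?C"
      then obtain f where f: "f \<in> arcs ?C" "x = ?\<psi> f" by blast
      then show "x \<in> arcs (cayley_graph \<A> u)"
        using arc[OF f(1)] \<phi>'_act by (auto simp: cayley_graph_def g_def)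
    next
      fix x assume "x \<in> arcs (cayley_graph \<A> u)"
      then obtain a s where x: "x = (a, s)" "a \<in> carrier (vgrp \<A> u)" "s \<in> gset u"
        by (auto simp: cayley_graph_def)
      have "reads T (act u z a) (gen_word [(s, True)]) (act u (act u z a) (val u [(s, True)]))"
        using act_type[OF z x(2)] x(3) by (intro act_reads) simp_all
      then obtain y where "(act u z a, Gen s, y) \<in> T" by auto
      then obtain f where f: "f \<in> arcs \<Gamma>" "tail \<Gamma> f = act u z a" "lab \<Gamma> f = Gen s"
        by (auto simp: triples_def)
      have "f \<in> arcs ?C" unfolding A using f x by (simp add: gen_letters_def)
      moreover have "?\<psi> f = x" using f x \<phi>'_act by (simp add: g_def)
      ultimately show "x \<in> ?\<psi> ` arcs ?C" by blast
    qed
  qed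
  show ?thesis
    unfolding lgraph_iso_def
  proof (intro exI conjI ballI)
    fix f assume f: "f \<in> arcs ?C"
    obtain a s where as: "a \<in> carrier (vgrp \<A> u)" "s \<in> gset u" "tail \<Gamma> f = act u z a" "lab \<Gamma> f = Gen s"
      "head \<Gamma> f = act u z (a \<otimes>\<^bsub>vgrp \<A> u\<^esub> gval \<A> s)" using arc[OF f] by blast
    have h: "a \<otimes>\<^bsub>vgrp \<A> u\<^esub> gval \<A> s \<in> carrier (vgrp \<A> u)" using as(1) gval_in[OF u as(2)] by simp
    show "tail (cayley_graph \<A> u) (?\<psi> f) = \<phi>' (tail ?C f)"
      "head (cayley_graph \<A> u) (?\<psi> f) = \<phi>' (head ?C f)"
      "lab (cayley_graph \<A> u) (?\<psi> f) = lab ?C f"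
      using as \<phi>'_act[OF as(1)] \<phi>'_act[OF h]
      unfolding component_sel by (simp_all add: cayley_graph_def g_def)
  qed (fact bij1, fact bij2)
qed

text \<open>The isomorphism may send \<open>z\<close> to any vertex, but at every vertex of a Cayley
  graph a word read along a loop has trivial value, by left cancellation.\<close>

lemma component_iso_free:
  assumes z: "u \<in> vtypes \<A> v \<Gamma> z"
    and iso: "lgraph_iso (component \<Gamma> (gen_letters \<A> u) z) (cayley_graph \<A> u)"
    and a: "a \<in> carrier (vgrp \<A> u)" "act u z a = z"
  shows "a = \<one>\<^bsub>vgrp \<A> u\<^esub>"
proof -
  have u: "u \<in> \<V>" by (rule vtypes_\<V>[OF z])
  interpret group "vgrp \<A> u" by (rule vertex_group[OF u])
  let ?C = "component \<Gamma> (gen_letters \<A> u) z" and ?D = "cayley_graph \<A> u"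
  from iso obtain \<phi>' \<psi> where \<phi>': "bij_betw \<phi>' (verts ?C) (verts ?D)" and \<psi>: "bij_betw \<psi> (arcs ?C) (arcs ?D)"
    and hom: "\<And>f. f \<in> arcs ?C \<Longrightarrow> tail ?D (\<psi> f) = \<phi>' (tail ?C f) \<and> head ?D (\<psi> f) = \<phi>' (head ?C f) \<and>
      lab ?D (\<psi> f) = lab ?C f"
    unfolding lgraph_iso_def by blast
  have tri: "(\<phi>' x, l, \<phi>' y) \<in> triples ?D" if t: "(x, l, y) \<in> triples ?C" for x l y
  proof -
    obtain f where f: "f \<in> arcs ?C" "x = tail ?C f" "l = lab ?C f" "y = head ?C f"
      using t by (auto simp: triples_def)
    then show ?thesis using hom[OF f(1)] bij_betwE[OF \<psi>] unfolding triples_def by force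
  qed
  have T_C: "(x, Gen s, y) \<in> triples ?C"
    if t: "(x, Gen s, y) \<in> T" and "s \<in> gset u" "(z, x) \<in> (comp_rel u)\<^sup>*" for x s y
  proof -
    obtain f where f: "f \<in> arcs \<Gamma>" "tail \<Gamma> f = x" "lab \<Gamma> f = Gen s" "head \<Gamma> f = y"
      using t by (auto simp: triples_def)
    then have "f \<in> arcs ?C" unfolding component_sel using that by (simp add: gen_letters_def)
    then show ?thesis
      unfolding triples_def by (intro image_eqI[of _ _ f]) (simp_all only: component_sel f)
  qed
  have C: "reads (triples ?C) x (gen_word W) y"
    if "reads T x (gen_word W) y" "(z, x) \<in> (comp_rel u)\<^sup>*" "W \<in> words (gset u)" for x W y
    using that
  proof (induction W arbitrary: x)
    case (Cons l W)
    obtain s b where l: "l = (s, b)" by (cases l)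
    from Cons(2) obtain x' where x': "(if b then (x, Gen s, x') else (x', Gen s, x)) \<in> T"
      "reads T x' (gen_word W) y" using l by (cases b) auto
    have s: "s \<in> gset u" using Cons(4) l by auto
    have "(x, x') \<in> comp_rel u" using x'(1) s by (cases b) (auto simp: comp_rel_def)
    then have zx': "(z, x') \<in> (comp_rel u)\<^sup>*" using Cons(3) by simp
    have "(if b then (x, Gen s, x') else (x', Gen s, x)) \<in> triples ?C"
      using x'(1) zx' Cons(3) s T_C by (cases b) simp_all
    moreover have "reads (triples ?C) x' (gen_word W) y" using Cons(1)[OF x'(2) zx'] Cons(4) by simp
    ultimately show ?case using l by (cases b) auto
  qed simp
  obtain W where W: "W \<in> words (gset u)" "val u W = a" using val_surj[OF u a(1)] by blast
  have "reads T z (gen_word W) z" using act_reads[OF z W(1)] W(2) a(2) by simp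
  then have "reads (triples ?C) z (gen_word W) z" by (rule C[OF _ _ W(1)]) simp
  from reads_map[where \<pi> = \<phi>' and T' = "triples ?D", OF this tri]
  have R: "reads (triples ?D) (\<phi>' z) (gen_word W) (\<phi>' z)" .
  have \<phi>z: "\<phi>' z \<in> carrier (vgrp \<A> u)" using bij_betwE[OF \<phi>'] by (auto simp: component_sel)
  have "deterministic (triples ?D)"
    unfolding deterministic_def triples_cayley using gval_in[OF u] by auto
  then have "\<phi>' z = \<phi>' z \<otimes>\<^bsub>vgrp \<A> u\<^esub> a"
    using deterministic_reads[OF _ R reads_cayley[OF u \<phi>z W(1)]] W(2) by simp
  then show ?thesis using l_cancel_one[OF \<phi>z a(1)] by metis
qed

section \<open>Freeness in terms of components and in terms of loops\<close>

theorem free_iff_components: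
  "free_group (generated_subgroup \<A> Ws) \<longleftrightarrow>
    (\<forall>u \<in> \<V>. \<forall>C \<in> vertex_components \<A> v \<Gamma> u. lgraph_iso C (cayley_graph \<A> u))"
proof
  assume "free_group (generated_subgroup \<A> Ws)"
  then show "\<forall>u \<in> \<V>. \<forall>C \<in> vertex_components \<A> v \<Gamma> u. lgraph_iso C (cayley_graph \<A> u)"
    using free_group_stabiliser component_iso unfolding vertex_components_def by blast
next
  assume iso: "\<forall>u \<in> \<V>. \<forall>C \<in> vertex_components \<A> v \<Gamma> u. lgraph_iso C (cayley_graph \<A> u)"
  show "free_group (generated_subgroup \<A> Ws)"
  proof (rule free_group_if_free_actions)
    fix u z a assume z: "u \<in> vtypes \<A> v \<Gamma> z" and a: "a \<in> carrier (vgrp \<A> u)" "act u z a = z"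
    have "component \<Gamma> (gen_letters \<A> u) z \<in> vertex_components \<A> v \<Gamma> u"
      unfolding vertex_components_def using z type_verts[OF z] by blast
    then show "a = \<one>\<^bsub>vgrp \<A> u\<^esub>" using component_iso_free[OF z _ a] iso vtypes_\<V>[OF z] by blast
  qed
qed

text \<open>The form of the criterion that a program can test: one word for each nontrivial element,
  and no reference to types. Types are recovered because a word for a nontrivial element is
  nonempty, and a vertex at which its first letter can be read has type \<open>u\<close>.\<close>

lemma free_iff_no_loop:
  assumes w: "\<And>u a. u \<in> \<V> \<Longrightarrow> a \<in> carrier (vgrp \<A> u) \<Longrightarrow> w u a \<in> words (gset u) \<and> val u (w u a) = a"
  shows "free_group (generated_subgroup \<A> Ws) \<longleftrightarrow>
    (\<forall>z \<in> verts \<Gamma>. \<forall>u \<in> \<V>. \<forall>a \<in> carrier (vgrp \<A> u) - {\<one>\<^bsub>vgrp \<A> u\<^esub>}. \<not> reads T z (gen_word (w u a)) z)"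
proof
  assume free: "free_group (generated_subgroup \<A> Ws)"
  show "\<forall>z \<in> verts \<Gamma>. \<forall>u \<in> \<V>. \<forall>a \<in> carrier (vgrp \<A> u) - {\<one>\<^bsub>vgrp \<A> u\<^esub>}. \<not> reads T z (gen_word (w u a)) z"
  proof (intro ballI notI)
    fix z u a assume u: "u \<in> \<V>" and a: "a \<in> carrier (vgrp \<A> u) - {\<one>\<^bsub>vgrp \<A> u\<^esub>}"
      and R: "reads T z (gen_word (w u a)) z"
    have wa: "w u a \<in> words (gset u)" "val u (w u a) = a" using w u a by blast+
    then have "w u a \<noteq> []" using a by auto
    then obtain l W where l: "w u a = l # W" by (cases "w u a") auto
    then have "fst l \<in> gset u" using wa(1) by (auto simp: mem_Times_iff)
    moreover have "\<exists>y. (z, Gen (fst l), y) \<in> T \<or> (y, Gen (fst l), z) \<in> T"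
      using R l by (auto split: if_splits)
    ultimately have z: "u \<in> vtypes \<A> v \<Gamma> z" unfolding vtypes_iff using u by blast
    have "act u z a = z" using T_det[OF act_reads[OF z wa(1)] R] wa(2) by simp
    then show False using free_group_stabiliser[OF free z] a by blast
  qed
next
  assume no_loop: "\<forall>z \<in> verts \<Gamma>. \<forall>u \<in> \<V>. \<forall>a \<in> carrier (vgrp \<A> u) - {\<one>\<^bsub>vgrp \<A> u\<^esub>}. \<not> reads T z (gen_word (w u a)) z"
  show "free_group (generated_subgroup \<A> Ws)"
  proof (rule free_group_if_free_actions, rule ccontr)
    fix u z a assume z: "u \<in> vtypes \<A> v \<Gamma> z" and a: "a \<in> carrier (vgrp \<A> u)" "act u z a = z" "a \<noteq> \<one>\<^bsub>vgrp \<A> u\<^esub>"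
    have u: "u \<in> \<V>" by (rule vtypes_\<V>[OF z])
    have "reads T z (gen_word (w u a)) z" using act_reads[OF z, of "w u a"] w[OF u a(1)] a(2) by simp
    then show False using no_loop type_verts[OF z] u a by blast
  qed
qed

end

subsection \<open>Execution of programs\<close>

lemma tested_deterministic: "tested b \<sigma> p \<Longrightarrow> tested b \<sigma> q \<Longrightarrow> p = q"
  by (auto elim!: tested.cases)

inductive_cases exec_SkipE: "exec B Skip \<sigma> t \<sigma>'"
inductive_cases exec_SetNullE: "exec B (SetNull r) \<sigma> t \<sigma>'"
inductive_cases exec_ConstE: "exec B (Const r i) \<sigma> t \<sigma>'"
inductive_cases exec_CopyE: "exec B (Copy r s) \<sigma> t \<sigma>'"
inductive_cases exec_ArithE: "exec B (Arith f r s q) \<sigma> t \<sigma>'"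
inductive_cases exec_NewE: "exec B (New r) \<sigma> t \<sigma>'"
inductive_cases exec_LoadE: "exec B (Load r s k) \<sigma> t \<sigma>'"
inductive_cases exec_StoreE: "exec B (Store r k s) \<sigma> t \<sigma>'"
inductive_cases exec_SeqE: "exec B (Seq c d) \<sigma> t \<sigma>'"
inductive_cases exec_IfE: "exec B (If b c d) \<sigma> t \<sigma>'"
inductive_cases exec_WhileE: "exec B (While b c) \<sigma> t \<sigma>'"

text \<open>The bound only decides whether a step is possible, never its result, so runs under
  different bounds agree. This transfers the time bound from the run supplied by
  \<open>implements_folding\<close> to an arbitrary run of the same program.\<close>

lemma exec_deterministic:
  "exec B c \<sigma> t \<sigma>' \<Longrightarrow> exec B' c \<sigma> t' \<sigma>'' \<Longrightarrow> t = t' \<and> \<sigma>' = \<sigma>''"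
proof (induction arbitrary: t' \<sigma>'' rule: exec.induct)
  case (9 c \<sigma> t \<sigma>' d t1 \<sigma>1)
  from 9(5) show ?case by (rule exec_SeqE) (use 9(3,4) in blast)
next
  case (10 b \<sigma> c t \<sigma>' d)
  from 10(4) show ?case
    by (rule exec_IfE) (use 10(1,3) tested_deterministic in blast)+
next
  case (11 b \<sigma> d t \<sigma>' c)
  from 11(4) show ?case
    by (rule exec_IfE) (use 11(1,3) tested_deterministic in blast)+
next
  case (12 b \<sigma> c)
  from 12(2) show ?case
  proof (rule exec_WhileE)
    assume "tested b \<sigma> True"
    then show ?thesis using tested_deterministic[OF 12(1)] by blast
  qed simp_all
next
  case (13 b \<sigma> c t \<sigma>' t1 \<sigma>1)
  from 13(6) show ?case
    by (rule exec_WhileE) (use 13(1,4,5) tested_deterministic in blast)+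
qed (auto elim: exec_SkipE exec_SetNullE exec_ConstE exec_CopyE exec_ArithE exec_NewE exec_LoadE exec_StoreE)

lemma exec_mono: "exec B c \<sigma> t \<sigma>' \<Longrightarrow> B \<le> B' \<Longrightarrow> exec B' c \<sigma> t \<sigma>'"
  by (induction rule: exec.induct) (auto intro: exec.intros simp del: One_nat_def)

section \<open>Record fields that a program never writes\<close>

fun stored_fields :: "com \<Rightarrow> nat set" where
  "stored_fields (Store r k s) = {k}"
| "stored_fields (Seq c d) = stored_fields c \<union> stored_fields d"
| "stored_fields (If b c d) = stored_fields c \<union> stored_fields d"
| "stored_fields (While b c) = stored_fields c"
| "stored_fields _ = {}"

lemma finite_stored_fields: "finite (stored_fields c)"
  by (induction c) auto

text \<open>Fresh records start with all fields \<open>Null\<close>, and \<open>Store\<close> names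
  its field literally, so a field outside \<open>stored_fields c\<close> keeps the value
  \<open>Null\<close> in every record.\<close>

lemma exec_unused_field:
  "exec B c \<sigma> t \<sigma>' \<Longrightarrow> k \<notin> stored_fields c \<Longrightarrow> (\<And>a. mem \<sigma> a k = Null) \<Longrightarrow> mem \<sigma>' a k = Null"
  by (induction arbitrary: a rule: exec.induct) auto

lemma put_list_field:
  "put_list xs (m, n) = (p, m', n') \<Longrightarrow> 1 < k \<Longrightarrow> (\<And>a. m a k = Null) \<Longrightarrow> m' a k = Null"
  by (induction xs arbitrary: p m' n' a) (auto simp: Let_def split: prod.splits)

lemma put_words_field:
  "put_words num Ws (m, n) = (ps, m', n') \<Longrightarrow> 1 < k \<Longrightarrow> (\<And>a. m a k = Null) \<Longrightarrow> m' a k = Null"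
proof (induction Ws arbitrary: m n ps m' n' a)
  case (Cons W Ws)
  obtain p m1 n1 where 1: "put_list (map (\<lambda>l. Num (int (code num l))) W) (m, n) = (p, m1, n1)"
    by (cases "put_list (map (\<lambda>l. Num (int (code num l))) W) (m, n)") auto
  obtain ps' m2 n2 where 2: "put_words num Ws (m1, n1) = (ps', m2, n2)"
    by (cases "put_words num Ws (m1, n1)") auto
  have "m1 a k = Null" for a by (rule put_list_field[OF 1 Cons(3,4)])
  then have "m2 a k = Null" for a using Cons(1)[OF 2 Cons(3)] by blast
  then show ?case using Cons(2) 1 2 by simp
qed auto

text \<open>List cells use the fields 0 and 1 only, which leaves all other fields available for the
  marks of the search.\<close>

lemma input_state_field: "1 < k \<Longrightarrow> mem (input_state num Ws) a k = Null"
proof -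
  assume k: "1 < k"
  obtain ps m n where 1: "put_words num Ws (\<lambda>_ _. Null, 0) = (ps, m, n)"
    by (cases "put_words num Ws (\<lambda>_ _. Null, 0)") auto
  obtain p m' n' where 2: "put_list ps (m, n) = (p, m', n')"
    by (cases "put_list ps (m, n)") auto
  have "m a k = Null" for a by (rule put_words_field[OF 1 k]) simp
  from put_list_field[OF 2 k this] show ?thesis using 1 2 by (simp add: input_state_def)
qed

section \<open>Total correctness of programs with time bounds\<close>

definition runs :: "int \<Rightarrow> com \<Rightarrow> state \<Rightarrow> nat \<Rightarrow> (state \<Rightarrow> bool) \<Rightarrow> bool" where
  "runs B c \<sigma> n P \<longleftrightarrow> (\<exists>t \<sigma>'. exec B c \<sigma> t \<sigma>' \<and> t \<le> n \<and> P \<sigma>')"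

lemma runs_mono: "runs B c \<sigma> n P \<Longrightarrow> n \<le> n' \<Longrightarrow> (\<And>\<sigma>'. P \<sigma>' \<Longrightarrow> Q \<sigma>') \<Longrightarrow> runs B c \<sigma> n' Q"
  unfolding runs_def by (meson order_trans)

lemma runs_Skip: "P \<sigma> \<Longrightarrow> runs B Skip \<sigma> 0 P"
  unfolding runs_def using exec.intros(1) by blast

lemma runs_SetNull: "P (set_reg \<sigma> r Null) \<Longrightarrow> runs B (SetNull r) \<sigma> 1 P"
  unfolding runs_def using exec.intros(2) by blast

lemma runs_Const: "\<bar>i\<bar> \<le> B \<Longrightarrow> P (set_reg \<sigma> r (Num i)) \<Longrightarrow> runs B (Const r i) \<sigma> 1 P"
  unfolding runs_def using exec.intros(3) by blast

lemma runs_Copy: "P (set_reg \<sigma> r (regs \<sigma> s)) \<Longrightarrow> runs B (Copy r s) \<sigma> 1 P"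
  unfolding runs_def using exec.intros(4) by blast

lemma runs_Load: "regs \<sigma> s = Ptr a \<Longrightarrow> P (set_reg \<sigma> r (mem \<sigma> a k)) \<Longrightarrow> runs B (Load r s k) \<sigma> 1 P"
  unfolding runs_def using exec.intros(7) by blast

lemma runs_Store:
  "regs \<sigma> r = Ptr a \<Longrightarrow> P (\<sigma>\<lparr>mem := (mem \<sigma>)(a := (mem \<sigma> a)(k := regs \<sigma> s))\<rparr>) \<Longrightarrow>
    runs B (Store r k s) \<sigma> 1 P"
  unfolding runs_def using exec.intros(8) by blast

lemma runs_Seq:
  "runs B c \<sigma> n Q \<Longrightarrow> (\<And>\<sigma>'. Q \<sigma>' \<Longrightarrow> runs B d \<sigma>' n' P) \<Longrightarrow> runs B (Seq c d) \<sigma> (n + n') P"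
  unfolding runs_def by (meson add_mono exec.intros(9))

lemma runs_If_Eq:
  assumes "regs \<sigma> r = regs \<sigma> s \<Longrightarrow> runs B c \<sigma> n P" "regs \<sigma> r \<noteq> regs \<sigma> s \<Longrightarrow> runs B d \<sigma> n P"
  shows "runs B (If (Eq r s) c d) \<sigma> (Suc n) P"
proof (cases "regs \<sigma> r = regs \<sigma> s")
  case True
  then have "tested (Eq r s) \<sigma> True" using tested.intros(1)[of r s \<sigma>] by simp
  then show ?thesis using assms(1)[OF True] exec.intros(10) unfolding runs_def by (meson Suc_le_mono)
next
  case False
  then have "tested (Eq r s) \<sigma> False" using tested.intros(1)[of r s \<sigma>] by simp
  then show ?thesis using assms(2)[OF False] exec.intros(11) unfolding runs_def by (meson Suc_le_mono)
qed

lemma runs_While_Eq_exit: "regs \<sigma> r \<noteq> regs \<sigma> s \<Longrightarrow> P \<sigma> \<Longrightarrow> runs B (While (Eq r s) c) \<sigma> 1 P"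
  unfolding runs_def using exec.intros(12)[of "Eq r s" \<sigma>] tested.intros(1)[of r s \<sigma>] by auto

lemma runs_While_Eq_step:
  assumes "regs \<sigma> r = regs \<sigma> s" "runs B c \<sigma> n Q" "\<And>\<sigma>'. Q \<sigma>' \<Longrightarrow> runs B (While (Eq r s) c) \<sigma>' n' P"
  shows "runs B (While (Eq r s) c) \<sigma> (Suc (n + n')) P"
proof -
  have T: "tested (Eq r s) \<sigma> True" using tested.intros(1)[of r s \<sigma>] assms(1) by simp
  obtain t \<sigma>' where 1: "exec B c \<sigma> t \<sigma>'" "t \<le> n" "Q \<sigma>'" using assms(2) unfolding runs_def by blast
  obtain t' \<sigma>'' where 2: "exec B (While (Eq r s) c) \<sigma>' t' \<sigma>''" "t' \<le> n'" "P \<sigma>''"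
    using assms(3)[OF 1(3)] unfolding runs_def by blast
  show ?thesis
    unfolding runs_def using exec.intros(13)[OF T 1(1) 2(1)] 1(2) 2(2,3) by (meson Suc_le_mono add_mono)
qed

subsection \<open>A graph search that looks for loops\<close>

text \<open>Register \<open>0\<close> points to the base point, register \<open>1\<close> holds the answer, register \<open>2\<close> the
  top of a stack of vertices that is linked through the field \<open>k\<close> of their records; a record is
  visited if this field is not \<open>Null\<close>, and \<open>Num 0\<close> marks the bottom of the stack. Register \<open>5\<close> is
  \<open>Null\<close> as long as the stack is not empty, and register \<open>7\<close> points to the current vertex.\<close>

definition push_com :: "nat \<Rightarrow> nat \<Rightarrow> com" where
  "push_com k n = Seq (Load 8 7 n) (If (Eq 8 4) Skip
    (Seq (Load 9 8 k) (If (Eq 9 4) (Seq (Store 8 k 2) (Copy 2 8)) Skip)))"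

fun push_all_com :: "nat \<Rightarrow> nat list \<Rightarrow> com" where
  "push_all_com k [] = Skip"
| "push_all_com k (n # ns) = Seq (push_com k n) (push_all_com k ns)"

text \<open>Register 8 holds the vertex reached so far and stays \<open>Null\<close> once a letter
  cannot be read, so a failed walk never compares equal to the starting vertex in register
  7.\<close>

fun walk_com :: "nat list \<Rightarrow> com" where
  "walk_com [] = Skip"
| "walk_com (n # ns) = Seq (If (Eq 8 4) Skip (Load 8 8 n)) (walk_com ns)"

definition check_com :: "nat list \<Rightarrow> com" where
  "check_com ns = Seq (Copy 8 7) (Seq (walk_com ns) (If (Eq 8 7) (Const 1 0) Skip))"

fun check_all_com :: "nat list list \<Rightarrow> com" where
  "check_all_com [] = Skip"
| "check_all_com (ns # nss) = Seq (check_com ns) (check_all_com nss)"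

definition body_com :: "nat \<Rightarrow> nat list \<Rightarrow> nat list list \<Rightarrow> com" where
  "body_com k ns nss = Seq (Copy 7 2) (Seq (Load 2 7 k) (Seq (push_all_com k ns)
    (Seq (check_all_com nss) (If (Eq 2 3) (Const 5 0) Skip))))"

text \<open>Tests have no negation, so the condition that the stack is not empty is kept as an
  equality between register 5 and the constant \<open>Null\<close> in register 4. Register 3 holds
  the constant \<open>Num 0\<close>, with which the bottom of the stack is marked and
  recognised.\<close>

definition search_com :: "nat \<Rightarrow> nat list \<Rightarrow> nat list list \<Rightarrow> com" where
  "search_com k ns nss = Seq (Const 1 1) (Seq (Const 3 0) (Seq (SetNull 4) (Seq (SetNull 5)
    (Seq (Store 0 k 3) (Seq (Copy 2 0) (While (Eq 5 4) (body_com k ns nss)))))))"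

section \<open>Correctness and cost of the search on a graph stored in memory\<close>

locale graph_memory =
  fixes V :: "'a set" and b0 :: 'a and T :: "('a \<times> 'x \<times> 'a) set" and X :: "'x set"
    and \<rho> :: "'a \<Rightarrow> nat" and cd :: "'x \<times> bool \<Rightarrow> nat" and k :: nat and m0 :: "nat \<Rightarrow> nat \<Rightarrow> val"
    and Ls :: "('x \<times> bool) list" and Wl :: "'x word list" and B :: int
  assumes finite_V: "finite V" and b0: "b0 \<in> V" and \<rho>: "inj_on \<rho> V"
    and det: "deterministic T" and T_V: "\<And>x l y. (x, l, y) \<in> T \<Longrightarrow> x \<in> V \<and> l \<in> X \<and> y \<in> V"
    and conn: "\<And>z. z \<in> V \<Longrightarrow> \<exists>W. reads T b0 W z"
    and m0_some: "\<And>z l y. reads T z [l] y \<Longrightarrow> m0 (\<rho> z) (cd l) = Ptr (\<rho> y)"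
    and m0_none: "\<And>z l. z \<in> V \<Longrightarrow> l \<in> X \<times> UNIV \<Longrightarrow> \<nexists>y. reads T z [l] y \<Longrightarrow> m0 (\<rho> z) (cd l) = Null"
    and k: "k \<notin> cd ` (X \<times> UNIV)" and Ls: "set Ls = X \<times> UNIV"
    and Wl: "\<And>W. W \<in> set Wl \<Longrightarrow> W \<in> words X" and B: "1 \<le> B"
begin

definition agree :: "state \<Rightarrow> bool" where
  "agree \<sigma> \<longleftrightarrow> (\<forall>a j. j \<noteq> k \<longrightarrow> mem \<sigma> a j = m0 a j) \<and> regs \<sigma> 0 = Ptr (\<rho> b0) \<and>
    regs \<sigma> 3 = Num 0 \<and> regs \<sigma> 4 = Null"

fun chain :: "(nat \<Rightarrow> nat \<Rightarrow> val) \<Rightarrow> val \<Rightarrow> 'a list \<Rightarrow> bool" where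
  "chain m p [] \<longleftrightarrow> p = Num 0"
| "chain m p (z # zs) \<longleftrightarrow> p = Ptr (\<rho> z) \<and> chain m (m (\<rho> z) k) zs"

text \<open>\<open>D\<close> is the set of processed vertices and \<open>zs\<close> the stack. A
  popped vertex keeps its old link, which is not \<open>Null\<close>, and thereby stays
  marked.\<close>

definition search_inv :: "state \<Rightarrow> 'a set \<Rightarrow> 'a list \<Rightarrow> bool" where
  "search_inv \<sigma> D zs \<longleftrightarrow> agree \<sigma> \<and> chain (mem \<sigma>) (regs \<sigma> 2) zs \<and> distinct zs \<and> D \<inter> set zs = {} \<and>
    D \<union> set zs \<subseteq> V \<and> (\<forall>z \<in> V. mem \<sigma> (\<rho> z) k = Null \<longleftrightarrow> z \<notin> D \<union> set zs)"

definition loopless :: "'x word list \<Rightarrow> 'a \<Rightarrow> bool" where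
  "loopless Us z \<longleftrightarrow> (\<forall>W \<in> set Us. \<not> reads T z W z)"

lemma step_V: "reads T z [l] y \<Longrightarrow> z \<in> V \<and> y \<in> V \<and> l \<in> X \<times> UNIV"
  using T_V by (cases l) (auto split: if_splits)

lemma chain_not_Null: "chain m p zs \<Longrightarrow> p \<noteq> Null"
  by (cases zs) auto

lemma chain_bottom: "chain m p zs \<Longrightarrow> p = Num 0 \<longleftrightarrow> zs = []"
  by (cases zs) auto

lemma chain_update:
  "chain m p zs \<Longrightarrow> set zs \<subseteq> V \<Longrightarrow> y \<in> V \<Longrightarrow> y \<notin> set zs \<Longrightarrow> chain (m(\<rho> y := (m (\<rho> y))(k := q))) p zs"
proof (induction zs arbitrary: p)
  case (Cons z zs)
  have "\<rho> z \<noteq> \<rho> y" using Cons(3-5) inj_onD[OF \<rho>] by auto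
  then show ?case using Cons by simp
qed simp

lemma search_inv_regs:
  "search_inv \<sigma> D zs \<Longrightarrow> r \<notin> {0, 2, 3, 4} \<Longrightarrow> search_inv (set_reg \<sigma> r x) D zs"
  by (simp add: search_inv_def agree_def)

text \<open>At most six operations: two loads, two tests, a store and a copy. The link written into
  field \<open>k\<close> of the new vertex is the old top of the stack, which is never
  \<open>Null\<close>, so linking also marks the vertex.\<close>

lemma runs_push:
  assumes I: "search_inv \<sigma> D zs" and z: "regs \<sigma> 7 = Ptr (\<rho> z)" "z \<in> V" and l: "l \<in> X \<times> UNIV"
  shows "runs B (push_com k (cd l)) \<sigma> 6 (\<lambda>\<sigma>'. \<exists>zs'. search_inv \<sigma>' D zs' \<and> set zs \<subseteq> set zs' \<and>
    (\<forall>y. reads T z [l] y \<longrightarrow> y \<in> D \<union> set zs') \<and> (\<forall>r \<in> {1, 5, 7}. regs \<sigma>' r = regs \<sigma> r))"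
    (is "runs B _ \<sigma> 6 ?P")
proof -
  have kl: "cd l \<noteq> k" using k l by blast
  have ml: "mem \<sigma> (\<rho> z) (cd l) = m0 (\<rho> z) (cd l)" using I kl by (simp add: search_inv_def agree_def)
  let ?\<sigma> = "set_reg \<sigma> 8 (m0 (\<rho> z) (cd l))"
  have I1: "search_inv ?\<sigma> D zs" by (rule search_inv_regs[OF I]) simp
  have r4: "regs \<sigma> 4 = Null" using I by (simp add: search_inv_def agree_def)
  have "runs B (If (Eq 8 4) Skip (Seq (Load 9 8 k) (If (Eq 9 4) (Seq (Store 8 k 2) (Copy 2 8)) Skip))) ?\<sigma> (Suc (1 + Suc (1 + 1))) ?P"
  proof (rule runs_If_Eq)
    assume "regs ?\<sigma> 8 = regs ?\<sigma> 4"
    then have "m0 (\<rho> z) (cd l) = Null" using r4 by simp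
    then have "\<nexists>y. reads T z [l] y" using m0_some by (metis val.distinct(1))
    then have "?P ?\<sigma>" using I1 by (intro exI[of _ zs]) auto
    from runs_Skip[of ?P, OF this] show "runs B Skip ?\<sigma> (1 + Suc (1 + 1)) ?P" by (rule runs_mono) simp_all
  next
    assume "regs ?\<sigma> 8 \<noteq> regs ?\<sigma> 4"
    then have "m0 (\<rho> z) (cd l) \<noteq> Null" using r4 by simp
    then obtain y where y: "reads T z [l] y" using m0_none[OF z(2) l] by blast
    have y_only: "y' = y" if "reads T z [l] y'" for y' using deterministic_reads[OF det that y] .
    have yV: "y \<in> V" using step_V[OF y] by blast
    have r8: "m0 (\<rho> z) (cd l) = Ptr (\<rho> y)" by (rule m0_some[OF y])
    let ?\<sigma>' = "set_reg ?\<sigma> 9 (mem \<sigma> (\<rho> y) k)"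
    have I2: "search_inv ?\<sigma>' D zs" by (rule search_inv_regs[OF I1]) simp
    show "runs B (Seq (Load 9 8 k) (If (Eq 9 4) (Seq (Store 8 k 2) (Copy 2 8)) Skip)) ?\<sigma> (1 + Suc (1 + 1)) ?P"
    proof (rule runs_Seq[where Q = "\<lambda>\<tau>. \<tau> = ?\<sigma>'"])
      show "runs B (Load 9 8 k) ?\<sigma> 1 (\<lambda>\<tau>. \<tau> = ?\<sigma>')" by (rule runs_Load[of _ _ "\<rho> y"]) (simp_all add: r8)
      fix \<tau> assume \<tau>: "\<tau> = ?\<sigma>'"
      show "runs B (If (Eq 9 4) (Seq (Store 8 k 2) (Copy 2 8)) Skip) \<tau> (Suc (1 + 1)) ?P"
        unfolding \<tau>
      proof (rule runs_If_Eq)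
        assume "regs ?\<sigma>' 9 = regs ?\<sigma>' 4"
        then have "mem \<sigma> (\<rho> y) k = Null" using r4 by simp
        then have y_new: "y \<notin> D \<union> set zs" using I yV by (auto simp: search_inv_def)
        let ?m = "(mem \<sigma>)(\<rho> y := (mem \<sigma> (\<rho> y))(k := regs \<sigma> 2))"
        let ?\<sigma>1 = "?\<sigma>'\<lparr>mem := ?m\<rparr>"
        have ch: "chain (mem \<sigma>) (regs \<sigma> 2) zs" using I by (simp add: search_inv_def)
        have "set zs \<subseteq> V" using I by (simp add: search_inv_def)
        from chain_update[OF ch this yV] y_new have ch': "chain ?m (regs \<sigma> 2) zs" by blast
        have "search_inv (set_reg ?\<sigma>1 2 (Ptr (\<rho> y))) D (y # zs)"
        proof -
          have "?m (\<rho> x) k = Null \<longleftrightarrow> x \<notin> D \<union> set (y # zs)" if "x \<in> V" for x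
          proof (cases "x = y")
            case True
            then show ?thesis using chain_not_Null[OF ch] by simp
          next
            case False
            then have "\<rho> x \<noteq> \<rho> y" using inj_onD[OF \<rho> _ that yV] by blast
            then show ?thesis using I False that by (simp add: search_inv_def)
          qed
          then show ?thesis using I ch' yV y_new by (auto simp: search_inv_def agree_def)
        qed
        then have P: "?P (set_reg ?\<sigma>1 2 (Ptr (\<rho> y)))" using y_only by (intro exI[of _ "y # zs"]) auto
        show "runs B (Seq (Store 8 k 2) (Copy 2 8)) ?\<sigma>' (1 + 1) ?P"
        proof (rule runs_Seq[where Q = "\<lambda>\<tau>. \<tau> = ?\<sigma>1"])
          show "runs B (Store 8 k 2) ?\<sigma>' 1 (\<lambda>\<tau>. \<tau> = ?\<sigma>1)"
            by (rule runs_Store[of _ _ "\<rho> y"]) (simp_all add: r8)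
          fix \<tau> assume "\<tau> = ?\<sigma>1"
          then show "runs B (Copy 2 8) \<tau> 1 ?P" using P by (intro runs_Copy) (simp add: r8)
        qed
      next
        assume "regs ?\<sigma>' 9 \<noteq> regs ?\<sigma>' 4"
        then have "mem \<sigma> (\<rho> y) k \<noteq> Null" using r4 by simp
        then have "y \<in> D \<union> set zs" using I yV unfolding search_inv_def by blast
        then have "?P ?\<sigma>'" using I2 y_only by (intro exI[of _ zs]) auto
        from runs_Skip[of ?P, OF this] show "runs B Skip ?\<sigma>' (1 + 1) ?P" by (rule runs_mono) simp_all
      qed
    qed
  qed
  then have "runs B (push_com k (cd l)) \<sigma> (1 + Suc (1 + Suc (1 + 1))) ?P"
    unfolding push_com_def
    by (intro runs_Seq[where Q = "\<lambda>\<tau>. \<tau> = ?\<sigma>"] runs_Load[of _ _ "\<rho> z"]) (simp_all add: z ml)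
  then show ?thesis by (rule runs_mono) simp_all
qed

lemma runs_push_all:
  assumes "search_inv \<sigma> D zs" and z: "regs \<sigma> 7 = Ptr (\<rho> z)" "z \<in> V" and "set ls \<subseteq> X \<times> UNIV"
  shows "runs B (push_all_com k (map cd ls)) \<sigma> (6 * length ls) (\<lambda>\<sigma>'. \<exists>zs'. search_inv \<sigma>' D zs' \<and>
    set zs \<subseteq> set zs' \<and> (\<forall>l \<in> set ls. \<forall>y. reads T z [l] y \<longrightarrow> y \<in> D \<union> set zs') \<and>
    (\<forall>r \<in> {1, 5, 7}. regs \<sigma>' r = regs \<sigma> r))"
  using assms(1,2,4)
proof (induction ls arbitrary: \<sigma> zs)
  case Nil
  then show ?case by (auto intro!: runs_Skip)
next
  case (Cons l ls)
  let ?P = "\<lambda>\<sigma>'. \<exists>zs'. search_inv \<sigma>' D zs' \<and> set zs \<subseteq> set zs' \<and>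
    (\<forall>y. reads T z [l] y \<longrightarrow> y \<in> D \<union> set zs') \<and> (\<forall>r \<in> {1, 5, 7}. regs \<sigma>' r = regs \<sigma> r)"
  have "runs B (Seq (push_com k (cd l)) (push_all_com k (map cd ls))) \<sigma> (6 + 6 * length ls)
    (\<lambda>\<sigma>'. \<exists>zs'. search_inv \<sigma>' D zs' \<and> set zs \<subseteq> set zs' \<and>
      (\<forall>l' \<in> set (l # ls). \<forall>y. reads T z [l'] y \<longrightarrow> y \<in> D \<union> set zs') \<and>
      (\<forall>r \<in> {1, 5, 7}. regs \<sigma>' r = regs \<sigma> r))"
  proof (rule runs_Seq[where Q = ?P])
    show "runs B (push_com k (cd l)) \<sigma> 6 ?P" using Cons(4) by (intro runs_push[OF Cons(2,3) z(2)]) simp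
    fix \<sigma>' assume "?P \<sigma>'"
    then obtain zs' where zs': "search_inv \<sigma>' D zs'" "set zs \<subseteq> set zs'"
      "\<And>y. reads T z [l] y \<Longrightarrow> y \<in> D \<union> set zs'" "\<forall>r \<in> {1, 5, 7}. regs \<sigma>' r = regs \<sigma> r" by blast
    have "regs \<sigma>' 7 = Ptr (\<rho> z)" using zs'(4) Cons(3) by simp
    from Cons(1)[OF zs'(1) this] Cons(4)
    have "runs B (push_all_com k (map cd ls)) \<sigma>' (6 * length ls) (\<lambda>\<sigma>''. \<exists>zs''. search_inv \<sigma>'' D zs'' \<and>
      set zs' \<subseteq> set zs'' \<and> (\<forall>l \<in> set ls. \<forall>y. reads T z [l] y \<longrightarrow> y \<in> D \<union> set zs'') \<and>
      (\<forall>r \<in> {1, 5, 7}. regs \<sigma>'' r = regs \<sigma>' r))" by simp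
    then show "runs B (push_all_com k (map cd ls)) \<sigma>' (6 * length ls)
      (\<lambda>\<sigma>'. \<exists>zs'. search_inv \<sigma>' D zs' \<and> set zs \<subseteq> set zs' \<and>
        (\<forall>l' \<in> set (l # ls). \<forall>y. reads T z [l'] y \<longrightarrow> y \<in> D \<union> set zs') \<and>
        (\<forall>r \<in> {1, 5, 7}. regs \<sigma>' r = regs \<sigma> r))"
    proof (rule runs_mono)
      fix \<sigma>'' assume "\<exists>zs''. search_inv \<sigma>'' D zs'' \<and> set zs' \<subseteq> set zs'' \<and>
        (\<forall>l \<in> set ls. \<forall>y. reads T z [l] y \<longrightarrow> y \<in> D \<union> set zs'') \<and> (\<forall>r \<in> {1, 5, 7}. regs \<sigma>'' r = regs \<sigma>' r)"
      then obtain zs'' where zs'': "search_inv \<sigma>'' D zs''" "set zs' \<subseteq> set zs''"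
        "\<And>l y. l \<in> set ls \<Longrightarrow> reads T z [l] y \<Longrightarrow> y \<in> D \<union> set zs''" "\<forall>r \<in> {1, 5, 7}. regs \<sigma>'' r = regs \<sigma>' r" by blast
      have "y \<in> D \<union> set zs''" if "l' \<in> set (l # ls)" "reads T z [l'] y" for l' y
        using that zs'(3)[of y] zs''(2) zs''(3)[of l' y] by (auto simp del: reads.simps)
      moreover have "\<forall>r \<in> {1, 5, 7}. regs \<sigma>'' r = regs \<sigma> r" using zs'(4) zs''(4) by simp
      ultimately show "\<exists>zs'. search_inv \<sigma>'' D zs' \<and> set zs \<subseteq> set zs' \<and>
        (\<forall>l' \<in> set (l # ls). \<forall>y. reads T z [l'] y \<longrightarrow> y \<in> D \<union> set zs') \<and> (\<forall>r \<in> {1, 5, 7}. regs \<sigma>'' r = regs \<sigma> r)"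
        using zs''(1,2) zs'(2) by blast
    qed simp
  qed
  then show ?case by simp
qed

definition encodes :: "val \<Rightarrow> 'a \<Rightarrow> 'x word \<Rightarrow> bool" where
  "encodes p z W \<longleftrightarrow> (\<exists>y \<in> V. reads T z W y \<and> p = Ptr (\<rho> y)) \<or> ((\<nexists>y. reads T z W y) \<and> p = Null)"

text \<open>Each letter costs a test and at most one load. The word \<open>U\<close> that has
  already been read is carried along for the induction.\<close>

lemma runs_walk:
  assumes "search_inv \<sigma> D zs" "encodes (regs \<sigma> 8) z U" "W \<in> words X"
  shows "runs B (walk_com (map cd W)) \<sigma> (2 * length W) (\<lambda>\<sigma>'. search_inv \<sigma>' D zs \<and>
    encodes (regs \<sigma>' 8) z (U @ W) \<and> (\<forall>r \<in> {1, 5, 7}. regs \<sigma>' r = regs \<sigma> r))"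
  using assms
proof (induction W arbitrary: \<sigma> U)
  case Nil
  then show ?case by (auto intro!: runs_Skip)
next
  case (Cons l W)
  have l: "l \<in> X \<times> UNIV" and W: "W \<in> words X" using Cons(4) by simp_all
  let ?Q = "\<lambda>\<sigma>'. search_inv \<sigma>' D zs \<and> encodes (regs \<sigma>' 8) z (U @ [l]) \<and> (\<forall>r \<in> {1, 5, 7}. regs \<sigma>' r = regs \<sigma> r)"
  have r4: "regs \<sigma> 4 = Null" using Cons(2) by (simp add: search_inv_def agree_def)
  have "runs B (Seq (If (Eq 8 4) Skip (Load 8 8 (cd l))) (walk_com (map cd W))) \<sigma> (Suc 1 + 2 * length W)
    (\<lambda>\<sigma>'. search_inv \<sigma>' D zs \<and> encodes (regs \<sigma>' 8) z (U @ l # W) \<and> (\<forall>r \<in> {1, 5, 7}. regs \<sigma>' r = regs \<sigma> r))"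
  proof (rule runs_Seq[where Q = ?Q])
    show "runs B (If (Eq 8 4) Skip (Load 8 8 (cd l))) \<sigma> (Suc 1) ?Q"
    proof (rule runs_If_Eq)
      assume "regs \<sigma> 8 = regs \<sigma> 4"
      then have "regs \<sigma> 8 = Null" "\<nexists>y. reads T z U y" using r4 Cons(3) by (auto simp: encodes_def)
      then have "?Q \<sigma>" using Cons(2) by (auto simp: encodes_def reads_append simp del: reads.simps)
      from runs_Skip[of ?Q, OF this] show "runs B Skip \<sigma> 1 ?Q" by (rule runs_mono) simp_all
    next
      assume "regs \<sigma> 8 \<noteq> regs \<sigma> 4"
      then obtain y where y: "y \<in> V" "reads T z U y" "regs \<sigma> 8 = Ptr (\<rho> y)"
        using r4 Cons(3) by (auto simp: encodes_def)
      have "cd l \<noteq> k" using k l by blast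
      then have m: "mem \<sigma> (\<rho> y) (cd l) = m0 (\<rho> y) (cd l)" using Cons(2) by (simp add: search_inv_def agree_def)
      have "encodes (m0 (\<rho> y) (cd l)) z (U @ [l])"
      proof (cases "\<exists>x. reads T y [l] x")
        case True
        then obtain x where x: "reads T y [l] x" by blast
        then have "reads T z (U @ [l]) x" using y(2) unfolding reads_append by blast
        then show ?thesis using m0_some[OF x] step_V[OF x] unfolding encodes_def by blast
      next
        case False
        have "\<nexists>x. reads T z (U @ [l]) x"
          using False deterministic_reads[OF det y(2)] unfolding reads_append by blast
        then show ?thesis using m0_none[OF y(1) l] False unfolding encodes_def by blast
      qed
      moreover have "search_inv (set_reg \<sigma> 8 (mem \<sigma> (\<rho> y) (cd l))) D zs"
        by (rule search_inv_regs[OF Cons(2)]) simp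
      ultimately show "runs B (Load 8 8 (cd l)) \<sigma> 1 ?Q"
        by (intro runs_Load[OF y(3)]) (simp add: m)
    qed
    fix \<sigma>' assume Q: "?Q \<sigma>'"
    then have "runs B (walk_com (map cd W)) \<sigma>' (2 * length W) (\<lambda>\<sigma>''. search_inv \<sigma>'' D zs \<and>
      encodes (regs \<sigma>'' 8) z ((U @ [l]) @ W) \<and> (\<forall>r \<in> {1, 5, 7}. regs \<sigma>'' r = regs \<sigma>' r))"
      by (intro Cons(1) W) simp_all
    then show "runs B (walk_com (map cd W)) \<sigma>' (2 * length W)
      (\<lambda>\<sigma>'. search_inv \<sigma>' D zs \<and> encodes (regs \<sigma>' 8) z (U @ l # W) \<and> (\<forall>r \<in> {1, 5, 7}. regs \<sigma>' r = regs \<sigma> r))"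
      by (rule runs_mono) (use Q in simp_all)
  qed
  then show ?case by simp
qed

text \<open>Besides the two operations per letter, there are the initial copy, the final test and
  the assignment of the answer.\<close>

lemma runs_check:
  assumes I: "search_inv \<sigma> D zs" and z: "regs \<sigma> 7 = Ptr (\<rho> z)" "z \<in> V" and W: "W \<in> words X"
  shows "runs B (check_com (map cd W)) \<sigma> (3 + 2 * length W) (\<lambda>\<sigma>'. search_inv \<sigma>' D zs \<and>
    regs \<sigma>' 1 = (if reads T z W z then Num 0 else regs \<sigma> 1) \<and> (\<forall>r \<in> {5, 7}. regs \<sigma>' r = regs \<sigma> r))"
    (is "runs B _ \<sigma> _ ?P")
proof -
  let ?\<sigma> = "set_reg \<sigma> 8 (Ptr (\<rho> z))"
  let ?Q = "\<lambda>\<sigma>'. search_inv \<sigma>' D zs \<and> encodes (regs \<sigma>' 8) z ([] @ W) \<and> (\<forall>r \<in> {1, 5, 7}. regs \<sigma>' r = regs ?\<sigma> r)"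
  have "search_inv ?\<sigma> D zs" by (rule search_inv_regs[OF I]) simp
  moreover have "encodes (regs ?\<sigma> 8) z []" using z(2) by (simp add: encodes_def)
  ultimately have walk: "runs B (walk_com (map cd W)) ?\<sigma> (2 * length W) ?Q" using W by (rule runs_walk)
  have "runs B (Seq (walk_com (map cd W)) (If (Eq 8 7) (Const 1 0) Skip)) ?\<sigma> (2 * length W + Suc 1) ?P"
  proof (rule runs_Seq[OF walk])
    fix \<sigma>' assume Q: "?Q \<sigma>'"
    then have r: "regs \<sigma>' 7 = Ptr (\<rho> z)" "encodes (regs \<sigma>' 8) z W" "search_inv \<sigma>' D zs"
      "regs \<sigma>' 1 = regs \<sigma> 1" "regs \<sigma>' 5 = regs \<sigma> 5" using z(1) by simp_all
    have loop: "regs \<sigma>' 8 = regs \<sigma>' 7 \<longleftrightarrow> reads T z W z"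
    proof
      assume "regs \<sigma>' 8 = regs \<sigma>' 7"
      then obtain y where y: "y \<in> V" "reads T z W y" "\<rho> y = \<rho> z" using r(1,2) by (auto simp: encodes_def)
      have "y = z" by (rule inj_onD[OF \<rho> y(3,1) z(2)])
      then show "reads T z W z" using y(2) by simp
    next
      assume R: "reads T z W z"
      then obtain y where y: "reads T z W y" "regs \<sigma>' 8 = Ptr (\<rho> y)" using r(2) unfolding encodes_def by blast
      show "regs \<sigma>' 8 = regs \<sigma>' 7" using deterministic_reads[OF det R y(1)] y(2) r(1) by simp
    qed
    show "runs B (If (Eq 8 7) (Const 1 0) Skip) \<sigma>' (Suc 1) ?P"
    proof (rule runs_If_Eq)
      assume "regs \<sigma>' 8 = regs \<sigma>' 7"
      moreover have "search_inv (set_reg \<sigma>' 1 (Num 0)) D zs" by (rule search_inv_regs[OF r(3)]) simp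
      ultimately show "runs B (Const 1 0) \<sigma>' 1 ?P" using loop r z(1) B by (intro runs_Const) simp_all
    next
      assume "regs \<sigma>' 8 \<noteq> regs \<sigma>' 7"
      then have "?P \<sigma>'" using loop r z(1) by simp
      from runs_Skip[of ?P, OF this] show "runs B Skip \<sigma>' 1 ?P" by (rule runs_mono) simp_all
    qed
  qed
  then have "runs B (check_com (map cd W)) \<sigma> (1 + (2 * length W + Suc 1)) ?P"
    unfolding check_com_def
    by (intro runs_Seq[where Q = "\<lambda>\<tau>. \<tau> = ?\<sigma>", OF runs_Copy]) (simp_all add: z(1))
  then show ?thesis by (rule runs_mono) simp_all
qed

lemma runs_check_all:
  assumes "search_inv \<sigma> D zs" and z: "regs \<sigma> 7 = Ptr (\<rho> z)" "z \<in> V"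
    and "\<And>W. W \<in> set Us \<Longrightarrow> W \<in> words X" and "regs \<sigma> 1 = Num (if Q then 1 else 0)"
  shows "runs B (check_all_com (map (map cd) Us)) \<sigma> (\<Sum>W\<leftarrow>Us. 3 + 2 * length W) (\<lambda>\<sigma>'. search_inv \<sigma>' D zs \<and>
    regs \<sigma>' 1 = Num (if Q \<and> loopless Us z then 1 else 0) \<and> (\<forall>r \<in> {5, 7}. regs \<sigma>' r = regs \<sigma> r))"
  using assms(1,2,4,5)
proof (induction Us arbitrary: \<sigma> Q)
  case Nil
  then show ?case by (auto intro!: runs_Skip simp: loopless_def)
next
  case (Cons W Us)
  have "runs B (Seq (check_com (map cd W)) (check_all_com (map (map cd) Us))) \<sigma>
    ((3 + 2 * length W) + (\<Sum>W\<leftarrow>Us. 3 + 2 * length W)) (\<lambda>\<sigma>'. search_inv \<sigma>' D zs \<and>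
    regs \<sigma>' 1 = Num (if Q \<and> loopless (W # Us) z then 1 else 0) \<and> (\<forall>r \<in> {5, 7}. regs \<sigma>' r = regs \<sigma> r))"
  proof (rule runs_Seq[OF runs_check[OF Cons(2,3) z(2)]])
    show "W \<in> words X" using Cons(4) by simp
    fix \<sigma>' assume \<sigma>': "search_inv \<sigma>' D zs \<and> regs \<sigma>' 1 = (if reads T z W z then Num 0 else regs \<sigma> 1) \<and>
      (\<forall>r \<in> {5, 7}. regs \<sigma>' r = regs \<sigma> r)"
    then have "runs B (check_all_com (map (map cd) Us)) \<sigma>' (\<Sum>W\<leftarrow>Us. 3 + 2 * length W) (\<lambda>\<sigma>''. search_inv \<sigma>'' D zs \<and>
      regs \<sigma>'' 1 = Num (if (Q \<and> \<not> reads T z W z) \<and> loopless Us z then 1 else 0) \<and> (\<forall>r \<in> {5, 7}. regs \<sigma>'' r = regs \<sigma>' r))"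
      using Cons(3-5) by (intro Cons(1)) auto
    then show "runs B (check_all_com (map (map cd) Us)) \<sigma>' (\<Sum>W\<leftarrow>Us. 3 + 2 * length W) (\<lambda>\<sigma>'. search_inv \<sigma>' D zs \<and>
      regs \<sigma>' 1 = Num (if Q \<and> loopless (W # Us) z then 1 else 0) \<and> (\<forall>r \<in> {5, 7}. regs \<sigma>' r = regs \<sigma> r))"
      by (rule runs_mono) (use \<sigma>' in \<open>auto simp: loopless_def\<close>)
  qed
  then show ?case by simp
qed

text \<open>The summand 4 pays for the copy and the load that pop the stack and for the final test
  with its assignment; the rest are the costs of \<open>runs_push\<close> and
  \<open>runs_check\<close>.\<close>

definition body_cost :: nat where
  "body_cost = 4 + 6 * length Ls + (\<Sum>W\<leftarrow>Wl. 3 + 2 * length W)"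

definition closed :: "'a set \<Rightarrow> 'a set \<Rightarrow> bool" where
  "closed D S \<longleftrightarrow> (\<forall>z \<in> D. \<forall>l y. reads T z [l] y \<longrightarrow> y \<in> S)"

definition loop_inv :: "state \<Rightarrow> 'a set \<Rightarrow> 'a list \<Rightarrow> bool" where
  "loop_inv \<sigma> D zs \<longleftrightarrow> search_inv \<sigma> D zs \<and> b0 \<in> D \<union> set zs \<and> closed D (D \<union> set zs) \<and>
    regs \<sigma> 1 = Num (if \<forall>z \<in> D. loopless Wl z then 1 else 0) \<and>
    (regs \<sigma> 5 = Null \<longleftrightarrow> zs \<noteq> [])"

lemma runs_body:
  assumes I: "loop_inv \<sigma> D (z # zs)"
  shows "runs B (body_com k (map cd Ls) (map (map cd) Wl)) \<sigma> body_cost (\<lambda>\<sigma>'. \<exists>zs'. loop_inv \<sigma>' (insert z D) zs')"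
proof -
  have S: "search_inv \<sigma> D (z # zs)" using I by (simp add: loop_inv_def)
  have z: "z \<in> V" "z \<notin> D" "regs \<sigma> 2 = Ptr (\<rho> z)" using S by (auto simp: search_inv_def)
  have r5: "regs \<sigma> 5 = Null" using I by (simp add: loop_inv_def)
  let ?\<sigma>1 = "set_reg \<sigma> 7 (Ptr (\<rho> z))"
  let ?\<sigma>2 = "set_reg ?\<sigma>1 2 (mem \<sigma> (\<rho> z) k)"
  let ?D = "insert z D"
  \<comment> \<open>Popping leaves field \<open>k\<close> of \<open>z\<close> unchanged, so
    \<open>z\<close> moves from the stack to the processed vertices and stays marked.\<close>
  have S2: "search_inv ?\<sigma>2 ?D zs" using S by (auto simp: search_inv_def agree_def)
  let ?Q = "\<forall>x \<in> D. loopless Wl x"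
  let ?P1 = "\<lambda>\<sigma>'. \<exists>zs'. search_inv \<sigma>' ?D zs' \<and> set zs \<subseteq> set zs' \<and>
    (\<forall>l \<in> set Ls. \<forall>y. reads T z [l] y \<longrightarrow> y \<in> ?D \<union> set zs') \<and> (\<forall>r \<in> {1, 5, 7}. regs \<sigma>' r = regs ?\<sigma>2 r)"
  let ?P2 = "\<lambda>\<sigma>'. \<exists>zs'. search_inv \<sigma>' ?D zs' \<and> set zs \<subseteq> set zs' \<and>
    (\<forall>l \<in> set Ls. \<forall>y. reads T z [l] y \<longrightarrow> y \<in> ?D \<union> set zs') \<and>
    regs \<sigma>' 1 = Num (if ?Q \<and> loopless Wl z then 1 else 0) \<and> regs \<sigma>' 5 = Null"
  let ?P = "\<lambda>\<sigma>'. \<exists>zs'. loop_inv \<sigma>' ?D zs'"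
  have final: "runs B (If (Eq 2 3) (Const 5 0) Skip) \<sigma>' (Suc 1) ?P" if P2: "?P2 \<sigma>'" for \<sigma>'
  proof -
    from P2 obtain zs' where zs': "search_inv \<sigma>' ?D zs'" "set zs \<subseteq> set zs'"
      "\<And>l y. l \<in> set Ls \<Longrightarrow> reads T z [l] y \<Longrightarrow> y \<in> ?D \<union> set zs'"
      "regs \<sigma>' 1 = Num (if ?Q \<and> loopless Wl z then 1 else 0)" "regs \<sigma>' 5 = Null" by blast
    have b: "b0 \<in> ?D \<union> set zs'" using I zs'(2) by (auto simp: loop_inv_def)
    have cl: "closed ?D (?D \<union> set zs')"
      unfolding closed_def
    proof (intro ballI allI impI)
      fix x l y assume x: "x \<in> ?D" and R: "reads T x [l] y"
      show "y \<in> ?D \<union> set zs'"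
      proof (cases "x = z")
        case True
        then show ?thesis using zs'(3)[of l y] R step_V[OF R] Ls by blast
      next
        case False
        then have "y \<in> D \<union> set (z # zs)" using I R x unfolding loop_inv_def closed_def by blast
        then show ?thesis using zs'(2) by auto
      qed
    qed
    have fl: "regs \<sigma>' 1 = Num (if \<forall>x \<in> ?D. loopless Wl x then 1 else 0)" using zs'(4) by auto
    have "regs \<sigma>' 3 = Num 0" "chain (mem \<sigma>') (regs \<sigma>' 2) zs'" using zs'(1) by (simp_all add: search_inv_def agree_def)
    then have empty: "regs \<sigma>' 2 = regs \<sigma>' 3 \<longleftrightarrow> zs' = []" using chain_bottom by simp
    show ?thesis
    proof (rule runs_If_Eq)
      assume "regs \<sigma>' 2 = regs \<sigma>' 3"
      moreover have "search_inv (set_reg \<sigma>' 5 (Num 0)) ?D zs'" by (rule search_inv_regs[OF zs'(1)]) simp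
      ultimately have "loop_inv (set_reg \<sigma>' 5 (Num 0)) ?D zs'" using b cl fl empty by (simp add: loop_inv_def)
      then show "runs B (Const 5 0) \<sigma>' 1 ?P" using B by (intro runs_Const) auto
    next
      assume "regs \<sigma>' 2 \<noteq> regs \<sigma>' 3"
      then have "loop_inv \<sigma>' ?D zs'" using zs'(1,5) b cl fl empty by (simp add: loop_inv_def)
      then have "?P \<sigma>'" by blast
      from runs_Skip[of ?P, OF this] show "runs B Skip \<sigma>' 1 ?P" by (rule runs_mono) simp_all
    qed
  qed
  have check: "runs B (Seq (check_all_com (map (map cd) Wl)) (If (Eq 2 3) (Const 5 0) Skip)) \<sigma>'
    ((\<Sum>W\<leftarrow>Wl. 3 + 2 * length W) + Suc 1) ?P" if P1: "?P1 \<sigma>'" for \<sigma>'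
  proof (rule runs_Seq[where Q = ?P2])
    from P1 obtain zs' where zs': "search_inv \<sigma>' ?D zs'" "set zs \<subseteq> set zs'"
      "\<forall>l \<in> set Ls. \<forall>y. reads T z [l] y \<longrightarrow> y \<in> ?D \<union> set zs'" "\<forall>r \<in> {1, 5, 7}. regs \<sigma>' r = regs ?\<sigma>2 r" by blast
    have r: "regs \<sigma>' 7 = Ptr (\<rho> z)" "regs \<sigma>' 1 = Num (if ?Q then 1 else 0)" "regs \<sigma>' 5 = Null"
      using zs'(4) I r5 by (simp_all add: loop_inv_def)
    show "runs B (check_all_com (map (map cd) Wl)) \<sigma>' (\<Sum>W\<leftarrow>Wl. 3 + 2 * length W) ?P2"
      by (rule runs_mono[OF runs_check_all[OF zs'(1) r(1) z(1) Wl r(2)]])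
        (use zs'(2,3) r(3) in \<open>auto simp del: reads.simps One_nat_def intro!: exI[of _ zs']\<close>)
  qed (rule final)
  have push: "runs B (Seq (push_all_com k (map cd Ls)) (Seq (check_all_com (map (map cd) Wl)) (If (Eq 2 3) (Const 5 0) Skip))) ?\<sigma>2
    (6 * length Ls + ((\<Sum>W\<leftarrow>Wl. 3 + 2 * length W) + Suc 1)) ?P"
    by (rule runs_Seq[OF runs_push_all[OF S2 _ z(1)] check]) (use Ls in simp_all)
  have "runs B (body_com k (map cd Ls) (map (map cd) Wl)) \<sigma>
    (1 + (1 + (6 * length Ls + ((\<Sum>W\<leftarrow>Wl. 3 + 2 * length W) + Suc 1)))) ?P"
    unfolding body_com_def
  proof (rule runs_Seq[where Q = "\<lambda>\<tau>. \<tau> = ?\<sigma>1"])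
    show "runs B (Copy 7 2) \<sigma> 1 (\<lambda>\<tau>. \<tau> = ?\<sigma>1)" by (rule runs_Copy) (simp add: z(3))
    fix \<tau> assume "\<tau> = ?\<sigma>1"
    then show "runs B (Seq (Load 2 7 k) (Seq (push_all_com k (map cd Ls)) (Seq (check_all_com (map (map cd) Wl))
      (If (Eq 2 3) (Const 5 0) Skip)))) \<tau> (1 + (6 * length Ls + ((\<Sum>W\<leftarrow>Wl. 3 + 2 * length W) + Suc 1))) ?P"
      using push by (intro runs_Seq[where Q = "\<lambda>\<tau>. \<tau> = ?\<sigma>2", OF runs_Load[of _ _ "\<rho> z"]]) simp_all
  qed
  then show ?thesis by (rule runs_mono) (simp_all add: body_cost_def)
qed

text \<open>Induction on the number of vertices not yet processed. When the stack is empty, the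
  processed set contains the base point and is closed under reading letters, so it is everything by
  connectedness. A round costs its body and one test, and the failing test adds one
  operation.\<close>

lemma runs_loop:
  assumes "loop_inv \<sigma> D zs"
  shows "runs B (While (Eq 5 4) (body_com k (map cd Ls) (map (map cd) Wl))) \<sigma> (Suc (card (V - D) * Suc body_cost))
    (\<lambda>\<sigma>'. agree \<sigma>' \<and> regs \<sigma>' 1 = Num (if \<forall>z \<in> V. loopless Wl z then 1 else 0))" (is "runs B ?loop _ _ ?P")
  using assms
proof (induction "card (V - D)" arbitrary: \<sigma> D zs)
  case (0 D \<sigma> zs)
  then have DV: "V - D = {}" using finite_V by simp
  have "zs = []" using 0(2) DV unfolding loop_inv_def search_inv_def by (cases zs) auto
  moreover have "D = V" using 0(2) DV unfolding loop_inv_def search_inv_def by blast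
  ultimately have "?P \<sigma>" "regs \<sigma> 5 \<noteq> regs \<sigma> 4"
    using 0(2) by (auto simp: loop_inv_def search_inv_def agree_def)
  then have "runs B ?loop \<sigma> 1 ?P" by (intro runs_While_Eq_exit)
  then show ?case by (rule runs_mono) simp_all
next
  case (Suc n D \<sigma> zs)
  have r4: "regs \<sigma> 4 = Null" using Suc(3) by (simp add: loop_inv_def search_inv_def agree_def)
  show ?case
  proof (cases zs)
    case Nil
    have "D = V"
    proof
      show "D \<subseteq> V" using Suc(3) by (auto simp: loop_inv_def search_inv_def)
      show "V \<subseteq> D"
      proof
        fix x assume "x \<in> V"
        then obtain W where "reads T b0 W x" using conn by blast
        moreover have "y \<in> D" if "reads T y' W y" "y' \<in> D" for y' W y
          using that
        proof (induction W arbitrary: y')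
          case (Cons l W)
          obtain x where x: "reads T y' [l] x" "reads T x W y"
            using Cons(2) reads_append[of T y' "[l]" W y] by auto
          have "closed D D" using Suc(3) Nil by (simp add: loop_inv_def)
          then have "x \<in> D" using x(1) Cons(3) unfolding closed_def by blast
          then show ?case using Cons(1) x(2) by blast
        qed simp
        moreover have "b0 \<in> D" using Suc(3) Nil by (simp add: loop_inv_def)
        ultimately show "x \<in> D" by blast
      qed
    qed
    then show ?thesis using Suc(2) by simp
  next
    case (Cons z zs0)
    have z: "z \<in> V" "z \<notin> D" using Suc(3) Cons by (auto simp: loop_inv_def search_inv_def)
    have "V - insert z D = (V - D) - {z}" by blast
    then have card: "n = card (V - insert z D)" using z Suc(2) finite_V by simp
    have "runs B ?loop \<sigma> (Suc (body_cost + Suc (n * Suc body_cost))) ?P"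
    proof (rule runs_While_Eq_step)
      show "regs \<sigma> 5 = regs \<sigma> 4" using Suc(3) Cons r4 by (simp add: loop_inv_def)
      show "runs B (body_com k (map cd Ls) (map (map cd) Wl)) \<sigma> body_cost (\<lambda>\<sigma>'. \<exists>zs'. loop_inv \<sigma>' (insert z D) zs')"
        using Suc(3) Cons by (intro runs_body[of _ _ _ zs0]) simp
      fix \<sigma>' assume "\<exists>zs'. loop_inv \<sigma>' (insert z D) zs'"
      then obtain zs' where "loop_inv \<sigma>' (insert z D) zs'" by blast
      from Suc(1)[OF card this] show "runs B ?loop \<sigma>' (Suc (n * Suc body_cost)) ?P" unfolding card .
    qed
    then show ?thesis by (rule runs_mono) (simp_all flip: Suc(2))
  qed
qed

text \<open>The seven operations outside the rounds are the six initialisations and the failing test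
  of the loop.\<close>

lemma runs_search:
  assumes \<sigma>: "mem \<sigma> = m0" "regs \<sigma> 0 = Ptr (\<rho> b0)" "\<And>a. m0 a k = Null"
  shows "runs B (search_com k (map cd Ls) (map (map cd) Wl)) \<sigma> (7 + card V * Suc body_cost)
    (\<lambda>\<sigma>'. agree \<sigma>' \<and> regs \<sigma>' 1 = Num (if \<forall>z \<in> V. loopless Wl z then 1 else 0))" (is "runs B _ _ _ ?P")
proof -
  let ?loop = "While (Eq 5 4) (body_com k (map cd Ls) (map (map cd) Wl))"
  let ?\<sigma>1 = "set_reg \<sigma> 1 (Num 1)"
  let ?\<sigma>2 = "set_reg ?\<sigma>1 3 (Num 0)"
  let ?\<sigma>3 = "set_reg ?\<sigma>2 4 Null"
  let ?\<sigma>4 = "set_reg ?\<sigma>3 5 Null"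
  let ?\<sigma>5 = "?\<sigma>4\<lparr>mem := (mem \<sigma>)(\<rho> b0 := (mem \<sigma> (\<rho> b0))(k := Num 0))\<rparr>"
  let ?\<sigma>6 = "set_reg ?\<sigma>5 2 (Ptr (\<rho> b0))"
  have "mem ?\<sigma>6 (\<rho> z) k = Null \<longleftrightarrow> z \<notin> {} \<union> set [b0]" if "z \<in> V" for z
    using inj_onD[OF \<rho> _ that b0] \<sigma> by auto
  then have "loop_inv ?\<sigma>6 {} [b0]"
    using \<sigma> b0 by (auto simp: loop_inv_def search_inv_def agree_def closed_def)
  from runs_loop[OF this] have L: "runs B ?loop ?\<sigma>6 (Suc (card V * Suc body_cost)) ?P" by simp
  have "runs B (search_com k (map cd Ls) (map (map cd) Wl)) \<sigma>
    (1 + (1 + (1 + (1 + (1 + (1 + Suc (card V * Suc body_cost))))))) ?P"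
    unfolding search_com_def
    apply (rule runs_Seq[where Q = "\<lambda>\<tau>. \<tau> = ?\<sigma>1"], rule runs_Const, use B in simp, simp)
    apply (rule runs_Seq[where Q = "\<lambda>\<tau>. \<tau> = ?\<sigma>2"], rule runs_Const, use B in simp, simp)
    apply (rule runs_Seq[where Q = "\<lambda>\<tau>. \<tau> = ?\<sigma>3"], rule runs_SetNull, simp)
    apply (rule runs_Seq[where Q = "\<lambda>\<tau>. \<tau> = ?\<sigma>4"], rule runs_SetNull, simp)
    apply (rule runs_Seq[where Q = "\<lambda>\<tau>. \<tau> = ?\<sigma>5"], rule runs_Store[of _ _ "\<rho> b0"], simp add: \<sigma>, simp)
    apply (rule runs_Seq[where Q = "\<lambda>\<tau>. \<tau> = ?\<sigma>6"], rule runs_Copy, simp add: \<sigma>)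
    using L by simp
  then show ?thesis by (rule runs_mono) simp_all
qed

end

section \<open>The search on the folded graph and the modified program\<close>

context folded_gog
begin

text \<open>The search changes memory only in field \<open>k\<close>, which encodes no letter, and
  preserves register 0, so the final state still outputs the same graph, as a modification of the
  folding algorithm must.\<close>

lemma runs_folded_search:
  assumes w: "\<And>u a. u \<in> \<V> \<Longrightarrow> a \<in> carrier (vgrp \<A> u) \<Longrightarrow> w u a \<in> words (gset u) \<and> val u (w u a) = a"
    and Ls: "set Ls = \<X> \<times> UNIV"
    and Wl: "set Wl = (\<lambda>(u, a). gen_word (w u a)) ` (SIGMA u:\<V>. carrier (vgrp \<A> u) - {\<one>\<^bsub>vgrp \<A> u\<^esub>})"
    and k: "k \<notin> code num ` (\<X> \<times> UNIV)" and B: "1 \<le> B"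
    and out: "outputs num \<X> \<sigma> \<Gamma>" and null: "\<And>a. mem \<sigma> a k = Null"
  shows "runs B (search_com k (map (code num) Ls) (map (map (code num)) Wl)) \<sigma>
    (7 + card (verts \<Gamma>) * Suc (4 + 6 * length Ls + (\<Sum>W\<leftarrow>Wl. 3 + 2 * length W)))
    (\<lambda>\<sigma>'. outputs num \<X> \<sigma>' \<Gamma> \<and>
      regs \<sigma>' 1 = Num (if free_group (generated_subgroup \<A> Ws) then 1 else 0))"
proof -
  obtain \<rho> where \<rho>: "inj_on \<rho> (verts \<Gamma>)" "regs \<sigma> 0 = Ptr (\<rho> (base \<Gamma>))"
    and arc: "\<forall>f \<in> arcs \<Gamma>. mem \<sigma> (\<rho> (tail \<Gamma> f)) (code num (lab \<Gamma> f, True)) = Ptr (\<rho> (head \<Gamma> f)) \<and>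
      mem \<sigma> (\<rho> (head \<Gamma> f)) (code num (lab \<Gamma> f, False)) = Ptr (\<rho> (tail \<Gamma> f))"
    and none: "\<forall>z \<in> verts \<Gamma>. \<forall>x \<in> \<X>.
      ((\<nexists>f. f \<in> arcs \<Gamma> \<and> lab \<Gamma> f = x \<and> tail \<Gamma> f = z) \<longrightarrow> mem \<sigma> (\<rho> z) (code num (x, True)) = Null) \<and>
      ((\<nexists>f. f \<in> arcs \<Gamma> \<and> lab \<Gamma> f = x \<and> head \<Gamma> f = z) \<longrightarrow> mem \<sigma> (\<rho> z) (code num (x, False)) = Null)"
    using out unfolding outputs_def by blast
  interpret M: graph_memory "verts \<Gamma>" "base \<Gamma>" T \<X> \<rho> "code num" k "mem \<sigma>" Ls Wl B
  proof
    fix z l y assume "reads T z [l] y"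
    then show "mem \<sigma> (\<rho> z) (code num l) = Ptr (\<rho> y)"
      using arc by (cases l) (auto simp: triples_def split: if_splits)
  next
    fix z l assume z: "z \<in> verts \<Gamma>" and l: "l \<in> \<X> \<times> (UNIV :: bool set)" and R: "\<nexists>y. reads T z [l] y"
    obtain x b where xb: "l = (x, b)" "x \<in> \<X>" using l by auto
    show "mem \<sigma> (\<rho> z) (code num l) = Null"
    proof (cases b)
      case True
      then have "\<nexists>f. f \<in> arcs \<Gamma> \<and> lab \<Gamma> f = x \<and> tail \<Gamma> f = z" using R xb(1) by (auto simp: triples_def)
      then show ?thesis using none z xb True by simp
    next
      case False
      then have "\<nexists>f. f \<in> arcs \<Gamma> \<and> lab \<Gamma> f = x \<and> head \<Gamma> f = z" using R xb(1) by (auto simp: triples_def)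
      then show ?thesis using none z xb False by simp
    qed
  next
    fix W assume "W \<in> set Wl"
    then show "W \<in> words \<X>" using Wl w by auto
  next
    fix x l y assume "(x, l, y) \<in> T"
    then show "x \<in> verts \<Gamma> \<and> l \<in> \<X> \<and> y \<in> verts \<Gamma>" using T_wf T_labels by blast
  next
    fix z assume "z \<in> verts \<Gamma>"
    then show "\<exists>W. reads T (base \<Gamma>) W z" using connected_\<Gamma> unfolding connected_graph_def by blast
  qed (use finite_card_verts(1) base_in \<rho>(1) deterministic_T k Ls B in blast)+
  have loopless: "(\<forall>z \<in> verts \<Gamma>. M.loopless Wl z) \<longleftrightarrow> free_group (generated_subgroup \<A> Ws)"
    unfolding M.loopless_def Wl by (subst free_iff_no_loop[of w]) (use w in auto)
  show ?thesis
  proof (rule runs_mono[OF M.runs_search])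
    fix \<sigma>' assume \<sigma>': "M.agree \<sigma>' \<and> regs \<sigma>' 1 = Num (if \<forall>z \<in> verts \<Gamma>. M.loopless Wl z then 1 else 0)"
    then have agree: "\<And>a j. j \<noteq> k \<Longrightarrow> mem \<sigma>' a j = mem \<sigma> a j" "regs \<sigma>' 0 = Ptr (\<rho> (base \<Gamma>))"
      unfolding M.agree_def by blast+
    have mem: "mem \<sigma>' a (code num (x, b)) = mem \<sigma> a (code num (x, b))" if "x \<in> \<X>" for a x b
    proof -
      have "code num (x, b) \<noteq> k" using k that by blast
      then show ?thesis by (rule agree(1))
    qed
    have "lab \<Gamma> f \<in> \<X>" if "f \<in> arcs \<Gamma>" for f
      using T_labels[of "tail \<Gamma> f" "lab \<Gamma> f" "head \<Gamma> f"] that by (auto simp: triples_def)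
    then have "outputs num \<X> \<sigma>' \<Gamma>"
      unfolding outputs_def using \<rho>(1) agree(2) arc none
      by (intro exI[of _ \<rho>]) (simp add: mem del: not_ex)
    then show "outputs num \<X> \<sigma>' \<Gamma> \<and>
      regs \<sigma>' 1 = Num (if free_group (generated_subgroup \<A> Ws) then 1 else 0)"
      using \<sigma>' loopless by simp
  qed (simp_all add: \<rho>(2) null M.body_cost_def)
qed

end

lemma (in finite_gog) freeness_in_linear_time:
  assumes v: "v \<in> \<V>" and c: "implements_folding \<A> v num B c"
  shows "\<exists>B' c' K. modification c c' \<and> implements_folding \<A> v num B' c' \<and>
    (\<forall>Ws \<in> input_tuples \<A> v. \<forall>t \<sigma>. exec B c (input_state num Ws) t \<sigma> \<longrightarrow>
      (\<exists>t' \<sigma>'. exec B' c' (input_state num Ws) t' \<sigma>' \<and>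
        regs \<sigma>' 1 = Num (if free_group (generated_subgroup \<A> Ws) then 1 else 0) \<and>
        t' \<le> t + K * (total_length Ws + 1)))"
proof -
  have "\<forall>u a. \<exists>W. u \<in> \<V> \<longrightarrow> a \<in> carrier (vgrp \<A> u) \<longrightarrow> W \<in> words (gset u) \<and> val u W = a"
    using val_surj by blast
  then obtain w where w: "\<And>u a. u \<in> \<V> \<Longrightarrow> a \<in> carrier (vgrp \<A> u) \<Longrightarrow> w u a \<in> words (gset u) \<and> val u (w u a) = a"
    by metis
  let ?\<Sigma> = "SIGMA u:\<V>. carrier (vgrp \<A> u) - {\<one>\<^bsub>vgrp \<A> u\<^esub>}"
  have "finite ((\<lambda>(u, a). gen_word (w u a) :: ('e, 's) letter word) ` ?\<Sigma>)"
    using finite_\<V> finite_vgrp by auto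
  then obtain Wl :: "('e, 's) letter word list" where Wl: "set Wl = (\<lambda>(u, a). gen_word (w u a)) ` ?\<Sigma>"
    using finite_list by meson
  have fin: "finite (\<X> \<times> (UNIV :: bool set))" using finite_\<X> by simp
  then obtain Ls :: "(('e, 's) letter \<times> bool) list" where Ls: "set Ls = \<X> \<times> UNIV"
    using finite_list by blast
  \<comment> \<open>The mark field must avoid the fields of the letters, the fields that
    \<open>c\<close> stores to, and the fields 0 and 1 of the input lists. It is then
    \<open>Null\<close> in every record when \<open>c\<close> ends.\<close>
  have "finite (code num ` (\<X> \<times> UNIV) \<union> stored_fields c \<union> {0, 1})"
    using fin finite_stored_fields by simp
  from ex_new_if_finite[OF infinite_UNIV_nat this]
  obtain k where "k \<notin> code num ` (\<X> \<times> UNIV) \<union> stored_fields c \<union> {0, 1}" ..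
  then have k: "k \<notin> code num ` (\<X> \<times> UNIV)" "k \<notin> stored_fields c" "1 < k" by auto
  define q where "q = search_com k (map (code num) Ls) (map (map (code num)) Wl)"
  \<comment> \<open>The cost of one round of the search, including the test of the loop.\<close>
  define C where "C = Suc (4 + 6 * length Ls + (\<Sum>W\<leftarrow>Wl. 3 + 2 * length W))"
  \<comment> \<open>The factor from \<open>finite_card_verts\<close>: the folded graph has at most
    \<open>D * (total_length Ws + 1)\<close> vertices.\<close>
  define D where "D = 1 + (\<Sum>u \<in> \<V>. card (carrier (vgrp \<A> u))) +
    (\<Sum>(e, h) \<in> (SIGMA e:\<E>. carrier (egrp \<A> e)). length (edge_relator \<A> e h))"
  \<comment> \<open>The bound is raised to at least one for the constants of the search. The factor
    \<open>total_length Ws + 1\<close> is positive, so the summand 7 covers the operations outside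
    the rounds even for inputs of total length zero.\<close>
  have search: "\<exists>t' \<sigma>' \<Gamma>. exec (max B 1) (Seq c q) (input_state num Ws) t' \<sigma>' \<and>
    folding_result \<A> v Ws \<Gamma> \<and> outputs num \<X> \<sigma>' \<Gamma> \<and>
    regs \<sigma>' 1 = Num (if free_group (generated_subgroup \<A> Ws) then 1 else 0) \<and>
    (\<forall>t \<sigma>. exec B c (input_state num Ws) t \<sigma> \<longrightarrow> t' \<le> t + (7 + D * C) * (total_length Ws + 1))"
    if Ws: "Ws \<in> input_tuples \<A> v" for Ws
  proof -
    obtain t \<sigma> \<Gamma> where ex: "exec B c (input_state num Ws) t \<sigma>"
      and \<Gamma>: "folding_result \<A> v Ws \<Gamma>" "outputs num \<X> \<sigma> \<Gamma>"
      using c Ws unfolding implements_folding_def by blast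
    interpret F: folded_gog \<A> v Ws \<Gamma> by unfold_locales (fact v Ws \<Gamma>(1))+
    have "mem \<sigma> a k = Null" for a
      by (rule exec_unused_field[OF ex k(2)]) (rule input_state_field[OF k(3)])
    then have "runs (max B 1) q \<sigma> (7 + card (verts \<Gamma>) * C) (\<lambda>\<sigma>'. outputs num \<X> \<sigma>' \<Gamma> \<and>
      regs \<sigma>' 1 = Num (if free_group (generated_subgroup \<A> Ws) then 1 else 0))"
      unfolding q_def C_def by (intro F.runs_folded_search[of w]) (simp_all add: w Ls Wl k(1) \<Gamma>(2))
    then obtain t' \<sigma>' where ex': "exec (max B 1) q \<sigma> t' \<sigma>'" and t': "t' \<le> 7 + card (verts \<Gamma>) * C"
      and \<sigma>': "outputs num \<X> \<sigma>' \<Gamma>" "regs \<sigma>' 1 = Num (if free_group (generated_subgroup \<A> Ws) then 1 else 0)"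
      unfolding runs_def by blast
    have "card (verts \<Gamma>) \<le> D * (total_length Ws + 1)" using F.finite_card_verts(2) unfolding D_def .
    then have "card (verts \<Gamma>) * C \<le> D * (total_length Ws + 1) * C" by (rule mult_right_mono) simp
    then have "t' \<le> (7 + D * C) * (total_length Ws + 1)" using t' by (simp add: algebra_simps)
    then have "t + t' \<le> t1 + (7 + D * C) * (total_length Ws + 1)"
      if "exec B c (input_state num Ws) t1 \<sigma>1" for t1 \<sigma>1
      using exec_deterministic[OF ex that] by simp
    moreover have "exec (max B 1) (Seq c q) (input_state num Ws) (t + t') \<sigma>'"
      using exec_mono[OF ex] ex' by (intro exec.intros(9)) simp_all
    ultimately show ?thesis using \<Gamma>(1) \<sigma>' by blast
  qed
  have "implements_folding \<A> v num (max B 1) (Seq c q)"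
    unfolding implements_folding_def using search by blast
  moreover have "modification c (Seq c q)" by (intro modification.intros(3) modification.intros(1))
  ultimately show ?thesis using search by blast
qed

theorem proposition6p3:
  fixes \<A> :: "('v, 'e, 'g, 'h, 's) presented_graph_of_groups" and v :: 'v
  assumes "presented_gog \<A>"
    and "\<And>w. w \<in> verts (ugraph \<A>) \<Longrightarrow> finite (carrier (vgrp \<A> w))"
    and "v \<in> verts (ugraph \<A>)"
  shows "(\<forall>Ws \<in> input_tuples \<A> v. \<forall>\<Gamma>. folding_result \<A> v Ws \<Gamma> \<longrightarrow>
      (free_group (generated_subgroup \<A> Ws) \<longleftrightarrow>
        (\<forall>u \<in> verts (ugraph \<A>). \<forall>C \<in> vertex_components \<A> v \<Gamma> u.
          lgraph_iso C (cayley_graph \<A> u)))) \<and>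
    (\<forall>num B c. inj_on num (alphabet \<A>) \<longrightarrow> implements_folding \<A> v num B c \<longrightarrow>
      (\<exists>B' c' K. modification c c' \<and> implements_folding \<A> v num B' c' \<and>
        (\<forall>Ws \<in> input_tuples \<A> v. \<forall>t \<sigma>. exec B c (input_state num Ws) t \<sigma> \<longrightarrow>
          (\<exists>t' \<sigma>'. exec B' c' (input_state num Ws) t' \<sigma>' \<and>
            regs \<sigma>' 1 = Num (if free_group (generated_subgroup \<A> Ws) then 1 else 0) \<and>
            t' \<le> t + K * (total_length Ws + 1)))))"
proof -
  interpret presented_gog \<A> by fact
  interpret finite_gog \<A> by unfold_locales (rule assms(2))
  show ?thesis
  proof (intro conjI allI impI ballI)
    fix Ws \<Gamma> assume "Ws \<in> input_tuples \<A> v" "folding_result \<A> v Ws \<Gamma>"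
    then interpret folded_gog \<A> v Ws \<Gamma> by unfold_locales (use assms(3) in auto)
    show "free_group (generated_subgroup \<A> Ws) \<longleftrightarrow>
      (\<forall>u \<in> \<V>. \<forall>C \<in> vertex_components \<A> v \<Gamma> u. lgraph_iso C (cayley_graph \<A> u))"
      by (rule free_iff_components)
  qed (rule freeness_in_linear_time[OF assms(3)])
qed

end
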